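(* Let $s\in(3/4,1)$, $a,b,m>0$, $1<q<2$ and $2<p<4$. Then, for every $\lambda>0$, the problem $$\left\{\begin{array}{ll}(a+b|u|^{2}_{\mathbb{H}^{s}_{2\pi}})(-\Delta+m^{2})^{s}u=\lambda|u|^{q-2}u+|u|^{p-2}u & \text{in } (-\pi,\pi)^{3},\\ u(x+2\pi e_{i})=u(x) & \text{for all } x\in\mathbb{R}^{3},\ i=1,2,3,\end{array}\right.$$ admits infinitely many (weak) periodic solutions.
   Context: All functions are real-valued. $\{e_i\}_{i=1,2,3}$ is the canonical basis of $\mathbb{R}^3$; $|\cdot|_r$ is the norm of $L^r((-\pi,\pi)^3)$; $2^*_s=\frac{6}{3-2s}$ (so $2^*_s>4$ when $s>3/4$). For a $2\pi$-periodic (in each variable) function $u=\sum_{k\in\mathbb{Z}^3}c_k\frac{e^{\imath k\cdot x}}{(2\pi)^{3/2}}$ with Fourier coefficients $c_k=(2\pi)^{-3/2}\int_{(-\pi,\pi)^3}u(x)e^{-\imath k\cdot x}dx$, set $(-\Delta+m^2)^su=\sum_k c_k(|k|^2+m^2)^s\frac{e^{\imath k\cdot x}}{(2\pi)^{3/2}}$ and $|u|_{\mathbb{H}^s_{2\pi}}^2=\sum_k(|k|^2+m^2)^s|c_k|^2$. The Hilbert space $\mathbb{H}^s_{2\pi}$ consists of those $u\in L^2((-\pi,\pi)^3)$ with $|u|_{\mathbb{H}^s_{2\pi}}<\infty$. Let $\mathcal{S}_{2\pi}=(-\pi,\pi)^3\times(0,\infty)$, with points $(x,y)$, and $\kappa_s=2^{1-2s}\Gamma(1-s)/\Gamma(s)$.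 The Hilbert space $\mathbb{X}^s_{2\pi}$ is the closure of the set of smooth functions on $\mathbb{R}^3\times[0,\infty)$ that are $2\pi$-periodic in each $x_i$ (and of finite norm) with respect to the norm induced by the inner product $$\langle U,V\rangle_{\mathbb{X}^s_{2\pi}}=\frac1{\kappa_s}\iint_{\mathcal{S}_{2\pi}}y^{1-2s}(\nabla U\cdot\nabla V+m^2UV)\,dx\,dy .$$ There is a bounded surjective linear trace operator $\mathrm{Tr}:\mathbb{X}^s_{2\pi}\to\mathbb{H}^s_{2\pi}$ extending $U\mapsto U(\cdot,0)$ from smooth functions; it satisfies $|\mathrm{Tr}(U)|_{\mathbb{H}^s_{2\pi}}\le\|U\|_{\mathbb{X}^s_{2\pi}}$, and $\mathrm{Tr}(\mathbb{X}^s_{2\pi})\subset L^r((-\pi,\pi)^3)$ continuously for $1\le r\le 2^*_s$. Weak solution: $u\in\mathbb{H}^s_{2\pi}$ is a weak (periodic) solution of the problem if $u=\mathrm{Tr}(U)$ for some $U\in\mathbb{X}^s_{2\pi}$ such that, for every $V\in\mathbb{X}^s_{2\pi}$, $$(a+b\|U\|^2_{\mathbb{X}^s_{2\pi}})\langle U,V\rangle_{\mathbb{X}^s_{2\pi}}=\int_{(-\pi,\pi)^3}\big[\lambda|u|^{q-2}u+|u|^{p-2}u\big]\mathrm{Tr}(V)\,dx .$$ *)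

theory Defs
  imports "HOL-Analysis.Analysis"
begin

section \<open>Smooth functions up to the boundary\<close>

text \<open>
  The derivatives are taken within the set. They are unique when the set is, as below, convex with
  nonempty interior, so this is the usual notion of a smooth function on a closed half-space.
\<close>

primrec Ck_on :: "nat \<Rightarrow> 'a::euclidean_space set \<Rightarrow> ('a \<Rightarrow> real) \<Rightarrow> bool" where
  "Ck_on 0 S f \<longleftrightarrow> continuous_on S f"
| "Ck_on (Suc k) S f \<longleftrightarrow>
     (\<exists>f'. (\<forall>x\<in>S. (f has_derivative f' x) (at x within S)) \<and>
           (\<forall>v\<in>Basis. Ck_on k S (\<lambda>x. f' x v)))"

definition smooth_on :: "'a::euclidean_space set \<Rightarrow> ('a \<Rightarrow> real) \<Rightarrow> bool" where
  "smooth_on S f \<longleftrightarrow> (\<forall>k. Ck_on k S f)"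


section \<open>The periodic fractional Sobolev space\<close>

definition cube :: "(real^3) set" where
  "cube = {x. \<forall>i. - pi < x $ i \<and> x $ i < pi}"

definition periodic3 :: "(real^3 \<Rightarrow> real) \<Rightarrow> bool" where
  "periodic3 u \<longleftrightarrow> (\<forall>x i. u (x + axis i (2 * pi)) = u x)"

definition freq :: "int^3 \<Rightarrow> real^3" where
  "freq k = (\<chi> i. real_of_int (k $ i))"

definition fourier_coeff :: "(real^3 \<Rightarrow> real) \<Rightarrow> int^3 \<Rightarrow> complex" where
  "fourier_coeff u k =
     complex_of_real ((2 * pi) powr (- (3/2))) *
     (LINT x:cube|lborel. complex_of_real (u x) * exp (- (\<i> * complex_of_real (freq k \<bullet> x))))"

definition Hs_term :: "real \<Rightarrow> real \<Rightarrow> (real^3 \<Rightarrow> real) \<Rightarrow> int^3 \<Rightarrow> real" where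
  "Hs_term s m u k = ((norm (freq k))\<^sup>2 + m\<^sup>2) powr s * (cmod (fourier_coeff u k))\<^sup>2"

text \<open>
  Functions are not identified modulo null sets here; only their restriction to the cube matters.
\<close>

definition Hs_space :: "real \<Rightarrow> real \<Rightarrow> (real^3 \<Rightarrow> real) set" where
  "Hs_space s m =
     {u. set_borel_measurable lborel cube u \<and> set_integrable lborel cube (\<lambda>x. (u x)\<^sup>2) \<and>
         Hs_term s m u summable_on UNIV}"

definition Hs_norm :: "real \<Rightarrow> real \<Rightarrow> (real^3 \<Rightarrow> real) \<Rightarrow> real" where
  "Hs_norm s m u = sqrt (\<Sum>\<^sub>\<infinity>k. Hs_term s m u k)"


section \<open>The weighted Sobolev space on the half-cylinder\<close>

definition half_cylinder :: "((real^3) \<times> real) set" where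
  "half_cylinder = cube \<times> {0<..}"

definition kappa :: "real \<Rightarrow> real" where
  "kappa s = 2 powr (1 - 2 * s) * Gamma (1 - s) / Gamma s"

text \<open>
  The closure of the smooth functions in the norm of \<open>X_inner\<close> is realised inside a weighted
  \<open>L\<^sup>2\<close> space: an element is a function \<open>U\<close> together with its gradient \<open>G\<close>, and the space is the
  closure of the pairs consisting of a smooth function and its classical gradient. As the weight
  \<open>y powr (1 - 2 * s)\<close> is bounded above and below on compact subsets of the half-cylinder, \<open>G\<close> is
  the distributional gradient of \<open>U\<close>, hence determined by \<open>U\<close> almost everywhere.
\<close>

type_synonym fun_with_grad =
  "((real^3) \<times> real \<Rightarrow> real) \<times> ((real^3) \<times> real \<Rightarrow> (real^3) \<times> real)"

definition weighted_L2 :: "real \<Rightarrow> fun_with_grad set" where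
  "weighted_L2 s =
     {(U, G). set_borel_measurable lborel half_cylinder U \<and>
              set_borel_measurable lborel half_cylinder G \<and>
              set_integrable lborel half_cylinder (\<lambda>z. snd z powr (1 - 2 * s) * (U z)\<^sup>2) \<and>
              set_integrable lborel half_cylinder (\<lambda>z. snd z powr (1 - 2 * s) * (norm (G z))\<^sup>2)}"

fun X_inner :: "real \<Rightarrow> real \<Rightarrow> fun_with_grad \<Rightarrow> fun_with_grad \<Rightarrow> real" where
  "X_inner s m (U, G) (V, H) =
     1 / kappa s *
     (LINT z:half_cylinder|lborel. snd z powr (1 - 2 * s) * (G z \<bullet> H z + m\<^sup>2 * U z * V z))"

definition X_norm :: "real \<Rightarrow> real \<Rightarrow> fun_with_grad \<Rightarrow> real" where
  "X_norm s m W = sqrt (X_inner s m W W)"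

fun fg_diff :: "fun_with_grad \<Rightarrow> fun_with_grad \<Rightarrow> fun_with_grad" where
  "fg_diff (U, G) (V, H) = ((\<lambda>z. U z - V z), (\<lambda>z. G z - H z))"

text \<open>Membership in \<open>weighted_L2\<close> is finiteness of the norm (as \<open>m > 0\<close>).\<close>

definition smooth_periodic :: "real \<Rightarrow> fun_with_grad set" where
  "smooth_periodic s =
     {(U, G). (U, G) \<in> weighted_L2 s \<and>
              smooth_on (UNIV \<times> {0..}) U \<and>
              (\<forall>x y i. 0 \<le> y \<longrightarrow> U (x + axis i (2 * pi), y) = U (x, y)) \<and>
              (\<forall>z\<in>half_cylinder. GDERIV U z :> G z)}"

definition X_space :: "real \<Rightarrow> real \<Rightarrow> fun_with_grad set" where
  "X_space s m =
     {W \<in> weighted_L2 s. \<exists>\<Phi>. (\<forall>n. \<Phi> n \<in> smooth_periodic s) \<and>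
                               (\<lambda>n. X_norm s m (fg_diff (\<Phi> n) W)) \<longlonglongrightarrow> 0}"

text \<open>
  The graph of the continuous extension of \<open>U \<mapsto> (\<lambda>x. U (x, 0))\<close> from the smooth
  functions. The trace is unique only up to null sets of the cube, and \<open>Tr\<close> picks one
  representative.
\<close>

definition has_trace :: "real \<Rightarrow> real \<Rightarrow> fun_with_grad \<Rightarrow> (real^3 \<Rightarrow> real) \<Rightarrow> bool" where
  "has_trace s m W u \<longleftrightarrow>
     u \<in> Hs_space s m \<and>
     (\<exists>\<Phi>. (\<forall>n. \<Phi> n \<in> smooth_periodic s) \<and>
          (\<lambda>n. X_norm s m (fg_diff (\<Phi> n) W)) \<longlonglongrightarrow> 0 \<and>
          (\<lambda>n. Hs_norm s m (\<lambda>x. fst (\<Phi> n) (x, 0) - u x)) \<longlonglongrightarrow> 0)"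

definition Tr :: "real \<Rightarrow> real \<Rightarrow> fun_with_grad \<Rightarrow> real^3 \<Rightarrow> real" where
  "Tr s m W = (SOME u. has_trace s m W u)"


section \<open>Weak solutions\<close>

definition ae_eq :: "((real^3 \<Rightarrow> real) \<times> (real^3 \<Rightarrow> real)) set" where
  "ae_eq = {(u, v). AE x\<in>cube in lborel. u x = v x}"

definition weak_solution ::
  "real \<Rightarrow> real \<Rightarrow> real \<Rightarrow> real \<Rightarrow> real \<Rightarrow> real \<Rightarrow> real \<Rightarrow> (real^3 \<Rightarrow> real) \<Rightarrow> bool" where
  "weak_solution s m a b lam q p u \<longleftrightarrow>
     u \<in> Hs_space s m \<and> periodic3 u \<and>
     (\<exists>U\<in>X_space s m. (u, Tr s m U) \<in> ae_eq \<and>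
        (\<forall>V\<in>X_space s m.
           (a + b * (X_norm s m U)\<^sup>2) * X_inner s m U V =
           (LINT x:cube|lborel.
              (lam * \<bar>u x\<bar> powr (q - 2) * u x + \<bar>u x\<bar> powr (p - 2) * u x) * Tr s m V x)))"

end

theory Submission
  imports Defs "HOL-Complex_Analysis.Great_Picard"
begin

text \<open>
Weak solutions are the critical points of the Kirchhoff energy
\<open>a/2 |U|\<^sup>2 + b/4 |U|^4 - \<integral> potential (Tr U)\<close>, where \<open>potential t = lam |t|^q / q + |t|^p / p\<close>. Since
\<open>p < 4\<close>, the quartic term wins at infinity and the energy is coercive; since \<open>q < 2\<close>, the
potential wins near the origin and the energy takes negative values. So there is a minimiser,
and it is not zero. Infinitely many solutions are obtained by solving one such minimisation problem
for each of infinitely many symmetry classes: for every \<open>n > 0\<close> there is a nonzero solution that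
depends on the first coordinate only and whose Fourier series contains nothing but the frequencies
\<open>\<plusminus> n (2 j + 1)\<close> along that axis. An integer has the form \<open>2^i (2 j + 1)\<close> up to sign for at
most one \<open>i\<close>, so the solutions for \<open>n = 2^i\<close> have disjoint Fourier supports and are different.

The symmetry is not imposed on the space. Instead, the potential is evaluated at the projection of
the trace to the frequencies above (\<open>odd_modes\<close>), while the quadratic form sees the whole function.
The projection is a trigonometric series in one variable. The trace inequality
(\<open>Sobolev_trace\<close>) controls its coefficients with the weight \<open>j powr (2 s)\<close>, and as \<open>s > 3/4\<close> the
series converges absolutely to a Hoelder continuous function. Hence the projection is bounded in
terms of the norm, and a bounded sequence has a subsequence whose projections converge to a
continuous function (\<open>odd_modes_bound\<close>, \<open>odd_modes_compact\<close>).

The minimisation is carried out in the locale \<open>kirchhoff\<close>, for a quadratic form and a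
compact linear map into the continuous functions. The parallelogram identity shows that
a minimising sequence of smooth functions is a Cauchy sequence (\<open>midpoint_estimate\<close>,
\<open>ground_state\<close>), and its limit satisfies the Euler-Lagrange equation. That equation contains
projections of the test functions. But the projection \<open>u\<close> of the limit changes its sign under the
translation by \<open>pi / n\<close> along the first axis, and so does \<open>nonlinearity u\<close>, because the
nonlinearity is odd. Therefore \<open>nonlinearity u\<close> is orthogonal to all other frequencies, and each
projected test function may be replaced by its trace (\<open>odd_modes_replace_trace\<close>).

It remains to see that \<open>u\<close> is the whole trace of the limit. The right-hand side of the equation is
invariant under the translations along the other axes, and under the translation by \<open>pi / n\<close>
combined with a change of sign. These maps are isometries, and the equation determines its solution,
so the limit is invariant as well. A frequency that is not compatible with this symmetry cannot
occur in its trace (\<open>symmetric_limit_coeff\<close>).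

The trace operator is treated on the Fourier side. At each height, Bessel's inequality splits the
energy into the energies of the Fourier coefficients, which are functions of one variable. A weighted
inequality on the half-line (\<open>trace_1d\<close>) bounds their values at 0. Functions with the same
Fourier coefficients agree almost everywhere (\<open>fourier_coeff_unique\<close>), by approximation of
indicators of boxes by trigonometric polynomials.
\<close>

section \<open>Square integrable functions\<close>

definition sq_integrable :: "'a measure \<Rightarrow> ('a \<Rightarrow> 'b::euclidean_space) \<Rightarrow> bool" where
  "sq_integrable M f \<longleftrightarrow> f \<in> borel_measurable M \<and> integrable M (\<lambda>x. (norm (f x))\<^sup>2)"

lemma quadratic_nonneg_discriminant:
  fixes A B C :: real
  assumes "\<And>t. 0 \<le> A + 2 * t * B + t\<^sup>2 * C" "0 \<le> C"
  shows "\<bar>B\<bar> \<le> sqrt A * sqrt C"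
proof -
  have "B\<^sup>2 \<le> A * C"
  proof (cases "C = 0")
    case True
    have "B = 0"
    proof (rule ccontr)
      assume "B \<noteq> 0"
      have "0 \<le> A + 2 * (- (A + 1) / (2 * B)) * B + (- (A + 1) / (2 * B))\<^sup>2 * C"
        by (rule assms)
      then show False using \<open>B \<noteq> 0\<close> True by (simp add: field_simps)
    qed
    then show ?thesis using True by simp
  next
    case False
    then have "C > 0" using assms(2) by simp
    have "0 \<le> A + 2 * (- B / C) * B + (- B / C)\<^sup>2 * C" by (rule assms)
    then have "0 \<le> (A + 2 * (- B / C) * B + (- B / C)\<^sup>2 * C) * C" using \<open>C > 0\<close> by simp
    also have "\<dots> = A * C - B\<^sup>2" using \<open>C > 0\<close> by (simp add: field_simps power2_eq_square)
    finally show ?thesis by simp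
  qed
  then have "sqrt (B\<^sup>2) \<le> sqrt (A * C)" by (rule real_sqrt_le_mono)
  then show ?thesis by (simp add: real_sqrt_mult)
qed

lemma sq_integrable_inner:
  assumes "sq_integrable M f" "sq_integrable M g"
  shows "integrable M (\<lambda>x. f x \<bullet> g x)"
proof (rule Bochner_Integration.integrable_bound)
  show "integrable M (\<lambda>x. (norm (f x))\<^sup>2 + (norm (g x))\<^sup>2)"
    using assms by (auto simp: sq_integrable_def)
  show "(\<lambda>x. f x \<bullet> g x) \<in> borel_measurable M"
    using assms by (auto simp: sq_integrable_def)
  have "\<bar>a \<bullet> b\<bar> \<le> (norm a)\<^sup>2 + (norm b)\<^sup>2" for a b :: 'b
  proof -
    have "\<bar>a \<bullet> b\<bar> \<le> norm a * norm b" by (rule Cauchy_Schwarz_ineq2)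
    moreover have "0 \<le> (norm a - norm b)\<^sup>2" by simp
    then have "2 * (norm a * norm b) \<le> (norm a)\<^sup>2 + (norm b)\<^sup>2"
      by (simp add: power2_diff)
    moreover have "0 \<le> norm a * norm b" by simp
    ultimately show ?thesis by linarith
  qed
  then show "AE x in M. norm (f x \<bullet> g x) \<le> norm ((norm (f x))\<^sup>2 + (norm (g x))\<^sup>2)"
    by auto
qed

lemma sq_integrable_add_scaled:
  assumes "sq_integrable M f" "sq_integrable M g"
  shows "sq_integrable M (\<lambda>x. f x + t *\<^sub>R g x)"
proof -
  have eq: "(norm (f x + t *\<^sub>R g x))\<^sup>2 = (norm (f x))\<^sup>2 + 2 * t * (f x \<bullet> g x) + t\<^sup>2 * (norm (g x))\<^sup>2" for x
    unfolding power2_norm_eq_inner by (simp add: inner_simps inner_commute power2_eq_square algebra_simps)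
  show ?thesis
    unfolding sq_integrable_def eq
    using assms sq_integrable_inner[OF assms] by (auto simp: sq_integrable_def)
qed

lemma integral_norm_add_scaled:
  assumes "sq_integrable M f" "sq_integrable M g"
  shows "(\<integral>x. (norm (f x + t *\<^sub>R g x))\<^sup>2 \<partial>M) =
    (\<integral>x. (norm (f x))\<^sup>2 \<partial>M) + 2 * t * (\<integral>x. f x \<bullet> g x \<partial>M) + t\<^sup>2 * (\<integral>x. (norm (g x))\<^sup>2 \<partial>M)"
proof -
  have eq: "(norm (f x + t *\<^sub>R g x))\<^sup>2 = (norm (f x))\<^sup>2 + 2 * t * (f x \<bullet> g x) + t\<^sup>2 * (norm (g x))\<^sup>2" for x
    unfolding power2_norm_eq_inner by (simp add: inner_simps inner_commute power2_eq_square algebra_simps)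
  show ?thesis
    unfolding eq
    using assms sq_integrable_inner[OF assms] by (simp add: sq_integrable_def)
qed

lemma integral_Cauchy_Schwarz:
  assumes "sq_integrable M f" "sq_integrable M g"
  shows "\<bar>\<integral>x. f x \<bullet> g x \<partial>M\<bar> \<le> sqrt (\<integral>x. (norm (f x))\<^sup>2 \<partial>M) * sqrt (\<integral>x. (norm (g x))\<^sup>2 \<partial>M)"
proof (rule quadratic_nonneg_discriminant)
  fix t
  show "0 \<le> (\<integral>x. (norm (f x))\<^sup>2 \<partial>M) + 2 * t * (\<integral>x. f x \<bullet> g x \<partial>M) + t\<^sup>2 * (\<integral>x. (norm (g x))\<^sup>2 \<partial>M)"
    unfolding integral_norm_add_scaled[OF assms, symmetric] by simp
qed simp

text \<open>
The Riesz-Fischer argument. Along a subsequence whose consecutive distances decay geometrically the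
increments are summable at almost every point, so the subsequence converges almost everywhere;
Fatou's lemma turns this into convergence in the mean of the whole sequence.
\<close>

lemma sq_integrable_complete:
  fixes f :: "nat \<Rightarrow> 'a \<Rightarrow> 'b::euclidean_space"
  assumes f: "\<And>n. sq_integrable M (f n)"
    and Cauchy: "\<And>e. e > 0 \<Longrightarrow> \<exists>N. \<forall>i\<ge>N. \<forall>j\<ge>N. (\<integral>x. (norm (f i x - f j x))\<^sup>2 \<partial>M) < e"
  obtains g where "sq_integrable M g" "(\<lambda>n. \<integral>x. (norm (f n x - g x))\<^sup>2 \<partial>M) \<longlonglongrightarrow> 0"
proof -
  have fm[measurable]: "f n \<in> borel_measurable M" for n using f by (simp add: sq_integrable_def)
  have diff: "sq_integrable M (\<lambda>x. f i x - f j x)" for i j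
    using sq_integrable_add_scaled[OF f f, of i "-1" j] by simp
  have "\<forall>k. \<exists>N. \<forall>i\<ge>N. \<forall>j\<ge>N. (\<integral>x. (norm (f i x - f j x))\<^sup>2 \<partial>M) < (1/4)^k"
    using Cauchy by auto
  then obtain N where N: "\<And>k i j. i \<ge> N k \<Longrightarrow> j \<ge> N k \<Longrightarrow> (\<integral>x. (norm (f i x - f j x))\<^sup>2 \<partial>M) < (1/4)^k"
    by metis
  (* an index that is beyond N 0, ..., N k and beyond k; consecutive members of the subsequence
     are then closer than 1/4^k in the square mean *)
  define r where "r k = k + (\<Sum>i\<le>k. N i)" for k
  have rN: "N k \<le> r l" if "k \<le> l" for k l
  proof -
    have "N k \<le> (\<Sum>i\<le>l. N i)" by (rule member_le_sum) (use that in auto)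
    then show ?thesis by (simp add: r_def)
  qed
  define h where "h k x = norm (f (r (Suc k)) x - f (r k) x)" for k x
  have hm[measurable]: "h k \<in> borel_measurable M" for k unfolding h_def by measurable
  have hint: "integrable M (\<lambda>x. (h k x)\<^sup>2)" for k
    using diff unfolding h_def sq_integrable_def by blast
  have hle: "(\<integral>x. (h k x)\<^sup>2 \<partial>M) \<le> (1/4)^k" for k
    unfolding h_def using N[of k "r (Suc k)" "r k"] rN by (simp add: less_imp_le)
  (* the factor 2^k forces geometric decay of the increments h k x wherever the series is finite *)
  have "(\<integral>\<^sup>+x. (\<Sum>k. ennreal (2^k * (h k x)\<^sup>2)) \<partial>M) = (\<Sum>k. \<integral>\<^sup>+x. ennreal (2^k * (h k x)\<^sup>2) \<partial>M)"
    by (rule nn_integral_suminf) measurable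
  also have "\<dots> \<le> (\<Sum>k. ennreal ((1/2)^k))"
  proof (rule suminf_le)
    fix k
    have "(\<integral>\<^sup>+x. ennreal (2^k * (h k x)\<^sup>2) \<partial>M) = ennreal (\<integral>x. 2^k * (h k x)\<^sup>2 \<partial>M)"
      by (rule nn_integral_eq_integral) (use hint in auto)
    also have "\<dots> \<le> ennreal ((1/2)^k)"
    proof (rule ennreal_leI)
      have "(\<integral>x. 2^k * (h k x)\<^sup>2 \<partial>M) = 2^k * (\<integral>x. (h k x)\<^sup>2 \<partial>M)" by simp
      also have "\<dots> \<le> 2^k * (1/4)^k" using hle by simp
      also have "\<dots> = (1/2)^k" by (simp flip: power_mult_distrib)
      finally show "(\<integral>x. 2^k * (h k x)\<^sup>2 \<partial>M) \<le> (1/2)^k" .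
    qed
    finally show "(\<integral>\<^sup>+x. ennreal (2^k * (h k x)\<^sup>2) \<partial>M) \<le> ennreal ((1/2)^k)" .
  qed auto
  also have "\<dots> = ennreal (\<Sum>k. (1/2)^k)"
    by (rule suminf_ennreal2) auto
  also have "\<dots> < \<infinity>" by simp
  finally have fin: "(\<integral>\<^sup>+x. (\<Sum>k. ennreal (2^k * (h k x)\<^sup>2)) \<partial>M) \<noteq> \<infinity>" by simp
  have AEfin: "AE x in M. (\<Sum>k. ennreal (2^k * (h k x)\<^sup>2)) \<noteq> \<infinity>"
    by (rule nn_integral_PInf_AE[OF _ fin]) measurable
  have conv: "convergent (\<lambda>k. f (r k) x)" if fx: "(\<Sum>k. ennreal (2^k * (h k x)\<^sup>2)) \<noteq> \<infinity>" for x
  proof -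
    obtain C where C: "C \<ge> 0" "(\<Sum>k. ennreal (2^k * (h k x)\<^sup>2)) = ennreal C"
      by (rule that[OF enn2real_nonneg], rule ennreal_enn2real[symmetric])
        (use fx in \<open>simp add: less_top\<close>)
    have hk: "h k x \<le> sqrt C * (sqrt (1/2))^k" for k
    proof -
      have "(\<Sum>i\<in>{k}. ennreal (2^i * (h i x)\<^sup>2)) \<le> (\<Sum>k. ennreal (2^k * (h k x)\<^sup>2))"
        by (rule sum_le_suminf) auto
      then have "2^k * (h k x)\<^sup>2 \<le> C" using C by simp
      then have "(h k x)\<^sup>2 \<le> C * (1/2)^k" by (simp add: field_simps)
      then have "sqrt ((h k x)\<^sup>2) \<le> sqrt (C * (1/2)^k)" by (rule real_sqrt_le_mono)
      then show ?thesis by (simp add: h_def real_sqrt_mult real_sqrt_power)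
    qed
    have "summable (\<lambda>k. sqrt C * (sqrt (1/2))^k)"
      by (intro summable_mult summable_geometric) (simp add: real_sqrt_divide)
    then have "summable (\<lambda>k. f (r (Suc k)) x - f (r k) x)"
      by (rule summable_comparison_test'[where N=0]) (use hk in \<open>auto simp: h_def\<close>)
    then have "convergent (\<lambda>n. \<Sum>k<n. f (r (Suc k)) x - f (r k) x)"
      by (simp add: summable_iff_convergent)
    then have "convergent (\<lambda>n. f (r n) x - f (r 0) x)"
      using sum_lessThan_telescope[of "\<lambda>k. f (r k) x"] by simp
    then have "convergent (\<lambda>n. (f (r n) x - f (r 0) x) + f (r 0) x)"
      by (intro convergent_add convergent_const)
    then show ?thesis by simp
  qed
  define g where "g x = lim (\<lambda>k. f (r k) x)" for x
  have gm[measurable]: "g \<in> borel_measurable M"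
    unfolding g_def by measurable
  have lim: "AE x in M. (\<lambda>k. f (r k) x) \<longlonglongrightarrow> g x"
    using AEfin by eventually_elim (use conv in \<open>auto simp: g_def convergent_LIMSEQ_iff\<close>)
  have bound: "(\<integral>\<^sup>+x. ennreal ((norm (f n x - g x))\<^sup>2) \<partial>M) \<le> ennreal e"
    if "\<And>i j. i \<ge> K \<Longrightarrow> j \<ge> K \<Longrightarrow> (\<integral>x. (norm (f i x - f j x))\<^sup>2 \<partial>M) < e" "n \<ge> K" for n K e
  proof -
    have "(\<integral>\<^sup>+x. ennreal ((norm (f n x - g x))\<^sup>2) \<partial>M) =
       (\<integral>\<^sup>+x. liminf (\<lambda>k. ennreal ((norm (f n x - f (r k) x))\<^sup>2)) \<partial>M)"
    proof (rule nn_integral_cong_AE, use lim in eventually_elim)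
      fix x assume "(\<lambda>k. f (r k) x) \<longlonglongrightarrow> g x"
      then have "(\<lambda>k. ennreal ((norm (f n x - f (r k) x))\<^sup>2)) \<longlonglongrightarrow> ennreal ((norm (f n x - g x))\<^sup>2)"
        by (intro tendsto_intros)
      then show "ennreal ((norm (f n x - g x))\<^sup>2) = liminf (\<lambda>k. ennreal ((norm (f n x - f (r k) x))\<^sup>2))"
        by (intro lim_imp_Liminf[symmetric]) simp
    qed
    also have "\<dots> \<le> liminf (\<lambda>k. \<integral>\<^sup>+x. ennreal ((norm (f n x - f (r k) x))\<^sup>2) \<partial>M)"
      by (rule nn_integral_liminf) measurable
    also have "\<dots> \<le> ennreal e"
    proof (rule Liminf_le)
      show "\<forall>\<^sub>F k in sequentially. (\<integral>\<^sup>+x. ennreal ((norm (f n x - f (r k) x))\<^sup>2) \<partial>M) \<le> ennreal e"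
        using eventually_ge_at_top[of K]
      proof eventually_elim
        case (elim k)
        then have "r k \<ge> K" by (simp add: r_def)
        have "(\<integral>\<^sup>+x. ennreal ((norm (f n x - f (r k) x))\<^sup>2) \<partial>M) = ennreal (\<integral>x. (norm (f n x - f (r k) x))\<^sup>2 \<partial>M)"
          by (rule nn_integral_eq_integral) (use diff in \<open>auto simp: sq_integrable_def\<close>)
        also have "\<dots> \<le> ennreal e"
          by (rule ennreal_leI) (use that(1)[OF that(2) \<open>r k \<ge> K\<close>] in simp)
        finally show ?case .
      qed
    qed simp
    finally show ?thesis .
  qed
  have sq: "sq_integrable M (\<lambda>x. f n x - g x)" and le: "(\<integral>x. (norm (f n x - g x))\<^sup>2 \<partial>M) \<le> e"
    if "\<And>i j. i \<ge> K \<Longrightarrow> j \<ge> K \<Longrightarrow> (\<integral>x. (norm (f i x - f j x))\<^sup>2 \<partial>M) < e" "n \<ge> K" "e > 0" for n K e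
  proof -
    have b: "(\<integral>\<^sup>+x. ennreal ((norm (f n x - g x))\<^sup>2) \<partial>M) \<le> ennreal e" by (rule bound[OF that(1,2)])
    have int: "integrable M (\<lambda>x. (norm (f n x - g x))\<^sup>2)"
      by (rule integrableI_nonneg) (use b in \<open>auto simp: le_less_trans\<close>)
    then show "sq_integrable M (\<lambda>x. f n x - g x)" by (simp add: sq_integrable_def)
    have "ennreal (\<integral>x. (norm (f n x - g x))\<^sup>2 \<partial>M) \<le> ennreal e"
      using b nn_integral_eq_integral[OF int] by simp
    then show "(\<integral>x. (norm (f n x - g x))\<^sup>2 \<partial>M) \<le> e" using that by (simp add: ennreal_le_iff)
  qed
  obtain N1 where N1: "\<And>i j. i \<ge> N1 \<Longrightarrow> j \<ge> N1 \<Longrightarrow> (\<integral>x. (norm (f i x - f j x))\<^sup>2 \<partial>M) < 1"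
    using Cauchy[of 1] by auto
  have "sq_integrable M (\<lambda>x. f N1 x + (-1) *\<^sub>R (f N1 x - g x))"
    by (rule sq_integrable_add_scaled[OF f sq[OF N1]]) auto
  then have "sq_integrable M g" by simp
  moreover have "(\<lambda>n. \<integral>x. (norm (f n x - g x))\<^sup>2 \<partial>M) \<longlonglongrightarrow> 0"
  proof (rule LIMSEQ_I)
    fix e :: real assume "e > 0"
    then obtain K where K: "\<And>i j. i \<ge> K \<Longrightarrow> j \<ge> K \<Longrightarrow> (\<integral>x. (norm (f i x - f j x))\<^sup>2 \<partial>M) < e/2"
      using Cauchy[of "e/2"] by auto
    have "norm ((\<integral>x. (norm (f n x - g x))\<^sup>2 \<partial>M) - 0) < e" if "n \<ge> K" for n
      using le[OF K that] \<open>e > 0\<close> by (simp add: abs_of_nonneg)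
    then show "\<exists>no. \<forall>n\<ge>no. norm ((\<integral>x. (norm (f n x - g x))\<^sup>2 \<partial>M) - 0) < e" by blast
  qed
  ultimately show ?thesis by (rule that)
qed

section \<open>Integrals of periodic functions over a period\<close>

lemma AE_lborel_hyperplane:
  fixes b :: "'a::euclidean_space"
  assumes "b \<in> Basis"
  shows "AE z in lborel. z \<bullet> b \<noteq> c"
proof -
  have "negligible {z. z \<bullet> b = c}" using negligible_standard_hyperplane[OF assms] .
  then have "{z. z \<bullet> b = c} \<in> null_sets lebesgue" by (simp add: negligible_iff_null_sets)
  moreover have "{z. z \<bullet> b = c} \<in> sets lborel"
    using borel_closed[of "{z. z \<bullet> b = c}"] by (simp add: closed_Collect_eq)
  ultimately have "{z. z \<bullet> b = c} \<in> null_sets lborel" by (simp add: null_sets_completion_iff)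
  then show ?thesis by (intro AE_I'[of "{z. z \<bullet> b = c}"]) auto
qed

lemma lborel_integrable_translate:
  fixes f :: "'a::euclidean_space \<Rightarrow> 'c::{banach,second_countable_topology}"
  assumes "f \<in> borel_measurable borel"
  shows "integrable lborel (\<lambda>z. f (z + c)) \<longleftrightarrow> integrable lborel f"
proof -
  have "integrable (distr lborel borel ((+) c)) f \<longleftrightarrow> integrable lborel (\<lambda>z. f (c + z))"
    by (rule integrable_distr_eq) (use assms in auto)
  then show ?thesis by (simp add: lborel_distr_plus add.commute)
qed

lemma lborel_integral_translate:
  fixes f :: "'a::euclidean_space \<Rightarrow> 'c::{banach,second_countable_topology}"
  assumes "f \<in> borel_measurable borel"
  shows "(\<integral>z. f (z + c) \<partial>lborel) = (\<integral>z. f z \<partial>lborel)"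
proof -
  have "integral\<^sup>L (distr lborel borel ((+) c)) f = (\<integral>z. f (c + z) \<partial>lborel)"
    by (rule integral_distr) (use assms in auto)
  then show ?thesis by (simp add: lborel_distr_plus add.commute)
qed

text \<open>
A slab of thickness \<open>2 * pi\<close> that is shifted by \<open>h\<close> loses a piece of thickness \<open>h\<close> at one end and
gains a piece of the same thickness at the other, which is a translate of the lost one by a period.
The set \<open>A\<close> describes the remaining coordinates: the same argument serves the cube and the
half-cylinder, where \<open>H\<close> may be singular on the boundary of \<open>A\<close>.
\<close>

lemma periodic_integral_shift:
  fixes H :: "'a::euclidean_space \<Rightarrow> 'c::{banach,second_countable_topology}"
  assumes b: "b \<in> Basis"
    and A: "\<And>z t. z + t *\<^sub>R b \<in> A \<longleftrightarrow> z \<in> A"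
    and HA: "(\<lambda>z. indicator A z *\<^sub>R H z) \<in> borel_measurable borel"
    and per: "\<And>z. z \<in> A \<Longrightarrow> H (z + (2 * pi) *\<^sub>R b) = H z"
    and h: "0 \<le> h" "h \<le> 2 * pi"
    and C: "C = {z \<in> A. - pi < z \<bullet> b \<and> z \<bullet> b < pi}"
    and int: "set_integrable lborel C H"
  shows "set_integrable lborel C (\<lambda>z. H (z + h *\<^sub>R b))"
    and "(LINT z:C|lborel. H (z + h *\<^sub>R b)) = (LINT z:C|lborel. H z)"
proof -
  define K where "K z = indicator A z *\<^sub>R H z" for z
  have Km[measurable]: "K \<in> borel_measurable borel" unfolding K_def by (rule HA)
  have Kper: "K (z + (2 * pi) *\<^sub>R b) = K z" for z
    unfolding K_def using A per by (auto simp: indicator_def)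
  define R where "R l u z = (if l < z \<bullet> b \<and> z \<bullet> b < u then K z else 0)" for l u :: real and z
  have Rm[measurable]: "R l u \<in> borel_measurable borel" for l u
    unfolding R_def by measurable
  have bb: "b \<bullet> b = 1" using b by simp
  have eqC: "indicator C z *\<^sub>R H z = R (-pi) pi z" for z
    unfolding C R_def K_def by (auto simp: indicator_def)
  have intR: "integrable lborel (R (-pi) pi)"
    using int unfolding set_integrable_def eqC .
  have sub: "integrable lborel (R l u)" if "- pi \<le> l" "u \<le> pi" for l u
  proof (rule Bochner_Integration.integrable_bound[OF intR])
    show "AE x in lborel. norm (R l u x) \<le> norm (R (- pi) pi x)"
      unfolding R_def using that by auto
  qed simp
  have Rper: "R (l + 2 * pi) (u + 2 * pi) (z + (2 * pi) *\<^sub>R b) = R l u z" for l u z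
    unfolding R_def Kper by (simp add: inner_simps bb)
  have p2: "integrable lborel (R pi (pi + h))" "(\<integral>z. R pi (pi + h) z \<partial>lborel) = (\<integral>z. R (-pi) (-pi + h) z \<partial>lborel)"
  proof -
    have e: "R pi (pi + h) (z + (2 * pi) *\<^sub>R b) = R (-pi) (-pi + h) z" for z
      using Rper[of "-pi" "-pi + h" z] by (simp add: algebra_simps)
    have "integrable lborel (\<lambda>z. R pi (pi + h) (z + (2 * pi) *\<^sub>R b))"
      unfolding e by (rule sub) (use h in auto)
    then show "integrable lborel (R pi (pi + h))"
      by (subst (asm) lborel_integrable_translate) auto
    show "(\<integral>z. R pi (pi + h) z \<partial>lborel) = (\<integral>z. R (-pi) (-pi + h) z \<partial>lborel)"
      using lborel_integral_translate[OF Rm, of pi "pi + h" "(2 * pi) *\<^sub>R b"] unfolding e by simp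
  qed
  have p1: "integrable lborel (R (-pi + h) pi)" by (rule sub) (use h in auto)
  have p3: "integrable lborel (R (-pi) (-pi + h))" by (rule sub) (use h in auto)
  have ae1: "AE z in lborel. R (-pi + h) pi z + R pi (pi + h) z = R (-pi + h) (pi + h) z"
    using AE_lborel_hyperplane[OF b, of pi]
    by eventually_elim (use h in \<open>auto simp: R_def\<close>)
  have ae2: "AE z in lborel. R (-pi + h) pi z + R (-pi) (-pi + h) z = R (-pi) pi z"
    using AE_lborel_hyperplane[OF b, of "-pi + h"]
    by eventually_elim (use h in \<open>auto simp: R_def\<close>)
  have g: "integrable lborel (R (-pi + h) (pi + h))"
    using Bochner_Integration.integrable_add[OF p1 p2(1)]
    by (subst (asm) integrable_cong_AE[OF _ _ ae1]) auto
  have "(\<integral>z. R (-pi + h) (pi + h) z \<partial>lborel) = (\<integral>z. R (-pi + h) pi z + R pi (pi + h) z \<partial>lborel)"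
    by (rule integral_cong_AE[symmetric]) (use ae1 in auto)
  also have "\<dots> = (\<integral>z. R (-pi + h) pi z + R (-pi) (-pi + h) z \<partial>lborel)"
    using p1 p2 p3 by simp
  also have "\<dots> = (\<integral>z. R (-pi) pi z \<partial>lborel)"
    by (rule integral_cong_AE) (use ae2 in auto)
  finally have geq: "(\<integral>z. R (-pi + h) (pi + h) z \<partial>lborel) = (\<integral>z. R (-pi) pi z \<partial>lborel)" .
  have e: "indicator C z *\<^sub>R H (z + h *\<^sub>R b) = R (-pi + h) (pi + h) (z + h *\<^sub>R b)" for z
    unfolding C R_def K_def by (auto simp: indicator_def inner_simps bb A)
  show "set_integrable lborel C (\<lambda>z. H (z + h *\<^sub>R b))"
    unfolding set_integrable_def e
    by (subst lborel_integrable_translate) (use g in auto)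
  show "(LINT z:C|lborel. H (z + h *\<^sub>R b)) = (LINT z:C|lborel. H z)"
    unfolding set_lebesgue_integral_def e eqC
    by (subst lborel_integral_translate) (use geq in auto)
qed

section \<open>Smooth functions on the half-space\<close>

lemma Ck_on_add_scaled:
  "Ck_on k S f \<Longrightarrow> Ck_on k S g \<Longrightarrow> Ck_on k S (\<lambda>x. f x + c * g x)"
proof (induction k arbitrary: f g)
  case 0
  then show ?case by (auto intro!: continuous_intros)
next
  case (Suc k)
  obtain f' where f': "\<forall>x\<in>S. (f has_derivative f' x) (at x within S)" "\<forall>v\<in>Basis. Ck_on k S (\<lambda>x. f' x v)"
    using Suc.prems by auto
  obtain g' where g': "\<forall>x\<in>S. (g has_derivative g' x) (at x within S)" "\<forall>v\<in>Basis. Ck_on k S (\<lambda>x. g' x v)"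
    using Suc.prems by auto
  show ?case
    unfolding Ck_on.simps
  proof (intro exI[of _ "\<lambda>x v. f' x v + c * g' x v"] conjI ballI)
    show "((\<lambda>x. f x + c * g x) has_derivative (\<lambda>v. f' x v + c * g' x v)) (at x within S)" if "x \<in> S" for x
      using f' g' that by (auto intro!: derivative_intros)
    show "Ck_on k S (\<lambda>x. f' x v + c * g' x v)" if "v \<in> Basis" for v
      using f' g' that Suc.IH by blast
  qed
qed

lemma Ck_on_translate:
  assumes "\<And>x. x \<in> S \<Longrightarrow> x + z \<in> S"
  shows "Ck_on k S f \<Longrightarrow> Ck_on k S (\<lambda>x. f (x + z))"
proof (induction k arbitrary: f)
  case 0
  then show ?case
    using continuous_on_compose2[of S f S "\<lambda>x. x + z"] assms
    by (simp add: continuous_on_add continuous_on_id continuous_on_const image_subset_iff)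
next
  case (Suc k)
  obtain f' where f': "\<forall>x\<in>S. (f has_derivative f' x) (at x within S)" "\<forall>v\<in>Basis. Ck_on k S (\<lambda>x. f' x v)"
    using Suc.prems by auto
  show ?case
    unfolding Ck_on.simps
  proof (intro exI[of _ "\<lambda>x v. f' (x + z) v"] conjI ballI)
    show "((\<lambda>x. f (x + z)) has_derivative f' (x + z)) (at x within S)" if "x \<in> S" for x
    proof -
      have "((\<lambda>x. f (x + z)) has_derivative (\<lambda>y. f' (x + z) y)) (at x within S)"
      proof (rule has_derivative_in_compose2[where t=S and f="\<lambda>x. x + z"])
        show "((\<lambda>x. x + z) has_derivative (\<lambda>y. y)) (at x within S)" by (auto intro!: derivative_eq_intros)
      qed (use f' that assms in auto)
      then show ?thesis by simp
    qed
    show "Ck_on k S (\<lambda>x. f' (x + z) v)" if "v \<in> Basis" for v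
      using f' that Suc.IH by blast
  qed
qed

definition half_space :: "((real^3) \<times> real) set" where
  "half_space = UNIV \<times> {0..}"

lemma half_space_iff: "(x, y) \<in> half_space \<longleftrightarrow> 0 \<le> y" by (simp add: half_space_def)

lemma at_within_half_space:
  assumes "0 < snd z" shows "at z within half_space = at z"
proof (rule at_within_interior)
  have "UNIV \<times> {0::real<..} \<subseteq> interior half_space"
    by (rule interior_maximal) (auto simp: half_space_def open_Times)
  then show "z \<in> interior half_space" using assms by (cases z) auto
qed

lemma cube_eq: "cube = box (\<chi> i. -pi) (\<chi> i. pi)"
  by (auto simp: cube_def box_def Basis_vec_def inner_axis)

lemma cube_open: "open cube" by (simp add: cube_eq open_box)

lemma cube_sets[measurable]: "cube \<in> sets borel" using cube_open by simp

lemma half_cylinder_open: "open half_cylinder"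
  by (simp add: half_cylinder_def cube_open open_Times)

lemma half_cylinder_sets[measurable]: "half_cylinder \<in> sets borel"
  using half_cylinder_open by simp

lemma smooth_gradient:
  assumes "smooth_on half_space U"
  obtains g where "continuous_on half_space g"
    "\<And>z. z \<in> half_space \<Longrightarrow> (U has_derivative (\<lambda>h. h \<bullet> g z)) (at z within half_space)"
proof -
  have "Ck_on (Suc 0) half_space U" using assms unfolding smooth_on_def by blast
  then obtain f' where f': "\<forall>x\<in>half_space. (U has_derivative f' x) (at x within half_space)"
      "\<forall>v\<in>Basis. continuous_on half_space (\<lambda>x. f' x v)"
    by auto
  define g where "g z = (\<Sum>v\<in>Basis. f' z v *\<^sub>R v)" for z
  have "continuous_on half_space g"
    unfolding g_def using f' by (intro continuous_intros) auto
  moreover have "(U has_derivative (\<lambda>h. h \<bullet> g z)) (at z within half_space)" if "z \<in> half_space" for z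
  proof -
    have d: "(U has_derivative f' z) (at z within half_space)" using f' that by blast
    then have lin: "linear (f' z)" by (simp add: has_derivative_linear)
    have "f' z h = h \<bullet> g z" for h
    proof -
      have "f' z h = f' z (\<Sum>v\<in>Basis. (h \<bullet> v) *\<^sub>R v)" by (simp only: euclidean_representation)
      also have "\<dots> = (\<Sum>v\<in>Basis. (h \<bullet> v) * f' z v)"
        using lin by (simp only: linear_sum linear_cmul real_scaleR_def)
      also have "\<dots> = h \<bullet> g z"
        unfolding g_def by (simp only: inner_sum_right inner_scaleR_right mult.commute)
      finally show ?thesis .
    qed
    then have "f' z = (\<lambda>h. h \<bullet> g z)" by blast
    then show ?thesis using d by simp
  qed
  ultimately show ?thesis by (rule that)
qed

lemma inner_fun_unique: "(\<lambda>h. h \<bullet> a) = (\<lambda>h. h \<bullet> b) \<Longrightarrow> a = (b::'a::real_inner)"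
proof -
  assume "(\<lambda>h. h \<bullet> a) = (\<lambda>h. h \<bullet> b)"
  then have "(a - b) \<bullet> a = (a - b) \<bullet> b" by (rule fun_cong)
  then have "(a - b) \<bullet> (a - b) = 0" by (simp add: inner_diff_right)
  then show "a = b" by simp
qed

text \<open>
The second component of an element of \<^const>\<open>smooth_periodic\<close> is prescribed on the half-cylinder only. The
gradient \<open>g\<close> obtained here extends it periodically and continuously up to the boundary, which is
what translations and the trace inequality work with.
\<close>

lemma smooth_periodic_gradient:
  assumes "(U, G) \<in> smooth_periodic s"
  obtains g where "continuous_on half_space g"
    "\<And>z. z \<in> half_space \<Longrightarrow> (U has_derivative (\<lambda>h. h \<bullet> g z)) (at z within half_space)"
    "\<And>z. z \<in> half_cylinder \<Longrightarrow> g z = G z"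
    "\<And>z i. 0 < snd z \<Longrightarrow> g (z + (axis i (2 * pi), 0)) = g z"
    "\<And>z. 0 < snd z \<Longrightarrow> GDERIV U z :> g z"
proof -
  have sm: "smooth_on half_space U" and per: "\<And>x y i. 0 \<le> y \<Longrightarrow> U (x + axis i (2 * pi), y) = U (x, y)"
    and G: "\<And>z. z\<in>half_cylinder \<Longrightarrow> GDERIV U z :> G z"
    using assms by (auto simp: smooth_periodic_def half_space_def)
  obtain g where g: "continuous_on half_space g"
    "\<And>z. z \<in> half_space \<Longrightarrow> (U has_derivative (\<lambda>h. h \<bullet> g z)) (at z within half_space)"
    using smooth_gradient[OF sm] by blast
  have gd: "(U has_derivative (\<lambda>h. h \<bullet> g z)) (at z)" if "0 < snd z" for z
    using g(2)[of z] at_within_half_space[OF that] that by (cases z) (auto simp: half_space_iff)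
  have "g z = G z" if "z \<in> half_cylinder" for z
  proof -
    have "0 < snd z" using that by (auto simp: half_cylinder_def)
    from has_derivative_unique[OF gd[OF this] G[OF that, unfolded gderiv_def]]
    show ?thesis by (rule inner_fun_unique)
  qed
  moreover have "g (z + (axis i (2 * pi), 0)) = g z" if z: "0 < snd z" for z i
  proof -
    let ?w = "(axis i (2 * pi), 0) :: (real^3) \<times> real"
    have d1: "((\<lambda>z. U (z + ?w)) has_derivative (\<lambda>h. h \<bullet> g (z + ?w))) (at z)"
    proof (rule has_derivative_compose[where g=U and f="\<lambda>z. z + ?w" and f'="\<lambda>h. h"])
      show "((\<lambda>z. z + ?w) has_derivative (\<lambda>h. h)) (at z)" by (auto intro!: derivative_eq_intros)
      show "(U has_derivative (\<lambda>h. h \<bullet> g (z + ?w))) (at (z + ?w))" by (rule gd) (use z in simp)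
    qed
    have d2: "open {z::(real^3) \<times> real. 0 < snd z}" by (intro open_Collect_less continuous_intros)
    have d3: "U (x + ?w) = U x" if "x \<in> {z. 0 < snd z}" for x
      using that per[of "snd x" "fst x" i] by (cases x) simp
    have "(U has_derivative (\<lambda>h. h \<bullet> g (z + ?w))) (at z)"
      by (rule has_derivative_transform_within_open[OF d1 d2 _ d3]) (use z in simp_all)
    from has_derivative_unique[OF this gd[OF z]] show ?thesis by (rule inner_fun_unique)
  qed
  moreover have "GDERIV U z :> g z" if "0 < snd z" for z
    using gd[OF that] by (simp add: gderiv_def)
  ultimately show ?thesis by (intro that[OF g]) auto
qed

section \<open>The weighted Sobolev space as a Hilbert space\<close>

lemma kappa_pos: "0 < s \<Longrightarrow> s < 1 \<Longrightarrow> 0 < kappa s"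
  unfolding kappa_def by (intro divide_pos_pos mult_pos_pos Gamma_real_pos) auto

text \<open>
The weight is absorbed into the function: \<open>X_inner\<close> becomes \<open>1 / kappa s\<close> times the inner product of
\<open>L\<^sup>2\<close> functions with values in a Euclidean space, so that completeness and the Cauchy-Schwarz
inequality are inherited from there.
\<close>

definition lift :: "real \<Rightarrow> real \<Rightarrow> fun_with_grad \<Rightarrow> (real^3) \<times> real \<Rightarrow> real \<times> ((real^3) \<times> real)" where
  "lift s m W z = (indicator half_cylinder z * sqrt (snd z powr (1 - 2 * s))) *\<^sub>R (m * fst W z, snd W z)"

text \<open>
The one operation \<open>W + t V\<close> provides sums, differences and multiples.
\<close>

definition fg_comb :: "fun_with_grad \<Rightarrow> real \<Rightarrow> fun_with_grad \<Rightarrow> fun_with_grad" where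
  "fg_comb W t V = (\<lambda>z. fst W z + t * fst V z, \<lambda>z. snd W z + t *\<^sub>R snd V z)"

lemma fg_diff_comb: "fg_diff W V = fg_comb W (-1) V"
  by (cases W; cases V) (simp add: fg_comb_def)

lemma lift_comb: "lift s m (fg_comb W t V) z = lift s m W z + t *\<^sub>R lift s m V z"
  by (simp add: lift_def fg_comb_def algebra_simps)

lemma borel_measurable_snd[measurable]: "snd \<in> borel_measurable (borel :: ('a::topological_space \<times> 'b::topological_space) measure)"
  by (intro borel_measurable_continuous_onI continuous_intros)

lemma borel_measurable_fst[measurable]: "fst \<in> borel_measurable (borel :: ('a::topological_space \<times> 'b::topological_space) measure)"
  by (intro borel_measurable_continuous_onI continuous_intros)

lemma weight_measurable[measurable]: "(\<lambda>z::(real^3) \<times> real. snd z powr (1 - 2 * s)) \<in> borel_measurable borel"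
  by (intro powr_real_measurable borel_measurable_snd borel_measurable_const)

lemma half_cylinder_snd: "z \<in> half_cylinder \<Longrightarrow> 0 < snd z" by (auto simp: half_cylinder_def)

lemma norm_lift:
  "(norm (lift s m W z))\<^sup>2 = indicator half_cylinder z * (snd z powr (1 - 2 * s) * (m\<^sup>2 * (fst W z)\<^sup>2 + (norm (snd W z))\<^sup>2))"
  by (simp add: lift_def norm_Pair power_mult_distrib indicator_def distrib_left)

lemma inner_lift:
  "lift s m W z \<bullet> lift s m V z =
    indicator half_cylinder z * (snd z powr (1 - 2 * s) * (snd W z \<bullet> snd V z + m\<^sup>2 * fst W z * fst V z))"
  by (simp add: lift_def indicator_def power2_eq_square algebra_simps flip: real_sqrt_mult)

lemma weighted_L2_iff:
  assumes "m > 0"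
  shows "W \<in> weighted_L2 s \<longleftrightarrow> sq_integrable lborel (lift s m W)"
proof -
  obtain U G where W: "W = (U, G)" by (cases W)
  let ?w = "\<lambda>z::(real^3) \<times> real. snd z powr (1 - 2 * s)"
  show ?thesis
  proof
    assume "W \<in> weighted_L2 s"
    then have mU: "(\<lambda>z. indicator half_cylinder z *\<^sub>R U z) \<in> borel_measurable lborel"
      and mG: "(\<lambda>z. indicator half_cylinder z *\<^sub>R G z) \<in> borel_measurable lborel"
      and iU: "integrable lborel (\<lambda>z. indicator half_cylinder z *\<^sub>R (?w z * (U z)\<^sup>2))"
      and iG: "integrable lborel (\<lambda>z. indicator half_cylinder z *\<^sub>R (?w z * (norm (G z))\<^sup>2))"
      by (auto simp: W weighted_L2_def set_borel_measurable_def set_integrable_def)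
    have "lift s m W = (\<lambda>z. sqrt (?w z) *\<^sub>R (m * (indicator half_cylinder z *\<^sub>R U z), indicator half_cylinder z *\<^sub>R G z))"
      by (rule ext) (simp add: lift_def W)
    moreover have "\<dots> \<in> borel_measurable lborel"
    proof (rule borel_measurable_scaleR)
      show "(\<lambda>z. sqrt (?w z)) \<in> borel_measurable lborel" by measurable
      show "(\<lambda>z. (m * (indicator half_cylinder z *\<^sub>R U z), indicator half_cylinder z *\<^sub>R G z)) \<in> borel_measurable lborel"
        by (intro borel_measurable_Pair borel_measurable_times borel_measurable_const mU mG)
    qed
    moreover have "integrable lborel (\<lambda>z. (norm (lift s m W z))\<^sup>2)"
    proof -
      have "integrable lborel (\<lambda>z. m\<^sup>2 * (indicator half_cylinder z *\<^sub>R (?w z * (U z)\<^sup>2))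
         + indicator half_cylinder z *\<^sub>R (?w z * (norm (G z))\<^sup>2))"
        using iU iG by simp
      then show ?thesis by (simp add: norm_lift W algebra_simps)
    qed
    ultimately show "sq_integrable lborel (lift s m W)" unfolding sq_integrable_def by metis
  next
    assume sq: "sq_integrable lborel (lift s m W)"
    then have lm[measurable]: "lift s m W \<in> borel_measurable borel"
      and li: "integrable lborel (\<lambda>z. (norm (lift s m W z))\<^sup>2)" by (auto simp: sq_integrable_def)
    have eU: "indicator half_cylinder z *\<^sub>R U z = indicator half_cylinder z * (fst (lift s m W z) / (m * sqrt (?w z)))" for z
      using assms half_cylinder_snd[of z] by (auto simp: lift_def W indicator_def)
    have eG: "indicator half_cylinder z *\<^sub>R G z = (indicator half_cylinder z / sqrt (?w z)) *\<^sub>R snd (lift s m W z)" for z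
      using assms half_cylinder_snd[of z] by (auto simp: lift_def W indicator_def)
    have mU: "(\<lambda>z. indicator half_cylinder z *\<^sub>R U z) \<in> borel_measurable borel"
      unfolding eU by measurable
    have mG: "(\<lambda>z. indicator half_cylinder z *\<^sub>R G z) \<in> borel_measurable borel"
      unfolding eG by measurable
    have iU: "integrable lborel (\<lambda>z. indicator half_cylinder z *\<^sub>R (?w z * (U z)\<^sup>2))"
    proof (rule Bochner_Integration.integrable_bound)
      show "integrable lborel (\<lambda>z. (norm (lift s m W z))\<^sup>2 / m\<^sup>2)" using li by simp
      have "(\<lambda>z. ?w z * (indicator half_cylinder z *\<^sub>R U z)\<^sup>2) \<in> borel_measurable borel"
        using mU by measurable
      also have "(\<lambda>z. ?w z * (indicator half_cylinder z *\<^sub>R U z)\<^sup>2) = (\<lambda>z. indicator half_cylinder z *\<^sub>R (?w z * (U z)\<^sup>2))"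
        by (auto simp: indicator_def)
      finally show "(\<lambda>z. indicator half_cylinder z *\<^sub>R (?w z * (U z)\<^sup>2)) \<in> borel_measurable lborel" by simp
      show "AE z in lborel. norm (indicator half_cylinder z *\<^sub>R (?w z * (U z)\<^sup>2)) \<le> norm ((norm (lift s m W z))\<^sup>2 / m\<^sup>2)"
        using assms by (intro AE_I2) (auto simp: norm_lift W indicator_def field_simps)
    qed
    have iG: "integrable lborel (\<lambda>z. indicator half_cylinder z *\<^sub>R (?w z * (norm (G z))\<^sup>2))"
    proof (rule Bochner_Integration.integrable_bound[OF li])
      have "(\<lambda>z. ?w z * (norm (indicator half_cylinder z *\<^sub>R G z))\<^sup>2) \<in> borel_measurable borel"
        using mG by measurable
      also have "(\<lambda>z. ?w z * (norm (indicator half_cylinder z *\<^sub>R G z))\<^sup>2) = (\<lambda>z. indicator half_cylinder z *\<^sub>R (?w z * (norm (G z))\<^sup>2))"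
        by (auto simp: indicator_def)
      finally show "(\<lambda>z. indicator half_cylinder z *\<^sub>R (?w z * (norm (G z))\<^sup>2)) \<in> borel_measurable lborel" by simp
      show "AE z in lborel. norm (indicator half_cylinder z *\<^sub>R (?w z * (norm (G z))\<^sup>2)) \<le> norm ((norm (lift s m W z))\<^sup>2)"
        by (intro AE_I2) (auto simp: norm_lift W indicator_def field_simps)
    qed
    show "W \<in> weighted_L2 s"
      using mU mG iU iG by (auto simp: W weighted_L2_def set_borel_measurable_def set_integrable_def)
  qed
qed

lemma X_inner_lift:
  "X_inner s m W V = (1 / kappa s) * (\<integral>z. lift s m W z \<bullet> lift s m V z \<partial>lborel)"
  by (cases W; cases V) (simp add: inner_lift set_lebesgue_integral_def)

lemma X_inner_commute: "X_inner s m W V = X_inner s m V W"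
  unfolding X_inner_lift by (simp add: inner_commute)

lemma weighted_L2_comb:
  fixes m :: real
  assumes "m > 0" "W \<in> weighted_L2 s" "V \<in> weighted_L2 s"
  shows "fg_comb W t V \<in> weighted_L2 s"
proof -
  have "sq_integrable lborel (\<lambda>z. lift s m W z + t *\<^sub>R lift s m V z)"
    using assms by (intro sq_integrable_add_scaled) (auto simp: weighted_L2_iff)
  then show ?thesis unfolding weighted_L2_iff[OF assms(1)] lift_comb[abs_def] .
qed

lemma X_inner_comb:
  assumes "m > 0" "W \<in> weighted_L2 s" "V \<in> weighted_L2 s" "Z \<in> weighted_L2 s"
  shows "X_inner s m (fg_comb W t V) Z = X_inner s m W Z + t * X_inner s m V Z"
proof -
  have "integrable lborel (\<lambda>z. lift s m W z \<bullet> lift s m Z z)" "integrable lborel (\<lambda>z. lift s m V z \<bullet> lift s m Z z)"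
    using assms by (auto intro!: sq_integrable_inner simp: weighted_L2_iff[of m])
  then show ?thesis
    unfolding X_inner_lift lift_comb by (simp add: inner_simps algebra_simps)
qed

lemma X_inner_self: "X_inner s m W W = (1 / kappa s) * (\<integral>z. (norm (lift s m W z))\<^sup>2 \<partial>lborel)"
  unfolding X_inner_lift by (simp add: power2_norm_eq_inner)

lemma X_inner_self_nonneg: "0 < s \<Longrightarrow> s < 1 \<Longrightarrow> 0 \<le> X_inner s m W W"
  unfolding X_inner_self using kappa_pos[of s] by simp

lemma X_norm_square: "0 < s \<Longrightarrow> s < 1 \<Longrightarrow> (X_norm s m W)\<^sup>2 = X_inner s m W W"
  unfolding X_norm_def using X_inner_self_nonneg by simp

lemma X_norm_nonneg: "0 < s \<Longrightarrow> s < 1 \<Longrightarrow> 0 \<le> X_norm s m W"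
  unfolding X_norm_def using X_inner_self_nonneg by simp

lemma X_Cauchy_Schwarz:
  assumes "0 < s" "s < 1" "m > 0" "W \<in> weighted_L2 s" "V \<in> weighted_L2 s"
  shows "\<bar>X_inner s m W V\<bar> \<le> X_norm s m W * X_norm s m V"
proof -
  have "\<bar>\<integral>z. lift s m W z \<bullet> lift s m V z \<partial>lborel\<bar>
      \<le> sqrt (\<integral>z. (norm (lift s m W z))\<^sup>2 \<partial>lborel) * sqrt (\<integral>z. (norm (lift s m V z))\<^sup>2 \<partial>lborel)"
    using assms by (intro integral_Cauchy_Schwarz) (auto simp: weighted_L2_iff[of m])
  then have "(1 / kappa s) * \<bar>\<integral>z. lift s m W z \<bullet> lift s m V z \<partial>lborel\<bar>
      \<le> (1 / kappa s) * (sqrt (\<integral>z. (norm (lift s m W z))\<^sup>2 \<partial>lborel) * sqrt (\<integral>z. (norm (lift s m V z))\<^sup>2 \<partial>lborel))"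
    using kappa_pos[OF assms(1,2)] by (intro mult_left_mono) auto
  moreover have "X_norm s m W * X_norm s m V =
      (1 / kappa s) * (sqrt (\<integral>z. (norm (lift s m W z))\<^sup>2 \<partial>lborel) * sqrt (\<integral>z. (norm (lift s m V z))\<^sup>2 \<partial>lborel))"
    unfolding X_norm_def X_inner_self using kappa_pos[OF assms(1,2)] by (simp add: real_sqrt_mult real_sqrt_divide)
  ultimately show ?thesis
    unfolding X_inner_lift abs_mult using kappa_pos[OF assms(1,2)] by simp
qed

lemma X_norm_comb_self:
  assumes "0 < s" "s < 1" "m > 0" "W \<in> weighted_L2 s" "V \<in> weighted_L2 s"
  shows "(X_norm s m (fg_comb W t V))\<^sup>2 = (X_norm s m W)\<^sup>2 + 2 * t * X_inner s m W V + t\<^sup>2 * (X_norm s m V)\<^sup>2"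
proof -
  have c: "fg_comb W t V \<in> weighted_L2 s" by (rule weighted_L2_comb[OF assms(3,4,5)])
  have "X_inner s m (fg_comb W t V) (fg_comb W t V) = X_inner s m W (fg_comb W t V) + t * X_inner s m V (fg_comb W t V)"
    by (rule X_inner_comb[OF assms(3,4,5) c])
  also have "X_inner s m W (fg_comb W t V) = X_inner s m W W + t * X_inner s m W V"
    using X_inner_comb[OF assms(3,4,5,4)] X_inner_commute by metis
  also have "X_inner s m V (fg_comb W t V) = X_inner s m W V + t * X_inner s m V V"
    using X_inner_comb[OF assms(3,4,5,5)] X_inner_commute by metis
  finally show ?thesis
    unfolding X_norm_square[OF assms(1,2)] by (simp add: power2_eq_square algebra_simps)
qed

lemma X_norm_triangle:
  assumes "0 < s" "s < 1" "m > 0" "W \<in> weighted_L2 s" "V \<in> weighted_L2 s"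
  shows "X_norm s m (fg_comb W t V) \<le> X_norm s m W + \<bar>t\<bar> * X_norm s m V"
proof (rule power2_le_imp_le)
  have "t * X_inner s m W V \<le> \<bar>t\<bar> * (X_norm s m W * X_norm s m V)"
    by (rule order_trans[OF abs_ge_self], unfold abs_mult, rule mult_left_mono[OF X_Cauchy_Schwarz[OF assms]]) simp
  then show "(X_norm s m (fg_comb W t V))\<^sup>2 \<le> (X_norm s m W + \<bar>t\<bar> * X_norm s m V)\<^sup>2"
    unfolding X_norm_comb_self[OF assms] power2_sum by (simp add: power_mult_distrib mult.assoc mult.left_commute)
  show "0 \<le> X_norm s m W + \<bar>t\<bar> * X_norm s m V" using assms X_norm_nonneg by simp
qed

lemma smooth_periodic_weighted_L2: "W \<in> smooth_periodic s \<Longrightarrow> W \<in> weighted_L2 s"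
  by (cases W) (simp add: smooth_periodic_def)

text \<open>
The limit of the lifted sequence exists by \<open>sq_integrable_complete\<close>; dividing by the
weight, which is positive on the half-cylinder, turns it back into a function with a gradient.
\<close>

lemma X_space_complete:
  assumes s: "0 < s" "s < 1" and m: "m > 0"
    and \<Phi>: "\<And>n. \<Phi> n \<in> smooth_periodic s"
    and Cauchy: "\<And>e. e > 0 \<Longrightarrow> \<exists>N. \<forall>i\<ge>N. \<forall>j\<ge>N. X_norm s m (fg_diff (\<Phi> i) (\<Phi> j)) < e"
  obtains W where "W \<in> X_space s m" "(\<lambda>n. X_norm s m (fg_diff (\<Phi> n) W)) \<longlonglongrightarrow> 0"
proof -
  note k = kappa_pos[OF s]
  have sq: "sq_integrable lborel (lift s m (\<Phi> n))" for n
    using \<Phi> smooth_periodic_weighted_L2 weighted_L2_iff[OF m] by blast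
  have eq: "(X_norm s m (fg_diff W V))\<^sup>2 = (1 / kappa s) * (\<integral>z. (norm (lift s m W z - lift s m V z))\<^sup>2 \<partial>lborel)" for W V
    unfolding fg_diff_comb using s by (simp add: X_norm_square X_inner_self lift_comb)
  have "\<exists>N. \<forall>i\<ge>N. \<forall>j\<ge>N. (\<integral>z. (norm (lift s m (\<Phi> i) z - lift s m (\<Phi> j) z))\<^sup>2 \<partial>lborel) < e" if "e > 0" for e
  proof -
    obtain N where N: "\<forall>i\<ge>N. \<forall>j\<ge>N. X_norm s m (fg_diff (\<Phi> i) (\<Phi> j)) < sqrt (e / kappa s)"
      using Cauchy[of "sqrt (e / kappa s)"] \<open>e > 0\<close> k by auto
    have "(\<integral>z. (norm (lift s m (\<Phi> i) z - lift s m (\<Phi> j) z))\<^sup>2 \<partial>lborel) < e" if "i \<ge> N" "j \<ge> N" for i j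
    proof -
      have "X_norm s m (fg_diff (\<Phi> i) (\<Phi> j)) < sqrt (e / kappa s)" using N that by blast
      then have "(X_norm s m (fg_diff (\<Phi> i) (\<Phi> j)))\<^sup>2 < (sqrt (e / kappa s))\<^sup>2"
        using X_norm_nonneg[OF s] by (intro power_strict_mono) auto
      then show ?thesis unfolding eq using k \<open>e > 0\<close> by (simp add: divide_strict_right_mono field_simps)
    qed
    then show ?thesis by blast
  qed
  from sq_integrable_complete[OF sq this]
  obtain g where g: "sq_integrable lborel g" "(\<lambda>n. \<integral>z. (norm (lift s m (\<Phi> n) z - g z))\<^sup>2 \<partial>lborel) \<longlonglongrightarrow> 0"
    by blast
  let ?r = "\<lambda>z::(real^3) \<times> real. sqrt (snd z powr (1 - 2 * s))"
  define W :: fun_with_grad where "W = (\<lambda>z. fst (g z) / (m * ?r z), \<lambda>z. (1 / ?r z) *\<^sub>R snd (g z))"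
  have lW: "lift s m W z = indicator half_cylinder z *\<^sub>R g z" for z
    using m half_cylinder_snd[of z] by (auto simp: lift_def W_def indicator_def prod_eq_iff)
  have gm[measurable]: "g \<in> borel_measurable borel" and gi: "integrable lborel (\<lambda>z. (norm (g z))\<^sup>2)"
    using g by (auto simp: sq_integrable_def)
  have "integrable lborel (\<lambda>z. (norm (lift s m W z))\<^sup>2)"
    unfolding lW by (rule Bochner_Integration.integrable_bound[OF gi]) (auto simp: indicator_def)
  then have sqW: "sq_integrable lborel (lift s m W)"
    unfolding sq_integrable_def by (simp add: lW[abs_def])
  then have WL: "W \<in> weighted_L2 s" using weighted_L2_iff[OF m] by blast
  have "(\<lambda>n. (X_norm s m (fg_diff (\<Phi> n) W))\<^sup>2) \<longlonglongrightarrow> 0"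
  proof (rule Lim_null_comparison)
    show "(\<lambda>n. (1 / kappa s) * (\<integral>z. (norm (lift s m (\<Phi> n) z - g z))\<^sup>2 \<partial>lborel)) \<longlonglongrightarrow> 0"
      using tendsto_mult_right_zero[OF g(2)] .
    have "(\<integral>z. (norm (lift s m (\<Phi> n) z - lift s m W z))\<^sup>2 \<partial>lborel) \<le> (\<integral>z. (norm (lift s m (\<Phi> n) z - g z))\<^sup>2 \<partial>lborel)" for n
    proof (rule integral_mono)
      show "integrable lborel (\<lambda>z. (norm (lift s m (\<Phi> n) z - lift s m W z))\<^sup>2)"
        using sq_integrable_add_scaled[OF sq[of n] sqW, of "-1"] by (simp add: sq_integrable_def)
      show "integrable lborel (\<lambda>z. (norm (lift s m (\<Phi> n) z - g z))\<^sup>2)"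
        using sq_integrable_add_scaled[OF sq[of n] g(1), of "-1"] by (simp add: sq_integrable_def)
      show "(norm (lift s m (\<Phi> n) z - lift s m W z))\<^sup>2 \<le> (norm (lift s m (\<Phi> n) z - g z))\<^sup>2" for z
        unfolding lW by (auto simp: indicator_def lift_def)
    qed
    then show "\<forall>\<^sub>F n in sequentially. norm ((X_norm s m (fg_diff (\<Phi> n) W))\<^sup>2) \<le> (1 / kappa s) * (\<integral>z. (norm (lift s m (\<Phi> n) z - g z))\<^sup>2 \<partial>lborel)"
      unfolding eq using k by (intro always_eventually allI) (simp add: divide_right_mono)
  qed
  then have lim: "(\<lambda>n. X_norm s m (fg_diff (\<Phi> n) W)) \<longlonglongrightarrow> 0"
    using tendsto_real_sqrt[of "\<lambda>n. (X_norm s m (fg_diff (\<Phi> n) W))\<^sup>2" 0] X_norm_nonneg[OF s] by simp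
  then have "W \<in> X_space s m" using WL \<Phi> unfolding X_space_def by blast
  then show ?thesis using lim by (rule that)
qed

lemma smooth_periodic_comb:
  fixes m :: real
  assumes "m > 0" "W \<in> smooth_periodic s" "V \<in> smooth_periodic s"
  shows "fg_comb W t V \<in> smooth_periodic s"
proof -
  obtain U G V' H where W: "W = (U, G)" "V = (V', H)" by (cases W; cases V)
  have L: "fg_comb W t V \<in> weighted_L2 s"
    by (intro weighted_L2_comb[OF assms(1)] smooth_periodic_weighted_L2 assms)
  have "smooth_on (UNIV \<times> {0..}) (\<lambda>z. U z + t * V' z)"
    using assms unfolding W smooth_periodic_def smooth_on_def by (auto intro: Ck_on_add_scaled)
  moreover have "GDERIV (\<lambda>z. U z + t * V' z) z :> G z + t *\<^sub>R H z" if "z \<in> half_cylinder" for z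
  proof -
    have "GDERIV U z :> G z" "GDERIV V' z :> H z"
      using assms that by (auto simp: W smooth_periodic_def)
    then show ?thesis unfolding gderiv_def
      by (auto intro!: derivative_eq_intros simp: inner_simps)
  qed
  ultimately show ?thesis
    using assms L unfolding W smooth_periodic_def fg_comb_def by auto
qed

section \<open>Translations combined with a change of sign\<close>

definition grad :: "((real^3) \<times> real \<Rightarrow> real) \<Rightarrow> (real^3) \<times> real \<Rightarrow> (real^3) \<times> real" where
  "grad U z = (SOME D. GDERIV U z :> D)"

lemma grad_eq:
  assumes "GDERIV U z :> D" shows "grad U z = D"
proof -
  have "GDERIV U z :> grad U z" unfolding grad_def by (rule someI) (rule assms)
  from has_derivative_unique[OF this[unfolded gderiv_def] assms[unfolded gderiv_def]]
  show ?thesis by (rule inner_fun_unique)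
qed

text \<open>
Translation by \<open>h\<close> along the \<open>i\<close>-th axis and multiplication by the sign \<open>\<eta>\<close>. As the given gradient
means nothing outside the half-cylinder, the translated one is taken from the function itself.
\<close>

definition fg_shift :: "3 \<Rightarrow> real \<Rightarrow> real \<Rightarrow> fun_with_grad \<Rightarrow> fun_with_grad" where
  "fg_shift i h \<eta> W = (\<lambda>z. \<eta> * fst W (z + (axis i h, 0)), \<lambda>z. \<eta> *\<^sub>R grad (fst W) (z + (axis i h, 0)))"

lemma axis_scale: "axis i (h::real) = h *\<^sub>R axis i 1"
  by (simp add: vec_eq_iff axis_def)

lemma axis_in_Basis: "axis i (1::real) \<in> Basis" by (auto simp: Basis_vec_def)

lemma half_cylinder_integral_shift:
  fixes H :: "(real^3) \<times> real \<Rightarrow> real"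
  assumes cont: "continuous_on {z. 0 < snd z} H"
    and per: "\<And>z. 0 < snd z \<Longrightarrow> H (z + (axis i (2 * pi), 0)) = H z"
    and h: "0 \<le> h" "h \<le> 2 * pi"
    and int: "set_integrable lborel half_cylinder H"
  shows "set_integrable lborel half_cylinder (\<lambda>z. H (z + (axis i h, 0)))"
    and "(LINT z:half_cylinder|lborel. H (z + (axis i h, 0))) = (LINT z:half_cylinder|lborel. H z)"
proof -
  let ?b = "(axis i 1, 0) :: (real^3) \<times> real"
  let ?A = "{z :: (real^3) \<times> real. 0 < snd z \<and> (\<forall>j. j \<noteq> i \<longrightarrow> - pi < fst z $ j \<and> fst z $ j < pi)}"
  have sc: "t *\<^sub>R ?b = (axis i t, 0)" for t :: real
    using axis_scale[of i t] by simp
  have b: "?b \<in> Basis" using axis_in_Basis[of i] by (simp add: Basis_prod_def)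
  have A: "z + t *\<^sub>R ?b \<in> ?A \<longleftrightarrow> z \<in> ?A" for z t
    unfolding sc by (simp add: axis_def)
  have opA: "open ?A"
  proof -
    have "?A = {z. 0 < snd z} \<inter> (\<Inter>j\<in>-{i}. {z. - pi < fst z $ j} \<inter> {z. fst z $ j < pi})" by auto
    also have "open \<dots>"
      by (intro open_Int open_INT open_Collect_less continuous_intros ballI) auto
    finally show ?thesis .
  qed
  have HA: "(\<lambda>z. indicator ?A z *\<^sub>R H z) \<in> borel_measurable borel"
    by (rule borel_measurable_continuous_on_indicator)
      (use opA continuous_on_subset[OF cont, of ?A] in auto)
  have C: "half_cylinder = {z \<in> ?A. - pi < z \<bullet> ?b \<and> z \<bullet> ?b < pi}"
  proof (rule set_eqI)
    fix z :: "(real^3) \<times> real"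
    have "(\<forall>j. - pi < fst z $ j \<and> fst z $ j < pi) \<longleftrightarrow>
        (\<forall>j. j \<noteq> i \<longrightarrow> - pi < fst z $ j \<and> fst z $ j < pi) \<and> (- pi < fst z $ i \<and> fst z $ i < pi)"
      by metis
    then show "z \<in> half_cylinder \<longleftrightarrow> z \<in> {z \<in> ?A. - pi < z \<bullet> ?b \<and> z \<bullet> ?b < pi}"
      by (cases z) (simp add: half_cylinder_def cube_def inner_axis conj_ac)
  qed
  have per': "H (z + (2 * pi) *\<^sub>R ?b) = H z" if "z \<in> ?A" for z
    unfolding sc using that per by simp
  note * = periodic_integral_shift[OF b A HA per' h C int]
  show "set_integrable lborel half_cylinder (\<lambda>z. H (z + (axis i h, 0)))"
    "(LINT z:half_cylinder|lborel. H (z + (axis i h, 0))) = (LINT z:half_cylinder|lborel. H z)"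
    using * unfolding sc by auto
qed

lemma continuous_cube_integrable:
  fixes H :: "real^3 \<Rightarrow> 'c::{banach,second_countable_topology}"
  assumes "continuous_on (cbox (\<chi> i. -pi) (\<chi> i. pi)) H"
  shows "set_integrable lborel cube H"
proof -
  have "set_integrable lborel (cbox (\<chi> i. -pi) (\<chi> i. pi)) H"
    unfolding set_integrable_def by (rule borel_integrable_compact[OF compact_cbox assms])
  then show ?thesis
    by (rule set_integrable_subset) (auto simp: cube_eq box_subset_cbox)
qed

lemma cube_integral_shift:
  fixes H :: "real^3 \<Rightarrow> 'c::{banach,second_countable_topology}"
  assumes cont: "continuous_on UNIV H"
    and per: "\<And>x. H (x + axis i (2 * pi)) = H x"
    and h: "0 \<le> h" "h \<le> 2 * pi"
  shows "(LINT x:cube|lborel. H (x + axis i h)) = (LINT x:cube|lborel. H x)"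
proof -
  let ?b = "axis i 1 :: real^3"
  let ?A = "{x :: real^3. (\<forall>j. j \<noteq> i \<longrightarrow> - pi < x $ j \<and> x $ j < pi)}"
  have sc: "t *\<^sub>R ?b = axis i t" for t :: real
    using axis_scale[of i t] by simp
  have A: "z + t *\<^sub>R ?b \<in> ?A \<longleftrightarrow> z \<in> ?A" for z t
    unfolding sc by (simp add: axis_def)
  have HA: "(\<lambda>z. indicator ?A z *\<^sub>R H z) \<in> borel_measurable borel"
  proof -
    have "?A = (\<Inter>j\<in>-{i}. {z. - pi < z $ j} \<inter> {z. z $ j < pi})" by auto
    also have "open \<dots>"
      by (intro open_Int open_INT open_Collect_less continuous_intros ballI) auto
    finally show ?thesis
      by (intro borel_measurable_continuous_on_indicator)
        (use continuous_on_subset[OF cont, of ?A] in auto)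
  qed
  have C: "cube = {z \<in> ?A. - pi < z \<bullet> ?b \<and> z \<bullet> ?b < pi}"
  proof (rule set_eqI)
    fix z :: "real^3"
    have "(\<forall>j. - pi < z $ j \<and> z $ j < pi) \<longleftrightarrow>
        (\<forall>j. j \<noteq> i \<longrightarrow> - pi < z $ j \<and> z $ j < pi) \<and> (- pi < z $ i \<and> z $ i < pi)"
      by metis
    then show "z \<in> cube \<longleftrightarrow> z \<in> {z \<in> ?A. - pi < z \<bullet> ?b \<and> z \<bullet> ?b < pi}"
      by (simp add: cube_def inner_axis)
  qed
  have int: "set_integrable lborel cube H"
    by (rule continuous_cube_integrable) (rule continuous_on_subset[OF cont], simp)
  have per': "H (z + (2 * pi) *\<^sub>R ?b) = H z" if "z \<in> ?A" for z
    unfolding sc using per by simp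
  from periodic_integral_shift(2)[OF axis_in_Basis A HA per' h C int]
  show ?thesis unfolding sc .
qed

lemma continuous_on_positive: "continuous_on half_space f \<Longrightarrow> continuous_on {z. 0 < snd z} f"
  by (rule continuous_on_subset) (auto simp: half_space_def)

lemma smooth_periodic_shift:
  assumes W: "W \<in> smooth_periodic s" and h: "0 \<le> h" "h \<le> 2 * pi"
  shows "fg_shift i h \<eta> W \<in> smooth_periodic s"
proof -
  obtain U G where WU: "W = (U, G)" by (cases W)
  note WS = W[unfolded WU]
  obtain g where g: "continuous_on half_space g"
    "\<And>z. z \<in> half_space \<Longrightarrow> (U has_derivative (\<lambda>h. h \<bullet> g z)) (at z within half_space)"
    "\<And>z. z \<in> half_cylinder \<Longrightarrow> g z = G z"
    "\<And>z i. 0 < snd z \<Longrightarrow> g (z + (axis i (2 * pi), 0)) = g z"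
    "\<And>z. 0 < snd z \<Longrightarrow> GDERIV U z :> g z"
    using smooth_periodic_gradient[OF WS] by blast
  let ?w = "(axis i h, 0) :: (real^3) \<times> real"
  have sm: "\<And>k. Ck_on k half_space U" and per: "\<And>x y i. 0 \<le> y \<Longrightarrow> U (x + axis i (2 * pi), y) = U (x, y)"
    using WS by (auto simp: smooth_periodic_def half_space_def smooth_on_def)
  have Uc: "continuous_on half_space U" using sm[of 0] by simp
  have gr: "grad U z = g z" if "0 < snd z" for z using grad_eq[OF g(5)[OF that]] .
  define U' where "U' z = \<eta> * U (z + ?w)" for z
  define G' where "G' z = \<eta> *\<^sub>R grad U (z + ?w)" for z
  have sh: "fg_shift i h \<eta> W = (U', G')" unfolding fg_shift_def WU U'_def G'_def by simp
  have U'sm: "smooth_on (UNIV \<times> {0..}) U'"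
    unfolding smooth_on_def
  proof
    fix k
    have "Ck_on k half_space (\<lambda>x. U (x + ?w))" by (rule Ck_on_translate[OF _ sm]) (auto simp: half_space_def)
    (* multiplication by eta, written as f + (eta - 1) f *)
    then have "Ck_on k half_space (\<lambda>x. U (x + ?w) + (\<eta> - 1) * U (x + ?w))" by (intro Ck_on_add_scaled)
    then show "Ck_on k (UNIV \<times> {0..}) U'" unfolding U'_def half_space_def by (simp add: algebra_simps)
  qed
  have U'per: "U' (x + axis j (2 * pi), y) = U' (x, y)" if "0 \<le> y" for x y j
    using per[OF that, of "x + axis i h" j] unfolding U'_def by (simp add: algebra_simps)
  have U'd: "GDERIV U' z :> G' z" if "0 < snd z" for z
  proof -
    have "((\<lambda>z. U (z + ?w)) has_derivative (\<lambda>h. h \<bullet> g (z + ?w))) (at z)"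
    proof (rule has_derivative_compose[where g=U and f="\<lambda>z. z + ?w" and f'="\<lambda>h. h"])
      show "((\<lambda>z. z + ?w) has_derivative (\<lambda>h. h)) (at z)" by (auto intro!: derivative_eq_intros)
      show "(U has_derivative (\<lambda>h. h \<bullet> g (z + ?w))) (at (z + ?w))"
        using g(5)[of "z + ?w"] that by (simp add: gderiv_def)
    qed
    from has_derivative_mult_right[OF this, of \<eta>]
    show ?thesis unfolding gderiv_def U'_def G'_def using gr[of "z + ?w"] that by simp
  qed
  have cUp: "continuous_on {z. 0 < snd z} U" and cgp: "continuous_on {z. 0 < snd z} g"
    using Uc g(1) by (auto intro: continuous_on_positive)
  have cw: "continuous_on {z::(real^3) \<times> real. 0 < snd z} (\<lambda>z. snd z powr (1 - 2 * s))"
    by (intro continuous_intros) auto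
  have cU': "continuous_on half_cylinder U'"
    unfolding U'_def
    by (intro continuous_intros continuous_on_compose2[OF cUp]) (auto simp: half_cylinder_def)
  have cg': "continuous_on half_cylinder (\<lambda>z. \<eta> *\<^sub>R g (z + ?w))"
    by (intro continuous_intros continuous_on_compose2[OF cgp]) (auto simp: half_cylinder_def)
  have G'g: "G' z = \<eta> *\<^sub>R g (z + ?w)" if "z \<in> half_cylinder" for z
    using half_cylinder_snd[OF that] gr[of "z + ?w"] by (simp add: G'_def)
  have cG': "continuous_on half_cylinder G'"
    using cg' G'g by (simp cong: continuous_on_cong)
  have WL: "(U, G) \<in> weighted_L2 s" using smooth_periodic_weighted_L2[OF WS] .
  have i1: "set_integrable lborel half_cylinder (\<lambda>z. snd z powr (1 - 2 * s) * (U' z)\<^sup>2)"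
  proof -
    have "set_integrable lborel half_cylinder (\<lambda>z. snd (z + ?w) powr (1 - 2 * s) * (U (z + ?w))\<^sup>2)"
    proof (rule half_cylinder_integral_shift(1)[OF _ _ h])
      show "continuous_on {z. 0 < snd z} (\<lambda>z::(real^3) \<times> real. snd z powr (1 - 2 * s) * (U z)\<^sup>2)"
        by (intro continuous_intros cUp cw)
      show "set_integrable lborel half_cylinder (\<lambda>z. snd z powr (1 - 2 * s) * (U z)\<^sup>2)"
        using WL by (simp add: weighted_L2_def)
      show "snd (z + (axis i (2 * pi), 0)) powr (1 - 2 * s) * (U (z + (axis i (2 * pi), 0)))\<^sup>2 =
          snd z powr (1 - 2 * s) * (U z)\<^sup>2" if "0 < snd z" for z
        using per[of "snd z" "fst z" i] that by (cases z) simp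
    qed
    then have "set_integrable lborel half_cylinder (\<lambda>z. \<eta>\<^sup>2 * (snd (z + ?w) powr (1 - 2 * s) * (U (z + ?w))\<^sup>2))"
      by (rule set_integrable_mult_right)
    then show ?thesis unfolding U'_def by (simp add: power_mult_distrib algebra_simps)
  qed
  have i2: "set_integrable lborel half_cylinder (\<lambda>z. snd z powr (1 - 2 * s) * (norm (G' z))\<^sup>2)"
  proof -
    have "set_integrable lborel half_cylinder (\<lambda>z. snd (z + ?w) powr (1 - 2 * s) * (norm (g (z + ?w)))\<^sup>2)"
    proof (rule half_cylinder_integral_shift(1)[OF _ _ h])
      show "continuous_on {z. 0 < snd z} (\<lambda>z::(real^3) \<times> real. snd z powr (1 - 2 * s) * (norm (g z))\<^sup>2)"
        by (intro continuous_intros cgp cw)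
      have "set_integrable lborel half_cylinder (\<lambda>z. snd z powr (1 - 2 * s) * (norm (G z))\<^sup>2)"
        using WL by (simp add: weighted_L2_def)
      then show "set_integrable lborel half_cylinder (\<lambda>z. snd z powr (1 - 2 * s) * (norm (g z))\<^sup>2)"
        unfolding set_integrable_def
        by (rule Bochner_Integration.integrable_cong[THEN iffD1, rotated -1]) (auto simp: indicator_def g(3))
      show "snd (z + (axis i (2 * pi), 0)) powr (1 - 2 * s) * (norm (g (z + (axis i (2 * pi), 0))))\<^sup>2 =
          snd z powr (1 - 2 * s) * (norm (g z))\<^sup>2" if "0 < snd z" for z
        using g(4)[OF that] by simp
    qed
    then have "set_integrable lborel half_cylinder (\<lambda>z. \<eta>\<^sup>2 * (snd (z + ?w) powr (1 - 2 * s) * (norm (g (z + ?w)))\<^sup>2))"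
      by (rule set_integrable_mult_right)
    then show ?thesis
      unfolding set_integrable_def
      by (rule Bochner_Integration.integrable_cong[THEN iffD1, rotated -1])
        (auto simp: indicator_def G'g power_mult_distrib algebra_simps)
  qed
  have m1: "set_borel_measurable lborel half_cylinder U'"
    unfolding set_borel_measurable_def
    using borel_measurable_continuous_on_indicator[OF half_cylinder_sets cU'] by simp
  have m2: "set_borel_measurable lborel half_cylinder G'"
    unfolding set_borel_measurable_def
    using borel_measurable_continuous_on_indicator[OF half_cylinder_sets cG'] by simp
  have "(U', G') \<in> weighted_L2 s" using m1 m2 i1 i2 by (simp add: weighted_L2_def)
  then show ?thesis unfolding sh smooth_periodic_def
    using U'sm U'per U'd half_cylinder_snd by auto
qed

lemma X_inner_shift:
  assumes W: "W \<in> smooth_periodic s" and V: "V \<in> smooth_periodic s"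
    and h: "0 \<le> h" "h \<le> 2 * pi" and m: "m > 0" and \<eta>: "\<eta>\<^sup>2 = 1"
  shows "X_inner s m (fg_shift i h \<eta> W) (fg_shift i h \<eta> V) = X_inner s m W V"
proof -
  obtain U G V' K where WU: "W = (U, G)" "V = (V', K)" by (cases W; cases V)
  obtain g where g: "continuous_on half_space g"
    "\<And>z. z \<in> half_cylinder \<Longrightarrow> g z = G z"
    "\<And>z i. 0 < snd z \<Longrightarrow> g (z + (axis i (2 * pi), 0)) = g z"
    "\<And>z. 0 < snd z \<Longrightarrow> GDERIV U z :> g z"
    using smooth_periodic_gradient[OF W[unfolded WU]] by metis
  obtain k where k: "continuous_on half_space k"
    "\<And>z. z \<in> half_cylinder \<Longrightarrow> k z = K z"
    "\<And>z i. 0 < snd z \<Longrightarrow> k (z + (axis i (2 * pi), 0)) = k z"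
    "\<And>z. 0 < snd z \<Longrightarrow> GDERIV V' z :> k z"
    using smooth_periodic_gradient[OF V[unfolded WU]] by metis
  let ?w = "(axis i h, 0) :: (real^3) \<times> real"
  have "Ck_on 0 half_space U" "Ck_on 0 half_space V'"
    and perU: "\<And>x y i. 0 \<le> y \<Longrightarrow> U (x + axis i (2 * pi), y) = U (x, y)"
    and perV: "\<And>x y i. 0 \<le> y \<Longrightarrow> V' (x + axis i (2 * pi), y) = V' (x, y)"
    using W V unfolding WU by (auto simp: smooth_periodic_def half_space_def smooth_on_def simp del: Ck_on.simps)
  then have c: "continuous_on {z. 0 < snd z} U" "continuous_on {z. 0 < snd z} V'"
    "continuous_on {z. 0 < snd z} g" "continuous_on {z. 0 < snd z} k"
    using g(1) k(1) by (auto intro: continuous_on_positive)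
  define H where "H z = snd z powr (1 - 2 * s) * (g z \<bullet> k z + m\<^sup>2 * U z * V' z)" for z
  have cH: "continuous_on {z. 0 < snd z} H"
    unfolding H_def by (intro continuous_intros c) auto
  have perH: "H (z + (axis i (2 * pi), 0)) = H z" if "0 < snd z" for z
    using perU[of "snd z" "fst z" i] perV[of "snd z" "fst z" i] g(3)[OF that, of i] k(3)[OF that, of i] that
    unfolding H_def by (cases z) simp
  have Heq: "indicator half_cylinder z *\<^sub>R H z = lift s m W z \<bullet> lift s m V z" for z
    unfolding inner_lift WU H_def using g(2) k(2) by (auto simp: indicator_def)
  have int: "set_integrable lborel half_cylinder H"
    unfolding set_integrable_def Heq
    by (rule sq_integrable_inner) (use W V m smooth_periodic_weighted_L2 weighted_L2_iff in blast)+
  have "lift s m (fg_shift i h \<eta> W) z \<bullet> lift s m (fg_shift i h \<eta> V) z = indicator half_cylinder z *\<^sub>R H (z + ?w)" for z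
  proof (cases "z \<in> half_cylinder")
    case True
    then have p: "0 < snd (z + ?w)" using half_cylinder_snd by simp
    have e: "grad U (z + ?w) = g (z + ?w)" "grad V' (z + ?w) = k (z + ?w)"
      using grad_eq[OF g(4)[OF p]] grad_eq[OF k(4)[OF p]] by auto
    have \<eta>2: "\<eta> * \<eta> = 1" using \<eta> by (simp add: power2_eq_square)
    have "(\<eta> *\<^sub>R g (z + ?w)) \<bullet> (\<eta> *\<^sub>R k (z + ?w)) = g (z + ?w) \<bullet> k (z + ?w)"
      using \<eta>2 by (simp flip: mult.assoc)
    moreover have "m\<^sup>2 * (\<eta> * U (z + ?w)) * (\<eta> * V' (z + ?w)) = (\<eta> * \<eta>) * (m\<^sup>2 * U (z + ?w) * V' (z + ?w))"
      by (simp only: mult_ac)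
    ultimately show ?thesis
      unfolding inner_lift WU fg_shift_def H_def using True e \<eta>2 by (simp del: inner_scaleR_left inner_scaleR_right)
  qed (simp add: inner_lift)
  then have "X_inner s m (fg_shift i h \<eta> W) (fg_shift i h \<eta> V) = (1 / kappa s) * (LINT z:half_cylinder|lborel. H (z + ?w))"
    unfolding X_inner_lift set_lebesgue_integral_def by simp
  also have "\<dots> = (1 / kappa s) * (LINT z:half_cylinder|lborel. H z)"
    using half_cylinder_integral_shift(2)[OF cH perH h int] by simp
  also have "\<dots> = X_inner s m W V"
    unfolding X_inner_lift set_lebesgue_integral_def Heq ..
  finally show ?thesis .
qed

section \<open>Fourier coefficients on the cube\<close>

abbreviation closed_cube :: "(real^3) set" where
  "closed_cube \<equiv> cbox (\<chi> i. - pi) (\<chi> i. pi)"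

lemma cube_integral_eq:
  fixes H :: "real^3 \<Rightarrow> 'c::euclidean_space"
  assumes "continuous_on closed_cube H"
  shows "(LINT x:cube|lborel. H x) = integral closed_cube H"
proof -
  have "(LINT x:cube|lborel. H x) = integral cube H"
    by (rule set_borel_integral_eq_integral(2)[OF continuous_cube_integrable[OF assms]])
  also have "\<dots> = integral closed_cube H"
    unfolding cube_eq by (rule integral_open_interval)
  finally show ?thesis .
qed

lemma measure_cube: "measure lborel cube = (2 * pi)^3"
proof -
  have "(\<Prod>b\<in>Basis. ((\<chi> i. pi) - (\<chi> i. - pi) :: real^3) \<bullet> b) = (\<Prod>b\<in>(Basis :: (real^3) set). 2 * pi)"
    by (rule prod.cong) (auto simp: Basis_vec_def inner_axis)
  also have "\<dots> = (2 * pi)^3" by simp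
  finally show ?thesis
    unfolding cube_eq by (subst measure_lborel_box) (auto simp: Basis_vec_def inner_axis)
qed

lemma emeasure_cube_finite: "emeasure lborel cube < \<infinity>"
  unfolding cube_eq by (rule emeasure_lborel_box_finite)

lemma cube_integrable_const: "set_integrable lborel cube (\<lambda>x. c :: 'c::{banach,second_countable_topology})"
  by (rule continuous_cube_integrable) simp

lemma cube_integral_const: "(LINT x:cube|lborel. c) = (2 * pi)^3 *\<^sub>R (c :: 'c::{banach,second_countable_topology})"
  unfolding set_lebesgue_integral_def using emeasure_cube_finite measure_cube by simp

definition ek :: "int^3 \<Rightarrow> real^3 \<Rightarrow> complex" where
  "ek k x = exp (- (\<i> * complex_of_real (freq k \<bullet> x)))"

lemma ek_continuous: "continuous_on A (ek k)"
  unfolding ek_def by (intro continuous_intros)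

lemma ek_continuous_compose[continuous_intros]: "continuous_on A f \<Longrightarrow> continuous_on A (\<lambda>x. ek k (f x))"
  unfolding ek_def by (intro continuous_intros)

lemma ek_measurable[measurable]: "ek k \<in> borel_measurable borel"
  by (rule borel_measurable_continuous_onI[OF ek_continuous])

lemma norm_ek[simp]: "cmod (ek k x) = 1" unfolding ek_def by simp

lemma ek_shift: "ek k (x + axis i h) = exp (- (\<i> * (of_int (k $ i) * of_real h))) * ek k x"
  unfolding ek_def by (simp add: inner_simps inner_axis freq_def exp_add[symmetric] algebra_simps)

lemma ek_periodic: "ek k (x + axis i (2 * pi)) = ek k x"
proof -
  have "exp (- (\<i> * (of_int (k $ i) * of_real (2 * pi)))) = exp (complex_of_real (2 * of_int (- (k $ i)) * pi) * \<i>)"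
    by (rule arg_cong[where f=exp]) (simp add: algebra_simps)
  also have "\<dots> = 1" using exp_integer_2pi[of "of_int (- (k $ i))"] by simp
  finally show ?thesis unfolding ek_shift by simp
qed

lemma ek_mult_cnj: "ek k x * cnj (ek l x) = ek (k - l) x"
  unfolding ek_def by (simp add: exp_cnj exp_add[symmetric] freq_def inner_vec_def algebra_simps sum_subtractf)

text \<open>
For \<open>k \<noteq> 0\<close> some translation of the cube multiplies \<open>ek k\<close> by \<open>-1\<close> and preserves the integral.
\<close>

lemma ek_integral: "(LINT x:cube|lborel. ek k x) = (if k = 0 then (2 * pi)^3 else 0)"
proof (cases "k = 0")
  case True
  then have "ek k x = 1" for x by (simp add: ek_def freq_def inner_vec_def)
  then show ?thesis using True cube_integral_const[of "1::complex"] by (simp add: scaleR_conv_of_real)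
next
  case False
  then obtain i where i: "k $ i \<noteq> 0" by (auto simp: vec_eq_iff)
  let ?h = "pi / \<bar>of_int (k $ i)\<bar> :: real"
  have h: "0 \<le> ?h" "?h \<le> 2 * pi"
  proof -
    have "1 \<le> \<bar>of_int (k $ i) :: real\<bar>" using i by linarith
    then show "?h \<le> 2 * pi" using i by (simp add: field_simps)
  qed simp
  have e: "exp (- (\<i> * (of_int (k $ i) * of_real ?h))) = - 1"
  proof -
    have "of_int (k $ i) * ?h = pi \<or> of_int (k $ i) * ?h = - pi"
      using i by (cases "k $ i > 0") auto
    then have "of_int (k $ i) * complex_of_real ?h = of_real pi \<or> of_int (k $ i) * complex_of_real ?h = - of_real pi"
      by (metis of_real_minus of_real_mult of_real_of_int_eq)
    moreover have "exp (- (\<i> * w)) = - 1" if "w = of_real pi \<or> w = - of_real pi" for w :: complex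
      using that by (auto simp: exp_minus)
    ultimately show ?thesis by blast
  qed
  have "(LINT x:cube|lborel. ek k x) = (LINT x:cube|lborel. ek k (x + axis i ?h))"
    by (rule cube_integral_shift[OF ek_continuous ek_periodic h, symmetric])
  also have "\<dots> = (LINT x:cube|lborel. - ek k x)"
    unfolding ek_shift e by simp
  also have "\<dots> = - (LINT x:cube|lborel. ek k x)"
    unfolding set_lebesgue_integral_def by simp
  finally show ?thesis using False by simp
qed

abbreviation (input) cfac :: real where "cfac \<equiv> (2 * pi) powr (- (3/2))"

lemma cfac_sq: "cfac * cfac * (2 * pi)^3 = 1"
proof -
  have "cfac * cfac = (2 * pi) powr (- 3)" by (simp flip: powr_add)
  also have "(2 * pi) powr (- 3) = 1 / (2 * pi)^3" by (simp add: powr_minus_divide)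
  finally show ?thesis by simp
qed

lemma fourier_coeff_ek: "fourier_coeff u k = of_real cfac * (LINT x:cube|lborel. of_real (u x) * ek k x)"
  unfolding fourier_coeff_def ek_def ..

lemma coeff_integrable:
  assumes "set_integrable lborel cube u"
  shows "set_integrable lborel cube (\<lambda>x. complex_of_real (u x) * ek k x)"
  unfolding set_integrable_def
proof (rule Bochner_Integration.integrable_bound)
  have i: "integrable lborel (\<lambda>x. indicator cube x *\<^sub>R u x)" using assms by (simp add: set_integrable_def)
  then show "integrable lborel (\<lambda>x. indicator cube x *\<^sub>R u x)" .
  have "(\<lambda>x. indicator cube x *\<^sub>R (complex_of_real (u x) * ek k x)) = (\<lambda>x. complex_of_real (indicator cube x *\<^sub>R u x) * ek k x)"
    by (auto simp: indicator_def)
  moreover have "\<dots> \<in> borel_measurable lborel"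
    using borel_measurable_integrable[OF i] by measurable
  ultimately show "(\<lambda>x. indicator cube x *\<^sub>R (complex_of_real (u x) * ek k x)) \<in> borel_measurable lborel" by metis
qed (auto simp: norm_mult)

lemma fourier_coeff_comb:
  assumes "set_integrable lborel cube u" "set_integrable lborel cube v"
  shows "fourier_coeff (\<lambda>x. u x + t * v x) k = fourier_coeff u k + of_real t * fourier_coeff v k"
proof -
  note i = coeff_integrable[OF assms(1), of k] coeff_integrable[OF assms(2), of k]
  have "(LINT x:cube|lborel. of_real (u x + t * v x) * ek k x) =
     (LINT x:cube|lborel. of_real (u x) * ek k x + of_real t * (of_real (v x) * ek k x))"
    by (simp add: algebra_simps)
  also have "\<dots> = (LINT x:cube|lborel. of_real (u x) * ek k x) + of_real t * (LINT x:cube|lborel. of_real (v x) * ek k x)"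
    using i by (simp add: set_integral_add set_integral_mult_right set_integrable_mult_right)
  finally show ?thesis unfolding fourier_coeff_ek by (simp add: algebra_simps)
qed

lemma cube_L2_L1:
  assumes "set_borel_measurable lborel cube u" "set_integrable lborel cube (\<lambda>x. (u x)\<^sup>2)"
  shows "set_integrable lborel cube (u :: real^3 \<Rightarrow> real)"
  unfolding set_integrable_def
proof (rule Bochner_Integration.integrable_bound)
  show "integrable lborel (\<lambda>x. indicator cube x *\<^sub>R (1::real) + indicator cube x *\<^sub>R (u x)\<^sup>2)"
    using assms(2) cube_integrable_const[of "1::real"] unfolding set_integrable_def
    by (intro Bochner_Integration.integrable_add)
  show "(\<lambda>x. indicator cube x *\<^sub>R u x) \<in> borel_measurable lborel" using assms(1) by (simp add: set_borel_measurable_def)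
  have "\<bar>a\<bar> \<le> 1 + a\<^sup>2" for a :: real
  proof -
    have "0 \<le> (\<bar>a\<bar> - 1)\<^sup>2" by simp
    then have "2 * \<bar>a\<bar> \<le> 1 + a\<^sup>2" by (simp add: power2_diff)
    then show ?thesis by linarith
  qed
  then show "AE x in lborel. norm (indicator cube x *\<^sub>R u x) \<le> norm (indicator cube x *\<^sub>R (1::real) + indicator cube x *\<^sub>R (u x)\<^sup>2)"
    by (auto simp: indicator_def)
qed

lemma set_integrable_finite_sum:
  fixes f :: "'i \<Rightarrow> 'a \<Rightarrow> 'c::{banach,second_countable_topology}"
  assumes "\<And>k. k \<in> F \<Longrightarrow> set_integrable M A (f k)"
  shows "set_integrable M A (\<lambda>x. \<Sum>k\<in>F. f k x)"
    and "(LINT x:A|M. (\<Sum>k\<in>F. f k x)) = (\<Sum>k\<in>F. LINT x:A|M. f k x)"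
  using assms unfolding set_integrable_def set_lebesgue_integral_def
  by (auto simp: scaleR_sum_right Bochner_Integration.integral_sum)

text \<open>
The integral of the squared distance from \<open>u\<close> to the partial sum \<open>S\<close> of its Fourier series equals
\<open>\<integral> u\<^sup>2 - \<Sum> |c k|\<^sup>2\<close>, and it is nonnegative.
\<close>

lemma Bessel_inequality:
  assumes m: "set_borel_measurable lborel cube u" and sq: "set_integrable lborel cube (\<lambda>x. (u x)\<^sup>2)"
    and F: "finite F"
  shows "(\<Sum>k\<in>F. (cmod (fourier_coeff u k))\<^sup>2) \<le> (LINT x:cube|lborel. (u x)\<^sup>2)"
proof -
  define c where "c k = fourier_coeff u k" for k
  have i1: "set_integrable lborel cube u" by (rule cube_L2_L1[OF m sq])
  define S where "S x = (\<Sum>k\<in>F. c k * of_real cfac * cnj (ek k x))" for x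
  have Sc: "continuous_on A S" for A unfolding S_def by (intro continuous_intros ek_continuous)
  (* the square of the distance, expanded into the two mixed terms and the Gram matrix of the ek k *)
  have e: "of_real ((cmod (of_real (u x) - S x))\<^sup>2) =
     of_real ((u x)\<^sup>2) - (\<Sum>k\<in>F. cnj (c k) * of_real cfac * (of_real (u x) * ek k x))
       - cnj (\<Sum>k\<in>F. cnj (c k) * of_real cfac * (of_real (u x) * ek k x)) +
      (\<Sum>k\<in>F. \<Sum>l\<in>F. c k * cnj (c l) * of_real (cfac * cfac) * ek (l - k) x)" for x
  proof -
    have SS: "S x * cnj (S x) = (\<Sum>k\<in>F. \<Sum>l\<in>F. c k * cnj (c l) * of_real (cfac * cfac) * ek (l - k) x)"
    proof -
      have "S x * cnj (S x) = (\<Sum>k\<in>F. \<Sum>l\<in>F. (c k * of_real cfac * cnj (ek k x)) * cnj (c l * of_real cfac * cnj (ek l x)))"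
        unfolding S_def cnj_sum sum_product ..
      also have "\<dots> = (\<Sum>k\<in>F. \<Sum>l\<in>F. c k * cnj (c l) * of_real (cfac * cfac) * ek (l - k) x)"
        by (intro sum.cong refl) (simp add: ek_mult_cnj[symmetric] algebra_simps)
      finally show ?thesis .
    qed
    have T: "(\<Sum>k\<in>F. cnj (c k) * of_real cfac * (of_real (u x) * ek k x)) = of_real (u x) * cnj (S x)"
      unfolding S_def cnj_sum sum_distrib_left by (intro sum.cong refl) simp
    show ?thesis
      unfolding complex_norm_square T SS[symmetric] by (simp add: algebra_simps power2_eq_square)
  qed
  define I where "I = (LINT x:cube|lborel. (u x)\<^sup>2)"
  have intT: "(LINT x:cube|lborel. of_real (u x) * ek k x) * of_real cfac = c k" for k
    unfolding c_def fourier_coeff_ek by simp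
  note ci = coeff_integrable[OF i1]
  have iT: "set_integrable lborel cube (\<lambda>x. \<Sum>k\<in>F. cnj (c k) * of_real cfac * (of_real (u x) * ek k x))"
    by (intro set_integrable_finite_sum(1) set_integrable_mult_right ci)
  have iT': "set_integrable lborel cube (\<lambda>x. cnj (\<Sum>k\<in>F. cnj (c k) * of_real cfac * (of_real (u x) * ek k x)))"
    using integrable_cnj[OF iT[unfolded set_integrable_def]] unfolding set_integrable_def complex_cnj_scaleR .
  have iE: "set_integrable lborel cube (\<lambda>x. \<Sum>k\<in>F. \<Sum>l\<in>F. c k * cnj (c l) * of_real (cfac * cfac) * ek (l - k) x)"
    by (rule continuous_cube_integrable) (intro continuous_intros ek_continuous)
  have iu: "set_integrable lborel cube (\<lambda>x. complex_of_real ((u x)\<^sup>2))"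
  proof -
    have "integrable lborel (\<lambda>x. complex_of_real (indicator cube x *\<^sub>R (u x)\<^sup>2))"
      using sq unfolding set_integrable_def by (rule integrable_of_real)
    then show ?thesis unfolding set_integrable_def by (simp add: scaleR_conv_of_real)
  qed
  have vT: "(LINT x:cube|lborel. (\<Sum>k\<in>F. cnj (c k) * of_real cfac * (of_real (u x) * ek k x))) = of_real (\<Sum>k\<in>F. (cmod (c k))\<^sup>2)"
  proof -
    have "(LINT x:cube|lborel. (\<Sum>k\<in>F. cnj (c k) * of_real cfac * (of_real (u x) * ek k x))) =
       (\<Sum>k\<in>F. cnj (c k) * of_real cfac * (LINT x:cube|lborel. of_real (u x) * ek k x))"
      by (subst set_integrable_finite_sum(2)) (auto intro!: set_integrable_mult_right ci simp: set_integral_mult_right)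
    also have "\<dots> = (\<Sum>k\<in>F. c k * cnj (c k))"
      by (intro sum.cong refl) (simp add: intT[symmetric] algebra_simps)
    also have "\<dots> = of_real (\<Sum>k\<in>F. (cmod (c k))\<^sup>2)" by (simp only: of_real_sum complex_norm_square)
    finally show ?thesis .
  qed
  have vT': "(LINT x:cube|lborel. cnj (\<Sum>k\<in>F. cnj (c k) * of_real cfac * (of_real (u x) * ek k x))) = of_real (\<Sum>k\<in>F. (cmod (c k))\<^sup>2)"
  proof -
    have "(LINT x:cube|lborel. cnj (\<Sum>k\<in>F. cnj (c k) * of_real cfac * (of_real (u x) * ek k x))) =
      cnj (LINT x:cube|lborel. (\<Sum>k\<in>F. cnj (c k) * of_real cfac * (of_real (u x) * ek k x)))"
      unfolding set_lebesgue_integral_def complex_cnj_scaleR[symmetric] by (rule Bochner_Integration.integral_cnj)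
    then show ?thesis unfolding vT by simp
  qed
  have vE: "(LINT x:cube|lborel. (\<Sum>k\<in>F. \<Sum>l\<in>F. c k * cnj (c l) * of_real (cfac * cfac) * ek (l - k) x)) = of_real (\<Sum>k\<in>F. (cmod (c k))\<^sup>2)"
  proof -
    have ie: "set_integrable lborel cube (\<lambda>x. a * ek (l - k) x)" for a k l
      by (rule continuous_cube_integrable) (intro continuous_intros ek_continuous)
    have "(LINT x:cube|lborel. (\<Sum>k\<in>F. \<Sum>l\<in>F. c k * cnj (c l) * of_real (cfac * cfac) * ek (l - k) x)) =
       (\<Sum>k\<in>F. \<Sum>l\<in>F. c k * cnj (c l) * of_real (cfac * cfac) * (LINT x:cube|lborel. ek (l - k) x))"
      by (simp only: set_integrable_finite_sum ie set_integral_mult_right)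
    also have "\<dots> = (\<Sum>k\<in>F. \<Sum>l\<in>F. if l = k then c k * cnj (c k) else 0)"
    proof (intro sum.cong refl)
      fix k l
      have "complex_of_real (cfac * cfac) * (2 * pi)^3 = 1"
        using cfac_sq by (metis of_real_1 of_real_mult of_real_power)
      then show "c k * cnj (c l) * of_real (cfac * cfac) * (LINT x:cube|lborel. ek (l - k) x) = (if l = k then c k * cnj (c k) else 0)"
        unfolding ek_integral by (auto simp: mult.assoc)
    qed
    also have "\<dots> = (\<Sum>k\<in>F. c k * cnj (c k))" using F by simp
    also have "\<dots> = of_real (\<Sum>k\<in>F. (cmod (c k))\<^sup>2)" by (simp only: of_real_sum complex_norm_square)
    finally show ?thesis .
  qed
  have "complex_of_real (LINT x:cube|lborel. (cmod (of_real (u x) - S x))\<^sup>2) =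
     (LINT x:cube|lborel. complex_of_real ((cmod (of_real (u x) - S x))\<^sup>2))"
    unfolding set_lebesgue_integral_def
    by (subst integral_complex_of_real[symmetric]) (simp add: scaleR_conv_of_real)
  also have "\<dots> = of_real I - of_real (\<Sum>k\<in>F. (cmod (c k))\<^sup>2)"
  proof -
    have lin: "(LINT x:cube|lborel. f1 x - f2 x - f3 x + f4 x) =
        (LINT x:cube|lborel. f1 x) - (LINT x:cube|lborel. f2 x) - (LINT x:cube|lborel. f3 x) + (LINT x:cube|lborel. f4 x)"
      if "set_integrable lborel cube f1" "set_integrable lborel cube f2"
        "set_integrable lborel cube f3" "set_integrable lborel cube f4"
      for f1 f2 f3 f4 :: "real^3 \<Rightarrow> complex"
      using that by (simp add: set_integral_add set_integral_diff)
    have vu: "(LINT x:cube|lborel. complex_of_real ((u x)\<^sup>2)) = of_real I"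
      unfolding I_def by (rule set_integral_complex_of_real)
    show ?thesis unfolding e lin[OF iu iT iT' iE] vT vT' vE vu by simp
  qed
  finally have "complex_of_real (LINT x:cube|lborel. (cmod (of_real (u x) - S x))\<^sup>2) = of_real (I - (\<Sum>k\<in>F. (cmod (c k))\<^sup>2))"
    by simp
  then have "(LINT x:cube|lborel. (cmod (of_real (u x) - S x))\<^sup>2) = I - (\<Sum>k\<in>F. (cmod (c k))\<^sup>2)"
    by (simp only: of_real_eq_iff)
  moreover have "0 \<le> (LINT x:cube|lborel. (cmod (of_real (u x) - S x))\<^sup>2)"
    unfolding set_lebesgue_integral_def by (rule integral_nonneg_AE) simp
  ultimately show ?thesis unfolding I_def c_def by simp
qed

text \<open>
Integration by parts, in the form that the integral of the derivative \<open>D\<close> of \<open>u * ek k\<close> in direction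
\<open>i\<close> is zero. Along each line of length one period the integral of \<open>D\<close> vanishes; averaging this over
the cube gives the integral over the cube itself, because \<open>D\<close> is periodic.
\<close>

lemma fourier_coeff_deriv:
  fixes u :: "real^3 \<Rightarrow> real"
  assumes d: "\<And>x. (u has_derivative (\<lambda>h. h \<bullet> g x)) (at x)"
    and g: "continuous_on UNIV g"
    and per: "\<And>x. u (x + axis i (2 * pi)) = u x" "\<And>x. g (x + axis i (2 * pi)) = g x"
  shows "fourier_coeff (\<lambda>x. g x $ i) k = \<i> * of_int (k $ i) * fourier_coeff u k"
proof -
  define D where "D x = of_real (g x $ i) * ek k x - \<i> * of_int (k $ i) * (of_real (u x) * ek k x)" for x
  have uc: "continuous_on A u" for A
    using d by (meson continuous_at_imp_continuous_on has_derivative_continuous)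
  have gc: "continuous_on A (\<lambda>x. g x $ i)" for A
    by (intro continuous_intros continuous_on_subset[OF g]) auto
  have Dc: "continuous_on A D" for A
    unfolding D_def by (intro continuous_intros gc uc ek_continuous)
  have Dper: "D (x + axis i (2 * pi)) = D x" for x
    unfolding D_def per ek_periodic ..
  have ftc: "integral {0..2*pi} (\<lambda>t. D (x + axis i t)) = 0" for x
  proof -
    let ?\<Psi> = "\<lambda>t. of_real (u (x + axis i t)) * ek k (x + axis i t)"
    have "(?\<Psi> has_vector_derivative D (x + axis i t)) (at t within {0..2*pi})" for t
    proof -
      have ax: "((\<lambda>t. x + axis i t) has_derivative (\<lambda>h. axis i h)) (at t)"
      proof -
        have "((\<lambda>t. x + t *\<^sub>R axis i 1) has_derivative (\<lambda>h. h *\<^sub>R axis i 1)) (at t)"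
          by (auto intro!: derivative_eq_intros)
        then show ?thesis by (simp only: axis_scale[symmetric])
      qed
      have "((\<lambda>t. u (x + axis i t)) has_derivative (\<lambda>h. axis i h \<bullet> g (x + axis i t))) (at t)"
        by (rule has_derivative_compose[OF ax d])
      then have "((\<lambda>t. u (x + axis i t)) has_vector_derivative (g (x + axis i t) $ i)) (at t)"
        unfolding has_vector_derivative_def by (simp add: inner_axis' mult.commute)
      then have u': "((\<lambda>t. complex_of_real (u (x + axis i t))) has_vector_derivative of_real (g (x + axis i t) $ i)) (at t)"
        by (rule bounded_linear.has_vector_derivative[OF bounded_linear_of_real])
      have "((\<lambda>t. exp (- (\<i> * (of_int (k $ i) * of_real t)))) has_vector_derivative
           (- (\<i> * of_int (k $ i))) * exp (- (\<i> * (of_int (k $ i) * of_real t)))) (at t)"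
        by (rule has_vector_derivative_real_field) (auto intro!: derivative_eq_intros)
      then have e': "((\<lambda>t. ek k (x + axis i t)) has_vector_derivative (- (\<i> * of_int (k $ i))) * ek k (x + axis i t)) (at t)"
        unfolding ek_shift by (auto intro!: derivative_eq_intros)
      have "(?\<Psi> has_vector_derivative of_real (u (x + axis i t)) * ((- (\<i> * of_int (k $ i))) * ek k (x + axis i t)) + of_real (g (x + axis i t) $ i) * ek k (x + axis i t)) (at t)"
        by (rule has_vector_derivative_mult[OF u' e'])
      then have "(?\<Psi> has_vector_derivative D (x + axis i t)) (at t)"
        unfolding D_def by (simp add: algebra_simps)
      then show ?thesis by (rule has_vector_derivative_at_within)
    qed
    then have "((\<lambda>t. D (x + axis i t)) has_integral (?\<Psi> (2*pi) - ?\<Psi> 0)) {0..2*pi}"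
      by (intro fundamental_theorem_of_calculus) auto
    moreover have "?\<Psi> (2*pi) - ?\<Psi> 0 = 0"
      using per(1) ek_periodic by (simp add: axis_def flip: zero_vec_def)
    ultimately show ?thesis by (simp add: integral_unique)
  qed
  have axc: "continuous_on A (\<lambda>p. fst p + axis i (snd p) :: real^3)" for A
  proof -
    have "continuous_on A (\<lambda>p. fst p + snd p *\<^sub>R axis i 1 :: real^3)" by (intro continuous_intros)
    then show ?thesis by (simp only: axis_scale[symmetric])
  qed
  have "0 = integral closed_cube (\<lambda>x. integral (cbox 0 (2*pi)) (\<lambda>t. D (x + axis i t)))"
    using ftc by simp
  also have "\<dots> = integral (cbox 0 (2*pi)) (\<lambda>t. integral closed_cube (\<lambda>x. D (x + axis i t)))"
    by (rule integral_swap_continuous)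
      (auto simp: split_def intro!: continuous_on_compose2[OF Dc axc])
  also have "\<dots> = integral (cbox 0 (2*pi)) (\<lambda>t. LINT x:cube|lborel. D x)"
  proof (rule integral_cong)
    fix t :: real assume t: "t \<in> cbox 0 (2*pi)"
    have "integral closed_cube (\<lambda>x. D (x + axis i t)) = (LINT x:cube|lborel. D (x + axis i t))"
      by (rule cube_integral_eq[symmetric]) (intro continuous_on_compose2[OF Dc[of UNIV]] continuous_intros, simp)
    also have "\<dots> = (LINT x:cube|lborel. D x)"
      by (rule cube_integral_shift[OF Dc Dper]) (use t in auto)
    finally show "integral closed_cube (\<lambda>x. D (x + axis i t)) = (LINT x:cube|lborel. D x)" .
  qed
  also have "\<dots> = (2 * pi) *\<^sub>R (LINT x:cube|lborel. D x)" by simp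
  finally have "(LINT x:cube|lborel. D x) = 0" by simp
  moreover have "(LINT x:cube|lborel. D x) = (LINT x:cube|lborel. of_real (g x $ i) * ek k x) - \<i> * of_int (k $ i) * (LINT x:cube|lborel. of_real (u x) * ek k x)"
    unfolding D_def
    by (subst set_integral_diff(2))
      (auto intro!: continuous_cube_integrable continuous_intros gc uc ek_continuous simp: set_integral_mult_right)
  ultimately show ?thesis unfolding fourier_coeff_ek by simp
qed

section \<open>The trace inequality\<close>

lemma ennreal_mult3: "0 \<le> a \<Longrightarrow> 0 \<le> b \<Longrightarrow> 0 \<le> c \<Longrightarrow> ennreal (a * (b * c)) = ennreal a * (ennreal b * ennreal c)"
  by (simp add: ennreal_mult)

lemma powr_times_self: "0 < y \<Longrightarrow> (y::real) powr a * y = y powr (a + 1)"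
  by (simp add: powr_add)

lemma nn_integral_Icc_continuous:
  fixes g :: "real \<Rightarrow> real"
  assumes "continuous_on {0..y} g" "\<And>t. t \<in> {0..y} \<Longrightarrow> 0 \<le> g t"
  shows "ennreal (integral {0..y} g) = (\<integral>\<^sup>+t. ennreal (indicator {0..y} t * g t) \<partial>lborel)"
proof -
  have i: "set_integrable lborel {0..y} g"
    by (rule borel_integrable_atLeastAtMost') (rule assms)
  have "(\<integral>\<^sup>+t. ennreal (indicator {0..y} t * g t) \<partial>lborel) = ennreal (LINT t:{0..y}|lborel. g t)"
    unfolding set_lebesgue_integral_def real_scaleR_def
    by (rule nn_integral_eq_integral) (use i assms(2) in \<open>auto simp: set_integrable_def indicator_def\<close>)
  then show ?thesis using set_borel_integral_eq_integral(2)[OF i] by simp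
qed

text \<open>
For \<open>y < 1 / \<mu>\<close> write \<open>f 0 = f y - (f y - f 0)\<close>. The Cauchy-Schwarz inequality with the weight
\<open>t powr (1 - 2 * s)\<close> bounds the square of the increment by \<open>y powr (2 * s)\<close> times the energy of \<open>f'\<close>. Averaging
over the interval \<open>{0<..<1 / \<mu>}\<close>, whose length balances the two terms, yields the inequality.
\<close>

lemma trace_1d:
  fixes f :: "real \<Rightarrow> 'a::euclidean_space"
  assumes s: "1/2 \<le> s" "s < 1" and \<mu>: "0 < \<mu>"
    and d: "\<And>t. 0 \<le> t \<Longrightarrow> (f has_vector_derivative f' t) (at t within {0..})"
    and c: "continuous_on {0..} f'"
  shows "ennreal (\<mu> powr (2 * s) * (norm (f 0))\<^sup>2) \<le>
    2 * (\<integral>\<^sup>+t. ennreal (indicator {0<..} t * (t powr (1 - 2 * s) * ((norm (f' t))\<^sup>2 + \<mu>\<^sup>2 * (norm (f t))\<^sup>2))) \<partial>lborel)"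
proof -
  have fc: "continuous_on {0..} f"
    using d by (auto simp: continuous_on_eq_continuous_within intro: has_vector_derivative_continuous)
  define p where "p t = indicator {0<..} t * norm (f' t)" for t :: real
  define r where "r t = indicator {0<..} t * norm (f t)" for t :: real
  have "(\<lambda>t. indicator {0<..} t *\<^sub>R norm (f' t)) \<in> borel_measurable borel"
    by (rule borel_measurable_continuous_on_indicator) (auto intro!: continuous_intros continuous_on_subset[OF c])
  then have pm[measurable]: "p \<in> borel_measurable borel" by (simp add: p_def[abs_def])
  have "(\<lambda>t. indicator {0<..} t *\<^sub>R norm (f t)) \<in> borel_measurable borel"
    by (rule borel_measurable_continuous_on_indicator) (auto intro!: continuous_intros continuous_on_subset[OF fc])
  then have rm[measurable]: "r \<in> borel_measurable borel" by (simp add: r_def[abs_def])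
  define A where "A = (\<integral>\<^sup>+t. ennreal (t powr (1 - 2 * s) * (p t)\<^sup>2) \<partial>lborel)"
  define B where "B = (\<integral>\<^sup>+t. ennreal (t powr (1 - 2 * s) * (r t)\<^sup>2) \<partial>lborel)"
  (* the increment: fundamental theorem of calculus and Cauchy-Schwarz with the weight split evenly *)
  have inc: "ennreal ((norm (f y - f 0))\<^sup>2) \<le> ennreal (y powr (2 * s)) * A" if y: "0 < y" for y
  proof -
    have d': "(f has_vector_derivative f' t) (at t within {0..y})" if "t \<in> {0..y}" for t
      using d[of t] that by (auto intro: has_vector_derivative_within_subset)
    have cy: "continuous_on {0..y} f'" by (rule continuous_on_subset[OF c]) auto
    have "(f' has_integral (f y - f 0)) {0..y}"
      by (rule fundamental_theorem_of_calculus) (use y d' in auto)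
    then have "norm (f y - f 0) \<le> integral {0..y} (\<lambda>t. norm (f' t))"
      using integral_norm_bound_integral[of f' "{0..y}" "\<lambda>t. norm (f' t)"] cy
      by (auto simp: integral_unique has_integral_integrable intro!: integrable_continuous_real continuous_intros)
    then have "ennreal (norm (f y - f 0)) \<le> (\<integral>\<^sup>+t. ennreal (indicator {0..y} t * norm (f' t)) \<partial>lborel)"
      by (subst nn_integral_Icc_continuous[symmetric]) (auto intro!: continuous_intros cy ennreal_leI)
    also have "\<dots> = (\<integral>\<^sup>+t. ennreal (t powr ((1 - 2 * s) / 2) * p t) * ennreal (indicator {0<..y} t * t powr ((2 * s - 1) / 2)) \<partial>lborel)"
    proof (rule nn_integral_cong_AE, use AE_lborel_singleton[of 0] in eventually_elim)
      fix t :: real assume t: "t \<noteq> 0"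
      have "t powr ((1 - 2 * s) / 2) * t powr ((2 * s - 1) / 2) = 1" if "0 < t"
      proof -
        have "(1 - 2 * s) / 2 + (2 * s - 1) / 2 = 0" by (simp add: field_simps)
        then show ?thesis using that by (simp flip: powr_add)
      qed
      then have "indicator {0..y} t * norm (f' t) = (t powr ((1 - 2 * s) / 2) * p t) * (indicator {0<..y} t * t powr ((2 * s - 1) / 2))"
        using t by (auto simp: indicator_def p_def)
      then show "ennreal (indicator {0..y} t * norm (f' t)) =
          ennreal (t powr ((1 - 2 * s) / 2) * p t) * ennreal (indicator {0<..y} t * t powr ((2 * s - 1) / 2))"
        by (simp add: p_def flip: ennreal_mult')
    qed
    finally have "(ennreal (norm (f y - f 0)))\<^sup>2 \<le>
       (\<integral>\<^sup>+t. ennreal (t powr ((1 - 2 * s) / 2) * p t) * ennreal (indicator {0<..y} t * t powr ((2 * s - 1) / 2)) \<partial>lborel)\<^sup>2"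
      by (rule power_mono) simp
    also have "\<dots> \<le> (\<integral>\<^sup>+t. (ennreal (t powr ((1 - 2 * s) / 2) * p t))\<^sup>2 \<partial>lborel) *
       (\<integral>\<^sup>+t. (ennreal (indicator {0<..y} t * t powr ((2 * s - 1) / 2)))\<^sup>2 \<partial>lborel)"
      by (rule Cauchy_Schwarz_nn_integral) measurable
    finally have CS: "ennreal ((norm (f y - f 0))\<^sup>2) \<le> (\<integral>\<^sup>+t. (ennreal (t powr ((1 - 2 * s) / 2) * p t))\<^sup>2 \<partial>lborel) *
       (\<integral>\<^sup>+t. (ennreal (indicator {0<..y} t * t powr ((2 * s - 1) / 2)))\<^sup>2 \<partial>lborel)"
      by (simp add: ennreal_power)
    have X: "(\<integral>\<^sup>+t. (ennreal (t powr ((1 - 2 * s) / 2) * p t))\<^sup>2 \<partial>lborel) = A"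
      unfolding A_def
    proof (rule nn_integral_cong)
      fix t :: real
      have "(t powr ((1 - 2 * s) / 2))\<^sup>2 = t powr (1 - 2 * s)"
        by (simp add: power2_eq_square flip: powr_add)
      then have "(t powr ((1 - 2 * s) / 2) * p t)\<^sup>2 = t powr (1 - 2 * s) * (p t)\<^sup>2"
        by (simp add: power_mult_distrib)
      then show "(ennreal (t powr ((1 - 2 * s) / 2) * p t))\<^sup>2 = ennreal (t powr (1 - 2 * s) * (p t)\<^sup>2)"
        by (subst ennreal_power) (auto simp: p_def)
    qed
    have "(\<integral>\<^sup>+t. (ennreal (indicator {0<..y} t * t powr ((2 * s - 1) / 2)))\<^sup>2 \<partial>lborel) \<le>
        (\<integral>\<^sup>+t. ennreal (y powr (2 * s - 1)) * indicator {0<..y} t \<partial>lborel)"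
    proof (rule nn_integral_mono)
      fix t :: real
      have "(t powr ((2 * s - 1) / 2))\<^sup>2 = t powr (2 * s - 1)"
        by (simp add: power2_eq_square flip: powr_add)
      moreover have "t powr (2 * s - 1) \<le> y powr (2 * s - 1)" if "0 < t" "t \<le> y"
        using that s by (intro powr_mono2) auto
      ultimately have "(indicator {0<..y} t * t powr ((2 * s - 1) / 2))\<^sup>2 \<le> y powr (2 * s - 1) * indicator {0<..y} t"
        by (auto simp: indicator_def)
      then have "ennreal ((indicator {0<..y} t * t powr ((2 * s - 1) / 2))\<^sup>2) \<le> ennreal (y powr (2 * s - 1) * indicator {0<..y} t)"
        by (rule ennreal_leI)
      then show "(ennreal (indicator {0<..y} t * t powr ((2 * s - 1) / 2)))\<^sup>2 \<le> ennreal (y powr (2 * s - 1)) * indicator {0<..y} t"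
        by (subst ennreal_power) (auto simp: indicator_def)
    qed
    also have "\<dots> = ennreal (y powr (2 * s - 1)) * ennreal y"
      using y by (simp add: nn_integral_cmult_indicator)
    also have "\<dots> = ennreal (y powr (2 * s))"
    proof -
      have "y powr (2 * s - 1) * y = y powr (2 * s)" using powr_times_self[OF y, of "2 * s - 1"] by simp
      then show ?thesis using y by (simp flip: ennreal_mult)
    qed
    finally have Y: "(\<integral>\<^sup>+t. (ennreal (indicator {0<..y} t * t powr ((2 * s - 1) / 2)))\<^sup>2 \<partial>lborel) \<le> ennreal (y powr (2 * s))" .
    have "ennreal ((norm (f y - f 0))\<^sup>2) \<le> A * ennreal (y powr (2 * s))"
      using CS unfolding X by (rule order_trans) (rule mult_left_mono[OF Y], simp)
    then show ?thesis by (simp add: mult.commute)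
  qed
  (* both terms estimated for y < 1 / mu, where the weight y powr (1 - 2 * s) is at least
     mu powr (2 * s - 1) *)
  have pt: "ennreal (\<mu> powr (2 * s - 1) * (norm (f 0))\<^sup>2) \<le>
      ennreal (2 * (y powr (1 - 2 * s) * (r y)\<^sup>2)) + ennreal (2 / \<mu>) * A" if y: "y \<in> {0<..<1/\<mu>}" for y
  proof -
    have y0: "0 < y" "y < 1 / \<mu>" using y by (simp_all only: greaterThanLessThan_iff)
    have "norm (f 0) \<le> norm (f y) + norm (f y - f 0)"
      using norm_triangle_ineq4[of "f y" "f y - f 0"] by simp
    then have "(norm (f 0))\<^sup>2 \<le> (norm (f y) + norm (f y - f 0))\<^sup>2" by (intro power_mono) auto
    also have "\<dots> \<le> 2 * (norm (f y))\<^sup>2 + 2 * (norm (f y - f 0))\<^sup>2"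
      using sum_squares_bound[of "norm (f y)" "norm (f y - f 0)"] by (simp add: power2_sum)
    finally have n: "\<mu> powr (2 * s - 1) * (norm (f 0))\<^sup>2 \<le> \<mu> powr (2 * s - 1) * (2 * (norm (f y))\<^sup>2 + 2 * (norm (f y - f 0))\<^sup>2)"
      by (intro mult_left_mono) auto
    have w: "\<mu> powr (2 * s - 1) \<le> y powr (1 - 2 * s)"
    proof -
      have "(1 / \<mu>) powr (1 - 2 * s) \<le> y powr (1 - 2 * s)"
        using y0 s by (intro powr_mono2') auto
      moreover have "(1 / \<mu>) powr (1 - 2 * s) = \<mu> powr (2 * s - 1)"
        using \<mu> by (simp add: powr_divide powr_minus[symmetric] flip: powr_minus_divide)
      ultimately show ?thesis by simp
    qed
    have y2: "\<mu> powr (2 * s - 1) * y powr (2 * s) \<le> 1 / \<mu>"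
    proof -
      have "y powr (2 * s) \<le> (1 / \<mu>) powr (2 * s)" using y0 s by (intro powr_mono2) auto
      then have "\<mu> powr (2 * s - 1) * y powr (2 * s) \<le> \<mu> powr (2 * s - 1) * (1 / \<mu>) powr (2 * s)"
        by (intro mult_left_mono) auto
      also have "\<dots> = \<mu> powr (2 * s - 1) * \<mu> powr (- (2 * s))"
        using \<mu> by (simp add: powr_divide powr_minus_divide)
      also have "\<dots> = \<mu> powr (- 1)" by (simp flip: powr_add)
      also have "\<dots> = 1 / \<mu>" using \<mu> by (simp add: powr_minus_divide)
      finally show ?thesis .
    qed
    have "ennreal (\<mu> powr (2 * s - 1) * (norm (f 0))\<^sup>2) \<le>
       ennreal (2 * (\<mu> powr (2 * s - 1) * (norm (f y))\<^sup>2)) + ennreal (2 * \<mu> powr (2 * s - 1)) * ennreal ((norm (f y - f 0))\<^sup>2)"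
      using ennreal_leI[OF n] by (simp add: algebra_simps flip: ennreal_plus ennreal_mult)
    also have "\<dots> \<le> ennreal (2 * (y powr (1 - 2 * s) * (r y)\<^sup>2)) + ennreal (2 * \<mu> powr (2 * s - 1)) * (ennreal (y powr (2 * s)) * A)"
    proof (intro add_mono mult_left_mono inc y0 ennreal_leI)
      show "\<mu> powr (2 * s - 1) * (norm (f y))\<^sup>2 \<le> y powr (1 - 2 * s) * (r y)\<^sup>2"
        using w y0 by (auto simp: r_def intro!: mult_right_mono)
    qed auto
    also have "ennreal (2 * \<mu> powr (2 * s - 1)) * (ennreal (y powr (2 * s)) * A) = ennreal (2 * (\<mu> powr (2 * s - 1) * y powr (2 * s))) * A"
      by (simp add: ennreal_mult mult.assoc)
    also have "\<dots> \<le> ennreal (2 / \<mu>) * A"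
      using y2 by (intro mult_right_mono ennreal_leI) auto
    finally show ?thesis by (simp add: add_left_mono)
  qed
  (* integration of the pointwise estimate over the interval from 0 to 1 / mu *)
  have "ennreal (\<mu> powr (2 * s - 1) * (norm (f 0))\<^sup>2) * ennreal (1 / \<mu>) =
     (\<integral>\<^sup>+y. ennreal (\<mu> powr (2 * s - 1) * (norm (f 0))\<^sup>2) * indicator {0<..<1/\<mu>} y \<partial>lborel)"
    using \<mu> by (simp add: nn_integral_cmult_indicator)
  also have "\<dots> \<le> (\<integral>\<^sup>+y. ennreal (2 * (y powr (1 - 2 * s) * (r y)\<^sup>2)) + (ennreal (2 / \<mu>) * A) * indicator {0<..<1/\<mu>} y \<partial>lborel)"
    by (rule nn_integral_mono) (use pt in \<open>auto simp: indicator_def\<close>)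
  also have "\<dots> = (\<integral>\<^sup>+y. ennreal (2 * (y powr (1 - 2 * s) * (r y)\<^sup>2)) \<partial>lborel) + (\<integral>\<^sup>+y. (ennreal (2 / \<mu>) * A) * indicator {0<..<1/\<mu>} y \<partial>lborel)"
    by (rule nn_integral_add) measurable
  also have "(\<integral>\<^sup>+y. (ennreal (2 / \<mu>) * A) * indicator {0<..<1/\<mu>} y \<partial>lborel) = (ennreal (2 / \<mu>) * A) * ennreal (1 / \<mu>)"
    using \<mu> by (simp add: nn_integral_cmult_indicator)
  also have "(\<integral>\<^sup>+y. ennreal (2 * (y powr (1 - 2 * s) * (r y)\<^sup>2)) \<partial>lborel) = 2 * B"
    unfolding B_def by (subst nn_integral_cmult[symmetric]) (auto simp: ennreal_mult' intro!: nn_integral_cong)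
  finally have main: "ennreal (\<mu> powr (2 * s - 1) * (norm (f 0))\<^sup>2) * ennreal (1 / \<mu>) \<le> 2 * B + (ennreal (2 / \<mu>) * A) * ennreal (1 / \<mu>)" .
  have "ennreal (\<mu> powr (2 * s) * (norm (f 0))\<^sup>2) = ennreal (\<mu>\<^sup>2) * (ennreal (\<mu> powr (2 * s - 1) * (norm (f 0))\<^sup>2) * ennreal (1 / \<mu>))"
  proof -
    have "\<mu> powr (2 * s) = \<mu> powr (2 * s - 1) * \<mu>" using powr_times_self[OF \<mu>, of "2 * s - 1"] by simp
    then have "\<mu> powr (2 * s) * (norm (f 0))\<^sup>2 = \<mu>\<^sup>2 * (\<mu> powr (2 * s - 1) * (norm (f 0))\<^sup>2 * (1 / \<mu>))"
      using \<mu> by (simp add: power2_eq_square)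
    then show ?thesis
      by (simp only:) (rule ennreal_mult3, use \<mu> in auto)
  qed
  also have "\<dots> \<le> ennreal (\<mu>\<^sup>2) * (2 * B + (ennreal (2 / \<mu>) * A) * ennreal (1 / \<mu>))"
    by (rule mult_left_mono[OF main]) simp
  also have "\<dots> = 2 * (A + ennreal (\<mu>\<^sup>2) * B)"
  proof -
    have "ennreal (\<mu>\<^sup>2) * (ennreal (2 / \<mu>) * A * ennreal (1 / \<mu>)) = ennreal (\<mu>\<^sup>2 * (2 / \<mu>) * (1 / \<mu>)) * A"
    proof -
      have "ennreal (\<mu>\<^sup>2 * (2 / \<mu>) * (1 / \<mu>)) = ennreal (\<mu>\<^sup>2) * (ennreal (2 / \<mu>) * ennreal (1 / \<mu>))"
        unfolding mult.assoc by (rule ennreal_mult3) (use \<mu> in auto)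
      then show ?thesis by (simp only: mult_ac)
    qed
    also have "\<mu>\<^sup>2 * (2 / \<mu>) * (1 / \<mu>) = 2" using \<mu> by (simp add: power2_eq_square)
    finally show ?thesis by (simp add: algebra_simps)
  qed
  also have "A + ennreal (\<mu>\<^sup>2) * B = (\<integral>\<^sup>+t. ennreal (indicator {0<..} t * (t powr (1 - 2 * s) * ((norm (f' t))\<^sup>2 + \<mu>\<^sup>2 * (norm (f t))\<^sup>2))) \<partial>lborel)"
  proof -
    have "ennreal (\<mu>\<^sup>2) * B = (\<integral>\<^sup>+t. ennreal (\<mu>\<^sup>2) * ennreal (t powr (1 - 2 * s) * (r t)\<^sup>2) \<partial>lborel)"
      unfolding B_def by (rule nn_integral_cmult[symmetric]) measurable
    then have "A + ennreal (\<mu>\<^sup>2) * B =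
        (\<integral>\<^sup>+t. ennreal (t powr (1 - 2 * s) * (p t)\<^sup>2) + ennreal (\<mu>\<^sup>2) * ennreal (t powr (1 - 2 * s) * (r t)\<^sup>2) \<partial>lborel)"
      unfolding A_def by (simp only:) (rule nn_integral_add[symmetric]; measurable)
    also have "\<dots> = (\<integral>\<^sup>+t. ennreal (indicator {0<..} t * (t powr (1 - 2 * s) * ((norm (f' t))\<^sup>2 + \<mu>\<^sup>2 * (norm (f t))\<^sup>2))) \<partial>lborel)"
    proof (rule nn_integral_cong)
      fix t :: real
      have "ennreal (t powr (1 - 2 * s) * (p t)\<^sup>2) + ennreal (\<mu>\<^sup>2) * ennreal (t powr (1 - 2 * s) * (r t)\<^sup>2)
        = ennreal (t powr (1 - 2 * s) * (p t)\<^sup>2 + \<mu>\<^sup>2 * (t powr (1 - 2 * s) * (r t)\<^sup>2))"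
        by (subst ennreal_plus) (simp_all add: ennreal_mult)
      also have "t powr (1 - 2 * s) * (p t)\<^sup>2 + \<mu>\<^sup>2 * (t powr (1 - 2 * s) * (r t)\<^sup>2)
        = indicator {0<..} t * (t powr (1 - 2 * s) * ((norm (f' t))\<^sup>2 + \<mu>\<^sup>2 * (norm (f t))\<^sup>2))"
        by (simp add: p_def r_def indicator_def algebra_simps)
      finally show "ennreal (t powr (1 - 2 * s) * (p t)\<^sup>2) + ennreal (\<mu>\<^sup>2) * ennreal (t powr (1 - 2 * s) * (r t)\<^sup>2)
        = ennreal (indicator {0<..} t * (t powr (1 - 2 * s) * ((norm (f' t))\<^sup>2 + \<mu>\<^sup>2 * (norm (f t))\<^sup>2)))" .
    qed
    finally show ?thesis .
  qed
  finally show ?thesis .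
qed

lemma gradient_slice_x:
  assumes "GDERIV U (x, y) :> g (x, y)"
  shows "((\<lambda>x. U (x, y)) has_derivative (\<lambda>h. h \<bullet> fst (g (x, y)))) (at x)"
proof -
  have "((\<lambda>x. U (x, y)) has_derivative (\<lambda>h. (h, 0) \<bullet> g (x, y))) (at x)"
    by (rule has_derivative_compose[where f="\<lambda>x. (x, y)" and f'="\<lambda>h. (h, 0)" and g=U])
      (use assms in \<open>auto simp: gderiv_def intro!: derivative_eq_intros\<close>)
  then show ?thesis by (simp add: inner_prod_def)
qed

lemma gradient_slice_y:
  assumes "\<And>z. z \<in> half_space \<Longrightarrow> (U has_derivative (\<lambda>h. h \<bullet> g z)) (at z within half_space)" "0 \<le> t"
  shows "((\<lambda>t. U (x, t)) has_vector_derivative snd (g (x, t))) (at t within {0..})"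
proof -
  have "((\<lambda>t. U (x, t)) has_derivative (\<lambda>h. (0, h) \<bullet> g (x, t))) (at t within {0..})"
  proof (rule has_derivative_in_compose2[where t=half_space and f="\<lambda>t. (x, t)" and g=U and f'="\<lambda>h. (0, h)" and g'="\<lambda>z h. h \<bullet> g z"])
    show "((\<lambda>t. (x, t)) has_derivative (\<lambda>h. (0, h))) (at t within {0..})"
      by (auto intro!: derivative_eq_intros)
  qed (use assms in \<open>auto simp: half_space_def\<close>)
  then show ?thesis unfolding has_vector_derivative_def by (simp add: inner_prod_def)
qed

lemma half_space_slice_continuous:
  assumes "continuous_on half_space f" "0 \<le> y"
  shows "continuous_on A (\<lambda>x. f (x, y))"
  by (rule continuous_on_compose2[OF assms(1)]) (use assms(2) in \<open>auto simp: half_space_def intro!: continuous_intros\<close>)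

lemma continuous_set_borel_measurable_cube:
  fixes f :: "real^3 \<Rightarrow> 'b::real_normed_vector"
  shows "continuous_on UNIV f \<Longrightarrow> set_borel_measurable lborel cube f"
  unfolding set_borel_measurable_def
  using borel_measurable_continuous_on_indicator[OF cube_sets, of f] continuous_on_subset[of UNIV f cube] by simp

lemma norm_freq_sq: "(norm (freq k))\<^sup>2 = (\<Sum>i\<in>UNIV. (of_int (k $ i))\<^sup>2)"
  unfolding power2_norm_eq_inner by (simp add: freq_def inner_vec_def power2_eq_square)

lemma Bessel_continuous:
  assumes "continuous_on UNIV u" "finite F"
  shows "(\<Sum>k\<in>F. (cmod (fourier_coeff u k))\<^sup>2) \<le> (LINT x:cube|lborel. (u x)\<^sup>2)"
  by (rule Bessel_inequality)
    (auto intro!: continuous_set_borel_measurable_cube continuous_cube_integrable continuous_intros assms continuous_on_subset[OF assms(1)])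

text \<open>
Bessel's inequality for the function and for each component of its gradient at height \<open>y\<close>; the
horizontal derivatives contribute the factor \<open>|k|\<^sup>2\<close>.
\<close>

lemma slice_energy:
  assumes Uc: "continuous_on half_space U" and gc: "continuous_on half_space g"
    and gd: "\<And>z. 0 < snd z \<Longrightarrow> GDERIV U z :> g z"
    and perU: "\<And>x i. U (x + axis i (2 * pi), y) = U (x, y)"
    and perg: "\<And>z i. 0 < snd z \<Longrightarrow> g (z + (axis i (2 * pi), 0)) = g z"
    and y: "0 < y" and F: "finite F"
  shows "(\<Sum>k\<in>F. (cmod (fourier_coeff (\<lambda>x. snd (g (x, y))) k))\<^sup>2 +
      ((norm (freq k))\<^sup>2 + m\<^sup>2) * (cmod (fourier_coeff (\<lambda>x. U (x, y)) k))\<^sup>2)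
    \<le> (LINT x:cube|lborel. (norm (g (x, y)))\<^sup>2 + m\<^sup>2 * (U (x, y))\<^sup>2)"
proof -
  have y': "0 \<le> y" using y by simp
  have c1: "continuous_on A (\<lambda>x. U (x, y))" for A by (rule half_space_slice_continuous[OF Uc y'])
  have c2: "continuous_on A (\<lambda>x. g (x, y))" for A by (rule half_space_slice_continuous[OF gc y'])
  have c3: "continuous_on A (\<lambda>x. fst (g (x, y)) $ i)" for A i by (intro continuous_intros c2)
  have c4: "continuous_on A (\<lambda>x. snd (g (x, y)))" for A by (intro continuous_intros c2)
  have fd: "fourier_coeff (\<lambda>x. fst (g (x, y)) $ i) k = \<i> * of_int (k $ i) * fourier_coeff (\<lambda>x. U (x, y)) k" for i k
  proof (rule fourier_coeff_deriv)
    show "((\<lambda>x. U (x, y)) has_derivative (\<lambda>h. h \<bullet> fst (g (x, y)))) (at x)" for x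
      by (rule gradient_slice_x) (rule gd, simp add: y)
    show "fst (g (x + axis i (2 * pi), y)) = fst (g (x, y))" for x
      using perg[of "(x, y)" i] y by simp
  qed (auto intro!: continuous_intros c2 perU)
  have e: "(norm (g z))\<^sup>2 = (\<Sum>i\<in>UNIV. (fst (g z) $ i)\<^sup>2) + (snd (g z))\<^sup>2" for z
    unfolding power2_norm_eq_inner by (simp add: inner_prod_def inner_vec_def power2_eq_square)
  have "(\<Sum>k\<in>F. (cmod (fourier_coeff (\<lambda>x. snd (g (x, y))) k))\<^sup>2 +
      ((norm (freq k))\<^sup>2 + m\<^sup>2) * (cmod (fourier_coeff (\<lambda>x. U (x, y)) k))\<^sup>2)
    = (\<Sum>k\<in>F. (cmod (fourier_coeff (\<lambda>x. snd (g (x, y))) k))\<^sup>2)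
     + (\<Sum>i\<in>UNIV. \<Sum>k\<in>F. (cmod (fourier_coeff (\<lambda>x. fst (g (x, y)) $ i) k))\<^sup>2)
     + m\<^sup>2 * (\<Sum>k\<in>F. (cmod (fourier_coeff (\<lambda>x. U (x, y)) k))\<^sup>2)"
    unfolding fd norm_freq_sq
    by (subst sum.swap) (simp add: norm_mult power_mult_distrib sum.distrib sum_distrib_left sum_distrib_right algebra_simps)
  also have "\<dots> \<le> (LINT x:cube|lborel. (snd (g (x, y)))\<^sup>2)
     + (\<Sum>i\<in>UNIV. LINT x:cube|lborel. (fst (g (x, y)) $ i)\<^sup>2)
     + m\<^sup>2 * (LINT x:cube|lborel. (U (x, y))\<^sup>2)"
    by (intro add_mono sum_mono mult_left_mono Bessel_continuous F c1 c3 c4) auto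
  also have "\<dots> = (LINT x:cube|lborel. (norm (g (x, y)))\<^sup>2 + m\<^sup>2 * (U (x, y))\<^sup>2)"
  proof -
    have i1: "set_integrable lborel cube (\<lambda>x. (snd (g (x, y)))\<^sup>2)"
      and i2: "\<And>i. set_integrable lborel cube (\<lambda>x. (fst (g (x, y)) $ i)\<^sup>2)"
      and i3: "set_integrable lborel cube (\<lambda>x. m\<^sup>2 * (U (x, y))\<^sup>2)"
      by (intro continuous_cube_integrable continuous_intros c1 c3 c4)+
    have i2': "set_integrable lborel cube (\<lambda>x. \<Sum>i\<in>UNIV. (fst (g (x, y)) $ i)\<^sup>2)"
      by (rule set_integrable_finite_sum(1)[OF i2])
    show ?thesis
      unfolding e using i1 i2 i2' i3
      by (simp add: set_integral_add set_integrable_finite_sum(2) set_integral_mult_right)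
  qed
  finally show ?thesis .
qed

text \<open>
The norm as an iterated integral in either order: over the heights for the Fourier side of the trace
inequality, over the cube for its pointwise version.
\<close>

lemma energy_nn_integral:
  assumes W: "(U, G) \<in> smooth_periodic s" and s: "0 < s" "s < 1" and m: "0 < m"
    and Uc: "continuous_on half_space U" and gc: "continuous_on half_space g"
    and gG: "\<And>z. z \<in> half_cylinder \<Longrightarrow> g z = G z"
  shows "(\<integral>\<^sup>+t. (\<integral>\<^sup>+x. ennreal (indicator half_cylinder (x, t) * (t powr (1 - 2 * s) * ((norm (g (x, t)))\<^sup>2 + m\<^sup>2 * (U (x, t))\<^sup>2))) \<partial>lborel) \<partial>lborel)
     = ennreal (kappa s * (X_norm s m (U, G))\<^sup>2)" (is ?A)
    and "(\<integral>\<^sup>+x. (\<integral>\<^sup>+t. ennreal (indicator half_cylinder (x, t) * (t powr (1 - 2 * s) * ((norm (g (x, t)))\<^sup>2 + m\<^sup>2 * (U (x, t))\<^sup>2))) \<partial>lborel) \<partial>lborel)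
     = ennreal (kappa s * (X_norm s m (U, G))\<^sup>2)" (is ?B)
proof -
  let ?f = "\<lambda>z. ennreal (indicator half_cylinder z * (snd z powr (1 - 2 * s) * ((norm (g z))\<^sup>2 + m\<^sup>2 * (U z)\<^sup>2)))"
  have li: "integrable lborel (\<lambda>z. (norm (lift s m (U, G) z))\<^sup>2)"
    using smooth_periodic_weighted_L2[OF W] weighted_L2_iff[OF m] by (auto simp: sq_integrable_def)
  have fe: "?f z = ennreal ((norm (lift s m (U, G) z))\<^sup>2)" for z
    unfolding norm_lift using gG by (auto simp: indicator_def add.commute)
  have fm: "?f \<in> borel_measurable (lborel \<Otimes>\<^sub>M lborel)"
    unfolding fe lborel_prod using li by measurable
  have "(\<integral>\<^sup>+z. ?f z \<partial>(lborel \<Otimes>\<^sub>M lborel)) = ennreal (\<integral>z. (norm (lift s m (U, G) z))\<^sup>2 \<partial>lborel)"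
    unfolding fe lborel_prod by (rule nn_integral_eq_integral[OF li]) simp
  also have "\<dots> = ennreal (kappa s * (X_norm s m (U, G))\<^sup>2)"
    using kappa_pos[OF s] by (simp only: X_norm_square[OF s] X_inner_self) simp
  finally have v: "(\<integral>\<^sup>+z. ?f z \<partial>(lborel \<Otimes>\<^sub>M lborel)) = ennreal (kappa s * (X_norm s m (U, G))\<^sup>2)" .
  show ?B using lborel.nn_integral_fst[OF fm] v by simp
  show ?A using lborel_pair.nn_integral_snd[OF fm] v by simp
qed

text \<open>
Each Fourier coefficient of the slices is a function of the height to which \<open>trace_1d\<close> applies with
\<open>\<mu>\<^sup>2 = |k|\<^sup>2 + m\<^sup>2\<close>; the sum of the right-hand sides is at most the energy by \<open>slice_energy\<close>. The
second inequality applies \<open>trace_1d\<close> with \<open>\<mu> = m\<close> on the vertical line above each point. It controls the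
\<open>L\<^sup>2\<close> norm of traces.
\<close>

lemma Sobolev_trace_bound:
  assumes W: "(U, G) \<in> smooth_periodic s" and s: "1/2 \<le> s" "s < 1" and m: "0 < m" and F: "finite F"
  shows "(\<Sum>k\<in>F. Hs_term s m (\<lambda>x. U (x, 0)) k) \<le> 2 * kappa s * (X_norm s m (U, G))\<^sup>2"
    and "m powr (2 * s) * (LINT x:cube|lborel. (U (x, 0))\<^sup>2) \<le> 2 * kappa s * (X_norm s m (U, G))\<^sup>2"
proof -
  have s0: "0 < s" using s by simp
  obtain g where gc: "continuous_on half_space g"
    and gd: "\<And>z. z \<in> half_space \<Longrightarrow> (U has_derivative (\<lambda>h. h \<bullet> g z)) (at z within half_space)"
    and gG: "\<And>z. z \<in> half_cylinder \<Longrightarrow> g z = G z"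
    and perg: "\<And>z i. 0 < snd z \<Longrightarrow> g (z + (axis i (2 * pi), 0)) = g z"
    and gD: "\<And>z. 0 < snd z \<Longrightarrow> GDERIV U z :> g z"
    using smooth_periodic_gradient[OF W] by metis
  have "Ck_on 0 half_space U" and perU: "\<And>x y i. 0 \<le> y \<Longrightarrow> U (x + axis i (2 * pi), y) = U (x, y)"
    using W by (auto simp: smooth_periodic_def half_space_def smooth_on_def simp del: Ck_on.simps)
  then have Uc: "continuous_on half_space U" by simp
  note en = energy_nn_integral[OF W s0 s(2) m Uc gc gG]
  let ?E = "\<lambda>x t. (norm (g (x, t)))\<^sup>2 + m\<^sup>2 * (U (x, t))\<^sup>2"
  have ind: "indicator half_cylinder (x, t) = (indicator {0<..} t * indicator cube x :: real)" for x t
    by (auto simp: half_cylinder_def indicator_def)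
  define f where "f k t = fourier_coeff (\<lambda>x. U (x, t)) k" for k t
  define f' where "f' k t = fourier_coeff (\<lambda>x. snd (g (x, t))) k" for k t
  have swapg: "continuous_on ({0..} \<times> closed_cube) (\<lambda>p. g (snd p, fst p))"
    by (rule continuous_on_compose2[OF gc]) (auto simp: half_space_def intro!: continuous_intros)
  (* differentiation of the Fourier coefficients of the slices under the integral sign *)
  have fd: "(f k has_vector_derivative f' k t) (at t within {0..})" if t: "0 \<le> t" for k t
  proof -
    have cc: "continuous_on closed_cube (\<lambda>x. complex_of_real (U (x, t)) * ek k x)" if "0 \<le> t" for t
      by (intro continuous_intros half_space_slice_continuous[OF Uc that])
    have cc': "continuous_on closed_cube (\<lambda>x. complex_of_real (snd (g (x, t))) * ek k x)" if "0 \<le> t" for t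
      by (intro continuous_intros half_space_slice_continuous[OF gc that])
    have "((\<lambda>t. integral closed_cube (\<lambda>x. complex_of_real (U (x, t)) * ek k x)) has_vector_derivative
        integral closed_cube (\<lambda>x. complex_of_real (snd (g (x, t))) * ek k x)) (at t within {0..})"
    proof (rule leibniz_rule_vector_derivative)
      show "((\<lambda>t. complex_of_real (U (x, t)) * ek k x) has_vector_derivative complex_of_real (snd (g (x, t))) * ek k x) (at t within {0..})"
        if "t \<in> {0..}" for t x
        by (intro has_vector_derivative_mult_left bounded_linear.has_vector_derivative[OF bounded_linear_of_real] gradient_slice_y gd)
          (use that in auto)
      show "(\<lambda>x. complex_of_real (U (x, t)) * ek k x) integrable_on closed_cube" if "t \<in> {0..}" for t
        by (rule integrable_continuous[OF cc]) (use that in simp)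
      have "continuous_on ({0..} \<times> closed_cube) (\<lambda>p. complex_of_real (snd (g (snd p, fst p))) * ek k (snd p))"
        by (intro continuous_intros swapg)
      then show "continuous_on ({0..} \<times> closed_cube) (\<lambda>(t, x). complex_of_real (snd (g (x, t))) * ek k x)"
        unfolding split_def .
    qed (use t in auto)
    then have "((\<lambda>t. of_real cfac * integral closed_cube (\<lambda>x. complex_of_real (U (x, t)) * ek k x)) has_vector_derivative
        of_real cfac * integral closed_cube (\<lambda>x. complex_of_real (snd (g (x, t))) * ek k x)) (at t within {0..})"
      by (rule has_vector_derivative_mult_right)
    then show ?thesis
      unfolding f'_def fourier_coeff_ek cube_integral_eq[OF cc'[OF t]]
      by (rule has_vector_derivative_transform[rotated 2]) (use t in \<open>auto simp: f_def fourier_coeff_ek cube_integral_eq[OF cc]\<close>)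
  qed
  have fc: "continuous_on {0..} (f' k)" for k
  proof -
    have cc': "continuous_on closed_cube (\<lambda>x. complex_of_real (snd (g (x, t))) * ek k x)" if "0 \<le> t" for t
      by (intro continuous_intros half_space_slice_continuous[OF gc that])
    have "continuous_on ({0..} \<times> closed_cube) (\<lambda>p. complex_of_real (snd (g (snd p, fst p))) * ek k (snd p))"
      by (intro continuous_intros swapg)
    then have "continuous_on {0..} (\<lambda>t. integral closed_cube (\<lambda>x. complex_of_real (snd (g (x, t))) * ek k x))"
      by (intro integral_continuous_on_param) (simp add: split_def)
    then have "continuous_on {0..} (\<lambda>t. of_real cfac * integral closed_cube (\<lambda>x. complex_of_real (snd (g (x, t))) * ek k x))"
      by (intro continuous_intros)
    then show ?thesis
      by (rule continuous_on_cong[THEN iffD1, rotated -1]) (auto simp: f'_def fourier_coeff_ek cube_integral_eq[OF cc'])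
  qed
  have kfin: "kappa s * (X_norm s m (U, G))\<^sup>2 \<ge> 0" using kappa_pos[OF s0 s(2)] by simp
  show "(\<Sum>k\<in>F. Hs_term s m (\<lambda>x. U (x, 0)) k) \<le> 2 * kappa s * (X_norm s m (U, G))\<^sup>2"
  proof -
    define \<mu> where "\<mu> k = sqrt ((norm (freq k))\<^sup>2 + m\<^sup>2)" for k
    have \<mu>: "0 < \<mu> k" "(\<mu> k)\<^sup>2 = (norm (freq k))\<^sup>2 + m\<^sup>2" for k
      using m by (auto simp: \<mu>_def add_nonneg_pos)
    have Ht: "Hs_term s m (\<lambda>x. U (x, 0)) k = \<mu> k powr (2 * s) * (norm (f k 0))\<^sup>2" for k
    proof -
      have "((norm (freq k))\<^sup>2 + m\<^sup>2) powr s = (\<mu> k powr 2) powr s" using \<mu>[of k] by (simp add: powr_numeral)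
      also have "\<dots> = \<mu> k powr (2 * s)" by (simp add: powr_powr)
      finally show ?thesis by (simp add: Hs_term_def f_def)
    qed
    have meas: "(\<lambda>t. ennreal (indicator {0<..} t * (t powr (1 - 2 * s) * ((norm (f' k t))\<^sup>2 + (\<mu> k)\<^sup>2 * (norm (f k t))\<^sup>2)))) \<in> borel_measurable lborel" for k
    proof -
      have "continuous_on {0..} (f k)"
        using fd by (auto simp: continuous_on_eq_continuous_within intro: has_vector_derivative_continuous)
      then have "(\<lambda>t. indicator {0<..} t *\<^sub>R (t powr (1 - 2 * s) * ((norm (f' k t))\<^sup>2 + (\<mu> k)\<^sup>2 * (norm (f k t))\<^sup>2))) \<in> borel_measurable borel"
        by (intro borel_measurable_continuous_on_indicator continuous_intros)
          (auto intro: continuous_on_subset continuous_on_subset[OF fc])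
      then show ?thesis by simp
    qed
    have "ennreal (\<Sum>k\<in>F. Hs_term s m (\<lambda>x. U (x, 0)) k) = (\<Sum>k\<in>F. ennreal (\<mu> k powr (2 * s) * (norm (f k 0))\<^sup>2))"
      unfolding Ht by (rule sum_ennreal[symmetric]) simp
    also have "\<dots> \<le> (\<Sum>k\<in>F. 2 * (\<integral>\<^sup>+t. ennreal (indicator {0<..} t * (t powr (1 - 2 * s) * ((norm (f' k t))\<^sup>2 + (\<mu> k)\<^sup>2 * (norm (f k t))\<^sup>2))) \<partial>lborel))"
      by (rule sum_mono, rule trace_1d[OF s \<mu>(1) fd fc])
    also have "\<dots> = 2 * (\<integral>\<^sup>+t. (\<Sum>k\<in>F. ennreal (indicator {0<..} t * (t powr (1 - 2 * s) * ((norm (f' k t))\<^sup>2 + (\<mu> k)\<^sup>2 * (norm (f k t))\<^sup>2)))) \<partial>lborel)"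
      by (subst nn_integral_sum[OF meas]) (simp add: sum_distrib_left)
    also have "\<dots> \<le> 2 * (\<integral>\<^sup>+t. (\<integral>\<^sup>+x. ennreal (indicator half_cylinder (x, t) * (t powr (1 - 2 * s) * ?E x t)) \<partial>lborel) \<partial>lborel)"
    proof (intro mult_left_mono nn_integral_mono)
      fix t :: real
      show "(\<Sum>k\<in>F. ennreal (indicator {0<..} t * (t powr (1 - 2 * s) * ((norm (f' k t))\<^sup>2 + (\<mu> k)\<^sup>2 * (norm (f k t))\<^sup>2))))
        \<le> (\<integral>\<^sup>+x. ennreal (indicator half_cylinder (x, t) * (t powr (1 - 2 * s) * ?E x t)) \<partial>lborel)"
      proof (cases "0 < t")
        case True
        have i: "set_integrable lborel cube (\<lambda>x. t powr (1 - 2 * s) * ?E x t)"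
          using True by (intro continuous_cube_integrable continuous_intros half_space_slice_continuous[OF Uc] half_space_slice_continuous[OF gc]) auto
        have "(\<Sum>k\<in>F. ennreal (indicator {0<..} t * (t powr (1 - 2 * s) * ((norm (f' k t))\<^sup>2 + (\<mu> k)\<^sup>2 * (norm (f k t))\<^sup>2))))
          = ennreal (t powr (1 - 2 * s) * (\<Sum>k\<in>F. (norm (f' k t))\<^sup>2 + (\<mu> k)\<^sup>2 * (norm (f k t))\<^sup>2))"
          using True by (subst sum_ennreal) (auto simp: sum_distrib_left)
        also have "\<dots> \<le> ennreal (t powr (1 - 2 * s) * (LINT x:cube|lborel. ?E x t))"
          unfolding f'_def f_def \<mu>(2)
          by (intro ennreal_leI mult_left_mono slice_energy[OF Uc gc gD _ perg True F]) (use perU True in auto)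
        also have "\<dots> = ennreal (LINT x:cube|lborel. t powr (1 - 2 * s) * ?E x t)"
          by (simp add: set_integral_mult_right)
        also have "\<dots> = (\<integral>\<^sup>+x. ennreal (indicator half_cylinder (x, t) * (t powr (1 - 2 * s) * ?E x t)) \<partial>lborel)"
          unfolding set_lebesgue_integral_def ind using True i
          by (subst nn_integral_eq_integral[symmetric]) (auto simp: set_integrable_def)
        finally show ?thesis .
      qed simp
    qed simp
    also have "\<dots> = 2 * ennreal (kappa s * (X_norm s m (U, G))\<^sup>2)" by (rule arg_cong[OF en(1), of "\<lambda>w. 2 * w"])
    also have "\<dots> = ennreal (2 * kappa s * (X_norm s m (U, G))\<^sup>2)" using kfin by (simp add: ennreal_mult' mult.assoc)
    finally show ?thesis using kfin by (simp add: mult.assoc ennreal_le_iff)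
  qed
  show "m powr (2 * s) * (LINT x:cube|lborel. (U (x, 0))\<^sup>2) \<le> 2 * kappa s * (X_norm s m (U, G))\<^sup>2"
  proof -
    have c0: "continuous_on A (\<lambda>x. U (x, 0))" for A by (rule half_space_slice_continuous[OF Uc]) simp
    have i: "set_integrable lborel cube (\<lambda>x. m powr (2 * s) * (U (x, 0))\<^sup>2)"
      by (intro continuous_cube_integrable continuous_intros c0)
    have "ennreal (m powr (2 * s) * (LINT x:cube|lborel. (U (x, 0))\<^sup>2)) = ennreal (LINT x:cube|lborel. m powr (2 * s) * (U (x, 0))\<^sup>2)"
      by (simp add: set_integral_mult_right)
    also have "\<dots> = (\<integral>\<^sup>+x. ennreal (indicator cube x * (m powr (2 * s) * (U (x, 0))\<^sup>2)) \<partial>lborel)"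
      unfolding set_lebesgue_integral_def using i
      by (subst nn_integral_eq_integral[symmetric]) (auto simp: set_integrable_def)
    also have "\<dots> \<le> (\<integral>\<^sup>+x. 2 * (\<integral>\<^sup>+t. ennreal (indicator half_cylinder (x, t) * (t powr (1 - 2 * s) * ?E x t)) \<partial>lborel) \<partial>lborel)"
    proof (rule nn_integral_mono)
      fix x :: "real^3"
      show "ennreal (indicator cube x * (m powr (2 * s) * (U (x, 0))\<^sup>2)) \<le>
         2 * (\<integral>\<^sup>+t. ennreal (indicator half_cylinder (x, t) * (t powr (1 - 2 * s) * ?E x t)) \<partial>lborel)"
      proof (cases "x \<in> cube")
        case True
        have "ennreal (m powr (2 * s) * (norm (U (x, 0)))\<^sup>2) \<le>
          2 * (\<integral>\<^sup>+t. ennreal (indicator {0<..} t * (t powr (1 - 2 * s) * ((norm (snd (g (x, t))))\<^sup>2 + m\<^sup>2 * (norm (U (x, t)))\<^sup>2))) \<partial>lborel)"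
        proof (rule trace_1d[OF s m])
          show "((\<lambda>t. U (x, t)) has_vector_derivative snd (g (x, t))) (at t within {0..})" if "0 \<le> t" for t
            by (rule gradient_slice_y[OF gd that])
          show "continuous_on {0..} (\<lambda>t. snd (g (x, t)))"
            by (intro continuous_intros continuous_on_compose2[OF gc]) (auto simp: half_space_def)
        qed
        also have "\<dots> \<le> 2 * (\<integral>\<^sup>+t. ennreal (indicator half_cylinder (x, t) * (t powr (1 - 2 * s) * ?E x t)) \<partial>lborel)"
        proof (intro mult_left_mono nn_integral_mono ennreal_leI)
          fix t
          have "(norm (snd (g (x, t))))\<^sup>2 \<le> (norm (g (x, t)))\<^sup>2"
            by (intro power_mono) (metis norm_snd_le prod.collapse, simp)
          then show "indicator {0<..} t * (t powr (1 - 2 * s) * ((norm (snd (g (x, t))))\<^sup>2 + m\<^sup>2 * (norm (U (x, t)))\<^sup>2))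
            \<le> indicator half_cylinder (x, t) * (t powr (1 - 2 * s) * ?E x t)"
            unfolding ind using True by (auto simp: indicator_def intro!: mult_left_mono)
        qed simp
        finally show ?thesis using True by simp
      qed simp
    qed
    also have "\<dots> = 2 * (\<integral>\<^sup>+x. (\<integral>\<^sup>+t. ennreal (indicator half_cylinder (x, t) * (t powr (1 - 2 * s) * ?E x t)) \<partial>lborel) \<partial>lborel)"
    proof (rule nn_integral_cmult)
      have "(\<lambda>z. ennreal (indicator half_cylinder z * (snd z powr (1 - 2 * s) * ((norm (g z))\<^sup>2 + m\<^sup>2 * (U z)\<^sup>2)))) \<in> borel_measurable (borel :: ((real^3) \<times> real) measure)"
      proof -
        have "(\<lambda>z. indicator half_cylinder z *\<^sub>R (snd z powr (1 - 2 * s) * ((norm (g z))\<^sup>2 + m\<^sup>2 * (U z)\<^sup>2))) \<in> borel_measurable borel"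
          by (intro borel_measurable_continuous_on_indicator continuous_intros half_cylinder_sets)
            (auto simp: half_cylinder_def half_space_def intro!: continuous_on_subset[OF Uc] continuous_on_subset[OF gc])
        then show ?thesis by simp
      qed
      then have "(\<lambda>z. ennreal (indicator half_cylinder z * (snd z powr (1 - 2 * s) * ((norm (g z))\<^sup>2 + m\<^sup>2 * (U z)\<^sup>2)))) \<in> borel_measurable (lborel \<Otimes>\<^sub>M (lborel :: real measure))"
        unfolding lborel_prod by simp
      from lborel.borel_measurable_nn_integral_fst[OF this]
      show "(\<lambda>x. \<integral>\<^sup>+t. ennreal (indicator half_cylinder (x, t) * (t powr (1 - 2 * s) * ?E x t)) \<partial>lborel) \<in> borel_measurable lborel"
        by simp
    qed
    also have "\<dots> = 2 * ennreal (kappa s * (X_norm s m (U, G))\<^sup>2)" by (rule arg_cong[OF en(2), of "\<lambda>w. 2 * w"])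
    also have "\<dots> = ennreal (2 * kappa s * (X_norm s m (U, G))\<^sup>2)" using kfin by (simp add: ennreal_mult' mult.assoc)
    finally show ?thesis using kfin by (simp add: mult.assoc ennreal_le_iff)
  qed
qed

section \<open>Uniqueness of Fourier coefficients\<close>

inductive trig_poly :: "(real \<Rightarrow> complex) \<Rightarrow> bool" where
  trig_mono: "trig_poly (\<lambda>x. c * cis (of_int k * x))"
| trig_add: "trig_poly P \<Longrightarrow> trig_poly Q \<Longrightarrow> trig_poly (\<lambda>x. P x + Q x)"

lemma trig_poly_mult:
  assumes "trig_poly P" "trig_poly Q"
  shows "trig_poly (\<lambda>x. P x * Q x)"
  using assms
proof (induction rule: trig_poly.induct)
  case (trig_mono c k)
  from trig_mono show ?case
  proof (induction rule: trig_poly.induct)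
    case (trig_mono d l)
    have "(\<lambda>x. c * cis (of_int k * x) * (d * cis (of_int l * x))) = (\<lambda>x. (c * d) * cis (of_int (k + l) * x))"
    proof
      fix x :: real
      have "of_int (k + l) * x = of_int k * x + of_int l * x" by (simp add: distrib_right)
      then show "c * cis (of_int k * x) * (d * cis (of_int l * x)) = (c * d) * cis (of_int (k + l) * x)"
        by (simp only: cis_mult[symmetric] mult_ac)
    qed
    then show ?case using trig_poly.trig_mono[of "c * d" "k + l"] by (simp only:)
  next
    case (trig_add P Q)
    then show ?case using trig_poly.trig_add by (simp add: distrib_left)
  qed
next
  case (trig_add P R)
  then show ?case using trig_poly.trig_add by (simp add: distrib_right)
qed

lemma trig_poly_const: "trig_poly (\<lambda>x. c)"
  using trig_mono[of c 0] by simp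

lemma trig_poly_periodic: "trig_poly P \<Longrightarrow> P (t + 2 * pi) = P t"
proof (induction rule: trig_poly.induct)
  case (trig_mono c k)
  have "cis (of_int k * (t + 2 * pi)) = cis (of_int k * t) * cis (2 * pi * of_int k)"
    by (simp add: cis_mult algebra_simps)
  then show ?case by (simp add: cis_multiple_2pi)
qed simp

lemma trig_poly_continuous: "trig_poly P \<Longrightarrow> continuous_on A P"
  by (induction rule: trig_poly.induct) (auto intro!: continuous_intros simp: cis_conv_exp)

lemma trig_poly_bounded: "trig_poly P \<Longrightarrow> \<exists>B. \<forall>t. cmod (P t) \<le> B"
proof (induction rule: trig_poly.induct)
  case (trig_add P Q)
  then obtain B C where "\<forall>t. cmod (P t) \<le> B" "\<forall>t. cmod (Q t) \<le> C" by blast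
  then have "cmod (P t + Q t) \<le> B + C" for t by (meson add_mono norm_triangle_le)
  then show ?case by blast
qed (auto simp: norm_mult)

lemma trig_poly_polynomial:
  fixes p :: "complex \<Rightarrow> real"
  assumes "real_polynomial_function p"
  shows "trig_poly (\<lambda>t. of_real (p (cis t)))"
  using assms
proof (induction rule: real_polynomial_function.induct)
  case (linear f)
  have "f (cis t) = cos t * f 1 + sin t * f \<i>" for t
  proof -
    have "cis t = cos t *\<^sub>R 1 + sin t *\<^sub>R \<i>" by (simp add: complex_eq_iff)
    then show ?thesis using linear by (simp add: linear_simps)
  qed
  then have "of_real (f (cis t)) = ((of_real (f 1) - \<i> * of_real (f \<i>)) / 2) * cis (of_int 1 * t) +
      ((of_real (f 1) + \<i> * of_real (f \<i>)) / 2) * cis (of_int (-1) * t)" for t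
    by (simp add: complex_eq_iff field_simps)
  then show ?case using trig_add[OF trig_mono trig_mono] by presburger
next
  case (const c)
  then show ?case by (rule trig_poly_const)
next
  case (add f g)
  then show ?case using trig_add by simp
next
  case (mult f g)
  then show ?case using trig_poly_mult by simp
qed

text \<open>
The map \<^const>\<open>cis\<close> from the interval onto the circle is a quotient map, being a continuous surjection from
a compact space; a function that agrees at the end points therefore descends to a continuous one.
\<close>

lemma periodic_on_circle:
  fixes g :: "real \<Rightarrow> real"
  assumes g: "continuous_on {-pi..pi} g" "g (-pi) = g pi"
  obtains G where "continuous_on (sphere (0::complex) 1) G" "\<And>t. t \<in> {-pi..pi} \<Longrightarrow> G (cis t) = g t"
proof -
  define G where "G z = g (Arg z)" for z
  have Gc: "G (cis t) = g t" if "t \<in> {-pi..pi}" for t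
  proof (cases "t = -pi")
    case True
    have "cis (- pi) = cis pi" by (simp add: complex_eq_iff)
    moreover have "Arg (cis pi) = pi" by (rule Arg_cis) auto
    ultimately show ?thesis unfolding True G_def using g(2) by (simp only:)
  next
    case False
    then show ?thesis using that by (simp add: G_def Arg_cis)
  qed
  have surj: "cis ` {-pi..pi} = sphere 0 1"
  proof
    show "sphere 0 1 \<subseteq> cis ` {-pi..pi}"
    proof
      fix z :: complex assume "z \<in> sphere 0 1"
      then have n: "cmod z = 1" by simp
      then have "z \<noteq> 0" by auto
      then have "z = cis (Arg z)" using cis_Arg[of z] n by (simp add: sgn_eq)
      moreover have "Arg z \<in> {-pi..pi}" using Arg_bounded[of z] by auto
      ultimately show "z \<in> cis ` {-pi..pi}" by blast
    qed
  qed (auto simp: dist_norm)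
  have ccis: "continuous_on {-pi..pi} cis" by (auto simp: cis_conv_exp intro!: continuous_intros)
  have "continuous_on (sphere 0 1) G"
    unfolding continuous_on_open_gen[of G "sphere 0 1" UNIV, simplified]
  proof (intro allI impI)
    fix U :: "real set" assume U: "open U"
    have eq: "{-pi..pi} \<inter> cis -` (sphere 0 1 \<inter> G -` U) = {-pi..pi} \<inter> g -` U"
      using Gc by (auto simp: dist_norm)
    have "openin (top_of_set {-pi..pi}) ({-pi..pi} \<inter> g -` U)"
      using g(1) U continuous_openin_preimage_gen by blast
    then show "openin (top_of_set (sphere 0 1)) (sphere 0 1 \<inter> G -` U)"
      using Abstract_Topology_2.continuous_imp_quotient_map[OF ccis surj compact_Icc, of "sphere 0 1 \<inter> G -` U"]
      unfolding eq by simp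
  qed
  then show ?thesis using Gc that by blast
qed

text \<open>
The Stone-Weierstrass theorem on the unit circle: real polynomials of \<open>cis t\<close> are
trigonometric polynomials.
\<close>

lemma trig_poly_dense:
  fixes g :: "real \<Rightarrow> real"
  assumes g: "continuous_on {-pi..pi} g" "g (-pi) = g pi" and e: "0 < e"
  obtains P where "trig_poly P" "\<And>t. t \<in> {-pi..pi} \<Longrightarrow> cmod (P t - of_real (g t)) < e"
proof -
  obtain G where G: "continuous_on (sphere (0::complex) 1) G" "\<And>t. t \<in> {-pi..pi} \<Longrightarrow> G (cis t) = g t"
    using periodic_on_circle[OF g] by blast
  obtain p where p: "real_polynomial_function p" "\<And>z. z \<in> sphere 0 1 \<Longrightarrow> \<bar>G z - p z\<bar> < e"
    using Stone_Weierstrass_real_polynomial_function[OF compact_sphere G(1) e] by blast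
  have "cmod (of_real (p (cis t)) - of_real (g t)) < e" if "t \<in> {-pi..pi}" for t
  proof -
    have "\<bar>G (cis t) - p (cis t)\<bar> < e" by (rule p(2)) simp
    then show ?thesis using G(2)[OF that] by (simp flip: of_real_diff add: abs_minus_commute)
  qed
  then show ?thesis using trig_poly_polynomial[OF p(1)] that by blast
qed

lemma periodic_reduce:
  assumes "\<And>t. t \<in> {-pi..pi} \<Longrightarrow> Q t" and "\<And>t::real. Q (t + 2 * pi) \<longleftrightarrow> Q t"
  shows "Q t"
proof -
  have shift: "Q (t + 2 * pi * of_int k) \<longleftrightarrow> Q t" for t k
  proof (induction k rule: int_induct[of _ 0])
    case base
    then show ?case by simp
  next
    case (step1 i)
    then show ?case using assms(2)[of "t + 2 * pi * of_int i"] by (simp add: algebra_simps)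
  next
    case (step2 i)
    then show ?case using assms(2)[of "t + 2 * pi * of_int (i - 1)"] by (simp add: algebra_simps)
  qed
  define k where "k = \<lfloor>(t + pi) / (2 * pi)\<rfloor>"
  have "of_int k \<le> (t + pi) / (2 * pi)" "(t + pi) / (2 * pi) < of_int k + 1"
    unfolding k_def by linarith+
  then have "2 * pi * of_int k \<le> t + pi" "t + pi < 2 * pi * of_int k + 2 * pi"
    by (simp_all add: field_simps)
  then have "t + 2 * pi * of_int (- k) \<in> {-pi..pi}" by simp
  then show ?thesis using assms(1) shift by blast
qed

lemma set_integrable_mult_bounded:
  fixes D :: "real^3 \<Rightarrow> real" and f :: "real^3 \<Rightarrow> 'c::{real_normed_algebra_1,banach,second_countable_topology}"
  assumes D: "set_integrable lborel cube D" and f: "f \<in> borel_measurable borel" and B: "\<And>x. norm (f x) \<le> B"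
  shows "set_integrable lborel cube (\<lambda>x. D x *\<^sub>R f x)"
  unfolding set_integrable_def
proof (rule Bochner_Integration.integrable_bound)
  have Di: "integrable lborel (\<lambda>x. indicator cube x *\<^sub>R D x)" using D by (simp add: set_integrable_def)
  then show "integrable lborel (\<lambda>x. B * (indicator cube x *\<^sub>R D x))" by simp
  have "(\<lambda>x. (indicator cube x *\<^sub>R D x) *\<^sub>R f x) \<in> borel_measurable lborel"
    using borel_measurable_integrable[OF Di] f by measurable
  then show "(\<lambda>x. indicator cube x *\<^sub>R (D x *\<^sub>R f x)) \<in> borel_measurable lborel" by simp
  have "0 \<le> B" using B[of 0] norm_ge_zero order_trans by blast
  then show "AE x in lborel. norm (indicator cube x *\<^sub>R (D x *\<^sub>R f x)) \<le> norm (B * (indicator cube x *\<^sub>R D x))"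
    using B by (intro AE_I2) (auto simp: indicator_def abs_mult mult.commute[of B] intro!: mult_left_mono)
qed

lemma trig_coord_measurable:
  assumes "trig_poly P" shows "(\<lambda>x::real^3. P (a * x $ i)) \<in> borel_measurable borel"
  by (intro borel_measurable_continuous_onI continuous_on_compose2[OF trig_poly_continuous[OF assms, of UNIV]] continuous_intros) auto

lemma cis_int_pi: "cis (of_int k * pi) = (if even k then 1 else -1)"
proof (cases "even k")
  case True
  then obtain l where "k = 2 * l" by blast
  then show ?thesis using cis_multiple_2pi[of "of_int l"] by (simp add: mult_ac)
next
  case False
  then obtain l where k: "k = 2 * l + 1" by (blast elim: oddE)
  have "cis (of_int k * pi) = cis (2 * pi * of_int l) * cis pi"
    unfolding k cis_mult by (simp add: algebra_simps)
  then show ?thesis using False cis_multiple_2pi[of "of_int l"] by simp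
qed

text \<open>
Let \<open>P\<close> be a trigonometric polynomial close to \<open>G\<close>. Its antiperiodic part
\<open>(P t - P (t + pi)) / 2\<close> is as close to \<open>G\<close> as \<open>P\<close> is, and contains odd frequencies only, so \<open>D\<close> is orthogonal
to it. Hence the integral of \<open>D\<close> against \<open>G\<close> is arbitrarily small.
\<close>

lemma antiperiodic_orthogonal:
  fixes G :: "real \<Rightarrow> real" and D :: "real^3 \<Rightarrow> real" and n :: nat
  assumes Gc: "continuous_on UNIV G" and per: "\<And>t. G (t + 2 * pi) = G t" and anti: "\<And>t. G (t + pi) = - G t"
    and D: "set_integrable lborel cube D"
    and orth: "\<And>l. odd l \<Longrightarrow> (LINT x:cube|lborel. D x *\<^sub>R cis (of_int l * (of_nat n * x $ 1))) = 0"
  shows "(LINT x:cube|lborel. D x * G (of_nat n * x $ 1)) = 0"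
proof -
  let ?L = "LINT x:cube|lborel. \<bar>D x\<bar>"
  have Dabs: "set_integrable lborel cube (\<lambda>x. \<bar>D x\<bar>)" by (rule set_integrable_abs[OF D])
  obtain B where B: "\<bar>G t\<bar> \<le> B" for t
  proof -
    have "compact (G ` {-pi..pi})" by (intro compact_continuous_image continuous_on_subset[OF Gc]) auto
    then have "bounded (G ` {-pi..pi})" by (rule compact_imp_bounded)
    then obtain B where B: "\<forall>y\<in>G ` {-pi..pi}. norm y \<le> B" unfolding bounded_iff by blast
    have "\<bar>G t\<bar> \<le> B" for t
      by (rule periodic_reduce[of "\<lambda>t. \<bar>G t\<bar> \<le> B"]) (use B in \<open>simp_all add: per\<close>)
    then show ?thesis using that by blast
  qed
  have Gm: "(\<lambda>x::real^3. G (of_nat n * x $ 1)) \<in> borel_measurable borel"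
    by (intro borel_measurable_continuous_onI continuous_on_compose2[OF Gc] continuous_intros) auto
  have bound: "cmod (of_real (LINT x:cube|lborel. D x * G (of_nat n * x $ 1))) \<le> e * ?L" if e: "0 < e" for e
  proof -
    obtain P where P: "trig_poly P" "\<And>t. t \<in> {-pi..pi} \<Longrightarrow> cmod (P t - of_real (G t)) < e"
    proof (rule trig_poly_dense[of G e])
      show "continuous_on {-pi..pi} G" by (rule continuous_on_subset[OF Gc]) simp
      show "G (- pi) = G pi" using per[of "-pi"] by simp
    qed (use e in auto)
    have Pall: "cmod (P t - of_real (G t)) < e" for t
      by (rule periodic_reduce[of "\<lambda>t. cmod (P t - of_real (G t)) < e"])
        (use P in \<open>auto simp: per trig_poly_periodic\<close>)
    (* the antiperiodic part of P: even frequencies cancel *)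
    define R where "R t = (P t - P (t + pi)) / 2" for t
    have Rclose: "cmod (of_real (G t) - R t) \<le> e" for t
    proof -
      have "of_real (G t) - R t = (of_real (G t) - P t) / 2 - (of_real (G (t + pi)) - P (t + pi)) / 2"
        unfolding R_def anti by (simp add: field_simps)
      also have "cmod \<dots> \<le> cmod ((of_real (G t) - P t) / 2) + cmod ((of_real (G (t + pi)) - P (t + pi)) / 2)"
        by (rule norm_triangle_ineq4)
      also have "\<dots> \<le> e" using Pall[of t] Pall[of "t + pi"] by (simp add: norm_minus_commute norm_divide)
      finally show ?thesis .
    qed
    have Rm: "(\<lambda>x::real^3. R (of_nat n * x $ 1)) \<in> borel_measurable borel"
    proof -
      have cR: "continuous_on UNIV R" unfolding R_def
        by (intro continuous_intros trig_poly_continuous[OF P(1)] continuous_on_compose2[OF trig_poly_continuous[OF P(1), of UNIV]]) auto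
      show ?thesis
        by (rule borel_measurable_continuous_onI, rule continuous_on_compose2[OF cR], intro continuous_intros, simp)
    qed
    have zero: "(LINT x:cube|lborel. D x *\<^sub>R ((P (of_nat n * x $ 1) - P (of_nat n * x $ 1 + pi)) / 2)) = 0"
      using P(1)
    proof (induction rule: trig_poly.induct)
      case (trig_mono c k)
      have "cis (of_int k * (t + pi)) = (if even k then 1 else -1) * cis (of_int k * t)" for t
      proof -
        have "cis (of_int k * (t + pi)) = cis (of_int k * t) * cis (of_int k * pi)"
          by (simp add: cis_mult algebra_simps)
        then show ?thesis by (simp add: cis_int_pi)
      qed
      then have e': "(c * cis (of_int k * (of_nat n * x $ 1)) - c * cis (of_int k * (of_nat n * x $ 1 + pi))) / 2 =
          (if even k then 0 else c * cis (of_int k * (of_nat n * x $ 1)))" for x :: "real^3"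
        by simp
      show ?case
      proof (cases "even k")
        case False
        have "(LINT x:cube|lborel. D x *\<^sub>R (c * cis (of_int k * (of_nat n * x $ 1)))) =
           c * (LINT x:cube|lborel. D x *\<^sub>R cis (of_int k * (of_nat n * x $ 1)))"
          by (subst set_integral_mult_right[symmetric]) (simp add: scaleR_conv_of_real algebra_simps)
        then show ?thesis unfolding e' using False orth by simp
      qed (simp add: e' set_lebesgue_integral_def)
    next
      case (trig_add P Q)
      have i: "set_integrable lborel cube (\<lambda>x. D x *\<^sub>R ((T (of_nat n * x $ 1) - T (of_nat n * x $ 1 + pi)) / 2))" if T: "trig_poly T" for T
      proof -
        obtain B where B: "\<forall>t. cmod (T t) \<le> B" using trig_poly_bounded[OF T] by blast
        have "cmod ((T a - T b) / 2) \<le> B" for a b :: real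
        proof -
          have "cmod (T a - T b) \<le> B + B" using norm_triangle_ineq4[of "T a" "T b"] B[rule_format, of a] B[rule_format, of b] by linarith
          then show ?thesis by (simp add: norm_divide)
        qed
        moreover have "(\<lambda>x::real^3. (T (of_nat n * x $ 1) - T (of_nat n * x $ 1 + pi)) / 2) \<in> borel_measurable borel"
          by (intro borel_measurable_continuous_onI continuous_intros continuous_on_compose2[OF trig_poly_continuous[OF T, of UNIV]]) auto
        ultimately show ?thesis by (intro set_integrable_mult_bounded[OF D])
      qed
      have eq: "D x *\<^sub>R ((P (of_nat n * x $ 1) + Q (of_nat n * x $ 1) - (P (of_nat n * x $ 1 + pi) + Q (of_nat n * x $ 1 + pi))) / 2) =
         D x *\<^sub>R ((P (of_nat n * x $ 1) - P (of_nat n * x $ 1 + pi)) / 2) + D x *\<^sub>R ((Q (of_nat n * x $ 1) - Q (of_nat n * x $ 1 + pi)) / 2)" for x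
        by (simp add: scaleR_conv_of_real field_simps)
      show ?case unfolding eq using trig_add i by (simp add: set_integral_add)
    qed
    have iR: "set_integrable lborel cube (\<lambda>x. D x *\<^sub>R R (of_nat n * x $ 1))"
    proof (rule set_integrable_mult_bounded[OF D Rm])
      show "cmod (R (of_nat n * x $ 1)) \<le> B + e" for x :: "real^3"
        using Rclose[of "of_nat n * x $ 1"] B[of "of_nat n * x $ 1"]
          norm_triangle_ineq2[of "R (of_nat n * x $ 1)" "of_real (G (of_nat n * x $ 1))"]
        by (simp add: norm_minus_commute)
    qed
    have iG: "set_integrable lborel cube (\<lambda>x. D x *\<^sub>R complex_of_real (G (of_nat n * x $ 1)))"
      by (rule set_integrable_mult_bounded[OF D, of _ B]) (use Gm B in auto)
    have "complex_of_real (LINT x:cube|lborel. D x * G (of_nat n * x $ 1)) = (LINT x:cube|lborel. D x *\<^sub>R complex_of_real (G (of_nat n * x $ 1)))"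
      by (subst set_integral_complex_of_real[symmetric]) (simp add: scaleR_conv_of_real)
    also have "\<dots> = (LINT x:cube|lborel. D x *\<^sub>R complex_of_real (G (of_nat n * x $ 1))) - (LINT x:cube|lborel. D x *\<^sub>R R (of_nat n * x $ 1))"
      using zero by (simp add: R_def)
    also have "\<dots> = (LINT x:cube|lborel. D x *\<^sub>R (complex_of_real (G (of_nat n * x $ 1)) - R (of_nat n * x $ 1)))"
      unfolding scaleR_diff_right by (rule set_integral_diff(2)[OF iG iR, symmetric])
    also have "cmod \<dots> \<le> (LINT x:cube|lborel. e * \<bar>D x\<bar>)"
      unfolding set_lebesgue_integral_def
    proof (rule Bochner_Integration.integral_norm_bound_integral)
      show "integrable lborel (\<lambda>x. indicator cube x *\<^sub>R (D x *\<^sub>R (complex_of_real (G (of_nat n * x $ 1)) - R (of_nat n * x $ 1))))"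
        using set_integral_diff(1)[OF iG iR] by (simp add: set_integrable_def scaleR_diff_right)
      show "integrable lborel (\<lambda>x. indicator cube x *\<^sub>R (e * \<bar>D x\<bar>))"
        using Dabs set_integrable_mult_right[of e lborel cube "\<lambda>x. \<bar>D x\<bar>"] by (simp add: set_integrable_def)
      show "norm (indicator cube x *\<^sub>R (D x *\<^sub>R (complex_of_real (G (of_nat n * x $ 1)) - R (of_nat n * x $ 1)))) \<le> indicator cube x *\<^sub>R (e * \<bar>D x\<bar>)" for x
        using Rclose[of "of_nat n * x $ 1"] by (auto simp: indicator_def mult.commute[of e] intro!: mult_left_mono)
    qed
    also have "\<dots> = e * ?L" by (rule set_integral_mult_right)
    finally show ?thesis .
  qed
  have Lnn: "0 \<le> ?L" unfolding set_lebesgue_integral_def by (rule integral_nonneg_AE) simp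
  have "\<bar>LINT x:cube|lborel. D x * G (of_nat n * x $ 1)\<bar> \<le> 0"
  proof (rule field_le_epsilon)
    fix e :: real assume e: "0 < e"
    have "\<bar>LINT x:cube|lborel. D x * G (of_nat n * x $ 1)\<bar> \<le> e / (?L + 1) * ?L"
      using bound[of "e / (?L + 1)"] e Lnn by simp
    also have "\<dots> \<le> e" using e Lnn by (simp add: field_simps)
    finally show "\<bar>LINT x:cube|lborel. D x * G (of_nat n * x $ 1)\<bar> \<le> 0 + e" by simp
  qed
  then show ?thesis by simp
qed

text \<open>
By linearity in each of the three factors it suffices to consider exponentials, whose product is
some \<open>ek k\<close>.
\<close>

lemma trig_poly_product_orthogonal:
  fixes D :: "real^3 \<Rightarrow> real"
  assumes D: "set_integrable lborel cube D"
    and orth: "\<And>k. (LINT x:cube|lborel. D x *\<^sub>R ek k x) = 0"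
    and P: "trig_poly P" and Q: "trig_poly Q" and R: "trig_poly R"
  shows "(LINT x:cube|lborel. D x *\<^sub>R (P (x $ 1) * Q (x $ 2) * R (x $ 3))) = 0"
proof -
  have int: "set_integrable lborel cube (\<lambda>x. D x *\<^sub>R (P (x $ 1) * Q (x $ 2) * R (x $ 3)))"
    if T: "trig_poly P" "trig_poly Q" "trig_poly R" for P Q R
  proof -
    obtain B1 B2 B3 where B: "\<And>t. cmod (P t) \<le> B1" "\<And>t. cmod (Q t) \<le> B2" "\<And>t. cmod (R t) \<le> B3"
      using T trig_poly_bounded by metis
    then have p: "0 \<le> B1" "0 \<le> B2" "0 \<le> B3" by (meson norm_ge_zero order_trans)+
    have "cmod (P (x $ 1) * Q (x $ 2) * R (x $ 3)) \<le> B1 * B2 * B3" for x :: "real^3"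
      unfolding norm_mult by (intro mult_mono B) (use p in auto)
    moreover have "(\<lambda>x::real^3. P (x $ 1) * Q (x $ 2) * R (x $ 3)) \<in> borel_measurable borel"
      using trig_coord_measurable[OF T(1), of 1 1] trig_coord_measurable[OF T(2), of 1 2] trig_coord_measurable[OF T(3), of 1 3]
      by simp
    ultimately show ?thesis by (intro set_integrable_mult_bounded[OF D])
  qed
  show ?thesis
    using P
  proof (induction rule: trig_poly.induct)
    case P: (trig_mono c1 k1)
    show ?case
      using Q
    proof (induction rule: trig_poly.induct)
      case Q: (trig_mono c2 k2)
      show ?case
        using R
      proof (induction rule: trig_poly.induct)
        case R: (trig_mono c3 k3)
        define k where "k = (vector [- k1, - k2, - k3] :: int^3)"
        have fx: "freq k \<bullet> x = - (of_int k1 * x $ 1 + of_int k2 * x $ 2 + of_int k3 * x $ 3)" for x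
          unfolding inner_vec_def sum_3 k_def freq_def by (simp add: algebra_simps)
        have "ek k x = cis (of_int k1 * x $ 1 + of_int k2 * x $ 2 + of_int k3 * x $ 3)" for x
          unfolding ek_def fx cis_conv_exp by (simp only: of_real_minus mult_minus_right minus_minus)
        then have e: "ek k x = cis (of_int k1 * x $ 1) * cis (of_int k2 * x $ 2) * cis (of_int k3 * x $ 3)" for x
          by (simp only: cis_mult)
        have "D x *\<^sub>R (c1 * cis (of_int k1 * x $ 1) * (c2 * cis (of_int k2 * x $ 2)) * (c3 * cis (of_int k3 * x $ 3))) =
            (c1 * c2 * c3) * (D x *\<^sub>R ek k x)" for x
          unfolding e scaleR_conv_of_real by (simp only: mult_ac)
        then have "(LINT x:cube|lborel. D x *\<^sub>R (c1 * cis (of_int k1 * x $ 1) * (c2 * cis (of_int k2 * x $ 2)) * (c3 * cis (of_int k3 * x $ 3))))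
          = (c1 * c2 * c3) * (LINT x:cube|lborel. D x *\<^sub>R ek k x)"
          by (simp only: set_integral_mult_right)
        then show ?case by (simp only: orth mult_zero_right)
      next
        case (trig_add R1 R2)
        then show ?case
          using int[OF trig_poly.trig_mono trig_poly.trig_mono trig_add.hyps(1)] int[OF trig_poly.trig_mono trig_poly.trig_mono trig_add.hyps(2)]
          by (simp add: distrib_left scaleR_add_right set_integral_add)
      qed
    next
      case (trig_add Q1 Q2)
      then show ?case
        using int[OF trig_poly.trig_mono trig_add.hyps(1) R] int[OF trig_poly.trig_mono trig_add.hyps(2) R]
        by (simp add: distrib_left distrib_right scaleR_add_right set_integral_add)
    qed
  next
    case (trig_add P1 P2)
    then show ?case
      using int[OF trig_add.hyps(1) Q R] int[OF trig_add.hyps(2) Q R]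
      by (simp add: distrib_left distrib_right scaleR_add_right set_integral_add)
  qed
qed

text \<open>
Trapezoidal functions that increase to the indicator of the open interval vanish at the end points of
the period, so they are approximated uniformly by trigonometric polynomials.
\<close>

lemma trig_poly_indicator_approx:
  assumes "- pi \<le> a" "b \<le> pi"
  obtains P where "\<And>n::nat. trig_poly (P n)" "\<And>n t. t \<in> {-pi..pi} \<Longrightarrow> cmod (P n t) \<le> 2"
    "\<And>t. t \<in> {-pi..pi} \<Longrightarrow> (\<lambda>n. P n t) \<longlonglongrightarrow> indicator {a<..<b} t"
proof -
  (* a trapezoid that is 0 outside of the interval and 1 at distance at least 1 / n from its ends *)
  define g where "g n t = max 0 (min 1 (real n * min (t - a) (b - t)))" for n t
  have gz: "g n t = 0" if "min (t - a) (b - t) \<le> 0" for n t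
  proof -
    have "real n * min (t - a) (b - t) \<le> 0" by (rule mult_nonneg_nonpos) (use that in auto)
    then show ?thesis unfolding g_def by linarith
  qed
  have "\<exists>P. trig_poly P \<and> (\<forall>t\<in>{-pi..pi}. cmod (P t - of_real (g n t)) < 1 / Suc n)" for n
  proof -
    have c: "continuous_on {-pi..pi} (g n)" unfolding g_def by (intro continuous_intros)
    have z: "g n (-pi) = 0" "g n pi = 0"
      by (rule gz, use assms in linarith)+
    obtain P where "trig_poly P" "\<And>t. t \<in> {-pi..pi} \<Longrightarrow> cmod (P t - of_real (g n t)) < 1 / Suc n"
      by (rule trig_poly_dense[OF c, of "1 / Suc n"]) (use z in auto)
    then show ?thesis by blast
  qed
  then obtain P where P: "\<And>n. trig_poly (P n)" "\<And>n t. t \<in> {-pi..pi} \<Longrightarrow> cmod (P n t - of_real (g n t)) < 1 / Suc n"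
    by metis
  have "cmod (P n t) \<le> 2" if "t \<in> {-pi..pi}" for n t
  proof -
    have "cmod (P n t) \<le> cmod (P n t - of_real (g n t)) + cmod (of_real (g n t))"
      using norm_triangle_ineq[of "P n t - of_real (g n t)" "of_real (g n t)"] by simp
    also have "\<dots> \<le> 1 / Suc n + 1"
      by (intro add_mono less_imp_le[OF P(2)[OF that, of n]]) (simp add: g_def)
    also have "\<dots> \<le> 2" by simp
    finally show ?thesis .
  qed
  moreover have "(\<lambda>n. P n t) \<longlonglongrightarrow> indicator {a<..<b} t" if t: "t \<in> {-pi..pi}" for t
  proof -
    have "(\<lambda>n. g n t) \<longlonglongrightarrow> indicator {a<..<b} t"
    proof (cases "t \<in> {a<..<b}")
      case True
      let ?d = "min (t - a) (b - t)"
      have d: "0 < ?d" using True by auto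
      have "eventually (\<lambda>n. g n t = 1) sequentially"
        using eventually_ge_at_top[of "nat \<lceil>1 / ?d\<rceil>"]
      proof eventually_elim
        case (elim n)
        then have "1 / ?d \<le> real n" by linarith
        then have "1 \<le> real n * ?d" using d by (simp add: field_simps)
        then show ?case by (simp add: g_def)
      qed
      then have "(\<lambda>n. g n t) \<longlonglongrightarrow> 1" by (rule tendsto_eventually)
      then show ?thesis using True by simp
    next
      case False
      then have "min (t - a) (b - t) \<le> 0" by auto
      then have "g n t = 0" for n by (rule gz)
      then show ?thesis using False by simp
    qed
    then have "(\<lambda>n. complex_of_real (g n t)) \<longlonglongrightarrow> of_real (indicator {a<..<b} t)" by (rule tendsto_of_real)
    moreover have "(\<lambda>n. P n t - of_real (g n t)) \<longlonglongrightarrow> 0"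
      by (rule Lim_null_comparison[OF _ LIMSEQ_inverse_real_of_nat])
        (use P(2)[OF t] in \<open>auto intro!: always_eventually simp: inverse_eq_divide less_imp_le\<close>)
    ultimately have "(\<lambda>n. (P n t - of_real (g n t)) + of_real (g n t)) \<longlonglongrightarrow> 0 + of_real (indicator {a<..<b} t)"
      by (intro tendsto_add)
    then show ?thesis by (cases "t \<in> {a<..<b}") simp_all
  qed
  ultimately show ?thesis using P(1) that by blast
qed

lemma box_integral_zero:
  fixes D :: "real^3 \<Rightarrow> real"
  assumes D: "set_integrable lborel cube D"
    and orth: "\<And>k. (LINT x:cube|lborel. D x *\<^sub>R ek k x) = 0"
    and ab: "\<And>i. - pi \<le> a $ i" "\<And>i. b $ i \<le> pi"
  shows "(LINT x:box a b|lborel. D x) = 0"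
proof -
  have "\<exists>P. (\<forall>n::nat. trig_poly (P n)) \<and> (\<forall>n. \<forall>t\<in>{-pi..pi}. cmod (P n t) \<le> 2) \<and>
      (\<forall>t\<in>{-pi..pi}. (\<lambda>n. P n t) \<longlonglongrightarrow> indicator {a $ i<..<b $ i} t)" for i
    using trig_poly_indicator_approx[OF ab(1)[of i] ab(2)[of i]] by metis
  then obtain P where P: "\<And>i n. trig_poly (P i n)" "\<And>i n t. t \<in> {-pi..pi} \<Longrightarrow> cmod (P i n t) \<le> 2"
    "\<And>i t. t \<in> {-pi..pi} \<Longrightarrow> (\<lambda>n. P i n t) \<longlonglongrightarrow> indicator {a $ i<..<b $ i} t"
    by metis
  (* products of one-dimensional approximations approximate the indicator of the box *)
  define F :: "nat \<Rightarrow> real^3 \<Rightarrow> complex" where "F n x = P 1 n (x $ 1) * P 2 n (x $ 2) * P 3 n (x $ 3)" for n x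
  have Fm: "F n \<in> borel_measurable borel" for n
    unfolding F_def
    using trig_coord_measurable[OF P(1)[of 1 n], of 1 1] trig_coord_measurable[OF P(1)[of 2 n], of 1 2]
      trig_coord_measurable[OF P(1)[of 3 n], of 1 3]
    by simp
  have Di: "integrable lborel (\<lambda>x. indicator cube x *\<^sub>R D x)" using D by (simp add: set_integrable_def)
  have incube: "x $ i \<in> {-pi..pi}" if "x \<in> cube" for x i
    using that by (auto simp: cube_def less_imp_le)
  have indbox: "indicator {a $ 1<..<b $ 1} (x $ 1) * indicator {a $ 2<..<b $ 2} (x $ 2) * indicator {a $ 3<..<b $ 3} (x $ 3)
      = (indicator (box a b) x :: complex)" for x
    by (auto simp: indicator_def mem_box_cart forall_3)
  have "(\<lambda>n. LINT x|lborel. indicator cube x *\<^sub>R (D x *\<^sub>R F n x)) \<longlonglongrightarrow> (LINT x|lborel. indicator cube x *\<^sub>R (D x *\<^sub>R (indicator (box a b) x :: complex)))"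
  proof (rule integral_dominated_convergence[where w="\<lambda>x. 8 * norm (indicator cube x *\<^sub>R D x)"])
    show "(\<lambda>x. indicator cube x *\<^sub>R (D x *\<^sub>R (indicator (box a b) x :: complex))) \<in> borel_measurable lborel"
    proof -
      have "(\<lambda>x. (indicator cube x *\<^sub>R D x) *\<^sub>R (indicator (box a b) x :: complex)) \<in> borel_measurable lborel"
        by (intro borel_measurable_scaleR borel_measurable_integrable[OF Di] borel_measurable_indicator) simp
      then show ?thesis by simp
    qed
    show "(\<lambda>x. indicator cube x *\<^sub>R (D x *\<^sub>R F n x)) \<in> borel_measurable lborel" for n
    proof -
      have "(\<lambda>x. (indicator cube x *\<^sub>R D x) *\<^sub>R F n x) \<in> borel_measurable lborel"
        using Fm[of n] by (intro borel_measurable_scaleR borel_measurable_integrable[OF Di]) simp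
      then show ?thesis by simp
    qed
    show "integrable lborel (\<lambda>x. 8 * norm (indicator cube x *\<^sub>R D x))" using Di by simp
    show "AE x in lborel. (\<lambda>n. indicator cube x *\<^sub>R (D x *\<^sub>R F n x)) \<longlonglongrightarrow> indicator cube x *\<^sub>R (D x *\<^sub>R (indicator (box a b) x :: complex))"
    proof (rule AE_I2)
      fix x :: "real^3"
      show "(\<lambda>n. indicator cube x *\<^sub>R (D x *\<^sub>R F n x)) \<longlonglongrightarrow> indicator cube x *\<^sub>R (D x *\<^sub>R (indicator (box a b) x :: complex))"
      proof (cases "x \<in> cube")
        case True
        show ?thesis unfolding F_def indbox[symmetric]
          by (intro tendsto_intros P(3) incube True)
      qed simp
    qed
    show "AE x in lborel. norm (indicator cube x *\<^sub>R (D x *\<^sub>R F n x)) \<le> 8 * norm (indicator cube x *\<^sub>R D x)" for n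
    proof (rule AE_I2)
      fix x :: "real^3"
      show "norm (indicator cube x *\<^sub>R (D x *\<^sub>R F n x)) \<le> 8 * norm (indicator cube x *\<^sub>R D x)"
      proof (cases "x \<in> cube")
        case True
        have "cmod (F n x) \<le> 2 * 2 * 2"
          unfolding F_def norm_mult by (intro mult_mono P(2) incube True) auto
        then show ?thesis using True mult_left_mono[of "cmod (F n x)" 8 "\<bar>D x\<bar>"] by (simp add: mult.commute)
      qed simp
    qed
  qed
  moreover have "(LINT x|lborel. indicator cube x *\<^sub>R (D x *\<^sub>R F n x)) = 0" for n
    using trig_poly_product_orthogonal[OF D orth P(1) P(1) P(1), of 1 n 2 n 3 n]
    unfolding F_def set_lebesgue_integral_def .
  ultimately have "(LINT x|lborel. indicator cube x *\<^sub>R (D x *\<^sub>R (indicator (box a b) x :: complex))) = 0"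
    by (simp add: LIMSEQ_const_iff)
  moreover have "indicator cube x *\<^sub>R (D x *\<^sub>R (indicator (box a b) x :: complex)) = of_real (indicator (box a b) x *\<^sub>R D x)" for x
  proof -
    have "box a b \<subseteq> cube"
    proof
      fix x assume "x \<in> box a b"
      then have "a $ i < x $ i" "x $ i < b $ i" for i by (auto simp: mem_box_cart)
      then have "- pi < x $ i" "x $ i < pi" for i
        using le_less_trans[OF ab(1)[of i]] less_le_trans[OF _ ab(2)[of i]] by blast+
      then show "x \<in> cube" by (simp add: cube_def)
    qed
    then show ?thesis by (auto simp: indicator_def scaleR_conv_of_real)
  qed
  ultimately have "complex_of_real (LINT x|lborel. indicator (box a b) x *\<^sub>R D x) = 0"
    by (simp only: integral_complex_of_real)
  then show ?thesis unfolding set_lebesgue_integral_def by simp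
qed

text \<open>
Boxes form an intersection-stable generator of the Borel sets, so by Dynkin's argument the integral
over every Borel set vanishes.
\<close>

lemma AE_zero_of_box_integrals:
  fixes D :: "'a::euclidean_space \<Rightarrow> real"
  assumes D: "integrable lborel D"
    and box: "\<And>a b. (LINT x:box a b|lborel. D x) = 0" and all: "(LINT x|lborel. D x) = 0"
  shows "AE x in lborel. D x = 0"
proof -
  have int: "set_integrable lborel A D" if "A \<in> sets lborel" for A
    unfolding set_integrable_def using integrable_mult_indicator[OF that D] .
  have "(LINT x:A|lborel. D x) = 0" if "A \<in> sets lborel" for A
  proof -
    have st: "Int_stable (range (\<lambda>(a, b). box a b :: 'a set))"
    proof (rule Int_stableI)
      fix A B assume "A \<in> range (\<lambda>(a, b). box a b :: 'a set)" "B \<in> range (\<lambda>(a, b). box a b :: 'a set)"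
      then obtain a b c d where "A = box a b" "B = box c d" by auto
      then have "A \<inter> B = (\<lambda>(a, b). box a b)
          (\<Sum>i\<in>Basis. max (a \<bullet> i) (c \<bullet> i) *\<^sub>R i, \<Sum>i\<in>Basis. min (b \<bullet> i) (d \<bullet> i) *\<^sub>R i)"
        by (simp add: box_Int_box)
      then show "A \<inter> B \<in> range (\<lambda>(a, b). box a b :: 'a set)" by (rule range_eqI)
    qed
    have "A \<in> sigma_sets UNIV (range (\<lambda>(a, b). box a b :: 'a set))"
      using that by (simp add: borel_eq_box)
    have GP: "range (\<lambda>(a, b). box a b :: 'a set) \<subseteq> Pow UNIV" by simp
    from st GP \<open>A \<in> sigma_sets UNIV (range (\<lambda>(a, b). box a b :: 'a set))\<close> show ?thesis
    proof (induction rule: sigma_sets_induct_disjoint)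
      case (basic A)
      then show ?case using box by auto
    next
      case empty
      then show ?case by (simp add: set_lebesgue_integral_def)
    next
      case (compl A)
      then have A: "A \<in> sets lborel" by (simp add: borel_eq_box)
      have "(LINT x:UNIV|lborel. D x) = (LINT x:A|lborel. D x) + (LINT x:UNIV - A|lborel. D x)"
        using set_integral_Un[of A "UNIV - A" lborel D] int[OF A] int[of "UNIV - A"] A by (simp add: Un_absorb1)
      then show ?case using compl all by (simp add: set_lebesgue_integral_def)
    next
      case (union A)
      then have A: "A i \<in> sets lborel" for i by (auto simp: borel_eq_box)
      then have UA: "(\<Union>i. A i) \<in> sets lborel" by auto
      have "(LINT x:(\<Union>i. A i)|lborel. D x) = (\<Sum>i. (LINT x:(A i)|lborel. D x))"
        by (rule lebesgue_integral_countable_add[OF _ _ int[OF UA]])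
          (use A union in \<open>auto simp: disjoint_family_on_def\<close>)
      then show ?case using union by simp
    qed
  qed
  then have "AE x in lborel. D x = (\<lambda>x. 0) x"
    by (intro density_unique_real[OF D]) (auto simp: set_lebesgue_integral_def)
  then show ?thesis by simp
qed

lemma fourier_coeff_unique:
  assumes u: "set_integrable lborel cube u" and z: "\<And>k. fourier_coeff u k = 0"
  shows "AE x\<in>cube in lborel. u x = 0"
proof -
  have orth: "(LINT x:cube|lborel. u x *\<^sub>R ek k x) = 0" for k
    using z[of k] unfolding fourier_coeff_ek by (simp add: scaleR_conv_of_real)
  define D where "D x = indicator cube x *\<^sub>R u x" for x
  have Di: "integrable lborel D" using u by (simp add: D_def[abs_def] set_integrable_def)
  have inter: "\<exists>a' b'. box a b \<inter> cube = box a' b' \<and> (\<forall>i. - pi \<le> a' $ i \<and> b' $ i \<le> pi)" for a b :: "real^3"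
  proof (intro exI conjI)
    show "box a b \<inter> cube = box (\<chi> i. max (a $ i) (-pi)) (\<chi> i. min (b $ i) pi)"
      by (auto simp: cube_def mem_box_cart)
  qed auto
  have "AE x in lborel. D x = 0"
  proof (rule AE_zero_of_box_integrals[OF Di])
    fix a b :: "real^3"
    from inter[of a b] obtain a' b' where ab: "box a b \<inter> cube = box a' b' \<and> (\<forall>i. - pi \<le> a' $ i \<and> b' $ i \<le> pi)"
      by (elim exE)
    have *: "box a b \<inter> cube = box a' b'" "\<And>i. - pi \<le> a' $ i" "\<And>i. b' $ i \<le> pi"
      using ab by simp_all
    have "indicator (box a b) x *\<^sub>R D x = indicator (box a' b') x *\<^sub>R u x" for x
      unfolding D_def *(1)[symmetric] by (simp add: indicator_def)
    then show "(LINT x:box a b|lborel. D x) = 0"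
      using box_integral_zero[OF u orth *(2,3)] by (simp add: set_lebesgue_integral_def)
  next
    have "(LINT x:box (\<chi> i. - pi) (\<chi> i. pi)|lborel. u x) = 0"
      by (rule box_integral_zero[OF u orth]) auto
    then show "(LINT x|lborel. D x) = 0" unfolding D_def set_lebesgue_integral_def cube_eq .
  qed
  then show ?thesis by eventually_elim (auto simp: D_def)
qed

section \<open>Traces\<close>

lemma smooth_periodic_continuous:
  assumes "W \<in> smooth_periodic s"
  shows "continuous_on half_space (fst W)"
proof -
  obtain U G where W: "W = (U, G)" by (cases W)
  have "Ck_on 0 half_space U"
    using assms unfolding W by (auto simp: smooth_periodic_def half_space_def smooth_on_def simp del: Ck_on.simps)
  then show ?thesis by (simp add: W)
qed

lemma trace_continuous:
  assumes "W \<in> smooth_periodic s"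
  shows "continuous_on A (\<lambda>x. fst W (x, 0))"
  by (rule half_space_slice_continuous[OF smooth_periodic_continuous[OF assms]]) simp

lemma trace_integrable: "W \<in> smooth_periodic s \<Longrightarrow> set_integrable lborel cube (\<lambda>x. fst W (x, 0))"
  by (intro continuous_cube_integrable trace_continuous)

lemma fourier_coeff_trace_comb:
  assumes "W \<in> smooth_periodic s" "V \<in> smooth_periodic s"
  shows "fourier_coeff (\<lambda>x. fst (fg_comb W t V) (x, 0)) k =
    fourier_coeff (\<lambda>x. fst W (x, 0)) k + of_real t * fourier_coeff (\<lambda>x. fst V (x, 0)) k"
  unfolding fg_comb_def fst_conv by (rule fourier_coeff_comb[OF trace_integrable[OF assms(1)] trace_integrable[OF assms(2)]])

lemma Hs_term_nonneg: "0 \<le> Hs_term s m u k" by (simp add: Hs_term_def)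

lemma Sobolev_trace:
  assumes W: "W \<in> smooth_periodic s" and s: "1/2 \<le> s" "s < 1" and m: "0 < m"
  shows "finite F \<Longrightarrow> (\<Sum>k\<in>F. Hs_term s m (\<lambda>x. fst W (x, 0)) k) \<le> 2 * kappa s * (X_norm s m W)\<^sup>2"
    and "m powr (2 * s) * (LINT x:cube|lborel. (fst W (x, 0))\<^sup>2) \<le> 2 * kappa s * (X_norm s m W)\<^sup>2"
  using Sobolev_trace_bound[of "fst W" "snd W" s m] assms by auto

lemma fourier_coeff_le_Hs_term:
  assumes m: "0 < m" and s: "0 < s"
  shows "m powr (2 * s) * (cmod (fourier_coeff u k))\<^sup>2 \<le> Hs_term s m u k"
proof -
  have "m powr (2 * s) = (m\<^sup>2) powr s" using m by (simp add: powr_powr flip: powr_numeral)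
  also have "\<dots> \<le> ((norm (freq k))\<^sup>2 + m\<^sup>2) powr s" using s m by (intro powr_mono2) auto
  finally show ?thesis unfolding Hs_term_def by (intro mult_right_mono) auto
qed

lemma sq_integrable_cube:
  fixes w :: "real^3 \<Rightarrow> real"
  assumes "set_borel_measurable lborel cube w" "set_integrable lborel cube (\<lambda>x. (w x)\<^sup>2)"
  shows "sq_integrable lborel (\<lambda>x. indicator cube x *\<^sub>R w x)"
proof -
  have "(norm (indicator cube x *\<^sub>R w x))\<^sup>2 = indicator cube x *\<^sub>R (w x)\<^sup>2" for x by (simp add: indicator_def)
  then show ?thesis unfolding sq_integrable_def
    using assms by (simp only: set_borel_measurable_def set_integrable_def simp_thms)
qed

lemma set_integrable_cube_sq_diff:
  fixes u v :: "real^3 \<Rightarrow> real"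
  assumes "set_borel_measurable lborel cube u" "set_integrable lborel cube (\<lambda>x. (u x)\<^sup>2)"
    and "set_borel_measurable lborel cube v" "set_integrable lborel cube (\<lambda>x. (v x)\<^sup>2)"
  shows "set_borel_measurable lborel cube (\<lambda>x. u x - v x)"
    and "set_integrable lborel cube (\<lambda>x. (u x - v x)\<^sup>2)"
proof -
  have "sq_integrable lborel (\<lambda>x. indicator cube x *\<^sub>R u x + (-1) *\<^sub>R (indicator cube x *\<^sub>R v x))"
    using assms by (intro sq_integrable_add_scaled sq_integrable_cube)
  also have "(\<lambda>x. indicator cube x *\<^sub>R u x + (-1) *\<^sub>R (indicator cube x *\<^sub>R v x)) = (\<lambda>x. indicator cube x *\<^sub>R (u x - v x))"
    by (auto simp: algebra_simps)
  finally have *: "sq_integrable lborel (\<lambda>x. indicator cube x *\<^sub>R (u x - v x))" .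
  then show "set_borel_measurable lborel cube (\<lambda>x. u x - v x)"
    by (simp add: sq_integrable_def set_borel_measurable_def)
  have "integrable lborel (\<lambda>x. (norm (indicator cube x *\<^sub>R (u x - v x)))\<^sup>2)" using * by (simp add: sq_integrable_def)
  also have "(\<lambda>x. (norm (indicator cube x *\<^sub>R (u x - v x)))\<^sup>2) = (\<lambda>x. indicator cube x *\<^sub>R (u x - v x)\<^sup>2)"
    by (auto simp: indicator_def)
  finally show "set_integrable lborel cube (\<lambda>x. (u x - v x)\<^sup>2)" by (simp add: set_integrable_def)
qed

lemma fourier_coeff_diff:
  assumes "set_integrable lborel cube u" "set_integrable lborel cube v"
  shows "fourier_coeff (\<lambda>x. u x - v x) k = fourier_coeff u k - fourier_coeff v k"
  using fourier_coeff_comb[OF assms, of "-1"] by simp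

lemma fourier_coeff_L2_limit:
  fixes u :: "real^3 \<Rightarrow> real"
  assumes f: "\<And>n. set_borel_measurable lborel cube (f n)" "\<And>n. set_integrable lborel cube (\<lambda>x. (f n x)\<^sup>2)"
    and u: "set_borel_measurable lborel cube u" "set_integrable lborel cube (\<lambda>x. (u x)\<^sup>2)"
    and lim: "(\<lambda>n. LINT x:cube|lborel. (f n x - u x)\<^sup>2) \<longlonglongrightarrow> 0"
  shows "(\<lambda>n. fourier_coeff (f n) k) \<longlonglongrightarrow> fourier_coeff u k"
proof -
  have "(\<lambda>n. (cmod (fourier_coeff (f n) k - fourier_coeff u k))\<^sup>2) \<longlonglongrightarrow> 0"
  proof (rule Lim_null_comparison[OF _ lim], intro always_eventually allI)
    fix n
    have "(\<Sum>k\<in>{k}. (cmod (fourier_coeff (\<lambda>x. f n x - u x) k))\<^sup>2) \<le> (LINT x:cube|lborel. (f n x - u x)\<^sup>2)"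
      using set_integrable_cube_sq_diff[OF f u] by (intro Bessel_inequality) auto
    then show "norm ((cmod (fourier_coeff (f n) k - fourier_coeff u k))\<^sup>2) \<le> (LINT x:cube|lborel. (f n x - u x)\<^sup>2)"
      using fourier_coeff_diff[OF cube_L2_L1[OF f] cube_L2_L1[OF u]] by simp
  qed
  then have "(\<lambda>n. sqrt ((cmod (fourier_coeff (f n) k - fourier_coeff u k))\<^sup>2)) \<longlonglongrightarrow> sqrt 0" by (rule tendsto_real_sqrt)
  then have "(\<lambda>n. fourier_coeff (f n) k - fourier_coeff u k) \<longlonglongrightarrow> 0" by (simp add: tendsto_norm_zero_iff)
  then show ?thesis by (simp add: LIM_zero_iff)
qed

text \<open>
The trace inequality makes the traces of the approximating functions a Cauchy sequence in \<open>L\<^sup>2\<close> of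
the cube. Their limit \<open>g\<close> lies in \<^const>\<open>Hs_space\<close> and is approached in its norm, because the bounds on finite
partial sums of the series survive the limit in each coefficient.
\<close>

lemma trace_exists:
  assumes s: "1/2 \<le> s" "s < 1" and m: "0 < m"
    and \<Phi>: "\<And>n. \<Phi> n \<in> smooth_periodic s" and W: "W \<in> weighted_L2 s"
    and lim: "(\<lambda>n. X_norm s m (fg_diff (\<Phi> n) W)) \<longlonglongrightarrow> 0"
  obtains u where "has_trace s m W u" "(\<lambda>n. LINT x:cube|lborel. (fst (\<Phi> n) (x, 0) - u x)\<^sup>2) \<longlonglongrightarrow> 0"
    "\<And>k. (\<lambda>n. fourier_coeff (\<lambda>x. fst (\<Phi> n) (x, 0)) k) \<longlonglongrightarrow> fourier_coeff u k"
proof -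
  have s0: "0 < s" using s by simp
  note k = kappa_pos[OF s0 s(2)]
  define \<phi> where "\<phi> n x = fst (\<Phi> n) (x, 0)" for n x
  define \<delta> where "\<delta> n = X_norm s m (fg_diff (\<Phi> n) W)" for n
  have \<delta>0: "0 \<le> \<delta> n" for n unfolding \<delta>_def by (rule X_norm_nonneg[OF s0 s(2)])
  have \<Phi>L: "\<Phi> n \<in> weighted_L2 s" for n by (rule smooth_periodic_weighted_L2[OF \<Phi>])
  have \<Phi>d: "fg_diff (\<Phi> i) (\<Phi> j) \<in> smooth_periodic s" for i j
    unfolding fg_diff_comb by (rule smooth_periodic_comb[OF m \<Phi> \<Phi>])
  have tri: "X_norm s m (fg_diff (\<Phi> i) (\<Phi> j)) \<le> \<delta> i + \<delta> j" for i j
  proof -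
    have "fg_diff (\<Phi> i) (\<Phi> j) = fg_comb (fg_diff (\<Phi> i) W) (-1) (fg_diff (\<Phi> j) W)"
      unfolding fg_diff_comb by (simp add: fg_comb_def)
    then show ?thesis
      using X_norm_triangle[OF s0 s(2) m, of "fg_diff (\<Phi> i) W" "fg_diff (\<Phi> j) W" "-1"]
        weighted_L2_comb[OF m \<Phi>L W, of _ "-1"] by (simp add: \<delta>_def fg_diff_comb)
  qed
  have \<phi>c: "continuous_on A (\<phi> n)" for A n unfolding \<phi>_def by (rule trace_continuous[OF \<Phi>])
  have \<phi>d: "(\<lambda>x. fst (fg_diff (\<Phi> i) (\<Phi> j)) (x, 0)) = (\<lambda>x. \<phi> i x - \<phi> j x)" for i j
    unfolding fg_diff_comb by (simp add: fg_comb_def \<phi>_def)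
  have L2: "m powr (2 * s) * (LINT x:cube|lborel. (\<phi> i x - \<phi> j x)\<^sup>2) \<le> 2 * kappa s * (\<delta> i + \<delta> j)\<^sup>2" for i j
  proof -
    have "m powr (2 * s) * (LINT x:cube|lborel. (\<phi> i x - \<phi> j x)\<^sup>2) \<le> 2 * kappa s * (X_norm s m (fg_diff (\<Phi> i) (\<Phi> j)))\<^sup>2"
      using Sobolev_trace(2)[OF \<Phi>d s m, of i j] fun_cong[OF \<phi>d[of i j]] by simp
    also have "\<dots> \<le> 2 * kappa s * (\<delta> i + \<delta> j)\<^sup>2"
      using tri X_norm_nonneg[OF s0 s(2)] k by (intro mult_left_mono power_mono) auto
    finally show ?thesis .
  qed
  have Hsd: "(\<Sum>k\<in>F. Hs_term s m (\<lambda>x. \<phi> i x - \<phi> j x) k) \<le> 2 * kappa s * (\<delta> i + \<delta> j)\<^sup>2" if "finite F" for F i j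
  proof -
    have "(\<Sum>k\<in>F. Hs_term s m (\<lambda>x. \<phi> i x - \<phi> j x) k) \<le> 2 * kappa s * (X_norm s m (fg_diff (\<Phi> i) (\<Phi> j)))\<^sup>2"
      using Sobolev_trace(1)[OF \<Phi>d s m that, of i j] unfolding \<phi>d .
    also have "\<dots> \<le> 2 * kappa s * (\<delta> i + \<delta> j)\<^sup>2"
      using tri X_norm_nonneg[OF s0 s(2)] k by (intro mult_left_mono power_mono) auto
    finally show ?thesis .
  qed
  define f where "f n x = indicator cube x *\<^sub>R \<phi> n x" for n x
  have \<phi>m: "set_borel_measurable lborel cube (\<phi> n)" for n by (rule continuous_set_borel_measurable_cube[OF \<phi>c])
  have \<phi>i: "set_integrable lborel cube (\<lambda>x. (\<phi> n x)\<^sup>2)" for n by (intro continuous_cube_integrable continuous_intros \<phi>c)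
  have fsq: "sq_integrable lborel (f n)" for n
    unfolding f_def[abs_def] by (rule sq_integrable_cube[OF \<phi>m \<phi>i])
  have fd: "(\<integral>x. (norm (f i x - f j x))\<^sup>2 \<partial>lborel) = (LINT x:cube|lborel. (\<phi> i x - \<phi> j x)\<^sup>2)" for i j
    unfolding set_lebesgue_integral_def by (rule Bochner_Integration.integral_cong) (auto simp: f_def indicator_def)
  have mp: "0 < m powr (2 * s)" using m by simp
  obtain g where g: "sq_integrable lborel g" "(\<lambda>n. \<integral>x. (norm (f n x - g x))\<^sup>2 \<partial>lborel) \<longlonglongrightarrow> 0"
  proof (rule sq_integrable_complete[OF fsq])
    fix e :: real assume e: "e > 0"
    define C where "C = 8 * kappa s / m powr (2 * s)"
    have C: "0 < C" using k mp by (simp add: C_def)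
    have "eventually (\<lambda>n. \<delta> n < sqrt (e / C)) sequentially"
      using order_tendstoD(2)[OF lim[folded \<delta>_def], of "sqrt (e / C)"] e C by simp
    then obtain N where N: "\<And>n. n \<ge> N \<Longrightarrow> \<delta> n < sqrt (e / C)" unfolding eventually_sequentially by blast
    have "(\<integral>x. (norm (f i x - f j x))\<^sup>2 \<partial>lborel) < e" if "i \<ge> N" "j \<ge> N" for i j
    proof -
      have "\<delta> i + \<delta> j < 2 * sqrt (e / C)" using N[OF that(1)] N[OF that(2)] by simp
      then have "(\<delta> i + \<delta> j)\<^sup>2 < (2 * sqrt (e / C))\<^sup>2" using \<delta>0[of i] \<delta>0[of j] by (intro power_strict_mono) auto
      also have "\<dots> = 4 * (e / C)" using e C by (simp add: power_mult_distrib)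
      finally have "2 * kappa s * (\<delta> i + \<delta> j)\<^sup>2 < 2 * kappa s * (4 * (e / C))" using k by (intro mult_strict_left_mono) auto
      also have "\<dots> = m powr (2 * s) * e" using k mp by (simp add: C_def field_simps)
      finally have "m powr (2 * s) * (LINT x:cube|lborel. (\<phi> i x - \<phi> j x)\<^sup>2) < m powr (2 * s) * e" using L2[of i j] by linarith
      then show ?thesis unfolding fd using mp by simp
    qed
    then show "\<exists>N. \<forall>i\<ge>N. \<forall>j\<ge>N. (\<integral>x. (norm (f i x - f j x))\<^sup>2 \<partial>lborel) < e" by blast
  qed (rule that)
  have gm: "g \<in> borel_measurable lborel" and gi: "integrable lborel (\<lambda>x. (g x)\<^sup>2)"
    using g(1) by (auto simp: sq_integrable_def)
  have um: "set_borel_measurable lborel cube g"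
    unfolding set_borel_measurable_def using gm by simp
  have ui: "set_integrable lborel cube (\<lambda>x. (g x)\<^sup>2)"
    unfolding set_integrable_def by (rule integrable_mult_indicator[OF _ gi]) simp
  have L2lim: "(\<lambda>n. LINT x:cube|lborel. (\<phi> n x - g x)\<^sup>2) \<longlonglongrightarrow> 0"
  proof (rule Lim_null_comparison[OF _ g(2)], intro always_eventually allI)
    fix n
    have i2: "integrable lborel (\<lambda>x. (norm (f n x - g x))\<^sup>2)"
      using sq_integrable_add_scaled[OF fsq[of n] g(1), of "-1"] by (simp add: sq_integrable_def)
    have "(LINT x:cube|lborel. (\<phi> n x - g x)\<^sup>2) \<le> (\<integral>x. (norm (f n x - g x))\<^sup>2 \<partial>lborel)"
      unfolding set_lebesgue_integral_def
      by (rule integral_mono) (use set_integrable_cube_sq_diff(2)[OF \<phi>m \<phi>i um ui, of n] i2 in \<open>auto simp: set_integrable_def f_def indicator_def\<close>)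
    moreover have "0 \<le> (LINT x:cube|lborel. (\<phi> n x - g x)\<^sup>2)"
      unfolding set_lebesgue_integral_def by (rule integral_nonneg_AE) simp
    ultimately show "norm (LINT x:cube|lborel. (\<phi> n x - g x)\<^sup>2) \<le> (\<integral>x. (norm (f n x - g x))\<^sup>2 \<partial>lborel)" by simp
  qed
  have fc: "(\<lambda>n. fourier_coeff (\<phi> n) k) \<longlonglongrightarrow> fourier_coeff g k" for k
    by (rule fourier_coeff_L2_limit[OF \<phi>m \<phi>i um ui L2lim])
  have dcoef: "fourier_coeff (\<lambda>x. \<phi> n x - g x) k = fourier_coeff (\<phi> n) k - fourier_coeff g k"
    "fourier_coeff (\<lambda>x. \<phi> n x - \<phi> j x) k = fourier_coeff (\<phi> n) k - fourier_coeff (\<phi> j) k" for n j k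
    by (rule fourier_coeff_diff[OF cube_L2_L1[OF \<phi>m \<phi>i] cube_L2_L1[OF um ui]], rule fourier_coeff_diff[OF cube_L2_L1[OF \<phi>m \<phi>i] cube_L2_L1[OF \<phi>m \<phi>i]])
  have Hs: "(\<Sum>k\<in>F. Hs_term s m (\<lambda>x. \<phi> n x - g x) k) \<le> 2 * kappa s * (\<delta> n)\<^sup>2" if F: "finite F" for F n
  proof (rule LIMSEQ_le)
    show "(\<lambda>j. \<Sum>k\<in>F. Hs_term s m (\<lambda>x. \<phi> n x - \<phi> j x) k) \<longlonglongrightarrow> (\<Sum>k\<in>F. Hs_term s m (\<lambda>x. \<phi> n x - g x) k)"
      unfolding Hs_term_def dcoef by (intro tendsto_intros fc)
    have "(\<lambda>j. 2 * kappa s * (\<delta> n + \<delta> j)\<^sup>2) \<longlonglongrightarrow> 2 * kappa s * (\<delta> n + 0)\<^sup>2"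
      using lim[folded \<delta>_def] by (intro tendsto_intros)
    then show "(\<lambda>j. 2 * kappa s * (\<delta> n + \<delta> j)\<^sup>2) \<longlonglongrightarrow> 2 * kappa s * (\<delta> n)\<^sup>2" by simp
    show "\<exists>N. \<forall>j\<ge>N. (\<Sum>k\<in>F. Hs_term s m (\<lambda>x. \<phi> n x - \<phi> j x) k) \<le> 2 * kappa s * (\<delta> n + \<delta> j)\<^sup>2"
      using Hsd[OF F] by blast
  qed
  have bsum: "f summable_on UNIV" if "\<And>F. finite F \<Longrightarrow> sum f F \<le> C" "\<And>k. 0 \<le> f k" for f :: "int^3 \<Rightarrow> real" and C
    by (rule nonneg_bdd_above_summable_on) (use that in \<open>auto simp: bdd_above_def\<close>)
  have sd: "Hs_term s m (\<lambda>x. \<phi> n x - g x) summable_on UNIV" for n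
    by (rule bsum[OF Hs Hs_term_nonneg])
  have s\<phi>: "Hs_term s m (\<phi> n) summable_on UNIV" for n
  proof (rule bsum[OF _ Hs_term_nonneg])
    show "(\<Sum>k\<in>F. Hs_term s m (\<phi> n) k) \<le> 2 * kappa s * (X_norm s m (\<Phi> n))\<^sup>2" if "finite F" for F
      using Sobolev_trace(1)[OF \<Phi> s m that, of n] unfolding \<phi>_def[symmetric] by (simp add: \<phi>_def[abs_def])
  qed
  have "Hs_term s m g summable_on UNIV"
  proof (rule summable_on_comparison_test)
    show "(\<lambda>k. 2 * Hs_term s m (\<phi> 0) k + 2 * Hs_term s m (\<lambda>x. \<phi> 0 x - g x) k) summable_on UNIV"
      by (intro summable_on_add summable_on_cmult_right s\<phi> sd)
    show "Hs_term s m g k \<le> 2 * Hs_term s m (\<phi> 0) k + 2 * Hs_term s m (\<lambda>x. \<phi> 0 x - g x) k" for k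
    proof -
      have "(cmod b)\<^sup>2 \<le> 2 * (cmod a)\<^sup>2 + 2 * (cmod (a - b))\<^sup>2" for a b :: complex
      proof -
        have "cmod b \<le> cmod a + cmod (a - b)" using norm_triangle_ineq4[of a "a - b"] by simp
        then have "(cmod b)\<^sup>2 \<le> (cmod a + cmod (a - b))\<^sup>2" by (intro power_mono) auto
        also have "\<dots> \<le> 2 * (cmod a)\<^sup>2 + 2 * (cmod (a - b))\<^sup>2"
          using sum_squares_bound[of "cmod a" "cmod (a - b)"] by (simp add: power2_sum)
        finally show ?thesis .
      qed
      from mult_left_mono[OF this[of "fourier_coeff g k" "fourier_coeff (\<phi> 0) k"], of "((norm (freq k))\<^sup>2 + m\<^sup>2) powr s"]
      show ?thesis unfolding Hs_term_def dcoef by (simp add: algebra_simps)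
    qed
  qed (simp add: Hs_term_nonneg)
  then have gH: "g \<in> Hs_space s m" using um ui by (simp add: Hs_space_def)
  have "(\<lambda>n. Hs_norm s m (\<lambda>x. \<phi> n x - g x)) \<longlonglongrightarrow> 0"
  proof (rule Lim_null_comparison[where g="\<lambda>n. sqrt (2 * kappa s) * \<delta> n"])
    show "(\<lambda>n. sqrt (2 * kappa s) * \<delta> n) \<longlonglongrightarrow> 0" using tendsto_mult_right_zero[OF lim[folded \<delta>_def]] .
    have "norm (Hs_norm s m (\<lambda>x. \<phi> n x - g x)) \<le> sqrt (2 * kappa s) * \<delta> n" for n
    proof -
      have nn: "0 \<le> (\<Sum>\<^sub>\<infinity>k. Hs_term s m (\<lambda>x. \<phi> n x - g x) k)" by (rule infsum_nonneg) (rule Hs_term_nonneg)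
      have "(\<Sum>\<^sub>\<infinity>k. Hs_term s m (\<lambda>x. \<phi> n x - g x) k) \<le> 2 * kappa s * (\<delta> n)\<^sup>2"
        by (rule infsum_le_finite_sums[OF sd]) (rule Hs)
      then have "sqrt (\<Sum>\<^sub>\<infinity>k. Hs_term s m (\<lambda>x. \<phi> n x - g x) k) \<le> sqrt (2 * kappa s * (\<delta> n)\<^sup>2)" by (rule real_sqrt_le_mono)
      then show ?thesis unfolding Hs_norm_def using nn \<delta>0[of n] by (simp add: real_sqrt_mult)
    qed
    then show "\<forall>\<^sub>F n in sequentially. norm (Hs_norm s m (\<lambda>x. \<phi> n x - g x)) \<le> sqrt (2 * kappa s) * \<delta> n" by simp
  qed
  then have "has_trace s m W g" unfolding has_trace_def using gH \<Phi> lim unfolding \<phi>_def by blast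
  then show ?thesis using that L2lim fc unfolding \<phi>_def by blast
qed

lemma bounded_sums_summable_on:
  fixes f :: "'i \<Rightarrow> real"
  assumes "\<And>F. finite F \<Longrightarrow> sum f F \<le> C" "\<And>k. 0 \<le> f k"
  shows "f summable_on UNIV"
  by (rule nonneg_bdd_above_summable_on) (use assms in \<open>auto simp: bdd_above_def\<close>)

lemma trace_in_Hs_space:
  assumes W: "W \<in> smooth_periodic s" and s: "1/2 \<le> s" "s < 1" and m: "0 < m"
  shows "(\<lambda>x. fst W (x, 0)) \<in> Hs_space s m"
  unfolding Hs_space_def
  using bounded_sums_summable_on[OF Sobolev_trace(1)[OF W s m] Hs_term_nonneg]
    continuous_set_borel_measurable_cube[OF trace_continuous[OF W]]
    continuous_cube_integrable[OF continuous_on_power[OF trace_continuous[OF W], of _ 2]]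
  by simp

lemma Hs_spaceD:
  assumes "u \<in> Hs_space s m"
  shows "set_borel_measurable lborel cube u" "set_integrable lborel cube (\<lambda>x. (u x)\<^sup>2)"
    "set_integrable lborel cube u" "Hs_term s m u summable_on UNIV"
  using assms cube_L2_L1[of u] by (auto simp: Hs_space_def)

lemma Hs_term_diff_summable:
  assumes u: "u \<in> Hs_space s m" and v: "v \<in> Hs_space s m"
  shows "Hs_term s m (\<lambda>x. u x - v x) summable_on UNIV"
proof (rule summable_on_comparison_test)
  show "(\<lambda>k. 2 * Hs_term s m u k + 2 * Hs_term s m v k) summable_on UNIV"
    by (intro summable_on_add summable_on_cmult_right Hs_spaceD u v)
  show "Hs_term s m (\<lambda>x. u x - v x) k \<le> 2 * Hs_term s m u k + 2 * Hs_term s m v k" for k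
  proof -
    have "(cmod (a - b))\<^sup>2 \<le> 2 * (cmod a)\<^sup>2 + 2 * (cmod b)\<^sup>2" for a b :: complex
    proof -
      have "(cmod (a - b))\<^sup>2 \<le> (cmod a + cmod b)\<^sup>2" by (intro power_mono norm_triangle_ineq4) auto
      also have "\<dots> \<le> 2 * (cmod a)\<^sup>2 + 2 * (cmod b)\<^sup>2"
        using sum_squares_bound[of "cmod a" "cmod b"] by (simp add: power2_sum)
      finally show ?thesis .
    qed
    from mult_left_mono[OF this[of "fourier_coeff u k" "fourier_coeff v k"], of "((norm (freq k))\<^sup>2 + m\<^sup>2) powr s"]
    show ?thesis unfolding Hs_term_def fourier_coeff_diff[OF Hs_spaceD(3)[OF u] Hs_spaceD(3)[OF v]]
      by (simp add: algebra_simps)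
  qed
qed (simp add: Hs_term_nonneg)

text \<open>
A single frequency of the trace depends continuously on the function: this is how coefficients are
identified in limits.
\<close>

lemma fourier_coeff_trace_bound:
  assumes W: "W \<in> smooth_periodic s" and s: "1/2 \<le> s" "s < 1" and m: "0 < m"
  shows "cmod (fourier_coeff (\<lambda>x. fst W (x, 0)) k) \<le> sqrt (2 * kappa s / m powr (2 * s)) * X_norm s m W"
proof (rule power2_le_imp_le)
  have s0: "0 < s" using s by simp
  have mp: "0 < m powr (2 * s)" using m by simp
  have k0: "0 < kappa s" using kappa_pos s0 s by blast
  have "m powr (2 * s) * (cmod (fourier_coeff (\<lambda>x. fst W (x, 0)) k))\<^sup>2 \<le> 2 * kappa s * (X_norm s m W)\<^sup>2"
    using fourier_coeff_le_Hs_term[OF m s0, of "\<lambda>x. fst W (x, 0)" k] Sobolev_trace(1)[OF W s m, of "{k}"] by simp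
  then have "(cmod (fourier_coeff (\<lambda>x. fst W (x, 0)) k))\<^sup>2 \<le> 2 * kappa s / m powr (2 * s) * (X_norm s m W)\<^sup>2"
    using mp by (simp add: field_simps)
  also have "\<dots> = (sqrt (2 * kappa s / m powr (2 * s)) * X_norm s m W)\<^sup>2"
    using k0 mp by (simp add: power_mult_distrib)
  finally show "(cmod (fourier_coeff (\<lambda>x. fst W (x, 0)) k))\<^sup>2 \<le> (sqrt (2 * kappa s / m powr (2 * s)) * X_norm s m W)\<^sup>2" .
  show "0 \<le> sqrt (2 * kappa s / m powr (2 * s)) * X_norm s m W"
    using X_norm_nonneg[OF s0 s(2)] k0 by simp
qed

lemma X_spaceD: "W \<in> X_space s m \<Longrightarrow> W \<in> weighted_L2 s" by (simp add: X_space_def)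

lemma has_trace_Tr:
  assumes s: "1/2 \<le> s" "s < 1" and m: "0 < m" and V: "V \<in> X_space s m"
  shows "has_trace s m V (Tr s m V)"
proof -
  obtain \<Phi> where \<Phi>: "\<And>n. \<Phi> n \<in> smooth_periodic s" "(\<lambda>n. X_norm s m (fg_diff (\<Phi> n) V)) \<longlonglongrightarrow> 0"
    using V by (auto simp: X_space_def)
  obtain u where "has_trace s m V u" by (rule trace_exists[OF s m \<Phi>(1) X_spaceD[OF V] \<Phi>(2)])
  then show ?thesis unfolding Tr_def by (rule someI[of "has_trace s m V"])
qed

lemma AE_eq_of_fourier_coeff:
  assumes "set_integrable lborel cube u" "set_integrable lborel cube v"
    and "\<And>k. fourier_coeff u k = fourier_coeff v k"
  shows "AE x\<in>cube in lborel. u x = v x"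
proof -
  have "AE x\<in>cube in lborel. u x - v x = 0"
    by (rule fourier_coeff_unique) (use assms fourier_coeff_diff[OF assms(1,2)] in auto)
  then show ?thesis by simp
qed

text \<open>
\<^const>\<open>Tr\<close> is one choice among all functions that satisfy \<^const>\<open>has_trace\<close>, possibly coming
from another approximating sequence. The coefficients of the traces along two such sequences
have the same limits, so any two traces agree almost everywhere.
\<close>

lemma trace_limit:
  assumes s: "1/2 \<le> s" "s < 1" and m: "0 < m"
    and W: "W \<in> weighted_L2 s" and tr: "has_trace s m W u"
    and \<Psi>: "\<And>n. \<Psi> n \<in> smooth_periodic s" and lim: "(\<lambda>n. X_norm s m (fg_diff (\<Psi> n) W)) \<longlonglongrightarrow> 0"
  shows "(\<lambda>n. fourier_coeff (\<lambda>x. fst (\<Psi> n) (x, 0)) k) \<longlonglongrightarrow> fourier_coeff u k"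
    and "(\<lambda>n. LINT x:cube|lborel. (fst (\<Psi> n) (x, 0) - u x)\<^sup>2) \<longlonglongrightarrow> 0"
proof -
  have s0: "0 < s" using s by simp
  obtain \<Phi> where uH: "u \<in> Hs_space s m" and \<Phi>: "\<And>n. \<Phi> n \<in> smooth_periodic s"
    and \<Phi>l: "(\<lambda>n. X_norm s m (fg_diff (\<Phi> n) W)) \<longlonglongrightarrow> 0"
    and Hl: "(\<lambda>n. Hs_norm s m (\<lambda>x. fst (\<Phi> n) (x, 0) - u x)) \<longlonglongrightarrow> 0"
    using tr unfolding has_trace_def by blast
  have "\<exists>v. has_trace s m W v \<and> (\<lambda>n. LINT x:cube|lborel. (fst (\<Psi> n) (x, 0) - v x)\<^sup>2) \<longlonglongrightarrow> 0 \<and>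
    (\<forall>k. (\<lambda>n. fourier_coeff (\<lambda>x. fst (\<Psi> n) (x, 0)) k) \<longlonglongrightarrow> fourier_coeff v k)"
    by (rule trace_exists[OF s m \<Psi> W lim]) blast
  then obtain v where v: "has_trace s m W v" "(\<lambda>n. LINT x:cube|lborel. (fst (\<Psi> n) (x, 0) - v x)\<^sup>2) \<longlonglongrightarrow> 0"
    "\<And>k. (\<lambda>n. fourier_coeff (\<lambda>x. fst (\<Psi> n) (x, 0)) k) \<longlonglongrightarrow> fourier_coeff v k"
    by blast
  have vH: "v \<in> Hs_space s m" using v(1) by (simp add: has_trace_def)
  have mp: "0 < m powr (2 * s)" using m by simp
  (* along the sequence that defines the trace u *)
  have c1: "(\<lambda>n. fourier_coeff (\<lambda>x. fst (\<Phi> n) (x, 0)) k) \<longlonglongrightarrow> fourier_coeff u k" for k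
  proof -
    have "(\<lambda>n. fourier_coeff (\<lambda>x. fst (\<Phi> n) (x, 0)) k - fourier_coeff u k) \<longlonglongrightarrow> 0"
    proof (rule Lim_null_comparison)
      show "(\<lambda>n. Hs_norm s m (\<lambda>x. fst (\<Phi> n) (x, 0) - u x) / sqrt (m powr (2 * s))) \<longlonglongrightarrow> 0"
        by (rule tendsto_divide_zero[OF Hl])
      have "norm (fourier_coeff (\<lambda>x. fst (\<Phi> n) (x, 0)) k - fourier_coeff u k) \<le> Hs_norm s m (\<lambda>x. fst (\<Phi> n) (x, 0) - u x) / sqrt (m powr (2 * s))" for n
      proof -
        let ?w = "\<lambda>x. fst (\<Phi> n) (x, 0) - u x"
        have e: "fourier_coeff ?w k = fourier_coeff (\<lambda>x. fst (\<Phi> n) (x, 0)) k - fourier_coeff u k"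
          by (rule fourier_coeff_diff[OF trace_integrable[OF \<Phi>] Hs_spaceD(3)[OF uH]])
        have sm: "Hs_term s m ?w summable_on UNIV" by (rule Hs_term_diff_summable[OF trace_in_Hs_space[OF \<Phi> s m] uH])
        have "m powr (2 * s) * (cmod (fourier_coeff ?w k))\<^sup>2 \<le> (\<Sum>k\<in>{k}. Hs_term s m ?w k)"
          using fourier_coeff_le_Hs_term[OF m s0] by simp
        also have "\<dots> \<le> (\<Sum>\<^sub>\<infinity>k. Hs_term s m ?w k)"
          by (rule finite_sum_le_infsum[OF sm]) (auto simp: Hs_term_nonneg)
        finally have "sqrt (m powr (2 * s) * (cmod (fourier_coeff ?w k))\<^sup>2) \<le> Hs_norm s m ?w"
          unfolding Hs_norm_def by (rule real_sqrt_le_mono)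
        then show ?thesis using mp unfolding e[symmetric] by (simp add: real_sqrt_mult field_simps)
      qed
      then show "\<forall>\<^sub>F n in sequentially. norm (fourier_coeff (\<lambda>x. fst (\<Phi> n) (x, 0)) k - fourier_coeff u k) \<le> Hs_norm s m (\<lambda>x. fst (\<Phi> n) (x, 0) - u x) / sqrt (m powr (2 * s))"
        by (intro always_eventually allI)
    qed
    then show ?thesis by (simp add: LIM_zero_iff)
  qed
  (* the two sequences have the same limit in the weighted space *)
  have c2: "(\<lambda>n. fourier_coeff (\<lambda>x. fst (\<Psi> n) (x, 0)) k - fourier_coeff (\<lambda>x. fst (\<Phi> n) (x, 0)) k) \<longlonglongrightarrow> 0" for k
  proof (rule Lim_null_comparison)
    let ?C = "sqrt (2 * kappa s / m powr (2 * s))"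
    have "(\<lambda>n. ?C * (X_norm s m (fg_diff (\<Psi> n) W) + X_norm s m (fg_diff (\<Phi> n) W))) \<longlonglongrightarrow> ?C * (0 + 0)"
      by (intro tendsto_intros lim \<Phi>l)
    then show "(\<lambda>n. ?C * (X_norm s m (fg_diff (\<Psi> n) W) + X_norm s m (fg_diff (\<Phi> n) W))) \<longlonglongrightarrow> 0" by simp
    have "norm (fourier_coeff (\<lambda>x. fst (\<Psi> n) (x, 0)) k - fourier_coeff (\<lambda>x. fst (\<Phi> n) (x, 0)) k) \<le> ?C * (X_norm s m (fg_diff (\<Psi> n) W) + X_norm s m (fg_diff (\<Phi> n) W))" for n
    proof -
      have L: "\<Psi> n \<in> weighted_L2 s" "\<Phi> n \<in> weighted_L2 s" by (intro smooth_periodic_weighted_L2 \<Psi> \<Phi>)+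
      have D: "fg_comb (\<Psi> n) (-1) (\<Phi> n) \<in> smooth_periodic s" by (rule smooth_periodic_comb[OF m \<Psi> \<Phi>])
      have eq: "fg_comb (\<Psi> n) (-1) (\<Phi> n) = fg_comb (fg_diff (\<Psi> n) W) (-1) (fg_diff (\<Phi> n) W)"
        unfolding fg_diff_comb by (simp add: fg_comb_def)
      have "norm (fourier_coeff (\<lambda>x. fst (\<Psi> n) (x, 0)) k - fourier_coeff (\<lambda>x. fst (\<Phi> n) (x, 0)) k) \<le> ?C * X_norm s m (fg_comb (\<Psi> n) (-1) (\<Phi> n))"
        using fourier_coeff_trace_bound[OF D s m, of k] fourier_coeff_trace_comb[OF \<Psi> \<Phi>, of n "-1" n k] by simp
      also have "\<dots> \<le> ?C * (X_norm s m (fg_diff (\<Psi> n) W) + X_norm s m (fg_diff (\<Phi> n) W))"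
      proof (rule mult_left_mono)
        show "X_norm s m (fg_comb (\<Psi> n) (-1) (\<Phi> n)) \<le> X_norm s m (fg_diff (\<Psi> n) W) + X_norm s m (fg_diff (\<Phi> n) W)"
          unfolding eq
          using X_norm_triangle[OF s0 s(2) m, of "fg_diff (\<Psi> n) W" "fg_diff (\<Phi> n) W" "-1"]
            weighted_L2_comb[OF m L(1) W, of "-1"] weighted_L2_comb[OF m L(2) W, of "-1"] by (simp add: fg_diff_comb)
        show "0 \<le> ?C" using kappa_pos[OF s0 s(2)] by simp
      qed
      finally show ?thesis .
    qed
    then show "\<forall>\<^sub>F n in sequentially. norm (fourier_coeff (\<lambda>x. fst (\<Psi> n) (x, 0)) k - fourier_coeff (\<lambda>x. fst (\<Phi> n) (x, 0)) k) \<le> ?C * (X_norm s m (fg_diff (\<Psi> n) W) + X_norm s m (fg_diff (\<Phi> n) W))"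
      by (intro always_eventually allI)
  qed
  have c3: "(\<lambda>n. fourier_coeff (\<lambda>x. fst (\<Psi> n) (x, 0)) k) \<longlonglongrightarrow> fourier_coeff u k" for k
    using tendsto_add[OF c2[of k] c1[of k]] by simp
  then show "(\<lambda>n. fourier_coeff (\<lambda>x. fst (\<Psi> n) (x, 0)) k) \<longlonglongrightarrow> fourier_coeff u k" .
  have "fourier_coeff u k = fourier_coeff v k" for k
    using LIMSEQ_unique[OF c3 v(3)] .
  then have ae: "AE x\<in>cube in lborel. u x = v x"
    by (rule AE_eq_of_fourier_coeff[OF Hs_spaceD(3)[OF uH] Hs_spaceD(3)[OF vH]])
  have "(LINT x:cube|lborel. (fst (\<Psi> n) (x, 0) - u x)\<^sup>2) = (LINT x:cube|lborel. (fst (\<Psi> n) (x, 0) - v x)\<^sup>2)" for n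
    unfolding set_lebesgue_integral_def
  proof (rule integral_cong_AE)
    have m1: "(\<lambda>x. indicator cube x *\<^sub>R (fst (\<Psi> n) (x, 0) - w x)\<^sup>2) \<in> borel_measurable lborel" if "w \<in> Hs_space s m" for w
      using set_integrable_cube_sq_diff(2)[OF Hs_spaceD(1,2)[OF trace_in_Hs_space[OF \<Psi> s m]] Hs_spaceD(1,2)[OF that], of n]
      unfolding set_integrable_def by (rule borel_measurable_integrable)
    show "(\<lambda>x. indicator cube x *\<^sub>R (fst (\<Psi> n) (x, 0) - u x)\<^sup>2) \<in> borel_measurable lborel" by (rule m1[OF uH])
    show "(\<lambda>x. indicator cube x *\<^sub>R (fst (\<Psi> n) (x, 0) - v x)\<^sup>2) \<in> borel_measurable lborel" by (rule m1[OF vH])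
    show "AE x in lborel. indicator cube x *\<^sub>R (fst (\<Psi> n) (x, 0) - u x)\<^sup>2 = indicator cube x *\<^sub>R (fst (\<Psi> n) (x, 0) - v x)\<^sup>2"
      using ae by eventually_elim (auto simp: indicator_def)
  qed
  then show "(\<lambda>n. LINT x:cube|lborel. (fst (\<Psi> n) (x, 0) - u x)\<^sup>2) \<longlonglongrightarrow> 0" using v(2) by simp
qed

lemma cube_integral_L2_limit:
  fixes c u :: "real^3 \<Rightarrow> real"
  assumes c: "continuous_on UNIV c"
    and f: "\<And>n. f n \<in> Hs_space s m" and u: "u \<in> Hs_space s m"
    and lim: "(\<lambda>n. LINT x:cube|lborel. (f n x - u x)\<^sup>2) \<longlonglongrightarrow> 0"
  shows "(\<lambda>n. LINT x:cube|lborel. c x * f n x) \<longlonglongrightarrow> (LINT x:cube|lborel. c x * u x)"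
proof -
  have cm: "set_borel_measurable lborel cube c" by (rule continuous_set_borel_measurable_cube[OF c])
  have ci: "set_integrable lborel cube (\<lambda>x. (c x)\<^sup>2)"
    by (rule continuous_cube_integrable) (intro continuous_intros continuous_on_subset[OF c], simp)
  let ?C = "sqrt (LINT x|lborel. (norm (indicator cube x *\<^sub>R c x))\<^sup>2)"
  have prod: "set_integrable lborel cube (\<lambda>x. c x * w x)" if w: "w \<in> Hs_space s m" for w
  proof -
    have "integrable lborel (\<lambda>x. (indicator cube x *\<^sub>R c x) \<bullet> (indicator cube x *\<^sub>R w x))"
      by (rule sq_integrable_inner[OF sq_integrable_cube[OF cm ci] sq_integrable_cube[OF Hs_spaceD(1,2)[OF w]]])
    also have "(\<lambda>x. (indicator cube x *\<^sub>R c x) \<bullet> (indicator cube x *\<^sub>R w x)) = (\<lambda>x. indicator cube x *\<^sub>R (c x * w x))"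
      by (auto simp: indicator_def)
    finally show ?thesis by (simp add: set_integrable_def)
  qed
  have "(\<lambda>n. (LINT x:cube|lborel. c x * f n x) - (LINT x:cube|lborel. c x * u x)) \<longlonglongrightarrow> 0"
  proof (rule Lim_null_comparison)
    have "(\<lambda>n. ?C * sqrt (LINT x:cube|lborel. (f n x - u x)\<^sup>2)) \<longlonglongrightarrow> ?C * sqrt 0"
      by (intro tendsto_intros lim)
    then show "(\<lambda>n. ?C * sqrt (LINT x:cube|lborel. (f n x - u x)\<^sup>2)) \<longlonglongrightarrow> 0" by simp
    have "norm ((LINT x:cube|lborel. c x * f n x) - (LINT x:cube|lborel. c x * u x)) \<le> ?C * sqrt (LINT x:cube|lborel. (f n x - u x)\<^sup>2)" for n
    proof -
      note d = set_integrable_cube_sq_diff[OF Hs_spaceD(1,2)[OF f[of n]] Hs_spaceD(1,2)[OF u]]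
      have "(LINT x:cube|lborel. c x * f n x) - (LINT x:cube|lborel. c x * u x) = (LINT x:cube|lborel. c x * f n x - c x * u x)"
        by (rule set_integral_diff(2)[OF prod[OF f] prod[OF u], symmetric])
      also have "\<dots> = (LINT x|lborel. (indicator cube x *\<^sub>R c x) \<bullet> (indicator cube x *\<^sub>R (f n x - u x)))"
        unfolding set_lebesgue_integral_def
        by (rule Bochner_Integration.integral_cong) (auto simp: indicator_def algebra_simps)
      finally have "norm ((LINT x:cube|lborel. c x * f n x) - (LINT x:cube|lborel. c x * u x))
         \<le> ?C * sqrt (LINT x|lborel. (norm (indicator cube x *\<^sub>R (f n x - u x)))\<^sup>2)"
        using integral_Cauchy_Schwarz[OF sq_integrable_cube[OF cm ci] sq_integrable_cube[OF d]] by simp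
      also have "(LINT x|lborel. (norm (indicator cube x *\<^sub>R (f n x - u x)))\<^sup>2) = (LINT x:cube|lborel. (f n x - u x)\<^sup>2)"
        unfolding set_lebesgue_integral_def
        by (rule Bochner_Integration.integral_cong) (auto simp: indicator_def)
      finally show ?thesis .
    qed
    then show "\<forall>\<^sub>F n in sequentially. norm ((LINT x:cube|lborel. c x * f n x) - (LINT x:cube|lborel. c x * u x)) \<le> ?C * sqrt (LINT x:cube|lborel. (f n x - u x)\<^sup>2)"
      by (intro always_eventually allI)
  qed
  then show ?thesis by (simp add: LIM_zero_iff)
qed

section \<open>Limits of approximate solutions\<close>

lemma X_inner_limit:
  assumes s: "0 < s" "s < 1" and m: "0 < m"
    and \<Phi>: "\<And>n. \<Phi> n \<in> weighted_L2 s" and U: "U \<in> weighted_L2 s" and V: "V \<in> weighted_L2 s"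
    and lim: "(\<lambda>n. X_norm s m (fg_diff (\<Phi> n) U)) \<longlonglongrightarrow> 0"
  shows "(\<lambda>n. X_inner s m (\<Phi> n) V) \<longlonglongrightarrow> X_inner s m U V"
proof -
  have "(\<lambda>n. X_inner s m (\<Phi> n) V - X_inner s m U V) \<longlonglongrightarrow> 0"
  proof (rule Lim_null_comparison)
    show "(\<lambda>n. X_norm s m (fg_diff (\<Phi> n) U) * X_norm s m V) \<longlonglongrightarrow> 0"
      using tendsto_mult_left_zero[OF lim] .
    have "norm (X_inner s m (\<Phi> n) V - X_inner s m U V) \<le> X_norm s m (fg_diff (\<Phi> n) U) * X_norm s m V" for n
      using X_Cauchy_Schwarz[OF s m weighted_L2_comb[OF m \<Phi> U, of n "-1"] V] X_inner_comb[OF m \<Phi> U V, of n "-1"]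
      by (simp add: fg_diff_comb)
    then show "\<forall>\<^sub>F n in sequentially. norm (X_inner s m (\<Phi> n) V - X_inner s m U V) \<le> X_norm s m (fg_diff (\<Phi> n) U) * X_norm s m V"
      by (intro always_eventually allI)
  qed
  then show ?thesis by (simp add: LIM_zero_iff)
qed

lemma X_norm_limit:
  assumes s: "0 < s" "s < 1" and m: "0 < m"
    and \<Phi>: "\<And>n. \<Phi> n \<in> weighted_L2 s" and U: "U \<in> weighted_L2 s"
    and lim: "(\<lambda>n. X_norm s m (fg_diff (\<Phi> n) U)) \<longlonglongrightarrow> 0"
  shows "(\<lambda>n. X_norm s m (\<Phi> n)) \<longlonglongrightarrow> X_norm s m U"
proof -
  have "(\<lambda>n. X_norm s m (\<Phi> n) - X_norm s m U) \<longlonglongrightarrow> 0"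
  proof (rule Lim_null_comparison[OF _ lim])
    have "norm (X_norm s m (\<Phi> n) - X_norm s m U) \<le> X_norm s m (fg_diff (\<Phi> n) U)" for n
    proof -
      have D: "fg_comb (\<Phi> n) (-1) U \<in> weighted_L2 s" by (rule weighted_L2_comb[OF m \<Phi> U])
      have e1: "fg_comb U 1 (fg_comb (\<Phi> n) (-1) U) = \<Phi> n" by (simp add: fg_comb_def)
      have e2: "fg_comb (\<Phi> n) (-1) (fg_comb (\<Phi> n) (-1) U) = U" by (simp add: fg_comb_def)
      have "X_norm s m (\<Phi> n) \<le> X_norm s m U + X_norm s m (fg_comb (\<Phi> n) (-1) U)"
        using X_norm_triangle[OF s m U D, of 1] e1 by simp
      moreover have "X_norm s m U \<le> X_norm s m (\<Phi> n) + X_norm s m (fg_comb (\<Phi> n) (-1) U)"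
        using X_norm_triangle[OF s m \<Phi> D, of n "-1"] e2 by simp
      ultimately show ?thesis unfolding fg_diff_comb by simp
    qed
    then show "\<forall>\<^sub>F n in sequentially. norm (X_norm s m (\<Phi> n) - X_norm s m U) \<le> X_norm s m (fg_diff (\<Phi> n) U)"
      by (intro always_eventually allI)
  qed
  then show ?thesis by (simp add: LIM_zero_iff)
qed

text \<open>
A Cauchy sequence of smooth functions that satisfies the equation in the limit, tested with smooth
functions, yields a weak solution. General test functions are reached by approximation: both sides
are continuous in the test function, the right-hand side since the nonlinear term is continuous and
traces converge in \<open>L\<^sup>2\<close>.
\<close>

lemma weak_solution_of_limit:
  assumes s: "1/2 \<le> s" "s < 1" and m: "0 < m"
    and \<Phi>: "\<And>n. \<Phi> n \<in> smooth_periodic s"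
    and Cauchy: "\<And>e. e > 0 \<Longrightarrow> \<exists>N. \<forall>i\<ge>N. \<forall>j\<ge>N. X_norm s m (fg_diff (\<Phi> i) (\<Phi> j)) < e"
    and uc: "continuous_on UNIV u" and per: "periodic3 u"
    and coef: "\<And>k. (\<lambda>n. fourier_coeff (\<lambda>x. fst (\<Phi> n) (x, 0)) k) \<longlonglongrightarrow> fourier_coeff u k"
    and fuc: "continuous_on UNIV (\<lambda>x. lam * \<bar>u x\<bar> powr (q - 2) * u x + \<bar>u x\<bar> powr (p - 2) * u x)"
    and EL: "\<And>V. V \<in> smooth_periodic s \<Longrightarrow>
      (\<lambda>n. (a + b * (X_norm s m (\<Phi> n))\<^sup>2) * X_inner s m (\<Phi> n) V) \<longlonglongrightarrow>
      (LINT x:cube|lborel. (lam * \<bar>u x\<bar> powr (q - 2) * u x + \<bar>u x\<bar> powr (p - 2) * u x) * fst V (x, 0))"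
  shows "weak_solution s m a b lam q p u"
proof -
  have s0: "0 < s" using s by simp
  obtain U where U: "U \<in> X_space s m" and lim: "(\<lambda>n. X_norm s m (fg_diff (\<Phi> n) U)) \<longlonglongrightarrow> 0"
    using X_space_complete[OF s0 s(2) m \<Phi> Cauchy] by blast
  note UL = X_spaceD[OF U]
  have \<Phi>L: "\<Phi> n \<in> weighted_L2 s" for n by (rule smooth_periodic_weighted_L2[OF \<Phi>])
  have tr: "has_trace s m U (Tr s m U)" by (rule has_trace_Tr[OF s m U])
  then have TH: "Tr s m U \<in> Hs_space s m" by (simp add: has_trace_def)
  have ui: "set_integrable lborel cube u" "set_integrable lborel cube (\<lambda>x. (u x)\<^sup>2)"
    by (intro continuous_cube_integrable continuous_intros continuous_on_subset[OF uc], simp)+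
  have ceq: "fourier_coeff u k = fourier_coeff (Tr s m U) k" for k
    by (rule LIMSEQ_unique[OF coef trace_limit(1)[OF s m UL tr \<Phi> lim]])
  have ae: "AE x\<in>cube in lborel. u x = Tr s m U x"
    by (rule AE_eq_of_fourier_coeff[OF ui(1) Hs_spaceD(3)[OF TH] ceq])
  have "Hs_term s m u = Hs_term s m (Tr s m U)" by (rule ext) (simp add: Hs_term_def ceq)
  then have uH: "u \<in> Hs_space s m"
    unfolding Hs_space_def using Hs_spaceD(4)[OF TH] ui continuous_set_borel_measurable_cube[OF uc] by simp
  let ?f = "\<lambda>x. lam * \<bar>u x\<bar> powr (q - 2) * u x + \<bar>u x\<bar> powr (p - 2) * u x"
  have smooth: "(a + b * (X_norm s m U)\<^sup>2) * X_inner s m U V = (LINT x:cube|lborel. ?f x * fst V (x, 0))"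
    if V: "V \<in> smooth_periodic s" for V
  proof (rule LIMSEQ_unique[OF _ EL[OF V]])
    show "(\<lambda>n. (a + b * (X_norm s m (\<Phi> n))\<^sup>2) * X_inner s m (\<Phi> n) V) \<longlonglongrightarrow> (a + b * (X_norm s m U)\<^sup>2) * X_inner s m U V"
      by (intro tendsto_intros X_norm_limit[OF s0 s(2) m \<Phi>L UL lim]
          X_inner_limit[OF s0 s(2) m \<Phi>L UL smooth_periodic_weighted_L2[OF V] lim])
  qed
  have "(a + b * (X_norm s m U)\<^sup>2) * X_inner s m U V = (LINT x:cube|lborel. ?f x * Tr s m V x)" if V: "V \<in> X_space s m" for V
  proof -
    obtain \<Psi> where \<Psi>: "\<And>n. \<Psi> n \<in> smooth_periodic s" and \<Psi>l: "(\<lambda>n. X_norm s m (fg_diff (\<Psi> n) V)) \<longlonglongrightarrow> 0"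
      using V by (auto simp: X_space_def)
    have trV: "has_trace s m V (Tr s m V)" by (rule has_trace_Tr[OF s m V])
    then have VH: "Tr s m V \<in> Hs_space s m" by (simp add: has_trace_def)
    have \<Psi>L: "\<Psi> n \<in> weighted_L2 s" for n by (rule smooth_periodic_weighted_L2[OF \<Psi>])
    have l1: "(\<lambda>n. (a + b * (X_norm s m U)\<^sup>2) * X_inner s m U (\<Psi> n)) \<longlonglongrightarrow> (a + b * (X_norm s m U)\<^sup>2) * X_inner s m U V"
      using X_inner_limit[OF s0 s(2) m \<Psi>L X_spaceD[OF V] UL \<Psi>l] X_inner_commute by (intro tendsto_intros) simp
    have l2: "(\<lambda>n. LINT x:cube|lborel. ?f x * fst (\<Psi> n) (x, 0)) \<longlonglongrightarrow> (LINT x:cube|lborel. ?f x * Tr s m V x)"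
      by (rule cube_integral_L2_limit[OF fuc trace_in_Hs_space[OF \<Psi> s m] VH trace_limit(2)[OF s m X_spaceD[OF V] trV \<Psi> \<Psi>l]])
    show ?thesis using LIMSEQ_unique[OF l1[unfolded smooth[OF \<Psi>]] l2] .
  qed
  then show ?thesis unfolding weak_solution_def ae_eq_def using uH per U ae by blast
qed

section \<open>Minimisation of the Kirchhoff energy\<close>

definition signed_power :: "real \<Rightarrow> real \<Rightarrow> real" where
  "signed_power r t = \<bar>t\<bar> powr (r - 2) * t"

lemma signed_power_continuous:
  assumes "1 < r" shows "continuous_on A (signed_power r)"
proof -
  have "signed_power r t = max t 0 powr (r - 1) - max (- t) 0 powr (r - 1)" for t
  proof (cases t "0::real" rule: linorder_cases)
    case less
    then show ?thesis using powr_times_self[of "- t" "r - 2"] assms by (simp add: signed_power_def max_def)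
  next
    case equal
    then show ?thesis using assms by (simp add: signed_power_def)
  next
    case greater
    then show ?thesis using powr_times_self[of t "r - 2"] assms by (simp add: signed_power_def max_def)
  qed
  then have "signed_power r = (\<lambda>t. max t 0 powr (r - 1) - max (- t) 0 powr (r - 1))" by blast
  then show ?thesis
    using assms by (simp only:) (intro continuous_intros continuous_on_powr'; auto)
qed

lemma abs_powr_deriv:
  assumes r: "1 < r"
  shows "((\<lambda>t. \<bar>t\<bar> powr r / r) has_real_derivative signed_power r t) (at t)"
proof (cases t "0::real" rule: linorder_cases)
  case less
  have "((\<lambda>t. (- t) powr r / r) has_real_derivative signed_power r t) (at t)"
    using less r powr_times_self[of "- t" "r - 2"]
    by (auto intro!: derivative_eq_intros simp: signed_power_def)
  then show ?thesis
    by (rule has_field_derivative_transform_within_open[where S="{..<0}"]) (use less in auto)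
next
  case greater
  have "((\<lambda>t. t powr r / r) has_real_derivative signed_power r t) (at t)"
    using greater r powr_times_self[of "t" "r - 2"]
    by (auto intro!: derivative_eq_intros simp: signed_power_def)
  then show ?thesis
    by (rule has_field_derivative_transform_within_open[where S="{0<..}"]) (use greater in auto)
next
  case equal
  have "((\<lambda>h. \<bar>h\<bar> powr (r - 1) / r) \<longlongrightarrow> 0) (at 0)"
  proof -
    have "((\<lambda>h::real. \<bar>h\<bar> powr (r - 1) / r) \<longlongrightarrow> \<bar>0\<bar> powr (r - 1) / r) (at 0)"
      using r by (intro tendsto_intros) auto
    then show ?thesis using r by simp
  qed
  then have "((\<lambda>h. (\<bar>0 + h\<bar> powr r / r - \<bar>0\<bar> powr r / r) / h) \<longlongrightarrow> 0) (at 0)"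
  proof (rule Lim_null_comparison[rotated], intro always_eventually allI)
    fix h :: real
    show "norm ((\<bar>0 + h\<bar> powr r / r - \<bar>0\<bar> powr r / r) / h) \<le> \<bar>h\<bar> powr (r - 1) / r"
    proof (cases "h = 0")
      case False
      then have "\<bar>h\<bar> powr r = \<bar>h\<bar> powr (r - 1) * \<bar>h\<bar>" using powr_times_self[of "\<bar>h\<bar>" "r - 1"] by simp
      then show ?thesis using False r by (simp add: abs_mult)
    qed (use r in simp)
  qed
  then show ?thesis unfolding equal DERIV_def by (simp add: signed_power_def)
qed

text \<open>
Below the threshold \<open>N0\<close>, where both powers are equal, the left-hand side is at most its value at \<open>N0\<close>;
above it the quadratic term dominates.
\<close>

lemma power_absorb:
  fixes C r \<delta> :: real
  assumes r: "0 < r" "r < 2" and C: "0 \<le> C" and \<delta>: "0 < \<delta>"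
  obtains D where "0 \<le> D" "\<And>N. 0 \<le> N \<Longrightarrow> C * N powr r \<le> \<delta> * N\<^sup>2 + D"
proof -
  define N0 where "N0 = (C / \<delta>) powr (1 / (2 - r))"
  have "C * N powr r \<le> \<delta> * N\<^sup>2 + C * N0 powr r" if N: "0 \<le> N" for N
  proof (cases "N \<le> N0")
    case True
    then have "C * N powr r \<le> C * N0 powr r" using N r C by (intro mult_left_mono powr_mono2) auto
    then show ?thesis using \<delta> by (simp add: add_increasing)
  next
    case False
    then have N': "N0 < N" by simp
    have N0: "0 \<le> N0" by (simp add: N0_def)
    have "C / \<delta> = N0 powr (2 - r)" using r C \<delta> by (simp add: N0_def powr_powr)
    also have "\<dots> \<le> N powr (2 - r)" using N' N0 r by (intro powr_mono2) auto
    finally have "C \<le> \<delta> * N powr (2 - r)" using \<delta> by (simp add: field_simps)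
    then have "C * N powr r \<le> \<delta> * N powr (2 - r) * N powr r" by (intro mult_right_mono) auto
    also have "\<dots> = \<delta> * N powr 2" by (simp add: mult.assoc flip: powr_add)
    also have "\<dots> = \<delta> * N\<^sup>2" using N' N0 by (simp add: powr_numeral)
    finally show ?thesis using C by (simp add: add_increasing2)
  qed
  moreover have "0 \<le> C * N0 powr r" using C by simp
  ultimately show ?thesis using that by blast
qed

text \<open>
The minimisation uses only the following structure: a positive semidefinite form \<open>ip\<close> on a set \<open>Y\<close>
closed under \<open>comb v t w\<close> (which stands for \<open>v + t w\<close>), and a linear map \<open>tr\<close> into the continuous
functions that is bounded and compact with respect to pointwise convergence. The minimiser exists
only as the limit of a sequence in \<open>Y\<close>. The element \<open>e\<close> witnesses that \<open>tr\<close> is not zero.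
\<close>

locale kirchhoff =
  fixes Y :: "'v set" and ip :: "'v \<Rightarrow> 'v \<Rightarrow> real" and comb :: "'v \<Rightarrow> real \<Rightarrow> 'v \<Rightarrow> 'v"
    and tr :: "'v \<Rightarrow> real^3 \<Rightarrow> real" and a b lam q p K :: real and e :: 'v
  assumes comb_in: "\<And>v w t. v \<in> Y \<Longrightarrow> w \<in> Y \<Longrightarrow> comb v t w \<in> Y"
    and ip_comb: "\<And>v w z t. v \<in> Y \<Longrightarrow> w \<in> Y \<Longrightarrow> z \<in> Y \<Longrightarrow> ip (comb v t w) z = ip v z + t * ip w z"
    and ip_sym: "\<And>v w. ip v w = ip w v"
    and ip_nonneg: "\<And>v. v \<in> Y \<Longrightarrow> 0 \<le> ip v v"
    and ip_CS: "\<And>v w. v \<in> Y \<Longrightarrow> w \<in> Y \<Longrightarrow> \<bar>ip v w\<bar> \<le> sqrt (ip v v) * sqrt (ip w w)"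
    and tr_comb: "\<And>v w t x. v \<in> Y \<Longrightarrow> w \<in> Y \<Longrightarrow> tr (comb v t w) x = tr v x + t * tr w x"
    and tr_cont: "\<And>v A. v \<in> Y \<Longrightarrow> continuous_on A (tr v)"
    and K: "0 \<le> K" and tr_bound: "\<And>v x. v \<in> Y \<Longrightarrow> \<bar>tr v x\<bar> \<le> K * sqrt (ip v v)"
    and tr_compact: "\<And>v R. (\<And>n. v n \<in> Y) \<Longrightarrow> (\<And>n. ip (v n) (v n) \<le> R) \<Longrightarrow>
      \<exists>r u. strict_mono (r :: nat \<Rightarrow> nat) \<and> continuous_on UNIV u \<and> (\<forall>x. (\<lambda>n. tr (v (r n)) x) \<longlonglongrightarrow> u x)"
    and a: "0 < a" and b: "0 < b" and lam: "0 < lam" and q: "1 < q" "q < 2" and p: "2 < p" "p < 4"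
    and e: "e \<in> Y" and e_pos: "0 < (LINT x:cube|lborel. \<bar>tr e x\<bar> powr q)"
begin

definition nonlinearity :: "real \<Rightarrow> real" where "nonlinearity t = lam * signed_power q t + signed_power p t"

definition potential :: "real \<Rightarrow> real" where "potential t = lam * (\<bar>t\<bar> powr q / q) + \<bar>t\<bar> powr p / p"

definition energy :: "'v \<Rightarrow> real" where
  "energy v = a / 2 * ip v v + b / 4 * (ip v v)\<^sup>2 - (LINT x:cube|lborel. potential (tr v x))"

lemma nonlinearity_continuous: "continuous_on A nonlinearity"
  unfolding nonlinearity_def using q p by (intro continuous_intros signed_power_continuous) auto

lemma potential_deriv: "(potential has_real_derivative nonlinearity t) (at t)"
  unfolding potential_def nonlinearity_def using q p by (intro DERIV_add DERIV_cmult abs_powr_deriv) auto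

lemma potential_continuous: "continuous_on A potential"
  using potential_deriv by (meson DERIV_isCont continuous_at_imp_continuous_on)

lemma potential_nonneg: "0 \<le> potential t" unfolding potential_def using lam q p by simp

lemma potential_mono: "\<bar>t\<bar> \<le> M \<Longrightarrow> potential t \<le> potential M"
  unfolding potential_def using lam q p
  by (intro add_mono mult_left_mono divide_right_mono powr_mono2) auto

lemma potential_compose_continuous: "continuous_on A f \<Longrightarrow> continuous_on A (\<lambda>x. potential (f x))"
  by (rule continuous_on_compose2[OF potential_continuous[of UNIV]]) auto

lemma potential_integral_bound:
  assumes "continuous_on UNIV f" "\<And>x. \<bar>f x\<bar> \<le> M"
  shows "(LINT x:cube|lborel. potential (f x)) \<le> (2 * pi)^3 * potential M"
proof -
  have "(LINT x:cube|lborel. potential (f x)) \<le> (LINT x:cube|lborel. potential M)"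
    by (intro set_integral_mono continuous_cube_integrable potential_compose_continuous potential_mono assms
        continuous_on_subset[OF assms(1)] continuous_intros) auto
  then show ?thesis using cube_integral_const[of "potential M"] by simp
qed

lemma potential_integral_limit:
  assumes g: "\<And>n. continuous_on UNIV (g n)" and u: "continuous_on UNIV u"
    and bd: "\<And>n x. \<bar>g n x\<bar> \<le> M" and lim: "\<And>x. (\<lambda>n. g n x) \<longlonglongrightarrow> u x"
  shows "(\<lambda>n. LINT x:cube|lborel. potential (g n x)) \<longlonglongrightarrow> (LINT x:cube|lborel. potential (u x))"
  unfolding set_lebesgue_integral_def
proof (rule integral_dominated_convergence[where w="\<lambda>x. indicator cube x *\<^sub>R potential M"])
  have mm: "(\<lambda>x. indicator cube x *\<^sub>R potential (f x)) \<in> borel_measurable lborel" if "continuous_on UNIV f" for f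
    using continuous_set_borel_measurable_cube[OF potential_compose_continuous[OF that]] by (simp add: set_borel_measurable_def)
  show "(\<lambda>x. indicator cube x *\<^sub>R potential (u x)) \<in> borel_measurable lborel" by (rule mm[OF u])
  show "(\<lambda>x. indicator cube x *\<^sub>R potential (g n x)) \<in> borel_measurable lborel" for n by (rule mm[OF g])
  show "integrable lborel (\<lambda>x. indicator cube x *\<^sub>R potential M)"
    using cube_integrable_const[of "potential M"] by (simp add: set_integrable_def)
  have "isCont potential t" for t using potential_deriv DERIV_isCont by blast
  then have "(\<lambda>n. potential (g n x)) \<longlonglongrightarrow> potential (u x)" for x using isCont_tendsto_compose lim by blast
  then show "AE x in lborel. (\<lambda>n. indicator cube x *\<^sub>R potential (g n x)) \<longlonglongrightarrow> indicator cube x *\<^sub>R potential (u x)"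
    by (intro AE_I2 tendsto_intros)
  show "AE x in lborel. norm (indicator cube x *\<^sub>R potential (g n x)) \<le> indicator cube x *\<^sub>R potential M" for n
    using potential_mono[OF bd] potential_nonneg by (intro AE_I2) (simp add: indicator_def)
qed

text \<open>
The bound on \<open>tr\<close> makes the potential at most a sum of the powers \<open>q / 2\<close> and \<open>p / 2\<close> of
\<open>ip v v\<close>. Both exponents are less than 2, so half of the quartic term absorbs them.
\<close>

lemma energy_coercive:
  obtains D where "\<And>v. v \<in> Y \<Longrightarrow> b / 8 * (ip v v)\<^sup>2 - D \<le> energy v"
proof -
  define C1 where "C1 = (2 * pi)^3 * (lam / q * K powr q)"
  define C2 where "C2 = (2 * pi)^3 * (1 / p * K powr p)"
  have C: "0 \<le> C1" "0 \<le> C2" unfolding C1_def C2_def using lam q p by auto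
  obtain D1 where D1: "\<And>N. 0 \<le> N \<Longrightarrow> C1 * N powr (q / 2) \<le> b / 16 * N\<^sup>2 + D1"
    by (rule power_absorb[of "q / 2" C1 "b / 16"]) (use q C b in auto)
  obtain D2 where D2: "\<And>N. 0 \<le> N \<Longrightarrow> C2 * N powr (p / 2) \<le> b / 16 * N\<^sup>2 + D2"
    by (rule power_absorb[of "p / 2" C2 "b / 16"]) (use p C b in auto)
  have "b / 8 * (ip v v)\<^sup>2 - (D1 + D2) \<le> energy v" if v: "v \<in> Y" for v
  proof -
    define N where "N = ip v v"
    have N: "0 \<le> N" unfolding N_def using ip_nonneg v by simp
    have rt: "(K * sqrt N) powr r = K powr r * N powr (r / 2)" for r
      using K N by (simp add: powr_mult powr_half_sqrt[symmetric] powr_powr mult.commute)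
    have "(LINT x:cube|lborel. potential (tr v x)) \<le> (2 * pi)^3 * potential (K * sqrt N)"
      by (rule potential_integral_bound[OF tr_cont[OF v]]) (use tr_bound[OF v] in \<open>simp add: N_def\<close>)
    also have "\<dots> = C1 * N powr (q / 2) + C2 * N powr (p / 2)"
      unfolding potential_def C1_def C2_def using K N by (simp add: abs_mult rt algebra_simps)
    also have "\<dots> \<le> b / 8 * N\<^sup>2 + (D1 + D2)" using D1[OF N] D2[OF N] by simp
    finally have "(LINT x:cube|lborel. potential (tr v x)) \<le> b / 8 * N\<^sup>2 + (D1 + D2)" .
    moreover have "0 \<le> a / 2 * N" using a N by simp
    ultimately show ?thesis unfolding energy_def N_def[symmetric] by linarith
  qed
  then show ?thesis by (rule that)
qed

text \<open>
Along the ray through \<open>e\<close> the term of order \<open>q < 2\<close> is the leading one near the origin.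
\<close>

lemma energy_negative: "\<exists>v\<in>Y. energy v < 0"
proof -
  define N where "N = ip e e"
  define A where "A = (LINT x:cube|lborel. \<bar>tr e x\<bar> powr q)"
  have N: "0 \<le> N" unfolding N_def by (rule ip_nonneg[OF e])
  have "((\<lambda>\<epsilon>. a / 2 * N * \<epsilon> powr (2 - q) + b / 4 * N\<^sup>2 * \<epsilon> powr (4 - q)) \<longlongrightarrow> a / 2 * N * 0 powr (2 - q) + b / 4 * N\<^sup>2 * 0 powr (4 - q)) (at_right 0)"
    using q by (intro tendsto_intros) (auto simp: eventually_at_right_less less_imp_le eventually_at_filter)
  then have "((\<lambda>\<epsilon>. a / 2 * N * \<epsilon> powr (2 - q) + b / 4 * N\<^sup>2 * \<epsilon> powr (4 - q)) \<longlongrightarrow> 0) (at_right 0)"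
    using q by simp
  then have "\<forall>\<^sub>F \<epsilon> in at_right 0. a / 2 * N * \<epsilon> powr (2 - q) + b / 4 * N\<^sup>2 * \<epsilon> powr (4 - q) < lam / q * A"
    by (rule order_tendstoD) (use lam q e_pos in \<open>simp add: A_def\<close>)
  then have "\<forall>\<^sub>F \<epsilon> in at_right 0. a / 2 * N * \<epsilon> powr (2 - q) + b / 4 * N\<^sup>2 * \<epsilon> powr (4 - q) < lam / q * A \<and> 0 < \<epsilon>"
    by (rule eventually_conj) (rule eventually_at_right_less)
  then obtain \<epsilon> where \<epsilon>: "a / 2 * N * \<epsilon> powr (2 - q) + b / 4 * N\<^sup>2 * \<epsilon> powr (4 - q) < lam / q * A" "0 < \<epsilon>"
    using eventually_happens'[OF trivial_limit_at_right_real] by blast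
  (* w = eps e *)
  define w where "w = comb e (\<epsilon> - 1) e"
  have w: "w \<in> Y" unfolding w_def by (rule comb_in[OF e e])
  have ipw: "ip w z = \<epsilon> * ip e z" if "z \<in> Y" for z
    unfolding w_def ip_comb[OF e e that] by (simp add: algebra_simps)
  have Nw: "ip w w = \<epsilon>\<^sup>2 * N"
    unfolding ipw[OF w] ip_sym[of e w] ipw[OF e] N_def by (simp add: power2_eq_square)
  have trw: "tr w x = \<epsilon> * tr e x" for x unfolding w_def tr_comb[OF e e] by (simp add: algebra_simps)
  have ci: "set_integrable lborel cube (\<lambda>x. \<bar>tr v x\<bar> powr r)" if "v \<in> Y" "0 < r" for v r
    using that by (intro continuous_cube_integrable continuous_on_powr' continuous_intros tr_cont) auto
  have "\<epsilon> powr q * (lam / q * A) = (LINT x:cube|lborel. lam * (\<bar>tr w x\<bar> powr q / q))"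
    unfolding A_def trw abs_mult using \<epsilon>(2) q
    by (subst set_integral_mult_right[symmetric])+ (simp add: powr_mult set_integral_mult_right algebra_simps)
  also have "\<dots> \<le> (LINT x:cube|lborel. potential (tr w x))"
    using p q by (intro set_integral_mono set_integrable_mult_right set_integrable_divide ci w
      continuous_cube_integrable potential_compose_continuous tr_cont) (auto simp: potential_def)
  finally have Q: "\<epsilon> powr q * (lam / q * A) \<le> (LINT x:cube|lborel. potential (tr w x))" .
  have "a / 2 * ip w w + b / 4 * (ip w w)\<^sup>2 = \<epsilon> powr q * (a / 2 * N * \<epsilon> powr (2 - q) + b / 4 * N\<^sup>2 * \<epsilon> powr (4 - q))"
  proof -
    have "\<epsilon> powr q * \<epsilon> powr (2 - q) = \<epsilon>\<^sup>2" "\<epsilon> powr q * \<epsilon> powr (4 - q) = \<epsilon>^4"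
      using \<epsilon>(2) by (simp_all add: powr_numeral flip: powr_add)
    then show ?thesis unfolding Nw by (simp add: algebra_simps power_mult_distrib)
  qed
  also have "\<dots> < \<epsilon> powr q * (lam / q * A)" using \<epsilon> by (intro mult_strict_left_mono) auto
  finally have "energy w < 0" using Q unfolding energy_def by linarith
  then show ?thesis using w by blast
qed

end

lemma divide_succ_mult_less: "0 < \<epsilon> \<Longrightarrow> 0 \<le> x \<Longrightarrow> \<epsilon> / (x + 1) * x < (\<epsilon>::real)"
  by (simp add: field_simps)

context kirchhoff
begin

abbreviation dsq :: "'v \<Rightarrow> 'v \<Rightarrow> real" where
  "dsq v w \<equiv> ip (comb v (-1) w) (comb v (-1) w)"

lemma ip_comb_right:
  assumes "v \<in> Y" "w \<in> Y" "z \<in> Y"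
  shows "ip z (comb v t w) = ip z v + t * ip z w"
  using ip_comb[OF assms, of t] ip_sym by metis

lemma ip_comb_self:
  assumes v: "v \<in> Y" and w: "w \<in> Y"
  shows "ip (comb v t w) (comb v t w) = ip v v + 2 * t * ip v w + t\<^sup>2 * ip w w"
proof -
  have "ip (comb v t w) (comb v t w) = ip v (comb v t w) + t * ip w (comb v t w)"
    by (rule ip_comb[OF v w comb_in[OF v w]])
  also have "ip v (comb v t w) = ip v v + t * ip v w" by (rule ip_comb_right[OF v w v])
  also have "ip w (comb v t w) = ip v w + t * ip w w" using ip_comb_right[OF v w w, of t] ip_sym[of w v] by simp
  finally show ?thesis by (simp add: power2_eq_square algebra_simps)
qed

text \<open>
The parallelogram identity for the midpoint of \<open>v\<close> and \<open>w\<close>, whose energy is at least \<open>I\<close>. The quadratic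
form is uniformly convex and the quartic term is convex, so the distance of \<open>v\<close> and \<open>w\<close> is
controlled by their excess energy and the failure of convexity of the potential part.
\<close>

lemma midpoint_estimate:
  assumes v: "v \<in> Y" and w: "w \<in> Y" and I: "\<And>v. v \<in> Y \<Longrightarrow> I \<le> energy v"
  shows "a / 8 * dsq v w \<le> (energy v + energy w) / 2 - I
    + ((LINT x:cube|lborel. potential (tr v x)) + (LINT x:cube|lborel. potential (tr w x))) / 2
    - (LINT x:cube|lborel. potential ((tr v x + tr w x) / 2))"
proof -
  (* the midpoint w + (v - w) / 2 *)
  define z where "z = comb w (1/2) (comb v (-1) w)"
  have d: "comb v (-1) w \<in> Y" by (rule comb_in[OF v w])
  have z: "z \<in> Y" unfolding z_def by (rule comb_in[OF w d])
  have trz: "tr z x = (tr v x + tr w x) / 2" for x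
    unfolding z_def tr_comb[OF w d] tr_comb[OF v w] by (simp add: field_simps)
  have dd: "dsq v w = ip v v - 2 * ip v w + ip w w" using ip_comb_self[OF v w, of "-1"] by simp
  have "ip z z = ip w w + ip w (comb v (-1) w) + dsq v w / 4"
    unfolding z_def ip_comb_self[OF w d] by (simp add: power2_eq_square)
  also have "ip w (comb v (-1) w) = ip v w - ip w w" using ip_comb_right[OF v w w, of "-1"] ip_sym[of w v] by simp
  finally have zz: "ip z z = (ip v v + ip w w) / 2 - dsq v w / 4" unfolding dd by (simp add: field_simps)
  have dnn: "0 \<le> dsq v w" by (rule ip_nonneg[OF d])
  have znn: "0 \<le> ip z z" by (rule ip_nonneg[OF z])
  have "ip z z \<le> (ip v v + ip w w) / 2" using zz dnn by linarith
  then have "(ip z z)\<^sup>2 \<le> ((ip v v + ip w w) / 2)\<^sup>2" using znn by (intro power_mono)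
  also have "\<dots> \<le> ((ip v v)\<^sup>2 + (ip w w)\<^sup>2) / 2"
    using sum_squares_bound[of "ip v v" "ip w w"] by (simp add: power2_sum power_divide)
  finally have "b / 4 * (ip z z)\<^sup>2 \<le> b / 4 * (((ip v v)\<^sup>2 + (ip w w)\<^sup>2) / 2)" using b by (intro mult_left_mono) auto
  moreover have "I \<le> a / 2 * ip z z + b / 4 * (ip z z)\<^sup>2 - (LINT x:cube|lborel. potential ((tr v x + tr w x) / 2))"
    using I[OF z] unfolding energy_def trz .
  moreover have "a / 2 * ip z z = a / 2 * ((ip v v + ip w w) / 2) - a / 8 * dsq v w" unfolding zz by (simp add: field_simps)
  moreover have "(energy v + energy w) / 2 = a / 2 * ((ip v v + ip w w) / 2) + b / 4 * (((ip v v)\<^sup>2 + (ip w w)\<^sup>2) / 2)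
     - ((LINT x:cube|lborel. potential (tr v x)) + (LINT x:cube|lborel. potential (tr w x))) / 2"
    unfolding energy_def by (simp add: field_simps)
  ultimately show ?thesis by linarith
qed

text \<open>
Coercivity bounds a minimising sequence, so compactness of \<open>tr\<close> provides a pointwise limit of the
images of a subsequence.
\<close>

lemma minimising_sequence:
  "\<exists>v u I M. (\<forall>n. v n \<in> Y) \<and> (\<forall>w\<in>Y. I \<le> energy w) \<and> I < 0 \<and> (\<lambda>n. energy (v n)) \<longlonglongrightarrow> I \<and>
    (\<forall>n. ip (v n) (v n) \<le> M) \<and> 0 \<le> M \<and> continuous_on UNIV u \<and> (\<forall>x. (\<lambda>n. tr (v n) x) \<longlonglongrightarrow> u x)"
proof -
  obtain D where D: "\<And>v. v \<in> Y \<Longrightarrow> b / 8 * (ip v v)\<^sup>2 - D \<le> energy v" using energy_coercive by blast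
  have low: "- D \<le> energy v" if "v \<in> Y" for v
  proof -
    have "0 \<le> b / 8 * (ip v v)\<^sup>2" using b by simp
    then show ?thesis using D[OF that] by linarith
  qed
  define I where "I = Inf (energy ` Y)"
  have bdd: "bdd_below (energy ` Y)" using low by (auto simp: bdd_below_def)
  have I: "I \<le> energy w" if "w \<in> Y" for w unfolding I_def by (rule cInf_lower[OF _ bdd]) (use that in auto)
  have I0: "I < 0" using energy_negative I by fastforce
  have ex: "\<exists>v\<in>Y. energy v < I + 1 / Suc n" for n
  proof -
    have "Inf (energy ` Y) < I + 1 / Suc n" unfolding I_def by simp
    then obtain y where "y \<in> energy ` Y" "y < I + 1 / Suc n" using cInf_lessD[of "energy ` Y"] e by blast
    then show ?thesis by blast
  qed
  then obtain v0 where v0: "\<And>n. v0 n \<in> Y" "\<And>n. energy (v0 n) < I + 1 / Suc n" by metis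
  define M where "M = 1 + 8 / b * (I + 1 + D)"
  have M: "ip (v0 n) (v0 n) \<le> M" for n
  proof -
    have "1 / real (Suc n) \<le> 1" by simp
    then have "b / 8 * (ip (v0 n) (v0 n))\<^sup>2 \<le> I + 1 + D" using D[OF v0(1), of n] v0(2)[of n] by linarith
    then have "(ip (v0 n) (v0 n))\<^sup>2 \<le> 8 / b * (I + 1 + D)" using b by (simp add: field_simps)
    moreover have "x \<le> 1 + x\<^sup>2" for x :: real
    proof -
      have "0 \<le> (x - 1/2)\<^sup>2" by simp
      also have "(x - 1/2)\<^sup>2 = x\<^sup>2 - x + 1/4" by (simp add: power2_eq_square algebra_simps)
      finally show ?thesis by linarith
    qed
    ultimately show ?thesis unfolding M_def by (meson add_left_mono order_trans)
  qed
  obtain r u where r: "strict_mono r" and u: "continuous_on UNIV u" "\<And>x. (\<lambda>n. tr (v0 (r n)) x) \<longlonglongrightarrow> u x"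
    using tr_compact[of v0 M] v0(1) M by blast
  have lim: "(\<lambda>n. energy (v0 (r n))) \<longlonglongrightarrow> I"
  proof (rule real_tendsto_sandwich[OF _ _ tendsto_const])
    show "\<forall>\<^sub>F n in sequentially. I \<le> energy (v0 (r n))" using I v0(1) by simp
    have "energy (v0 (r n)) \<le> I + inverse (real (Suc n))" for n
    proof -
      have "n \<le> r n" using r by (rule seq_suble)
      then have "1 / real (Suc (r n)) \<le> 1 / real (Suc n)" by (simp add: field_simps)
      then show ?thesis using v0(2)[of "r n"] by (simp add: inverse_eq_divide)
    qed
    then show "\<forall>\<^sub>F n in sequentially. energy (v0 (r n)) \<le> I + inverse (real (Suc n))" by simp
    show "(\<lambda>n. I + inverse (real (Suc n))) \<longlonglongrightarrow> I"
      using tendsto_add[OF tendsto_const LIMSEQ_inverse_real_of_nat, of I] by simp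
  qed
  have "0 \<le> M" using M[of 0] ip_nonneg[OF v0(1), of 0] by linarith
  then show ?thesis
    by (intro exI[of _ "\<lambda>n. v0 (r n)"] exI[of _ u] exI[of _ I] exI[of _ M])
      (use v0(1) I I0 lim M u in auto)
qed

text \<open>
In \<open>midpoint_estimate\<close>, applied along a minimising sequence, the potential terms have a common limit
and cancel, so the sequence is a Cauchy sequence. The energy then converges along every line
through the sequence, to a differentiable function \<open>\<psi>\<close> with a minimum at 0; the
Euler-Lagrange equation is \<open>\<psi>' 0 = 0\<close>. The limit is not zero because its energy is negative.
\<close>

lemma ground_state:
  "\<exists>v u. (\<forall>n. v n \<in> Y) \<and>
    (\<forall>\<epsilon>>0. \<exists>N. \<forall>i\<ge>N. \<forall>j\<ge>N. dsq (v i) (v j) < \<epsilon>) \<and>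
    continuous_on UNIV u \<and> (\<forall>x. (\<lambda>n. tr (v n) x) \<longlonglongrightarrow> u x) \<and>
    (\<exists>B. \<forall>n. ip (v n) (v n) \<le> B) \<and>
    0 < (LINT x:cube|lborel. potential (u x)) \<and>
    (\<forall>w\<in>Y. (\<lambda>n. (a + b * ip (v n) (v n)) * ip (v n) w) \<longlonglongrightarrow> (LINT x:cube|lborel. nonlinearity (u x) * tr w x))"
proof -
  obtain v u I M where v: "\<And>n. v n \<in> Y" and I: "\<And>w. w \<in> Y \<Longrightarrow> I \<le> energy w" and I0: "I < 0"
    and Jl: "(\<lambda>n. energy (v n)) \<longlonglongrightarrow> I" and M: "\<And>n. ip (v n) (v n) \<le> M" "0 \<le> M"
    and uc: "continuous_on UNIV u" and ul: "\<And>x. (\<lambda>n. tr (v n) x) \<longlonglongrightarrow> u x"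
    using minimising_sequence by blast
  define L where "L = K * sqrt M"
  have L: "0 \<le> L" unfolding L_def using K M by simp
  have trL: "\<bar>tr (v n) x\<bar> \<le> L" for n x
    using tr_bound[OF v, of n x] M(1)[of n] K unfolding L_def
    by (meson mult_left_mono order_trans real_sqrt_le_mono)
  have Ql: "(\<lambda>n. LINT x:cube|lborel. potential (tr (v (i n)) x)) \<longlonglongrightarrow> (LINT x:cube|lborel. potential (u x))"
    if "filterlim i at_top sequentially" for i :: "nat \<Rightarrow> nat"
    by (rule potential_integral_limit[OF tr_cont[OF v] uc trL]) (rule filterlim_compose[OF ul that])
  have Cauchy: "\<exists>N. \<forall>i\<ge>N. \<forall>j\<ge>N. dsq (v i) (v j) < \<epsilon>" if \<epsilon>: "0 < \<epsilon>" for \<epsilon>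
  proof (rule ccontr)
    assume "\<not> ?thesis"
    then have "\<forall>N. \<exists>i j. i \<ge> N \<and> j \<ge> N \<and> \<epsilon> \<le> dsq (v i) (v j)" by (meson not_le)
    then obtain i j where ij: "\<And>N. i N \<ge> N" "\<And>N. j N \<ge> N" "\<And>N. \<epsilon> \<le> dsq (v (i N)) (v (j N))" by metis
    have fi: "filterlim i at_top sequentially" by (rule filterlim_at_top_mono[OF filterlim_ident]) (simp add: ij)
    have fj: "filterlim j at_top sequentially" by (rule filterlim_at_top_mono[OF filterlim_ident]) (simp add: ij)
    let ?Q = "\<lambda>f. LINT x:cube|lborel. potential (f x)"
    have mid: "(\<lambda>n. ?Q (\<lambda>x. (tr (v (i n)) x + tr (v (j n)) x) / 2)) \<longlonglongrightarrow> ?Q u"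
    proof (rule potential_integral_limit[OF _ uc])
      show "continuous_on UNIV (\<lambda>x. (tr (v (i n)) x + tr (v (j n)) x) / 2)" for n
        by (intro continuous_intros tr_cont v) auto
      show "\<bar>(tr (v (i n)) x + tr (v (j n)) x) / 2\<bar> \<le> L" for n x
        using trL[of "i n" x] trL[of "j n" x] by simp
      have "(\<lambda>n. (tr (v (i n)) x + tr (v (j n)) x) / 2) \<longlonglongrightarrow> (u x + u x) / 2" for x
        by (intro tendsto_intros filterlim_compose[OF ul fi] filterlim_compose[OF ul fj]) simp
      then show "(\<lambda>n. (tr (v (i n)) x + tr (v (j n)) x) / 2) \<longlonglongrightarrow> u x" for x by simp
    qed
    (* the energies tend to I, the potentials at v (i n), v (j n) and at the midpoint to one limit *)
    have "(\<lambda>n. (energy (v (i n)) + energy (v (j n))) / 2 - I + (?Q (tr (v (i n))) + ?Q (tr (v (j n)))) / 2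
       - ?Q (\<lambda>x. (tr (v (i n)) x + tr (v (j n)) x) / 2)) \<longlonglongrightarrow> (I + I) / 2 - I + (?Q u + ?Q u) / 2 - ?Q u"
      by (intro tendsto_intros mid Ql fi fj filterlim_compose[OF Jl fi] filterlim_compose[OF Jl fj]) simp_all
    then have "(\<lambda>n. (energy (v (i n)) + energy (v (j n))) / 2 - I + (?Q (tr (v (i n))) + ?Q (tr (v (j n)))) / 2
       - ?Q (\<lambda>x. (tr (v (i n)) x + tr (v (j n)) x) / 2)) \<longlonglongrightarrow> 0" by simp
    moreover have "a / 8 * \<epsilon> \<le> (energy (v (i n)) + energy (v (j n))) / 2 - I + (?Q (tr (v (i n))) + ?Q (tr (v (j n)))) / 2
       - ?Q (\<lambda>x. (tr (v (i n)) x + tr (v (j n)) x) / 2)" for n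
      using midpoint_estimate[OF v v I, of "i n" "j n"] mult_left_mono[OF ij(3)[of n], of "a / 8"] a by linarith
    ultimately have "a / 8 * \<epsilon> \<le> 0" by (intro LIMSEQ_le_const) auto
    then show False using a \<epsilon> by (simp add: mult_le_0_iff)
  qed
  have ipC: "convergent (\<lambda>n. ip (v n) w)" if w: "w \<in> Y" for w
  proof -
    have "Cauchy (\<lambda>n. ip (v n) w)"
    proof (rule CauchyI')
      fix \<epsilon> :: real assume \<epsilon>: "0 < \<epsilon>"
      define \<eta> where "\<eta> = \<epsilon> / (sqrt (ip w w) + 1)"
      have W: "0 \<le> sqrt (ip w w)" using ip_nonneg[OF w] by simp
      have \<eta>: "0 < \<eta>" unfolding \<eta>_def by (rule divide_pos_pos[OF \<epsilon> add_nonneg_pos[OF W zero_less_one]])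
      obtain N where N: "\<And>i j. i \<ge> N \<Longrightarrow> j \<ge> N \<Longrightarrow> dsq (v i) (v j) < \<eta>\<^sup>2" using Cauchy[of "\<eta>\<^sup>2"] \<eta> by auto
      have "dist (ip (v i) w) (ip (v j) w) < \<epsilon>" if "i \<ge> N" "j > i" for i j
      proof -
        have "dist (ip (v i) w) (ip (v j) w) = \<bar>ip (comb (v i) (-1) (v j)) w\<bar>"
          using ip_comb[OF v v w, of i "-1" j] by (simp add: dist_real_def)
        also have "\<dots> \<le> sqrt (dsq (v i) (v j)) * sqrt (ip w w)" by (rule ip_CS[OF comb_in[OF v v] w])
        also have "\<dots> \<le> \<eta> * sqrt (ip w w)"
        proof (rule mult_right_mono[OF _ W])
          have "sqrt (dsq (v i) (v j)) \<le> sqrt (\<eta>\<^sup>2)" using N[of i j] that by (intro real_sqrt_le_mono) auto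
          then show "sqrt (dsq (v i) (v j)) \<le> \<eta>" using \<eta> by simp
        qed
        also have "\<dots> < \<epsilon>" unfolding \<eta>_def by (rule divide_succ_mult_less[OF \<epsilon> W])
        finally show ?thesis .
      qed
      then show "\<exists>N. \<forall>i\<ge>N. \<forall>j>i. dist (ip (v i) w) (ip (v j) w) < \<epsilon>" by blast
    qed
    then show ?thesis by (simp add: Cauchy_convergent_iff)
  qed
  have NC: "convergent (\<lambda>n. ip (v n) (v n))"
  proof -
    have "Cauchy (\<lambda>n. ip (v n) (v n))"
    proof (rule CauchyI')
      fix \<epsilon> :: real assume \<epsilon>: "0 < \<epsilon>"
      define \<eta> where "\<eta> = \<epsilon> / (2 * sqrt M + 1)"
      have W: "0 \<le> sqrt M" using M by simp
      have \<eta>: "0 < \<eta>" unfolding \<eta>_def by (rule divide_pos_pos[OF \<epsilon> add_nonneg_pos[OF _ zero_less_one]]) (use W in simp)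
      obtain N where N: "\<And>i j. i \<ge> N \<Longrightarrow> j \<ge> N \<Longrightarrow> dsq (v i) (v j) < \<eta>\<^sup>2" using Cauchy[of "\<eta>\<^sup>2"] \<eta> by auto
      have "dist (ip (v i) (v i)) (ip (v j) (v j)) < \<epsilon>" if "i \<ge> N" "j > i" for i j
      proof -
        let ?d = "comb (v i) (-1) (v j)"
        have d: "?d \<in> Y" by (rule comb_in[OF v v])
        have "sqrt (dsq (v i) (v j)) \<le> sqrt (\<eta>\<^sup>2)" using N[of i j] that by (intro real_sqrt_le_mono) auto
        then have s\<eta>: "sqrt (dsq (v i) (v j)) \<le> \<eta>" using \<eta> by simp
        have one: "\<bar>ip ?d (v k)\<bar> \<le> \<eta> * sqrt M" for k
        proof -
          have "\<bar>ip ?d (v k)\<bar> \<le> sqrt (dsq (v i) (v j)) * sqrt (ip (v k) (v k))" by (rule ip_CS[OF d v])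
          also have "\<dots> \<le> \<eta> * sqrt M" using s\<eta> M \<eta> ip_nonneg[OF d] ip_nonneg[OF v] by (intro mult_mono real_sqrt_le_mono) auto
          finally show ?thesis .
        qed
        have "ip (v i) (v i) - ip (v j) (v j) = ip ?d (v i) + ip ?d (v j)"
          using ip_comb[OF v v v, of i "-1" j i] ip_comb[OF v v v, of i "-1" j j] ip_sym[of "v i" "v j"] by simp
        then have "dist (ip (v i) (v i)) (ip (v j) (v j)) \<le> 2 * (\<eta> * sqrt M)"
          using one[of i] one[of j] unfolding dist_real_def by linarith
        also have "\<dots> = \<epsilon> / (2 * sqrt M + 1) * (2 * sqrt M)" unfolding \<eta>_def by simp
        also have "\<dots> < \<epsilon>" by (rule divide_succ_mult_less[OF \<epsilon>]) (use W in simp)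
        finally show ?thesis .
      qed
      then show "\<exists>N. \<forall>i\<ge>N. \<forall>j>i. dist (ip (v i) (v i)) (ip (v j) (v j)) < \<epsilon>" by blast
    qed
    then show ?thesis by (simp add: Cauchy_convergent_iff)
  qed
  define S where "S = lim (\<lambda>n. ip (v n) (v n))"
  have S: "(\<lambda>n. ip (v n) (v n)) \<longlonglongrightarrow> S" unfolding S_def using NC by (simp only: convergent_LIMSEQ_iff)
  have S0: "0 \<le> S" by (rule LIMSEQ_le_const[OF S]) (use ip_nonneg v in blast)
  have JI: "a / 2 * S + b / 4 * S\<^sup>2 - (LINT x:cube|lborel. potential (u x)) = I"
  proof (rule LIMSEQ_unique[OF _ Jl])
    show "(\<lambda>n. energy (v n)) \<longlonglongrightarrow> a / 2 * S + b / 4 * S\<^sup>2 - (LINT x:cube|lborel. potential (u x))"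
      unfolding energy_def by (intro tendsto_intros S Ql[of "\<lambda>n. n"] filterlim_ident)
  qed
  have "0 \<le> a / 2 * S" "0 \<le> b / 4 * S\<^sup>2" using a b S0 by auto
  then have pos: "0 < (LINT x:cube|lborel. potential (u x))" using JI I0 by linarith
  have EL: "(\<lambda>n. (a + b * ip (v n) (v n)) * ip (v n) w) \<longlonglongrightarrow> (LINT x:cube|lborel. nonlinearity (u x) * tr w x)" if w: "w \<in> Y" for w
  proof -
    define T where "T = lim (\<lambda>n. ip (v n) w)"
    have T: "(\<lambda>n. ip (v n) w) \<longlonglongrightarrow> T" unfolding T_def using ipC[OF w] by (simp only: convergent_LIMSEQ_iff)
    (* the limits of the squared norm and of the energy of v n + t w *)
    define N where "N t = S + 2 * t * T + t\<^sup>2 * ip w w" for t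
    define \<psi> where "\<psi> t = a / 2 * N t + b / 4 * (N t)\<^sup>2 - (LINT x:cube|lborel. potential (u x + t * tr w x))" for t
    have wc: "continuous_on A (tr w)" for A by (rule tr_cont[OF w])
    have ucA: "continuous_on A u" for A by (rule continuous_on_subset[OF uc]) simp
    have \<psi>I: "I \<le> \<psi> t" for t
    proof (rule LIMSEQ_le_const)
      show "\<exists>n0. \<forall>n\<ge>n0. I \<le> energy (comb (v n) t w)" using I comb_in v w by blast
      have Qt: "(\<lambda>n. LINT x:cube|lborel. potential (tr (v n) x + t * tr w x)) \<longlonglongrightarrow> (LINT x:cube|lborel. potential (u x + t * tr w x))"
      proof (rule potential_integral_limit)
        show "\<bar>tr (v n) x + t * tr w x\<bar> \<le> L + \<bar>t\<bar> * (K * sqrt (ip w w))" for n x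
        proof -
          have "\<bar>t * tr w x\<bar> \<le> \<bar>t\<bar> * (K * sqrt (ip w w))" unfolding abs_mult by (rule mult_left_mono[OF tr_bound[OF w]]) simp
          then show ?thesis using trL[of n x] by linarith
        qed
      qed (intro continuous_intros tr_cont v wc ucA tendsto_intros ul)+
      show "(\<lambda>n. energy (comb (v n) t w)) \<longlonglongrightarrow> \<psi> t"
        unfolding energy_def \<psi>_def N_def ip_comb_self[OF v w] tr_comb[OF v w]
        by (intro tendsto_intros S T Qt)
    qed
    have \<psi>0: "\<psi> 0 = I" using JI by (simp add: \<psi>_def N_def)
    have Qd: "((\<lambda>t. LINT x:cube|lborel. potential (u x + t * tr w x)) has_real_derivative (LINT x:cube|lborel. nonlinearity (u x) * tr w x)) (at 0)"
    proof -
      have cp: "continuous_on closed_cube (\<lambda>x. potential (u x + t * tr w x))" for t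
        by (intro potential_compose_continuous continuous_intros wc ucA)
      have cn: "continuous_on closed_cube (\<lambda>x. nonlinearity (u x) * tr w x)"
        by (intro continuous_intros wc continuous_on_compose2[OF nonlinearity_continuous[of UNIV] ucA]) auto
      have "((\<lambda>t. integral closed_cube (\<lambda>x. potential (u x + t * tr w x))) has_real_derivative
          integral closed_cube (\<lambda>x. nonlinearity (u x + 0 * tr w x) * tr w x)) (at 0 within UNIV)"
      proof (rule leibniz_rule_field_derivative)
        show "((\<lambda>t. potential (u x + t * tr w x)) has_real_derivative nonlinearity (u x + t * tr w x) * tr w x) (at t within UNIV)" for t x
          by (rule DERIV_chain2[OF potential_deriv]) (auto intro!: derivative_eq_intros)
        show "(\<lambda>x. potential (u x + t * tr w x)) integrable_on closed_cube" for t
          by (rule integrable_continuous[OF cp])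
        show "continuous_on (UNIV \<times> closed_cube) (\<lambda>(t, x). nonlinearity (u x + t * tr w x) * tr w x)"
          unfolding split_def
          by (intro continuous_intros continuous_on_compose2[OF nonlinearity_continuous[of UNIV]] continuous_on_compose2[OF wc[of UNIV]] continuous_on_compose2[OF ucA[of UNIV]]) auto
      qed auto
      then show ?thesis unfolding cube_integral_eq[OF cp] cube_integral_eq[OF cn] by simp
    qed
    have "(\<psi> has_real_derivative a * T + b * S * T - (LINT x:cube|lborel. nonlinearity (u x) * tr w x)) (at 0)"
    proof -
      have Nd: "(N has_real_derivative 2 * T) (at 0)" unfolding N_def by (auto intro!: derivative_eq_intros)
      have N0: "N 0 = S" by (simp add: N_def)
      show ?thesis unfolding \<psi>_def
        by (auto intro!: derivative_eq_intros Nd Qd simp: N0)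
    qed
    then have "a * T + b * S * T - (LINT x:cube|lborel. nonlinearity (u x) * tr w x) = 0"
      by (rule DERIV_local_min[of _ _ _ 1]) (use \<psi>I \<psi>0 in auto)
    then have "(LINT x:cube|lborel. nonlinearity (u x) * tr w x) = (a + b * S) * T" by (simp add: algebra_simps)
    then show ?thesis by (simp only:) (intro tendsto_intros S T)
  qed
  show ?thesis
    by (intro exI[of _ v] exI[of _ u]) (use v Cauchy uc ul M pos EL in blast)
qed

end

section \<open>The odd modes of the trace\<close>

definition weight_const :: "real \<Rightarrow> real" where
  "weight_const s = sqrt (\<Sum>j. (real j + 1) powr (1/4 - 2 * s))"

lemma weight_summable: "3/4 < s \<Longrightarrow> summable (\<lambda>j. (real j + 1) powr (1/4 - 2 * s))"
  using summable_real_powr_iff[of "1/4 - 2 * s"] summable_Suc_iff[of "\<lambda>j. real j powr (1/4 - 2 * s)"]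
  by (simp add: add.commute)

text \<open>
The Cauchy-Schwarz inequality. The exponent \<open>1/8\<close> leaves room for one Hoelder estimate of the
exponentials: with \<open>s > 3/4\<close> the series of \<open>j powr (1/4 - 2 * s)\<close> converges.
\<close>

lemma weighted_series_bound:
  fixes c z :: "nat \<Rightarrow> complex"
  assumes s: "3/4 < s" and A: "0 \<le> A" and c: "\<And>F. finite F \<Longrightarrow> (\<Sum>j\<in>F. (real j + 1) powr (2 * s) * (cmod (c j))\<^sup>2) \<le> A\<^sup>2"
    and D: "0 \<le> D" and z: "\<And>j. cmod (z j) \<le> D * (real j + 1) powr (1/8)"
  shows "summable (\<lambda>j. c j * z j)" "cmod (\<Sum>j. c j * z j) \<le> A * D * weight_const s"
proof -
  have W: "0 \<le> weight_const s" unfolding weight_const_def by (intro real_sqrt_ge_zero suminf_nonneg weight_summable s) simp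
  have part: "(\<Sum>j\<in>F. cmod (c j * z j)) \<le> A * D * weight_const s" if F: "finite F" for F
  proof (rule power2_le_imp_le)
    have "(\<Sum>j\<in>F. cmod (c j * z j)) \<le> (\<Sum>j\<in>F. ((real j + 1) powr s * cmod (c j)) * (D * (real j + 1) powr (1/8 - s)))"
    proof (rule sum_mono)
      fix j
      have "(real j + 1) powr s * (real j + 1) powr (1/8 - s) = (real j + 1) powr (1/8)" by (simp flip: powr_add)
      then have "cmod (c j) * (D * (real j + 1) powr (1/8)) = ((real j + 1) powr s * cmod (c j)) * (D * (real j + 1) powr (1/8 - s))"
        by (metis mult.assoc mult.commute)
      moreover have "cmod (c j * z j) \<le> cmod (c j) * (D * (real j + 1) powr (1/8))"
        unfolding norm_mult by (rule mult_left_mono[OF z]) simp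
      ultimately show "cmod (c j * z j) \<le> ((real j + 1) powr s * cmod (c j)) * (D * (real j + 1) powr (1/8 - s))"
        by (simp only:)
    qed
    then have "(\<Sum>j\<in>F. cmod (c j * z j))\<^sup>2 \<le> (\<Sum>j\<in>F. ((real j + 1) powr s * cmod (c j)) * (D * (real j + 1) powr (1/8 - s)))\<^sup>2"
      by (intro power_mono sum_nonneg) auto
    also have "\<dots> \<le> (\<Sum>j\<in>F. ((real j + 1) powr s * cmod (c j))\<^sup>2) * (\<Sum>j\<in>F. (D * (real j + 1) powr (1/8 - s))\<^sup>2)"
      by (rule Cauchy_Schwarz_ineq_sum)
    also have "\<dots> \<le> A\<^sup>2 * (D\<^sup>2 * (weight_const s)\<^sup>2)"
    proof (rule mult_mono)
      have "((real j + 1) powr s)\<^sup>2 = (real j + 1) powr (2 * s)" for j by (simp add: power2_eq_square flip: powr_add)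
      then show "(\<Sum>j\<in>F. ((real j + 1) powr s * cmod (c j))\<^sup>2) \<le> A\<^sup>2" using c[OF F] by (simp add: power_mult_distrib)
      have "((real j + 1) powr (1/8 - s))\<^sup>2 = (real j + 1) powr (1/4 - 2 * s)" for j
        by (simp add: power2_eq_square flip: powr_add)
      then have "(\<Sum>j\<in>F. (D * (real j + 1) powr (1/8 - s))\<^sup>2) = D\<^sup>2 * (\<Sum>j\<in>F. (real j + 1) powr (1/4 - 2 * s))"
        by (simp add: power_mult_distrib sum_distrib_left)
      also have "\<dots> \<le> D\<^sup>2 * (\<Sum>j. (real j + 1) powr (1/4 - 2 * s))"
        by (intro mult_left_mono sum_le_suminf weight_summable s F) auto
      also have "(\<Sum>j. (real j + 1) powr (1/4 - 2 * s)) = (weight_const s)\<^sup>2"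
        unfolding weight_const_def by (subst real_sqrt_pow2) (auto intro!: suminf_nonneg weight_summable s)
      finally show "(\<Sum>j\<in>F. (D * (real j + 1) powr (1/8 - s))\<^sup>2) \<le> D\<^sup>2 * (weight_const s)\<^sup>2" .
    qed (auto intro!: sum_nonneg)
    finally show "(\<Sum>j\<in>F. cmod (c j * z j))\<^sup>2 \<le> (A * D * weight_const s)\<^sup>2" by (simp add: power_mult_distrib)
    show "0 \<le> A * D * weight_const s" using A D W by simp
  qed
  have sn: "summable (\<lambda>j. cmod (c j * z j))"
    by (rule bounded_imp_summable[where B="A * D * weight_const s"]) (use part in auto)
  then show "summable (\<lambda>j. c j * z j)" by (rule summable_norm_cancel)
  have "cmod (\<Sum>j. c j * z j) \<le> (\<Sum>j. cmod (c j * z j))" by (rule summable_norm[OF sn])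
  also have "\<dots> \<le> A * D * weight_const s" by (rule suminf_le_const[OF sn]) (use part in auto)
  finally show "cmod (\<Sum>j. c j * z j) \<le> A * D * weight_const s" .
qed

lemma norm_cis_diff_le: "cmod (cis x - cis y) \<le> \<bar>x - y\<bar>"
proof -
  have "cis x - cis y = cis y * (exp (\<i> * of_real (x - y)) - 1)"
  proof -
    have "cis x = cis y * cis (x - y)" by (simp add: cis_mult)
    then show ?thesis by (simp add: cis_conv_exp algebra_simps)
  qed
  then have "cmod (cis x - cis y) = 2 * \<bar>sin ((x - y) / 2)\<bar>" using dist_exp_i_1[of "x - y"] by (simp add: norm_mult)
  then show ?thesis using abs_sin_x_le_abs_x[of "(x - y) / 2"] by simp
qed

text \<open>
Exponentials are bounded and Lipschitz continuous. Interpolation trades regularity for a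
smaller power of the frequency, small enough for \<open>weighted_series_bound\<close>.
\<close>

lemma norm_cis_diff_Holder:
  "cmod (cis ((2 * real j + 1) * t) - cis ((2 * real j + 1) * t')) \<le> 4 * \<bar>t - t'\<bar> powr (1/8) * (real j + 1) powr (1/8)"
proof -
  have h: "cmod (cis x - cis y) \<le> 2 * \<bar>x - y\<bar> powr (1/8)" for x y
  proof (cases "\<bar>x - y\<bar> \<le> 1")
    case True
    have "\<bar>x - y\<bar> \<le> \<bar>x - y\<bar> powr (1/8)"
    proof (cases "x = y")
      case False
      then have "\<bar>x - y\<bar> powr 1 \<le> \<bar>x - y\<bar> powr (1/8)" using True by (intro powr_mono') auto
      then show ?thesis using False by simp
    qed simp
    then show ?thesis using norm_cis_diff_le[of x y] by (smt (verit) powr_ge_zero)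
  next
    case False
    have "cmod (cis x - cis y) \<le> 2" using norm_triangle_ineq4[of "cis x" "cis y"] by simp
    moreover have "1 \<le> \<bar>x - y\<bar> powr (1/8)" using False by (intro ge_one_powr_ge_zero) auto
    ultimately show ?thesis by linarith
  qed
  have "\<bar>(2 * real j + 1) * t - (2 * real j + 1) * t'\<bar> = (2 * real j + 1) * \<bar>t - t'\<bar>"
    by (simp add: abs_mult flip: right_diff_distrib)
  moreover have "((2 * real j + 1) * \<bar>t - t'\<bar>) powr (1/8) \<le> (2 * (real j + 1) * \<bar>t - t'\<bar>) powr (1/8)"
    by (intro powr_mono2 mult_right_mono) auto
  moreover have "(2 * (real j + 1) * \<bar>t - t'\<bar>) powr (1/8) = 2 powr (1/8) * (real j + 1) powr (1/8) * \<bar>t - t'\<bar> powr (1/8)"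
  proof -
    have "(2 * x * y) powr r = 2 powr r * x powr r * y powr r" if "0 \<le> x" "0 \<le> y" for x y r :: real
      using that by (simp add: powr_mult)
    from this[OF _ abs_ge_zero, of "real j + 1" "t - t'" "1/8"] show ?thesis by (simp only: of_nat_0_le_iff add_nonneg_nonneg zero_le_one)
  qed
  moreover have "(2::real) powr (1/8) \<le> 2 powr 1" by (intro powr_mono) auto
  then have "2 powr (1/8) * (real j + 1) powr (1/8) * \<bar>t - t'\<bar> powr (1/8) \<le> 2 * (real j + 1) powr (1/8) * \<bar>t - t'\<bar> powr (1/8)"
    by (intro mult_right_mono) auto
  ultimately show ?thesis using h[of "(2 * real j + 1) * t" "(2 * real j + 1) * t'"] by (simp add: algebra_simps)
qed

text \<open>
Half of the spectrum of the \<open>n\<close>-th solution; the other half consists of the opposite frequencies.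
\<close>

definition odd_freq :: "nat \<Rightarrow> nat \<Rightarrow> int^3" where
  "odd_freq n j = axis 1 (int n * (2 * int j + 1))"

definition mode_coeff :: "nat \<Rightarrow> fun_with_grad \<Rightarrow> nat \<Rightarrow> complex" where
  "mode_coeff n W j = fourier_coeff (\<lambda>x. fst W (x, 0)) (odd_freq n j)"

text \<open>
The projection of the trace to the frequencies \<open>\<plusminus> odd_freq n j\<close>, as a function of \<open>t = n * x $ 1\<close>. The trace is
real, so the coefficients at opposite frequencies are conjugate to each other and twice the real part
collects them.
\<close>

definition odd_modes :: "nat \<Rightarrow> fun_with_grad \<Rightarrow> real \<Rightarrow> real" where
  "odd_modes n W t = 2 * cfac * Re (\<Sum>j. mode_coeff n W j * cis ((2 * real j + 1) * t))"

definition mode_const :: "real \<Rightarrow> real" where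
  "mode_const s = 2 * cfac * (sqrt (2 * kappa s) * weight_const s)"

lemma odd_freq_inj: "0 < n \<Longrightarrow> inj (odd_freq n)"
  by (auto simp: inj_def odd_freq_def axis_eq_axis)

lemma norm_odd_freq: "(norm (freq (odd_freq n j)))\<^sup>2 = (real n * (2 * real j + 1))\<^sup>2"
proof -
  have "(of_int (odd_freq n j $ i) :: real)\<^sup>2 = (if i = 1 then (real n * (2 * real j + 1))\<^sup>2 else 0)" for i
    by (simp add: odd_freq_def axis_def)
  then show ?thesis unfolding norm_freq_sq by simp
qed

lemma mode_coeff_weighted:
  assumes W: "W \<in> smooth_periodic s" and s: "3/4 < s" "s < 1" and m: "0 < m" and n: "0 < n" and F: "finite F"
  shows "(\<Sum>j\<in>F. (real j + 1) powr (2 * s) * (cmod (mode_coeff n W j))\<^sup>2) \<le> (sqrt (2 * kappa s) * X_norm s m W)\<^sup>2"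
proof -
  have s': "1/2 \<le> s" using s by simp
  have kap: "0 < kappa s" by (rule kappa_pos) (use s in auto)
  have "(real j + 1) powr (2 * s) * (cmod (mode_coeff n W j))\<^sup>2 \<le> Hs_term s m (\<lambda>x. fst W (x, 0)) (odd_freq n j)" for j
  proof -
    have "real j + 1 \<le> real n * (2 * real j + 1)"
    proof -
      have "1 \<le> real n" using n by simp
      have "real j + 1 \<le> 1 * (2 * real j + 1)" by simp
      also have "\<dots> \<le> real n * (2 * real j + 1)" by (rule mult_right_mono[OF \<open>1 \<le> real n\<close>]) simp
      finally show ?thesis .
    qed
    then have "(real j + 1)\<^sup>2 \<le> (real n * (2 * real j + 1))\<^sup>2" by (rule power_mono) simp
    then have "(real j + 1)\<^sup>2 \<le> (norm (freq (odd_freq n j)))\<^sup>2 + m\<^sup>2"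
      unfolding norm_odd_freq using zero_le_power2[of m] by linarith
    then have "((real j + 1)\<^sup>2) powr s \<le> ((norm (freq (odd_freq n j)))\<^sup>2 + m\<^sup>2) powr s" using s by (intro powr_mono2) auto
    moreover have "((real j + 1)\<^sup>2) powr s = (real j + 1) powr (2 * s)"
      by (simp add: powr_powr flip: powr_numeral)
    ultimately show ?thesis unfolding Hs_term_def mode_coeff_def by (intro mult_right_mono) auto
  qed
  then have "(\<Sum>j\<in>F. (real j + 1) powr (2 * s) * (cmod (mode_coeff n W j))\<^sup>2) \<le> (\<Sum>j\<in>F. Hs_term s m (\<lambda>x. fst W (x, 0)) (odd_freq n j))"
    by (rule sum_mono)
  also have "\<dots> = (\<Sum>k\<in>odd_freq n ` F. Hs_term s m (\<lambda>x. fst W (x, 0)) k)"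
    by (subst sum.reindex) (use odd_freq_inj[OF n] in \<open>auto intro: inj_on_subset\<close>)
  also have "\<dots> \<le> 2 * kappa s * (X_norm s m W)\<^sup>2" by (rule Sobolev_trace(1)[OF W s' s(2) m]) (use F in simp)
  also have "\<dots> = (sqrt (2 * kappa s) * X_norm s m W)\<^sup>2" using kap by (simp add: power_mult_distrib)
  finally show ?thesis .
qed

lemma Holder_continuous:
  fixes g :: "real \<Rightarrow> real"
  assumes "\<And>t t'. \<bar>g t - g t'\<bar> \<le> C * \<bar>t - t'\<bar> powr (1/8)"
  shows "continuous_on A g"
proof -
  have "(g \<longlongrightarrow> g t) (at t)" for t
  proof -
    have "((\<lambda>x. C * \<bar>x - t\<bar> powr (1/8)) \<longlongrightarrow> C * \<bar>t - t\<bar> powr (1/8)) (at t)"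
      by (intro tendsto_intros) auto
    then have "((\<lambda>x. C * \<bar>x - t\<bar> powr (1/8)) \<longlongrightarrow> 0) (at t)" by simp
    then have "((\<lambda>x. g x - g t) \<longlongrightarrow> 0) (at t)"
      by (rule Lim_null_comparison[rotated]) (use assms in \<open>auto intro!: always_eventually\<close>)
    then show ?thesis by (simp add: LIM_zero_iff)
  qed
  then show ?thesis by (simp add: continuous_at_imp_continuous_on isCont_def)
qed

context
  fixes s m :: real and n :: nat
  assumes s: "3/4 < s" "s < 1" and m: "0 < m" and n: "0 < n"
begin

lemma trace_factor_nonneg: "0 \<le> sqrt (2 * kappa s) * X_norm s m W"
  using kappa_pos[of s] X_norm_nonneg[of s m W] s by simp

lemma one_le_weight: "1 \<le> (real j + 1) powr (1/8)"
  by (rule ge_one_powr_ge_zero) auto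

lemma odd_modes_summable:
  assumes W: "W \<in> smooth_periodic s"
  shows "summable (\<lambda>j. mode_coeff n W j * cis ((2 * real j + 1) * t))"
  by (rule weighted_series_bound(1)[OF s(1) trace_factor_nonneg mode_coeff_weighted[OF W s m n], of 1]) (use one_le_weight in auto)

lemma mode_const_nonneg: "0 \<le> mode_const s"
  unfolding mode_const_def weight_const_def using kappa_pos[of s] s
  by (intro mult_nonneg_nonneg real_sqrt_ge_zero suminf_nonneg weight_summable) auto

lemma odd_modes_bound:
  assumes W: "W \<in> smooth_periodic s"
  shows "\<bar>odd_modes n W t\<bar> \<le> mode_const s * X_norm s m W"
proof -
  have "cmod (\<Sum>j. mode_coeff n W j * cis ((2 * real j + 1) * t)) \<le> sqrt (2 * kappa s) * X_norm s m W * 1 * weight_const s"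
    by (rule weighted_series_bound(2)[OF s(1) trace_factor_nonneg mode_coeff_weighted[OF W s m n]]) (use one_le_weight in auto)
  then have "\<bar>Re (\<Sum>j. mode_coeff n W j * cis ((2 * real j + 1) * t))\<bar> \<le> sqrt (2 * kappa s) * X_norm s m W * weight_const s"
    using abs_Re_le_cmod order_trans by fastforce
  then have "2 * cfac * \<bar>Re (\<Sum>j. mode_coeff n W j * cis ((2 * real j + 1) * t))\<bar> \<le> 2 * cfac * (sqrt (2 * kappa s) * X_norm s m W * weight_const s)"
    by (intro mult_left_mono) auto
  then show ?thesis unfolding odd_modes_def mode_const_def by (simp add: abs_mult algebra_simps)
qed

lemma odd_modes_Holder:
  assumes W: "W \<in> smooth_periodic s"
  shows "\<bar>odd_modes n W t - odd_modes n W t'\<bar> \<le> mode_const s * X_norm s m W * (4 * \<bar>t - t'\<bar> powr (1/8))"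
proof -
  let ?S = "\<lambda>t. \<Sum>j. mode_coeff n W j * cis ((2 * real j + 1) * t)"
  have "?S t - ?S t' = (\<Sum>j. mode_coeff n W j * (cis ((2 * real j + 1) * t) - cis ((2 * real j + 1) * t')))"
    by (subst suminf_diff[OF odd_modes_summable[OF W] odd_modes_summable[OF W]]) (simp add: right_diff_distrib)
  also have "cmod \<dots> \<le> sqrt (2 * kappa s) * X_norm s m W * (4 * \<bar>t - t'\<bar> powr (1/8)) * weight_const s"
    by (rule weighted_series_bound(2)[OF s(1) trace_factor_nonneg mode_coeff_weighted[OF W s m n]]) (use norm_cis_diff_Holder in auto)
  finally have "\<bar>Re (?S t - ?S t')\<bar> \<le> sqrt (2 * kappa s) * X_norm s m W * (4 * \<bar>t - t'\<bar> powr (1/8)) * weight_const s"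
    using abs_Re_le_cmod order_trans by blast
  then have "2 * cfac * \<bar>Re (?S t - ?S t')\<bar> \<le> 2 * cfac * (sqrt (2 * kappa s) * X_norm s m W * (4 * \<bar>t - t'\<bar> powr (1/8)) * weight_const s)"
    by (intro mult_left_mono) auto
  moreover have "\<bar>odd_modes n W t - odd_modes n W t'\<bar> = 2 * cfac * \<bar>Re (?S t - ?S t')\<bar>"
    unfolding odd_modes_def by (simp add: abs_mult flip: right_diff_distrib)
  ultimately show ?thesis unfolding mode_const_def by (simp add: algebra_simps)
qed

lemma odd_modes_continuous:
  assumes W: "W \<in> smooth_periodic s" shows "continuous_on A (odd_modes n W)"
  by (rule Holder_continuous[of _ "mode_const s * X_norm s m W * 4"])
    (use odd_modes_Holder[OF W] in \<open>simp add: mult.assoc\<close>)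

lemma odd_modes_comb:
  assumes W: "W \<in> smooth_periodic s" and V: "V \<in> smooth_periodic s"
  shows "odd_modes n (fg_comb W c V) t = odd_modes n W t + c * odd_modes n V t"
proof -
  have "(\<Sum>j. mode_coeff n (fg_comb W c V) j * cis ((2 * real j + 1) * t)) =
     (\<Sum>j. mode_coeff n W j * cis ((2 * real j + 1) * t) + of_real c * (mode_coeff n V j * cis ((2 * real j + 1) * t)))"
    unfolding mode_coeff_def fourier_coeff_trace_comb[OF W V] by (simp add: algebra_simps)
  also have "\<dots> = (\<Sum>j. mode_coeff n W j * cis ((2 * real j + 1) * t)) + of_real c * (\<Sum>j. mode_coeff n V j * cis ((2 * real j + 1) * t))"
    by (subst suminf_add[symmetric]) (auto intro!: odd_modes_summable W V summable_mult simp: suminf_mult odd_modes_summable[OF V])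
  finally show ?thesis unfolding odd_modes_def by (simp add: algebra_simps)
qed

lemma odd_modes_antiperiodic:
  assumes W: "W \<in> smooth_periodic s"
  shows "odd_modes n W (t + pi) = - odd_modes n W t"
proof -
  have "cis ((2 * real j + 1) * (t + pi)) = - cis ((2 * real j + 1) * t)" for j
  proof -
    have "cis ((2 * real j + 1) * (t + pi)) = cis ((2 * real j + 1) * t) * cis (of_int (2 * int j + 1) * pi)"
      by (simp add: cis_mult algebra_simps)
    then show ?thesis unfolding cis_int_pi by simp
  qed
  then have "(\<Sum>j. mode_coeff n W j * cis ((2 * real j + 1) * (t + pi))) = (\<Sum>j. - (mode_coeff n W j * cis ((2 * real j + 1) * t)))"
    by (simp only: mult_minus_right)
  also have "\<dots> = - (\<Sum>j. mode_coeff n W j * cis ((2 * real j + 1) * t))"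
    by (rule suminf_minus[OF odd_modes_summable[OF W]])
  finally show ?thesis unfolding odd_modes_def by simp
qed

lemma odd_modes_periodic:
  assumes W: "W \<in> smooth_periodic s"
  shows "odd_modes n W (t + 2 * pi) = odd_modes n W t"
  using odd_modes_antiperiodic[OF W, of "t + pi"] odd_modes_antiperiodic[OF W, of t] by (simp add: add.assoc)

text \<open>
The Hoelder bounds make the projections of a bounded sequence equicontinuous, so the
Arzela-Ascoli theorem applies on one period. Convergence elsewhere follows from
periodicity.
\<close>

lemma odd_modes_compact:
  assumes v: "\<And>k. v k \<in> smooth_periodic s" and R: "\<And>k. X_norm s m (v k) \<le> R"
  shows "\<exists>r G. strict_mono (r :: nat \<Rightarrow> nat) \<and> continuous_on UNIV G \<and> (\<forall>t. (\<lambda>k. odd_modes n (v (r k)) t) \<longlonglongrightarrow> G t)"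
proof -
  have R0: "0 \<le> R" using R[of 0] X_norm_nonneg[of s m "v 0"] s by simp
  have H: "\<bar>odd_modes n (v k) t - odd_modes n (v k) t'\<bar> \<le> mode_const s * R * 4 * \<bar>t - t'\<bar> powr (1/8)" for k t t'
  proof -
    have "mode_const s * X_norm s m (v k) * (4 * \<bar>t - t'\<bar> powr (1/8)) \<le> mode_const s * R * (4 * \<bar>t - t'\<bar> powr (1/8))"
      by (intro mult_right_mono mult_left_mono R mode_const_nonneg) auto
    from order_trans[OF odd_modes_Holder[OF v, of k t t'] this] show ?thesis by (simp only: mult.assoc)
  qed
  have B: "\<bar>odd_modes n (v k) t\<bar> \<le> mode_const s * R" for k t
    using odd_modes_bound[OF v, of k t] mult_left_mono[OF R[of k] mode_const_nonneg] by linarith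
  obtain G0 r where r: "strict_mono (r :: nat \<Rightarrow> nat)"
    and G0: "\<And>\<epsilon>. 0 < \<epsilon> \<Longrightarrow> \<exists>N. \<forall>k x. N \<le> k \<and> x \<in> {-pi..pi} \<longrightarrow> norm (odd_modes n (v (r k)) x - G0 x) < \<epsilon>"
  proof (rule Arzela_Ascoli[of "{-pi..pi}" "\<lambda>k. odd_modes n (v k)" "mode_const s * R"])
    show "norm (odd_modes n (v k) x) \<le> mode_const s * R" for k x using B by simp
    fix x \<epsilon> :: real assume \<epsilon>: "0 < \<epsilon>"
    have "((\<lambda>y. mode_const s * R * 4 * \<bar>x - y\<bar> powr (1/8)) \<longlongrightarrow> mode_const s * R * 4 * \<bar>x - x\<bar> powr (1/8)) (at x)"
      by (intro tendsto_intros) auto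
    then have "((\<lambda>y. mode_const s * R * 4 * \<bar>x - y\<bar> powr (1/8)) \<longlongrightarrow> 0) (at x)" by simp
    then have "\<forall>\<^sub>F y in at x. mode_const s * R * 4 * \<bar>x - y\<bar> powr (1/8) < \<epsilon>" using \<epsilon> by (rule order_tendstoD)
    then obtain d where d: "0 < d" "\<And>y. y \<noteq> x \<Longrightarrow> dist y x < d \<Longrightarrow> mode_const s * R * 4 * \<bar>x - y\<bar> powr (1/8) < \<epsilon>"
      unfolding eventually_at by auto
    have "norm (odd_modes n (v k) x - odd_modes n (v k) y) < \<epsilon>" if "norm (x - y) < d" for k y
    proof (cases "y = x")
      case False
      then show ?thesis using d(2)[of y] H[of k x y] that by (simp add: dist_real_def abs_minus_commute)
    qed (use \<epsilon> in simp)
    then show "\<exists>d>0. \<forall>k y. y \<in> {-pi..pi} \<and> norm (x - y) < d \<longrightarrow> norm (odd_modes n (v k) x - odd_modes n (v k) y) < \<epsilon>"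
      using d(1) by blast
  qed (auto intro: that)
  have conv: "convergent (\<lambda>k. odd_modes n (v (r k)) t)" for t
  proof (rule periodic_reduce[of "\<lambda>t. convergent (\<lambda>k. odd_modes n (v (r k)) t)"])
    fix t assume t: "t \<in> {-pi..pi}"
    have "(\<lambda>k. odd_modes n (v (r k)) t) \<longlonglongrightarrow> G0 t"
      unfolding LIMSEQ_iff using G0 t by meson
    then show "convergent (\<lambda>k. odd_modes n (v (r k)) t)" by (rule convergentI)
  qed (simp add: odd_modes_periodic[OF v])
  (* the limit taken pointwise, since the uniform limit is known on one period only *)
  define G where "G t = lim (\<lambda>k. odd_modes n (v (r k)) t)" for t
  have G: "(\<lambda>k. odd_modes n (v (r k)) t) \<longlonglongrightarrow> G t" for t
    unfolding G_def using conv by (simp only: convergent_LIMSEQ_iff)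
  have "\<bar>G t - G t'\<bar> \<le> mode_const s * R * 4 * \<bar>t - t'\<bar> powr (1/8)" for t t'
    by (rule LIMSEQ_le_const2[OF tendsto_rabs[OF tendsto_diff[OF G G]]]) (use H in blast)
  then have "continuous_on UNIV G" by (rule Holder_continuous)
  then show ?thesis using r G by blast
qed

end

lemma ek_uminus: "ek (- k) x = cnj (ek k x)"
  unfolding ek_def by (simp add: exp_cnj freq_def inner_vec_def sum_negf)

lemma ek_mult: "ek k x * ek l x = ek (k + l) x"
  using ek_mult_cnj[of k x "- l"] by (simp add: ek_uminus)

lemma fourier_coeff_cnj: "fourier_coeff u (- k) = cnj (fourier_coeff u k)"
proof -
  have "(LINT x:cube|lborel. of_real (u x) * ek (- k) x) = (LINT x:cube|lborel. cnj (of_real (u x) * ek k x))"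
    by (simp add: ek_uminus)
  also have "\<dots> = cnj (LINT x:cube|lborel. of_real (u x) * ek k x)"
    unfolding set_lebesgue_integral_def complex_cnj_scaleR[symmetric] by (rule Bochner_Integration.integral_cnj)
  finally show ?thesis unfolding fourier_coeff_ek by simp
qed

lemma fourier_coeff_bounded_limit:
  fixes u :: "real^3 \<Rightarrow> real"
  assumes g: "\<And>N. continuous_on UNIV (g N)" and u: "continuous_on UNIV u"
    and bd: "\<And>N x. \<bar>g N x\<bar> \<le> M" and lim: "\<And>x. (\<lambda>N. g N x) \<longlonglongrightarrow> u x"
  shows "(\<lambda>N. fourier_coeff (g N) k) \<longlonglongrightarrow> fourier_coeff u k"
  unfolding fourier_coeff_ek set_lebesgue_integral_def
proof (intro tendsto_mult tendsto_const integral_dominated_convergence[where w="\<lambda>x. indicator cube x *\<^sub>R M"])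
  have mm: "(\<lambda>x. indicator cube x *\<^sub>R (complex_of_real (f x) * ek k x)) \<in> borel_measurable lborel" if "continuous_on UNIV f" for f
  proof -
    have "continuous_on UNIV (\<lambda>x. complex_of_real (f x) * ek k x)" by (intro continuous_intros that ek_continuous)
    from continuous_set_borel_measurable_cube[OF this] show ?thesis by (simp add: set_borel_measurable_def)
  qed
  show "(\<lambda>x. indicator cube x *\<^sub>R (complex_of_real (u x) * ek k x)) \<in> borel_measurable lborel" by (rule mm[OF u])
  show "(\<lambda>x. indicator cube x *\<^sub>R (complex_of_real (g N x) * ek k x)) \<in> borel_measurable lborel" for N by (rule mm[OF g])
  show "integrable lborel (\<lambda>x. indicator cube x *\<^sub>R M)"
    using cube_integrable_const[of M] by (simp add: set_integrable_def)
  show "AE x in lborel. (\<lambda>N. indicator cube x *\<^sub>R (complex_of_real (g N x) * ek k x)) \<longlonglongrightarrow> indicator cube x *\<^sub>R (complex_of_real (u x) * ek k x)"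
    by (intro AE_I2 tendsto_intros lim)
  show "AE x in lborel. norm (indicator cube x *\<^sub>R (complex_of_real (g N x) * ek k x)) \<le> indicator cube x *\<^sub>R M" for N
    using bd by (intro AE_I2) (simp add: indicator_def norm_mult)
qed

lemma ek_odd_freq: "cnj (ek (odd_freq n j) x) = cis ((2 * real j + 1) * (real n * x $ 1))"
proof -
  have "freq (odd_freq n j) = axis 1 (real n * (2 * real j + 1))"
    by (simp add: vec_eq_iff freq_def odd_freq_def axis_def)
  then have "freq (odd_freq n j) \<bullet> x = (2 * real j + 1) * (real n * x $ 1)"
    by (simp add: inner_axis' mult_ac)
  then show ?thesis unfolding ek_def by (simp add: exp_cnj cis_conv_exp)
qed

lemma odd_freq_neq_uminus: "0 < n \<Longrightarrow> odd_freq n i \<noteq> - odd_freq n j"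
proof
  assume n: "0 < n" and e: "odd_freq n i = - odd_freq n j"
  then have "odd_freq n i $ 1 = (- odd_freq n j) $ 1" by simp
  then have "int n * (2 * int i + 1) = - (int n * (2 * int j + 1))" by (simp add: odd_freq_def)
  moreover have "0 < int n * (2 * int i + 1)" "0 < int n * (2 * int j + 1)" using n by simp_all
  ultimately show False by linarith
qed

lemma odd_modes_coord_continuous:
  fixes m :: real
  assumes "3/4 < s" "s < 1" "0 < m" "0 < n" "W \<in> smooth_periodic s"
  shows "continuous_on A (\<lambda>x::real^3. odd_modes n W (real n * x $ 1))"
  by (rule continuous_on_compose2[OF odd_modes_continuous[OF assms, of UNIV]]) (auto intro!: continuous_intros)

text \<open>
The partial sums are dominated and converge pointwise, so the coefficients are the limits of those of
the partial sums, which orthogonality evaluates.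
\<close>

lemma fourier_coeff_odd_modes:
  fixes m :: real
  assumes s: "3/4 < s" "s < 1" and m: "0 < m" and n: "0 < n" and W: "W \<in> smooth_periodic s"
  shows "fourier_coeff (\<lambda>x. odd_modes n W (real n * x $ 1)) k =
    (if \<exists>j. k = odd_freq n j \<or> k = - odd_freq n j then fourier_coeff (\<lambda>x. fst W (x, 0)) k else 0)"
proof -
  let ?c = "mode_coeff n W"
  define S where "S N x = 2 * cfac * Re (\<Sum>j<N. ?c j * cis ((2 * real j + 1) * (real n * x $ 1)))" for N and x :: "real^3"
  have Sc: "continuous_on UNIV (S N)" for N
    unfolding S_def ek_odd_freq[symmetric] by (intro continuous_intros ek_continuous)
  have Sl: "(\<lambda>N. S N x) \<longlonglongrightarrow> odd_modes n W (real n * x $ 1)" for x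
    unfolding S_def odd_modes_def
    by (intro tendsto_intros summable_LIMSEQ odd_modes_summable[OF s m n W])
  have Sb: "\<bar>S N x\<bar> \<le> 2 * cfac * (sqrt (2 * kappa s) * X_norm s m W * 1 * weight_const s)" for N x
  proof -
    (* partial sums are series with coefficients cut off at N, hence bounded by the same constant *)
    define z where "z j = (if j < N then cis ((2 * real j + 1) * (real n * x $ 1)) else 0)" for j
    have "(\<Sum>j. ?c j * z j) = (\<Sum>j<N. ?c j * z j)" by (rule suminf_finite) (auto simp: z_def)
    also have "\<dots> = (\<Sum>j<N. ?c j * cis ((2 * real j + 1) * (real n * x $ 1)))" by (rule sum.cong) (auto simp: z_def)
    finally have "cmod (\<Sum>j<N. ?c j * cis ((2 * real j + 1) * (real n * x $ 1))) \<le> sqrt (2 * kappa s) * X_norm s m W * 1 * weight_const s"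
      using weighted_series_bound(2)[OF s(1) trace_factor_nonneg[OF s m n, of W] mode_coeff_weighted[OF W s m n], of 1 z] one_le_weight[OF s m n]
      by (simp add: z_def)
    then have "\<bar>Re (\<Sum>j<N. ?c j * cis ((2 * real j + 1) * (real n * x $ 1)))\<bar> \<le> sqrt (2 * kappa s) * X_norm s m W * 1 * weight_const s"
      using abs_Re_le_cmod order_trans by blast
    then show ?thesis unfolding S_def abs_mult by (simp add: mult_left_mono)
  qed
  have fl: "(\<lambda>N. fourier_coeff (S N) k) \<longlonglongrightarrow> fourier_coeff (\<lambda>x. odd_modes n W (real n * x $ 1)) k"
    by (rule fourier_coeff_bounded_limit[OF Sc odd_modes_coord_continuous[OF s m n W] Sb Sl])
  have fS: "fourier_coeff (S N) k = (\<Sum>j<N. (if k = odd_freq n j then ?c j else 0) + (if k = - odd_freq n j then cnj (?c j) else 0))" for N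
  proof -
    have e: "of_real (S N x) * ek k x = (\<Sum>j<N. of_real cfac * ?c j * ek (k - odd_freq n j) x + of_real cfac * cnj (?c j) * ek (k + odd_freq n j) x)" for x
    proof -
      have "2 * of_real (Re z) = z + cnj z" for z by (simp add: complex_eq_iff)
      then have "of_real (2 * cfac * Re z) = of_real cfac * (z + cnj z)" for z
        by (metis (no_types) mult.left_commute of_real_mult of_real_numeral mult.assoc)
      then have "of_real (S N x) = of_real cfac * ((\<Sum>j<N. ?c j * cnj (ek (odd_freq n j) x)) + cnj (\<Sum>j<N. ?c j * cnj (ek (odd_freq n j) x)))"
        unfolding S_def ek_odd_freq[symmetric] .
      also have "\<dots> = (\<Sum>j<N. of_real cfac * ?c j * cnj (ek (odd_freq n j) x) + of_real cfac * cnj (?c j) * ek (odd_freq n j) x)"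
        by (simp add: sum.distrib sum_distrib_left distrib_left mult.assoc)
      finally have eq: "of_real (S N x) = (\<Sum>j<N. of_real cfac * ?c j * cnj (ek (odd_freq n j) x) + of_real cfac * cnj (?c j) * ek (odd_freq n j) x)" .
      have "of_real (S N x) * ek k x = (\<Sum>j<N. of_real cfac * ?c j * (ek k x * cnj (ek (odd_freq n j) x)) + of_real cfac * cnj (?c j) * (ek k x * ek (odd_freq n j) x))"
        unfolding eq sum_distrib_right by (rule sum.cong[OF refl]) (simp only: ring_distribs mult_ac)
      then show ?thesis unfolding ek_mult_cnj ek_mult .
    qed
    have i: "set_integrable lborel cube (\<lambda>x. a * ek l x)" for a l
      by (rule continuous_cube_integrable) (intro continuous_intros ek_continuous)
    have "(LINT x:cube|lborel. of_real (S N x) * ek k x) =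
      (\<Sum>j<N. of_real cfac * ?c j * (LINT x:cube|lborel. ek (k - odd_freq n j) x) + of_real cfac * cnj (?c j) * (LINT x:cube|lborel. ek (k + odd_freq n j) x))"
      unfolding e by (subst set_integrable_finite_sum(2)) (auto intro!: set_integral_add(1) i simp: set_integral_add(2)[OF i i] set_integral_mult_right)
    also have "\<dots> = (\<Sum>j<N. of_real (cfac * (2 * pi)^3) * ((if k = odd_freq n j then ?c j else 0) + (if k = - odd_freq n j then cnj (?c j) else 0)))"
    proof (rule sum.cong[OF refl])
      fix j
      have "k - odd_freq n j = 0 \<longleftrightarrow> k = odd_freq n j" by simp
      moreover have "k + odd_freq n j = 0 \<longleftrightarrow> k = - odd_freq n j" by (simp add: eq_neg_iff_add_eq_0)
      ultimately show "of_real cfac * ?c j * (LINT x:cube|lborel. ek (k - odd_freq n j) x) + of_real cfac * cnj (?c j) * (LINT x:cube|lborel. ek (k + odd_freq n j) x)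
        = of_real (cfac * (2 * pi)^3) * ((if k = odd_freq n j then ?c j else 0) + (if k = - odd_freq n j then cnj (?c j) else 0))"
        unfolding ek_integral by (simp add: algebra_simps)
    qed
    finally have "fourier_coeff (S N) k = of_real (cfac * (cfac * (2 * pi)^3)) * (\<Sum>j<N. (if k = odd_freq n j then ?c j else 0) + (if k = - odd_freq n j then cnj (?c j) else 0))"
      unfolding fourier_coeff_ek by (simp only: sum_distrib_left[symmetric] of_real_mult mult.assoc)
    moreover have "cfac * (cfac * (2 * pi)^3) = 1" using cfac_sq by (simp only: mult.assoc)
    ultimately show ?thesis by (simp only: of_real_1 mult_1)
  qed
  have inj: "odd_freq n i = odd_freq n j \<longleftrightarrow> i = j" for i j using odd_freq_inj[OF n] by (auto simp: inj_def)
  show ?thesis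
  proof (cases "\<exists>j. k = odd_freq n j \<or> k = - odd_freq n j")
    case False
    then have "fourier_coeff (S N) k = 0" for N unfolding fS by simp
    then have "(\<lambda>N. 0) \<longlonglongrightarrow> fourier_coeff (\<lambda>x. odd_modes n W (real n * x $ 1)) k" using fl by simp
    then show ?thesis using False by (simp add: LIMSEQ_const_iff)
  next
    case True
    then obtain i where i: "k = odd_freq n i \<or> k = - odd_freq n i" by blast
    have "fourier_coeff (S N) k = fourier_coeff (\<lambda>x. fst W (x, 0)) k" if N: "N > i" for N
      using i
    proof
      assume k: "k = odd_freq n i"
      have "fourier_coeff (S N) k = (\<Sum>j<N. if j = i then ?c i else 0)"
        unfolding fS unfolding k using odd_freq_neq_uminus[OF n] by (intro sum.cong refl) (auto simp: inj)
      also have "\<dots> = ?c i" using N by simp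
      finally show ?thesis unfolding k mode_coeff_def .
    next
      assume k: "k = - odd_freq n i"
      have "fourier_coeff (S N) k = (\<Sum>j<N. if j = i then cnj (?c i) else 0)"
        unfolding fS unfolding k using odd_freq_neq_uminus[OF n, symmetric] by (intro sum.cong refl) (auto simp: inj)
      also have "\<dots> = cnj (?c i)" using N by simp
      finally show ?thesis unfolding k mode_coeff_def fourier_coeff_cnj .
    qed
    then have "\<forall>\<^sub>F N in sequentially. fourier_coeff (S N) k = fourier_coeff (\<lambda>x. fst W (x, 0)) k"
      using eventually_gt_at_top[of i] by (rule eventually_mono[rotated])
    then have "(\<lambda>N. fourier_coeff (S N) k) \<longlonglongrightarrow> fourier_coeff (\<lambda>x. fst W (x, 0)) k" by (rule tendsto_eventually)
    then show ?thesis using LIMSEQ_unique[OF fl] True by simp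
  qed
qed

text \<open>
The trace and its projection have the same coefficients at the odd multiples of \<open>n\<close> along the first
axis, and \<open>G\<close> is orthogonal to all others by \<open>antiperiodic_orthogonal\<close>.
\<close>

lemma odd_modes_replace_trace:
  fixes m :: real
  assumes s: "3/4 < s" "s < 1" and m: "0 < m" and n: "0 < n" and V: "V \<in> smooth_periodic s"
    and G: "continuous_on UNIV G" "\<And>t. G (t + 2 * pi) = G t" "\<And>t. G (t + pi) = - G t"
  shows "(LINT x:cube|lborel. G (real n * x $ 1) * odd_modes n V (real n * x $ 1)) = (LINT x:cube|lborel. G (real n * x $ 1) * fst V (x, 0))"
proof -
  let ?g = "\<lambda>x::real^3. G (real n * x $ 1)" and ?M = "\<lambda>x::real^3. odd_modes n V (real n * x $ 1)"
  have gc: "continuous_on A ?g" for A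
    by (rule continuous_on_compose2[OF G(1)]) (auto intro!: continuous_intros)
  have Mc: "continuous_on A ?M" for A by (rule odd_modes_coord_continuous[OF s m n V])
  have Vc: "continuous_on A (\<lambda>x. fst V (x, 0))" for A by (rule trace_continuous[OF V])
  have iM: "set_integrable lborel cube ?M" by (rule continuous_cube_integrable[OF Mc])
  have iD: "set_integrable lborel cube (\<lambda>x. fst V (x, 0) - ?M x)"
    by (intro continuous_cube_integrable continuous_intros Mc Vc)
  have "(LINT x:cube|lborel. (fst V (x, 0) - ?M x) * ?g x) = 0"
  proof (rule antiperiodic_orthogonal[OF G iD])
    fix l :: int assume l: "odd l"
    (* ek carries the conjugate exponential, hence the sign *)
    have k: "\<exists>j. axis 1 (- (int n * l)) = odd_freq n j \<or> axis 1 (- (int n * l)) = - odd_freq n j"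
    proof (cases "0 < l")
      case True
      from l obtain i where i: "l = 2 * i + 1" by (blast elim: oddE)
      with True have "int (nat i) = i" by simp
      then have "axis 1 (- (int n * l)) = - odd_freq n (nat i)"
        unfolding odd_freq_def i by (simp add: vec_eq_iff axis_def)
      then show ?thesis by blast
    next
      case False
      from l obtain i where i: "l = 2 * i + 1" by (blast elim: oddE)
      with False have "int (nat (- i - 1)) = - i - 1" by simp
      then have "int n * (2 * int (nat (- i - 1)) + 1) = - (int n * l)"
        unfolding i by (simp only:) (simp add: algebra_simps)
      then have "axis 1 (- (int n * l)) = odd_freq n (nat (- i - 1))"
        unfolding odd_freq_def by (simp only:)
      then show ?thesis by blast
    qed
    let ?k = "axis 1 (- (int n * l)) :: int^3"
    have "fourier_coeff (\<lambda>x. fst V (x, 0) - ?M x) ?k = 0"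
      unfolding fourier_coeff_diff[OF trace_integrable[OF V] iM] fourier_coeff_odd_modes[OF s m n V] using k by simp
    then have z: "(LINT x:cube|lborel. of_real (fst V (x, 0) - ?M x) * ek ?k x) = 0"
      unfolding fourier_coeff_ek by simp
    have "freq ?k \<bullet> x = - (of_int l * (real n * x $ 1))" for x
    proof -
      have "freq ?k = axis 1 (- (real n * of_int l))" by (simp add: vec_eq_iff freq_def axis_def)
      then show ?thesis by (simp add: inner_axis' mult_ac)
    qed
    then have "ek ?k x = cis (of_int l * (real n * x $ 1))" for x
      unfolding ek_def cis_conv_exp by simp
    then show "(LINT x:cube|lborel. (fst V (x, 0) - ?M x) *\<^sub>R cis (of_int l * (real n * x $ 1))) = 0"
      using z by (simp add: scaleR_conv_of_real)
  qed
  moreover have "(LINT x:cube|lborel. (fst V (x, 0) - ?M x) * ?g x) = (LINT x:cube|lborel. ?g x * fst V (x, 0)) - (LINT x:cube|lborel. ?g x * ?M x)"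
    by (subst set_integral_diff(2)[symmetric])
      (auto intro!: continuous_cube_integrable continuous_intros gc Mc Vc simp: algebra_simps)
  ultimately show ?thesis by simp
qed

section \<open>A function with a nonzero odd mode\<close>

lemma weighted_exp_integrable:
  assumes s: "s < 1"
  shows "set_integrable lborel half_cylinder (\<lambda>z. snd z powr (1 - 2 * s) * exp (- snd z))"
proof -
  let ?w = "\<lambda>y::real. indicator {0<..} y * (y powr (1 - 2 * s) * exp (- y))"
  have wm: "?w \<in> borel_measurable borel" by measurable
  have "((\<lambda>y. y powr ((2 - 2 * s) - 1) / exp y) has_integral Gamma (2 - 2 * s)) {0..}"
    by (rule Gamma_integral_real) (use s in simp)
  then have "(\<lambda>y. y powr ((2 - 2 * s) - 1) / exp y) absolutely_integrable_on {0..}"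
    by (intro nonnegative_absolutely_integrable_1) (auto simp: has_integral_integrable)
  then have "(\<lambda>y. y powr ((2 - 2 * s) - 1) / exp y) absolutely_integrable_on {0<..}"
    by (rule set_integrable_subset) auto
  then have "integrable lebesgue (\<lambda>y. indicator {0<..} y *\<^sub>R (y powr ((2 - 2 * s) - 1) / exp y))"
    by (simp only: set_integrable_def)
  moreover have "(\<lambda>y. indicator {0<..} y *\<^sub>R (y powr ((2 - 2 * s) - 1) / exp y)) = ?w"
    by (rule ext) (simp add: exp_minus field_simps)
  ultimately have "integrable lebesgue ?w" by (simp only:)
  then have "integrable lborel ?w" using wm by (simp add: integrable_completion)
  then have fin: "(\<integral>\<^sup>+y. ennreal (?w y) \<partial>lborel) < \<infinity>"
    by (subst nn_integral_eq_integral) (auto simp: indicator_def)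
  have vol: "emeasure lborel cube < \<infinity>" unfolding cube_eq by (rule emeasure_bounded_finite) (rule bounded_box)
  show ?thesis
    unfolding set_integrable_def
  proof (rule integrableI_bounded)
    have "(\<lambda>z. indicator half_cylinder z *\<^sub>R (snd z powr (1 - 2 * s) * exp (- snd z))) \<in> borel_measurable borel"
      by measurable
    then show "(\<lambda>z. indicator half_cylinder z *\<^sub>R (snd z powr (1 - 2 * s) * exp (- snd z))) \<in> borel_measurable lborel" by simp
    have "(\<integral>\<^sup>+z. ennreal (norm (indicator half_cylinder z *\<^sub>R (snd z powr (1 - 2 * s) * exp (- snd z)))) \<partial>lborel)
        = (\<integral>\<^sup>+z. indicator cube (fst z) * ennreal (?w (snd z)) \<partial>(lborel \<Otimes>\<^sub>M lborel))"
      unfolding lborel_prod by (intro nn_integral_cong) (auto simp: half_cylinder_def indicator_def)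
    also have "\<dots> = (\<integral>\<^sup>+x. \<integral>\<^sup>+y. indicator cube x * ennreal (?w y) \<partial>lborel \<partial>lborel)"
      by (subst lborel.nn_integral_fst[symmetric]) (auto simp: lborel_prod)
    also have "\<dots> = emeasure lborel cube * (\<integral>\<^sup>+y. ennreal (?w y) \<partial>lborel)"
      by (simp add: nn_integral_cmult nn_integral_multc)
    also have "\<dots> < \<infinity>" using vol fin by (simp add: ennreal_mult_less_top)
    finally show "(\<integral>\<^sup>+z. ennreal (norm (indicator half_cylinder z *\<^sub>R (snd z powr (1 - 2 * s) * exp (- snd z)))) \<partial>lborel) < \<infinity>" .
  qed
qed

lemma weighted_integrable_exp_bound:
  fixes h :: "(real^3) \<times> real \<Rightarrow> 'c::real_normed_vector"
  assumes s: "s < 1" and hm: "h \<in> borel_measurable borel" and b: "\<And>z. 0 < snd z \<Longrightarrow> norm (h z) \<le> C * exp (- snd z)"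
  shows "set_integrable lborel half_cylinder (\<lambda>z. snd z powr (1 - 2 * s) * (norm (h z))\<^sup>2)"
  unfolding set_integrable_def
proof (rule Bochner_Integration.integrable_bound)
  show "integrable lborel (\<lambda>z. C\<^sup>2 * (indicator half_cylinder z *\<^sub>R (snd z powr (1 - 2 * s) * exp (- snd z))))"
    using weighted_exp_integrable[OF s] unfolding set_integrable_def by (rule integrable_mult_right)
  have "(\<lambda>z. (norm (h z))\<^sup>2) \<in> borel_measurable borel" using hm by measurable
  then show "(\<lambda>z. indicator half_cylinder z *\<^sub>R (snd z powr (1 - 2 * s) * (norm (h z))\<^sup>2)) \<in> borel_measurable lborel"
    by measurable
  show "AE z in lborel. norm (indicator half_cylinder z *\<^sub>R (snd z powr (1 - 2 * s) * (norm (h z))\<^sup>2))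
      \<le> norm (C\<^sup>2 * (indicator half_cylinder z *\<^sub>R (snd z powr (1 - 2 * s) * exp (- snd z))))"
  proof (intro AE_I2)
    fix z :: "(real^3) \<times> real"
    show "norm (indicator half_cylinder z *\<^sub>R (snd z powr (1 - 2 * s) * (norm (h z))\<^sup>2))
      \<le> norm (C\<^sup>2 * (indicator half_cylinder z *\<^sub>R (snd z powr (1 - 2 * s) * exp (- snd z))))"
    proof (cases "z \<in> half_cylinder")
      case True
      then have z: "0 < snd z" by (rule half_cylinder_snd)
      have "(norm (h z))\<^sup>2 \<le> (C * exp (- snd z))\<^sup>2" by (rule power_mono[OF b[OF z]]) simp
      also have "\<dots> = C\<^sup>2 * exp (- snd z) * exp (- snd z)" by (simp add: power2_eq_square)
      also have "\<dots> \<le> C\<^sup>2 * exp (- snd z) * 1" by (rule mult_left_mono) (use z in auto)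
      finally have "snd z powr (1 - 2 * s) * (norm (h z))\<^sup>2 \<le> snd z powr (1 - 2 * s) * (C\<^sup>2 * exp (- snd z))"
        by (intro mult_left_mono) auto
      then show ?thesis using True by (simp add: mult_ac)
    qed simp
  qed
qed

text \<open>
The phase \<open>c\<close> closes the family under differentiation, so smoothness follows by induction on the
order.
\<close>

definition wave :: "nat \<Rightarrow> real \<Rightarrow> (real^3) \<times> real \<Rightarrow> real" where
  "wave n c z = exp (- snd z) * cos (real n * fst z $ 1 + c)"

lemma sin_eq_cos_shift: "- sin x = cos (x + pi / 2)" for x :: real
  by (simp add: cos_add)

definition wave_grad :: "nat \<Rightarrow> real \<Rightarrow> (real^3) \<times> real \<Rightarrow> (real^3) \<times> real" where
  "wave_grad n c z = (axis 1 (real n * wave n (c + pi / 2) z), - wave n c z)"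

lemma wave_has_derivative: "(wave n c has_derivative (\<lambda>h. h \<bullet> wave_grad n c z)) (at z within A)"
proof -
  have l: "((\<lambda>z::(real^3) \<times> real. fst z $ 1) has_derivative (\<lambda>h. fst h $ 1)) (at z within A)"
    by (intro bounded_linear_imp_has_derivative bounded_linear_compose[OF bounded_linear_vec_nth bounded_linear_fst])
  have "((\<lambda>z. exp (- snd z) * cos (real n * fst z $ 1 + c)) has_derivative
      (\<lambda>h. exp (- snd z) * (- sin (real n * fst z $ 1 + c) * (real n * fst h $ 1)) + exp (- snd z) * (- snd h) * cos (real n * fst z $ 1 + c))) (at z within A)"
    by (rule derivative_eq_intros l refl)+ (simp add: algebra_simps)
  moreover have "exp (- snd z) * (- sin (real n * fst z $ 1 + c) * (real n * fst h $ 1)) + exp (- snd z) * (- snd h) * cos (real n * fst z $ 1 + c)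
     = h \<bullet> wave_grad n c z" for h
    unfolding wave_grad_def wave_def sin_eq_cos_shift
    by (cases h) (simp add: inner_axis algebra_simps)
  ultimately show ?thesis unfolding wave_def[abs_def] by simp
qed

lemma wave_continuous: "continuous_on A (wave n c)"
  unfolding wave_def by (intro continuous_intros)

lemma wave_Ck: "Ck_on k S (\<lambda>z. A * wave n c z)"
proof (induction k arbitrary: A c)
  case 0
  show ?case by (simp add: wave_continuous continuous_on_mult_left)
next
  case (Suc k)
  have d: "((\<lambda>z. A * wave n c z) has_derivative (\<lambda>h. A * (h \<bullet> wave_grad n c z))) (at z within S)" for z
    by (rule has_derivative_mult_right[OF wave_has_derivative])
  have b: "\<exists>A' c'. (\<lambda>z. A * (v \<bullet> wave_grad n c z)) = (\<lambda>z. A' * wave n c' z)" if "v \<in> Basis" for v :: "(real^3) \<times> real"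
  proof -
    from that consider w where "v = (w, 0)" "w \<in> Basis" | "v = (0, 1)" by (auto simp: Basis_prod_def)
    then show ?thesis
    proof cases
      case (1 w)
      have "(\<lambda>z. A * (v \<bullet> wave_grad n c z)) = (\<lambda>z. (A * real n * w $ 1) * wave n (c + pi / 2) z)"
        unfolding 1 wave_grad_def by (simp add: inner_axis mult_ac)
      then show ?thesis by blast
    next
      case 2
      have "(\<lambda>z. A * (v \<bullet> wave_grad n c z)) = (\<lambda>z. (- A) * wave n c z)"
        unfolding 2 wave_grad_def by simp
      then show ?thesis by blast
    qed
  qed
  have "\<forall>v\<in>Basis. Ck_on k S (\<lambda>z. A * (v \<bullet> wave_grad n c z))"
  proof
    fix v :: "(real^3) \<times> real" assume "v \<in> Basis"
    from b[OF this] obtain A' c' where "(\<lambda>z. A * (v \<bullet> wave_grad n c z)) = (\<lambda>z. A' * wave n c' z)" by blast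
    then show "Ck_on k S (\<lambda>z. A * (v \<bullet> wave_grad n c z))" using Suc.IH by simp
  qed
  then show ?case unfolding Ck_on.simps using d by (intro exI[of _ "\<lambda>z h. A * (h \<bullet> wave_grad n c z)"]) blast
qed

lemma wave_in_smooth_periodic:
  assumes s: "s < 1"
  shows "(wave n c, wave_grad n c) \<in> smooth_periodic s"
proof -
  have wm: "wave n c \<in> borel_measurable borel" by (intro borel_measurable_continuous_onI wave_continuous)
  have gm: "wave_grad n c \<in> borel_measurable borel"
    unfolding wave_grad_def axis_scale[of 1 "real n * _"]
    by (intro borel_measurable_continuous_onI continuous_intros wave_continuous)
  have wb: "\<bar>wave n c z\<bar> \<le> exp (- snd z)" for c z
    unfolding wave_def abs_mult using abs_cos_le_one[of "real n * fst z $ 1 + c"] by (simp add: mult_left_le)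
  have gb: "norm (wave_grad n c z) \<le> (real n + 1) * exp (- snd z)" for z
  proof -
    have "norm (wave_grad n c z) \<le> norm (axis 1 (real n * wave n (c + pi / 2) z) :: real^3) + norm (- wave n c z)"
      unfolding wave_grad_def by (rule norm_Pair_le)
    also have "\<dots> = real n * \<bar>wave n (c + pi / 2) z\<bar> + \<bar>wave n c z\<bar>" by (simp add: axis_scale[of 1 "_ * _"] norm_axis_1 abs_mult)
    also have "\<dots> \<le> real n * exp (- snd z) + exp (- snd z)" by (intro add_mono mult_left_mono wb) auto
    finally show ?thesis by (simp add: algebra_simps)
  qed
  have "(wave n c, wave_grad n c) \<in> weighted_L2 s"
  proof -
    have "set_integrable lborel half_cylinder (\<lambda>z. snd z powr (1 - 2 * s) * (norm (wave n c z))\<^sup>2)"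
      by (rule weighted_integrable_exp_bound[OF s wm, of 1]) (use wb in auto)
    moreover have "set_integrable lborel half_cylinder (\<lambda>z. snd z powr (1 - 2 * s) * (norm (wave_grad n c z))\<^sup>2)"
      by (rule weighted_integrable_exp_bound[OF s gm gb])
    ultimately show ?thesis using wm gm by (simp add: weighted_L2_def set_borel_measurable_def)
  qed
  moreover have "smooth_on (UNIV \<times> {0..}) (wave n c)"
    unfolding smooth_on_def using wave_Ck[of _ "UNIV \<times> {0..}" 1 n c] by simp
  moreover have "wave n c (x + axis i (2 * pi), y) = wave n c (x, y)" for x y i
  proof -
    have "cos (real n * (x $ 1 + axis i (2 * pi) $ 1) + c) = cos (real n * x $ 1 + c)"
    proof (cases "i = 1")
      case True
      have "cos (real n * (x $ 1 + 2 * pi) + c) = cos ((real n * x $ 1 + c) + 2 * real n * pi)"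
        by (rule arg_cong[where f=cos]) (simp add: algebra_simps)
      also have "\<dots> = cos (real n * x $ 1 + c)" unfolding cos_add[of _ "2 * real n * pi"] by simp
      finally show ?thesis using True by (simp add: axis_def)
    qed (simp add: axis_def)
    then show ?thesis by (simp add: wave_def)
  qed
  moreover have "GDERIV (wave n c) z :> wave_grad n c z" for z
    using wave_has_derivative[of n c z UNIV] by (simp add: gderiv_def)
  ultimately show ?thesis by (simp add: smooth_periodic_def)
qed

text \<open>
The trace of \<open>wave n 0\<close> is \<open>cos (n * x $ 1)\<close>.
\<close>

lemma fourier_coeff_wave: "0 < n \<Longrightarrow> fourier_coeff (\<lambda>x. fst (wave n 0, G) (x, 0)) (odd_freq n 0) \<noteq> 0"
proof -
  assume n: "0 < n"
  let ?k = "odd_freq n 0"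
  have k: "?k + ?k \<noteq> 0" using odd_freq_neq_uminus[OF n, of 0 0] by (simp only: eq_neg_iff_add_eq_0 not_False_eq_True)
  have "complex_of_real (fst (wave n 0, G) (x, 0)) * ek ?k x = (1 / 2) * ek (?k + ?k) x + (1 / 2) * ek 0 x" for x
  proof -
    have c: "cnj (ek ?k x) = cis (real n * x $ 1)" using ek_odd_freq[of n 0 x] by simp
    have "complex_of_real (fst (wave n 0, G) (x, 0)) = (ek ?k x + cnj (ek ?k x)) / 2"
    proof -
      have "ek ?k x = cnj (cis (real n * x $ 1))" using c by (metis complex_cnj_cnj)
      then show ?thesis unfolding c by (simp add: wave_def complex_eq_iff)
    qed
    moreover have "a * e = (1 / 2) * (e * e) + (1 / 2) * (e * e')" if "a = (e + e') / 2" for a e e' :: complex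
      unfolding that by (simp add: add_divide_distrib distrib_right distrib_left mult_ac)
    ultimately have "complex_of_real (fst (wave n 0, G) (x, 0)) * ek ?k x = (1 / 2) * (ek ?k x * ek ?k x) + (1 / 2) * (ek ?k x * cnj (ek ?k x))"
      by blast
    then show ?thesis unfolding ek_mult ek_mult_cnj diff_self .
  qed
  moreover have i: "set_integrable lborel cube (\<lambda>x. (1 / 2) * ek l x)" for l
    by (rule continuous_cube_integrable) (intro continuous_intros ek_continuous)
  ultimately have "(LINT x:cube|lborel. complex_of_real (fst (wave n 0, G) (x, 0)) * ek ?k x) = (1 / 2) * (2 * pi)^3"
    using set_integral_add(2)[OF i[of "?k + ?k"] i[of 0]] k by (simp only: set_integral_mult_right ek_integral if_True if_False) simp
  then show ?thesis unfolding fourier_coeff_ek by simp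
qed

section \<open>Invariance of the limit under symmetries of the equation\<close>

text \<open>
Let \<open>W\<close> be the limit of the sequence and \<open>R\<close> the isometry \<^term>\<open>fg_shift i h \<eta>\<close>. The equation
determines \<open>\<langle>W, V\<rangle>\<close> for smooth \<open>V\<close>, and its right-hand side does not change under \<open>R\<close>, so
\<open>\<langle>W, R V\<rangle> = \<langle>W, V\<rangle>\<close>. Consequently \<open>|R \<Phi> - \<Phi>|\<^sup>2 = 2 |\<Phi>|\<^sup>2 - 2 \<langle>\<Phi>, R \<Phi>\<rangle>\<close> tends to 0 along the
sequence. But \<open>R\<close> multiplies the \<open>k\<close>-th coefficient of the trace by a number different from 1, so this
coefficient must tend to 0.
\<close>

lemma symmetric_limit_coeff:
  assumes s: "1/2 \<le> s" "s < 1" and m: "0 < m" and ab: "0 < a" "0 < b"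
    and \<Phi>: "\<And>n. \<Phi> n \<in> smooth_periodic s"
    and Cauchy: "\<And>e. e > 0 \<Longrightarrow> \<exists>N. \<forall>i\<ge>N. \<forall>j\<ge>N. X_norm s m (fg_diff (\<Phi> i) (\<Phi> j)) < e"
    and EL: "\<And>V. V \<in> smooth_periodic s \<Longrightarrow>
      (\<lambda>n. (a + b * (X_norm s m (\<Phi> n))\<^sup>2) * X_inner s m (\<Phi> n) V) \<longlonglongrightarrow> (LINT x:cube|lborel. f x * fst V (x, 0))"
    and fc: "continuous_on UNIV f" and fper: "\<And>x. f (x + axis i (2 * pi)) = f x"
    and sym: "\<And>x. f (x + axis i h) = \<eta> * f x" and \<eta>: "\<eta>\<^sup>2 = 1" and h: "0 \<le> h" "h \<le> 2 * pi"
    and phase: "exp (- (\<i> * (of_int (k $ i) * of_real h))) \<noteq> of_real \<eta>"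
  shows "(\<lambda>n. fourier_coeff (\<lambda>x. fst (\<Phi> n) (x, 0)) k) \<longlonglongrightarrow> 0"
proof -
  have s0: "0 < s" using s by simp
  obtain W where W: "W \<in> X_space s m" and lim: "(\<lambda>n. X_norm s m (fg_diff (\<Phi> n) W)) \<longlonglongrightarrow> 0"
    using X_space_complete[OF s0 s(2) m \<Phi> Cauchy] by blast
  note WL = X_spaceD[OF W]
  let ?R = "fg_shift i h \<eta>"
  have R: "?R V \<in> smooth_periodic s" if "V \<in> smooth_periodic s" for V by (rule smooth_periodic_shift[OF that h])
  note L = smooth_periodic_weighted_L2
  have nl: "(\<lambda>n. X_norm s m (\<Phi> n)) \<longlonglongrightarrow> X_norm s m W" by (rule X_norm_limit[OF s0 s(2) m L[OF \<Phi>] WL lim])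
  have EL': "(a + b * (X_norm s m W)\<^sup>2) * X_inner s m W V = (LINT x:cube|lborel. f x * fst V (x, 0))"
    if V: "V \<in> smooth_periodic s" for V
    by (rule LIMSEQ_unique[OF _ EL[OF V]])
      (intro tendsto_intros nl X_inner_limit[OF s0 s(2) m L[OF \<Phi>] WL L[OF V] lim])
  have pos: "0 < a + b * (X_norm s m W)\<^sup>2" using ab by (simp add: add_pos_nonneg)
  (* the equation transported by R: W has the same inner product with V and with R V *)
  have inv: "X_inner s m W (?R V) = X_inner s m W V" if V: "V \<in> smooth_periodic s" for V
  proof -
    have per: "fst V (x + axis i (2 * pi), 0) = fst V (x, 0)" for x
      using V by (cases V) (simp add: smooth_periodic_def)
    have "(LINT x:cube|lborel. f x * fst (?R V) (x, 0)) = (LINT x:cube|lborel. f (x + axis i h) * fst V (x + axis i h, 0))"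
      by (simp add: fg_shift_def sym mult_ac)
    also have "\<dots> = (LINT x:cube|lborel. f x * fst V (x, 0))"
      by (rule cube_integral_shift[OF _ _ h, of "\<lambda>x. f x * fst V (x, 0)"])
        (auto intro!: continuous_intros fc trace_continuous[OF V] simp: fper per)
    finally have "(a + b * (X_norm s m W)\<^sup>2) * X_inner s m W (?R V) = (a + b * (X_norm s m W)\<^sup>2) * X_inner s m W V"
      unfolding EL'[OF V] EL'[OF R[OF V]] .
    then show ?thesis using pos by simp
  qed
  have nR: "X_norm s m (?R V) = X_norm s m V" if "V \<in> smooth_periodic s" for V
    unfolding X_norm_def X_inner_shift[OF that that h m \<eta>] ..
  define d where "d n = X_norm s m (fg_comb (?R (\<Phi> n)) (-1) (\<Phi> n))" for n
  have d2: "(d n)\<^sup>2 \<le> 2 * ((X_norm s m (\<Phi> n))\<^sup>2 - X_inner s m (\<Phi> n) W) + 2 * (X_norm s m (fg_diff (\<Phi> n) W) * X_norm s m (\<Phi> n))" for n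
  proof -
    have "(d n)\<^sup>2 = 2 * (X_norm s m (\<Phi> n))\<^sup>2 - 2 * X_inner s m (\<Phi> n) (?R (\<Phi> n))"
      unfolding d_def X_norm_comb_self[OF s0 s(2) m L[OF R[OF \<Phi>]] L[OF \<Phi>]] nR[OF \<Phi>] X_inner_commute[of s m "?R (\<Phi> n)"] by simp
    moreover have "X_inner s m (fg_diff (\<Phi> n) W) (?R (\<Phi> n)) = X_inner s m (\<Phi> n) (?R (\<Phi> n)) - X_inner s m W (?R (\<Phi> n))"
      unfolding fg_diff_comb X_inner_comb[OF m L[OF \<Phi>] WL L[OF R[OF \<Phi>]]] by simp
    moreover have "\<bar>X_inner s m (fg_diff (\<Phi> n) W) (?R (\<Phi> n))\<bar> \<le> X_norm s m (fg_diff (\<Phi> n) W) * X_norm s m (\<Phi> n)"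
      using X_Cauchy_Schwarz[OF s0 s(2) m weighted_L2_comb[OF m L[OF \<Phi>] WL] L[OF R[OF \<Phi>]], of n "-1" n] nR[OF \<Phi>]
      unfolding fg_diff_comb by simp
    moreover have "D \<le> 2 * (N - I) + 2 * P" if "D = 2 * N - 2 * A" "E = A - A'" "\<bar>E\<bar> \<le> P" "A' = I" for D N A A' E P I :: real
      using that abs_le_D2[of E P] by (simp only:) (simp add: algebra_simps)
    ultimately show ?thesis using inv[OF \<Phi>, of n] X_inner_commute[of s m W "\<Phi> n"] by metis
  qed
  have "(\<lambda>n. 2 * ((X_norm s m (\<Phi> n))\<^sup>2 - X_inner s m (\<Phi> n) W) + 2 * (X_norm s m (fg_diff (\<Phi> n) W) * X_norm s m (\<Phi> n)))
      \<longlonglongrightarrow> 2 * ((X_norm s m W)\<^sup>2 - X_inner s m W W) + 2 * (0 * X_norm s m W)"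
    by (intro tendsto_intros nl lim X_inner_limit[OF s0 s(2) m L[OF \<Phi>] WL WL lim])
  then have "(\<lambda>n. 2 * ((X_norm s m (\<Phi> n))\<^sup>2 - X_inner s m (\<Phi> n) W) + 2 * (X_norm s m (fg_diff (\<Phi> n) W) * X_norm s m (\<Phi> n))) \<longlonglongrightarrow> 0"
    by (simp add: X_norm_square[OF s0 s(2)])
  then have "(\<lambda>n. (d n)\<^sup>2) \<longlonglongrightarrow> 0"
    by (rule tendsto_sandwich[OF _ _ tendsto_const, rotated 2]) (use d2 in auto)
  from tendsto_real_sqrt[OF this] have dl: "d \<longlonglongrightarrow> 0"
    unfolding d_def using X_norm_nonneg[OF s0 s(2)] by simp
  define ph where "ph = exp (- (\<i> * (of_int (k $ i) * complex_of_real h)))"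
  have phn: "cmod ph = 1" unfolding ph_def by (simp add: norm_exp_eq_Re)
  let ?c = "\<lambda>V::fun_with_grad. fourier_coeff (\<lambda>x. fst V (x, 0)) k"
  have cR: "ph * ?c (?R V) = of_real \<eta> * ?c V" if V: "V \<in> smooth_periodic s" for V
  proof -
    have per: "fst V (x + axis i (2 * pi), 0) = fst V (x, 0)" for x
      using V by (cases V) (simp add: smooth_periodic_def)
    have "ph * (LINT x:cube|lborel. of_real (fst (?R V) (x, 0)) * ek k x)
        = (LINT x:cube|lborel. of_real \<eta> * (of_real (fst V (x + axis i h, 0)) * ek k (x + axis i h)))"
      unfolding ek_shift ph_def[symmetric] by (simp add: fg_shift_def mult_ac flip: set_integral_mult_right)
    also have "\<dots> = of_real \<eta> * (LINT x:cube|lborel. of_real (fst V (x, 0)) * ek k x)"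
      unfolding set_integral_mult_right
      by (subst cube_integral_shift[OF _ _ h, of "\<lambda>x. of_real (fst V (x, 0)) * ek k x"])
        (auto intro!: continuous_intros ek_continuous trace_continuous[OF V] simp: ek_periodic per)
    finally show ?thesis unfolding fourier_coeff_ek by (simp add: mult_ac)
  qed
  define B where "B = sqrt (2 * kappa s / m powr (2 * s)) / cmod (of_real \<eta> - ph)"
  have ne: "cmod (of_real \<eta> - ph) > 0" using phase unfolding ph_def by simp
  have cb: "cmod (?c (\<Phi> n)) \<le> B * d n" for n
  proof -
    have "?c (fg_comb (?R (\<Phi> n)) (-1) (\<Phi> n)) = ?c (?R (\<Phi> n)) - ?c (\<Phi> n)"
      unfolding fourier_coeff_trace_comb[OF R[OF \<Phi>] \<Phi>] by simp
    then have "ph * ?c (fg_comb (?R (\<Phi> n)) (-1) (\<Phi> n)) = (of_real \<eta> - ph) * ?c (\<Phi> n)"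
      using cR[OF \<Phi>, of n] by (simp only: right_diff_distrib left_diff_distrib)
    then have "cmod ph * cmod (?c (fg_comb (?R (\<Phi> n)) (-1) (\<Phi> n))) = cmod (of_real \<eta> - ph) * cmod (?c (\<Phi> n))"
      unfolding norm_mult[symmetric] by (rule arg_cong)
    then have "cmod (of_real \<eta> - ph) * cmod (?c (\<Phi> n)) \<le> sqrt (2 * kappa s / m powr (2 * s)) * d n"
      using fourier_coeff_trace_bound[OF smooth_periodic_comb[OF m R[OF \<Phi>] \<Phi>] s m, of n "-1" n k] unfolding d_def phn by simp
    then show ?thesis unfolding B_def using ne by (simp add: field_simps)
  qed
  have Bd: "(\<lambda>n. B * d n) \<longlonglongrightarrow> 0" using tendsto_mult[OF tendsto_const dl, of B] by simp
  show ?thesis by (rule Lim_null_comparison[OF _ Bd]) (rule always_eventually, rule allI, rule cb)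
qed

section \<open>Infinitely many solutions\<close>

lemma fourier_coeff_AE_cong:
  assumes u: "set_integrable lborel cube u" and v: "set_integrable lborel cube v" and eq: "AE x\<in>cube in lborel. u x = v x"
  shows "fourier_coeff u k = fourier_coeff v k"
proof -
  have m: "(\<lambda>x. indicator cube x *\<^sub>R (complex_of_real (w x) * ek k x)) \<in> borel_measurable lborel" if "set_integrable lborel cube w" for w
    using coeff_integrable[OF that, of k] by (simp add: set_integrable_def)
  have "AE x in lborel. indicator cube x *\<^sub>R (complex_of_real (u x) * ek k x) = indicator cube x *\<^sub>R (complex_of_real (v x) * ek k x)"
    using eq by eventually_elim (auto simp: indicator_def)
  from integral_cong_AE[OF m[OF u] m[OF v] this] show ?thesis
    unfolding fourier_coeff_ek set_lebesgue_integral_def by simp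
qed

text \<open>
If the integral were zero, the projection would vanish almost everywhere, together with its
coefficient at \<open>odd_freq n 0\<close>.
\<close>

lemma odd_modes_wave_positive:
  fixes s m q :: real
  assumes s: "3/4 < s" "s < 1" and m: "0 < m" and n: "0 < n" and q: "0 < q"
  shows "0 < (LINT x:cube|lborel. \<bar>odd_modes n (wave n 0, wave_grad n 0) (real n * x $ 1)\<bar> powr q)"
proof (rule ccontr)
  let ?e = "(wave n 0, wave_grad n 0)"
  let ?t = "\<lambda>x::real^3. odd_modes n ?e (real n * x $ 1)"
  let ?F = "\<lambda>x. indicator cube x *\<^sub>R \<bar>?t x\<bar> powr q"
  have e: "?e \<in> smooth_periodic s" by (rule wave_in_smooth_periodic[OF s(2)])
  have tc: "continuous_on A ?t" for A by (rule odd_modes_coord_continuous[OF s m n e])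
  have "set_integrable lborel cube (\<lambda>x. \<bar>?t x\<bar> powr q)"
    by (intro continuous_cube_integrable continuous_on_powr' continuous_intros tc) (use q in auto)
  then have i: "integrable lborel ?F" by (simp add: set_integrable_def)
  have nn: "AE x in lborel. 0 \<le> ?F x" by (auto simp: indicator_def)
  assume "\<not> 0 < (LINT x:cube|lborel. \<bar>?t x\<bar> powr q)"
  moreover have "0 \<le> (LINT x:cube|lborel. \<bar>?t x\<bar> powr q)"
    unfolding set_lebesgue_integral_def by (rule integral_nonneg_AE[OF nn])
  ultimately have "(LINT x|lborel. ?F x) = 0" unfolding set_lebesgue_integral_def by linarith
  then have "AE x in lborel. ?F x = 0" using integral_nonneg_eq_0_iff_AE[OF i nn] by blast
  then have z: "AE x in lborel. x \<in> cube \<longrightarrow> ?t x = 0"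
    by eventually_elim (auto simp: indicator_def split: if_splits)
  then have "fourier_coeff ?t (odd_freq n 0) = fourier_coeff (\<lambda>_. 0) (odd_freq n 0)"
    by (intro fourier_coeff_AE_cong continuous_cube_integrable tc continuous_on_const)
  then have "fourier_coeff ?t (odd_freq n 0) = 0" by (simp add: fourier_coeff_ek)
  moreover have "fourier_coeff ?t (odd_freq n 0) = fourier_coeff (\<lambda>x. fst ?e (x, 0)) (odd_freq n 0)"
    unfolding fourier_coeff_odd_modes[OF s m n e] by auto
  ultimately show False using fourier_coeff_wave[OF n] by simp
qed

text \<open>
The minimisation problem is solved by \<open>ground_state\<close> with \<open>tr\<close> the projection to the odd modes. It
remains to identify the projection \<open>u\<close> of the limit with its trace, one frequency at a time: at the odd
multiples of \<open>n\<close> on the first axis by definition, and at all other frequencies because both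
coefficients are 0.
\<close>

lemma weak_solution_with_odd_modes:
  fixes s a b m lam q p :: real
  assumes s: "3/4 < s" "s < 1" and m: "0 < m" and ab: "0 < a" "0 < b" and lam: "0 < lam"
    and q: "1 < q" "q < 2" and p: "2 < p" "p < 4" and n: "0 < n"
  shows "\<exists>u. weak_solution s m a b lam q p u \<and> set_integrable lborel cube u \<and> \<not> (AE x\<in>cube in lborel. u x = 0) \<and>
    (\<forall>k. fourier_coeff u k \<noteq> 0 \<longrightarrow> (\<exists>j. k = odd_freq n j \<or> k = - odd_freq n j))"
proof -
  have s0: "0 < s" and s': "1/2 \<le> s" using s by simp_all
  let ?e = "(wave n 0, wave_grad n 0)"
  define tr where "tr V x = odd_modes n V (real n * x $ 1)" for V and x :: "real^3"
  note L = smooth_periodic_weighted_L2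
  interpret K: kirchhoff "smooth_periodic s" "X_inner s m" fg_comb tr a b lam q p "mode_const s" ?e
  proof
    show "fg_comb v t w \<in> smooth_periodic s" if "v \<in> smooth_periodic s" "w \<in> smooth_periodic s" for v w t
      by (rule smooth_periodic_comb[OF m that])
    show "X_inner s m (fg_comb v t w) z = X_inner s m v z + t * X_inner s m w z"
      if "v \<in> smooth_periodic s" "w \<in> smooth_periodic s" "z \<in> smooth_periodic s" for v w z t
      by (rule X_inner_comb[OF m that(1,2,3)[THEN L]])
    show "X_inner s m v w = X_inner s m w v" for v w by (rule X_inner_commute)
    show "0 \<le> X_inner s m v v" for v by (rule X_inner_self_nonneg[OF s0 s(2)])
    show "\<bar>X_inner s m v w\<bar> \<le> sqrt (X_inner s m v v) * sqrt (X_inner s m w w)"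
      if "v \<in> smooth_periodic s" "w \<in> smooth_periodic s" for v w
      using X_Cauchy_Schwarz[OF s0 s(2) m that[THEN L]] by (simp add: X_norm_def)
    show "tr (fg_comb v t w) x = tr v x + t * tr w x" if "v \<in> smooth_periodic s" "w \<in> smooth_periodic s" for v w t x
      unfolding tr_def by (rule odd_modes_comb[OF s m n that])
    show "continuous_on A (tr v)" if "v \<in> smooth_periodic s" for v A
      unfolding tr_def by (rule odd_modes_coord_continuous[OF s m n that])
    show "0 \<le> mode_const s" by (rule mode_const_nonneg[OF s m n])
    show "\<bar>tr v x\<bar> \<le> mode_const s * sqrt (X_inner s m v v)" if "v \<in> smooth_periodic s" for v x
      using odd_modes_bound[OF s m n that] by (simp add: tr_def X_norm_def)
    show "\<exists>r u. strict_mono (r :: nat \<Rightarrow> nat) \<and> continuous_on UNIV u \<and> (\<forall>x. (\<lambda>j. tr (v (r j)) x) \<longlonglongrightarrow> u x)"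
      if v: "\<And>j. v j \<in> smooth_periodic s" and R: "\<And>j. X_inner s m (v j) (v j) \<le> R" for v R
    proof -
      have "X_norm s m (v j) \<le> sqrt R" for j unfolding X_norm_def using R by simp
      then have "\<exists>r G. strict_mono (r :: nat \<Rightarrow> nat) \<and> continuous_on UNIV G \<and> (\<forall>t. (\<lambda>j. odd_modes n (v (r j)) t) \<longlonglongrightarrow> G t)"
        by (rule odd_modes_compact[OF s m n v])
      then obtain r G where r: "strict_mono (r :: nat \<Rightarrow> nat)" "continuous_on UNIV G"
        "\<And>t. (\<lambda>j. odd_modes n (v (r j)) t) \<longlonglongrightarrow> G t" by blast
      have "continuous_on UNIV (\<lambda>x::real^3. G (real n * x $ 1))"
        by (rule continuous_on_compose2[OF r(2)]) (auto intro!: continuous_intros)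
      then show ?thesis unfolding tr_def using r by blast
    qed
    show "?e \<in> smooth_periodic s" by (rule wave_in_smooth_periodic[OF s(2)])
    show "0 < (LINT x:cube|lborel. \<bar>tr ?e x\<bar> powr q)"
      unfolding tr_def by (rule odd_modes_wave_positive[OF s m n]) (use q in simp)
  qed (use ab lam q p in auto)
  obtain \<Phi> u B where \<Phi>: "\<And>j. \<Phi> j \<in> smooth_periodic s"
    and Cau: "\<And>\<epsilon>. 0 < \<epsilon> \<Longrightarrow> \<exists>N. \<forall>i\<ge>N. \<forall>j\<ge>N. X_inner s m (fg_comb (\<Phi> i) (-1) (\<Phi> j)) (fg_comb (\<Phi> i) (-1) (\<Phi> j)) < \<epsilon>"
    and uc: "continuous_on UNIV u" and lim: "\<And>x. (\<lambda>j. tr (\<Phi> j) x) \<longlonglongrightarrow> u x"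
    and B: "\<And>j. X_inner s m (\<Phi> j) (\<Phi> j) \<le> B" and pos: "0 < (LINT x:cube|lborel. K.potential (u x))"
    and EL0: "\<And>V. V \<in> smooth_periodic s \<Longrightarrow>
      (\<lambda>j. (a + b * X_inner s m (\<Phi> j) (\<Phi> j)) * X_inner s m (\<Phi> j) V) \<longlonglongrightarrow> (LINT x:cube|lborel. K.nonlinearity (u x) * tr V x)"
    using K.ground_state by blast
  (* u is a function of n * x $ 1 alone, and antiperiodic as such *)
  define G where "G t = u (axis 1 (t / real n))" for t
  have Gl: "(\<lambda>j. odd_modes n (\<Phi> j) t) \<longlonglongrightarrow> G t" for t
    using lim[of "axis 1 (t / real n)"] n by (simp add: tr_def G_def axis_def)
  have uG: "u x = G (real n * x $ 1)" for x
    by (rule LIMSEQ_unique[OF lim[of x]]) (simp add: tr_def Gl)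
  have ac: "continuous_on A (\<lambda>t. axis 1 (t / real n) :: real^3)" for A
    unfolding axis_scale[of 1 "_ / _"] using n by (intro continuous_intros) auto
  have Gc: "continuous_on UNIV G"
    unfolding G_def by (rule continuous_on_compose2[OF uc ac]) auto
  have Ganti: "G (t + pi) = - G t" for t
  proof (rule LIMSEQ_unique[OF Gl])
    show "(\<lambda>j. odd_modes n (\<Phi> j) (t + pi)) \<longlonglongrightarrow> - G t"
      unfolding odd_modes_antiperiodic[OF s m n \<Phi>] by (rule tendsto_minus[OF Gl])
  qed
  have Gper: "G (t + 2 * pi) = G t" for t using Ganti[of "t + pi"] Ganti[of t] by (simp add: add.assoc)
  have Gper_n: "G (t + real j * (2 * pi)) = G t" for t j
  proof (induction j)
    case (Suc j)
    have "t + real (Suc j) * (2 * pi) = (t + real j * (2 * pi)) + 2 * pi" by (simp add: algebra_simps)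
    then have "G (t + real (Suc j) * (2 * pi)) = G (t + real j * (2 * pi))" by (simp only: Gper)
    then show ?case using Suc.IH by (simp only:)
  qed simp
  have uper: "u (x + axis i (2 * pi)) = u x" for x i
  proof (cases "i = 1")
    case True
    then show ?thesis using Gper_n[of "real n * x $ 1" n] unfolding uG by (simp add: axis_def algebra_simps)
  qed (simp add: uG axis_def)
  have nonlinearity_minus: "K.nonlinearity (- t) = - K.nonlinearity t" for t by (simp add: K.nonlinearity_def signed_power_def)
  define f where "f x = K.nonlinearity (u x)" for x
  have fc: "continuous_on UNIV f" unfolding f_def
    by (rule continuous_on_compose2[OF K.nonlinearity_continuous[of UNIV] uc]) auto
  (* projected test functions are replaced by full traces *)
  have EL: "(\<lambda>j. (a + b * (X_norm s m (\<Phi> j))\<^sup>2) * X_inner s m (\<Phi> j) V) \<longlonglongrightarrow> (LINT x:cube|lborel. f x * fst V (x, 0))"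
    if V: "V \<in> smooth_periodic s" for V
  proof -
    have "(LINT x:cube|lborel. K.nonlinearity (G (real n * x $ 1)) * odd_modes n V (real n * x $ 1)) = (LINT x:cube|lborel. K.nonlinearity (G (real n * x $ 1)) * fst V (x, 0))"
    proof (rule odd_modes_replace_trace[OF s m n V, of "\<lambda>t. K.nonlinearity (G t)"])
      show "continuous_on UNIV (\<lambda>t. K.nonlinearity (G t))" by (rule continuous_on_compose2[OF K.nonlinearity_continuous[of UNIV] Gc]) auto
    qed (simp_all add: Gper Ganti nonlinearity_minus)
    then show ?thesis using EL0[OF V] unfolding X_norm_square[OF s0 s(2)] f_def uG tr_def by simp
  qed
  have Cau': "\<exists>N. \<forall>i\<ge>N. \<forall>j\<ge>N. X_norm s m (fg_diff (\<Phi> i) (\<Phi> j)) < \<epsilon>" if \<epsilon>: "0 < \<epsilon>" for \<epsilon>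
  proof -
    have "0 < \<epsilon>\<^sup>2" using \<epsilon> by simp
    from Cau[OF this] obtain N where N: "\<And>i j. i \<ge> N \<Longrightarrow> j \<ge> N \<Longrightarrow> X_inner s m (fg_comb (\<Phi> i) (-1) (\<Phi> j)) (fg_comb (\<Phi> i) (-1) (\<Phi> j)) < \<epsilon>\<^sup>2"
      by blast
    have "X_norm s m (fg_diff (\<Phi> i) (\<Phi> j)) < \<epsilon>" if "i \<ge> N" "j \<ge> N" for i j
      unfolding fg_diff_comb X_norm_def using real_sqrt_less_mono[OF N[OF that]] \<epsilon> by simp
    then show ?thesis by blast
  qed
  note sym = symmetric_limit_coeff[OF s' s(2) m ab \<Phi> Cau' EL fc]
  have fper: "f (x + axis i (2 * pi)) = f x" for x i by (simp add: f_def uper)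
  have inv: "f (x + axis i h) = 1 * f x" if "i \<noteq> 1" for x i h using that by (simp add: f_def uG axis_def)
  have anti: "f (x + axis 1 (pi / real n)) = - 1 * f x" for x
  proof -
    have "real n * (x + axis 1 (pi / real n)) $ 1 = real n * x $ 1 + pi"
      using n by (simp add: axis_def algebra_simps)
    then show ?thesis by (simp only: f_def uG Ganti nonlinearity_minus)
  qed
  (* frequencies outside of the symmetry class *)
  have off: "(\<lambda>j. fourier_coeff (\<lambda>x. fst (\<Phi> j) (x, 0)) k) \<longlonglongrightarrow> 0"
    if k: "\<not> (\<exists>j. k = odd_freq n j \<or> k = - odd_freq n j)" for k :: "int^3"
  proof (cases "\<exists>i. i \<noteq> 1 \<and> k $ i \<noteq> 0")
    case True
    then obtain i where i: "i \<noteq> 1" "k $ i \<noteq> 0" by blast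
    (* translation by half a wavelength along the i-th axis changes the sign of ek k, but not f *)
    let ?h = "pi / \<bar>of_int (k $ i)\<bar> :: real"
    have "1 \<le> \<bar>of_int (k $ i) :: real\<bar>" using i(2) by linarith
    then have h: "0 \<le> ?h" "?h \<le> 2 * pi" by (simp_all add: divide_le_eq mult_le_cancel_left)
    have "of_int (k $ i) * ?h = pi \<or> of_int (k $ i) * ?h = - pi" using i(2) by (auto simp: abs_if)
    then have "exp (- (\<i> * (of_int (k $ i) * of_real ?h))) = - 1"
    proof -
      have "exp (- (\<i> * (of_int (k $ i) * of_real ?h))) = cis (- (of_int (k $ i) * ?h))"
        unfolding cis_conv_exp by (simp add: mult_ac)
      then show ?thesis using \<open>of_int (k $ i) * ?h = pi \<or> of_int (k $ i) * ?h = - pi\<close>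
        by (auto simp: complex_eq_iff)
    qed
    then show ?thesis by (intro sym[of i ?h 1 k] fper inv i(1) h) auto
  next
    case False
    define l where "l = k $ 1"
    have kl: "k = axis 1 l" using False by (auto simp: vec_eq_iff axis_def l_def)
    (* f changes its sign under this translation; ek k does so only if k is an odd multiple of n *)
    let ?h = "pi / real n"
    have h: "0 \<le> ?h" "?h \<le> 2 * pi" using n by (simp_all add: divide_le_eq mult_le_cancel_left)
    have "exp (- (\<i> * (of_int (k $ 1) * of_real ?h))) \<noteq> of_real (- 1)"
    proof
      assume "exp (- (\<i> * (of_int (k $ 1) * of_real ?h))) = of_real (- 1)"
      moreover have "exp (- (\<i> * (of_int (k $ 1) * of_real ?h))) = cis (- (of_int l * ?h))"
        unfolding cis_conv_exp l_def by (simp add: mult_ac)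
      ultimately have "cis (- (of_int l * ?h)) = of_real (- 1)" by simp
      from arg_cong[OF this, of Re] have "cos (of_int l * ?h) = - 1" by (simp only: cis.sel cos_minus Re_complex_of_real)
      then obtain N :: int where N: "of_int l * ?h = (2 * of_int N + 1) * pi"
        unfolding cos_eq_minus1 by blast
      then have "pi * of_int l = pi * ((2 * real_of_int N + 1) * real n)" using n by (simp add: field_simps)
      then have "of_int l = (2 * real_of_int N + 1) * real n" by (simp only: mult_cancel_left pi_neq_zero simp_thms)
      then have "of_int l = (of_int (int n * (2 * N + 1)) :: real)" by (simp add: mult_ac)
      then have l: "l = int n * (2 * N + 1)" by (simp only: of_int_eq_iff)
      show False
      proof (cases "0 \<le> N")
        case True
        then have "k = odd_freq n (nat N)" unfolding kl l odd_freq_def by simp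
        then show False using k by blast
      next
        case False
        then have "int (nat (- N - 1)) = - N - 1" by simp
        then have "int n * (2 * int (nat (- N - 1)) + 1) = - l" unfolding l by (simp only:) (simp add: algebra_simps)
        then have "odd_freq n (nat (- N - 1)) = axis 1 (- l)" unfolding odd_freq_def by (simp only:)
        then have "k = - odd_freq n (nat (- N - 1))" unfolding kl by (simp add: vec_eq_iff axis_def)
        then show False using k by blast
      qed
    qed
    then show ?thesis by (intro sym[of 1 ?h "- 1" k] fper anti h) auto
  qed
  have ml: "(\<lambda>j. fourier_coeff (\<lambda>x. odd_modes n (\<Phi> j) (real n * x $ 1)) k) \<longlonglongrightarrow> fourier_coeff u k" for k
  proof (rule fourier_coeff_bounded_limit[OF odd_modes_coord_continuous[OF s m n \<Phi>] uc])
    show "\<bar>odd_modes n (\<Phi> j) (real n * x $ 1)\<bar> \<le> mode_const s * sqrt B" for j and x :: "real^3"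
      using odd_modes_bound[OF s m n \<Phi>, of j] mult_left_mono[OF real_sqrt_le_mono[OF B[of j]] mode_const_nonneg[OF s m n]]
      unfolding X_norm_def by (rule order_trans)
    show "(\<lambda>j. odd_modes n (\<Phi> j) (real n * x $ 1)) \<longlonglongrightarrow> u x" for x :: "real^3" unfolding uG by (rule Gl)
  qed
  have u0: "fourier_coeff u k = 0" if "\<not> (\<exists>j. k = odd_freq n j \<or> k = - odd_freq n j)" for k
    using ml[of k] that unfolding fourier_coeff_odd_modes[OF s m n \<Phi>] by (simp add: LIMSEQ_const_iff)
  have coef: "(\<lambda>j. fourier_coeff (\<lambda>x. fst (\<Phi> j) (x, 0)) k) \<longlonglongrightarrow> fourier_coeff u k" for k
  proof (cases "\<exists>j. k = odd_freq n j \<or> k = - odd_freq n j")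
    case True
    then show ?thesis using ml[of k] unfolding fourier_coeff_odd_modes[OF s m n \<Phi>] by simp
  next
    case False
    then show ?thesis using off[OF False] u0[OF False] by simp
  qed
  have f_eq: "f = (\<lambda>x. lam * \<bar>u x\<bar> powr (q - 2) * u x + \<bar>u x\<bar> powr (p - 2) * u x)"
    by (rule ext) (simp add: f_def K.nonlinearity_def signed_power_def mult.assoc)
  have "weak_solution s m a b lam q p u"
    by (rule weak_solution_of_limit[OF s' s(2) m \<Phi> Cau' uc _ coef fc[unfolded f_eq] EL[unfolded f_eq]])
      (simp_all add: periodic3_def uper)
  moreover have "set_integrable lborel cube u" by (rule continuous_cube_integrable) (rule continuous_on_subset[OF uc], simp)
  moreover have "\<not> (AE x\<in>cube in lborel. u x = 0)"
  proof
    assume "AE x\<in>cube in lborel. u x = 0"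
    then have "AE x in lborel. indicator cube x *\<^sub>R K.potential (u x) = 0"
      by eventually_elim (auto simp: indicator_def K.potential_def)
    then have "(LINT x:cube|lborel. K.potential (u x)) = 0"
      unfolding set_lebesgue_integral_def by (rule integral_eq_zero_AE)
    then show False using pos by simp
  qed
  ultimately show ?thesis using u0 by blast
qed

text \<open>
Comparing the powers of 2 on both sides.
\<close>

lemma odd_freq_power2_disjoint:
  assumes "odd_freq (2^i) j = odd_freq (2^i') j' \<or> odd_freq (2^i) j = - odd_freq (2^i') j'"
  shows "i = i'"
proof -
  have first: "odd_freq (2^i) j $ 1 = int (2^i * (2 * j + 1))" for i j
    unfolding odd_freq_def by (simp add: algebra_simps)
  have e: "odd_freq (2^i) j $ 1 = odd_freq (2^i') j' $ 1 \<or> odd_freq (2^i) j $ 1 = - (odd_freq (2^i') j' $ 1)" using assms by auto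
  have gen: "A = B" if "int A = int B \<or> int A = - int B" "0 < A" for A B using that by linarith
  have eq: "2^i * (2 * j + 1) = 2^i' * (2 * j' + 1)" by (rule gen[OF e[unfolded first]]) simp
  have aux: "\<not> x < y" if e: "2^x * (2 * c + 1) = 2^y * (2 * d + 1)" for x y :: nat and c d :: nat
  proof
    assume "x < y"
    then have "y = x + Suc (y - x - 1)" by simp
    then obtain r where r: "y = x + Suc r" by blast
    from e have "2^x * (2 * c + 1) = 2^x * (2 * (2^r * (2 * d + 1)))" unfolding r by (simp only: power_add power_Suc mult_ac)
    then have "2 * c + 1 = 2 * (2^r * (2 * d + 1))" unfolding mult_cancel1 by simp
    then show False by presburger
  qed
  show ?thesis using aux[OF eq] aux[OF eq[symmetric]] by linarith
qed

theorem theorem1: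
  fixes s a b m q p :: real
  assumes "3/4 < s" "s < 1"
    and "0 < a" "0 < b" "0 < m"
    and "1 < q" "q < 2"
    and "2 < p" "p < 4"
  shows "\<forall>lam>0. infinite ({u. weak_solution s m a b lam q p u} // ae_eq)"
proof (intro allI impI)
  fix lam :: real assume lam: "0 < lam"
  have "\<exists>u. \<forall>i. weak_solution s m a b lam q p (u i) \<and> set_integrable lborel cube (u i) \<and> \<not> (AE x\<in>cube in lborel. u i x = 0) \<and>
    (\<forall>k. fourier_coeff (u i) k \<noteq> 0 \<longrightarrow> (\<exists>j. k = odd_freq (2^i) j \<or> k = - odd_freq (2^i) j))"
    by (rule choice, rule allI, rule weak_solution_with_odd_modes[OF assms(1,2,5,3,4) lam assms(6-9)]) simp
  then obtain u where "\<forall>i. weak_solution s m a b lam q p (u i) \<and> set_integrable lborel cube (u i) \<and> \<not> (AE x\<in>cube in lborel. u i x = 0) \<and>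
    (\<forall>k. fourier_coeff (u i) k \<noteq> 0 \<longrightarrow> (\<exists>j. k = odd_freq (2^i) j \<or> k = - odd_freq (2^i) j))" by (rule exE)
  then have u: "\<And>i. weak_solution s m a b lam q p (u i)" "\<And>i. set_integrable lborel cube (u i)"
    "\<And>i. \<not> (AE x\<in>cube in lborel. u i x = 0)"
    "\<And>i k. fourier_coeff (u i) k \<noteq> 0 \<Longrightarrow> \<exists>j. k = odd_freq (2^i) j \<or> k = - odd_freq (2^i) j"
    by blast+
  have "inj (\<lambda>i. ae_eq `` {u i})"
  proof (rule injI)
    fix i i' assume "ae_eq `` {u i} = ae_eq `` {u i'}"
    moreover have "u i' \<in> ae_eq `` {u i'}" by (simp add: ae_eq_def)
    ultimately have ae: "AE x\<in>cube in lborel. u i x = u i' x" by (auto simp: ae_eq_def)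
    have eq: "fourier_coeff (u i) k = fourier_coeff (u i') k" for k
      by (rule fourier_coeff_AE_cong[OF u(2) u(2) ae])
    have "\<exists>k. fourier_coeff (u i) k \<noteq> 0" using fourier_coeff_unique[OF u(2)] u(3) by blast
    then obtain k where "fourier_coeff (u i) k \<noteq> 0" by blast
    then obtain j j' where "k = odd_freq (2^i) j \<or> k = - odd_freq (2^i) j" "k = odd_freq (2^i') j' \<or> k = - odd_freq (2^i') j'"
      using u(4)[of i k] u(4)[of i' k] eq by auto
    then have "odd_freq (2^i) j = odd_freq (2^i') j' \<or> odd_freq (2^i) j = - odd_freq (2^i') j'" by (auto simp: minus_equation_iff)
    then show "i = i'" by (rule odd_freq_power2_disjoint)
  qed
  then have "infinite (range (\<lambda>i. ae_eq `` {u i}))" by (rule range_inj_infinite)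
  moreover have "range (\<lambda>i. ae_eq `` {u i}) \<subseteq> {u. weak_solution s m a b lam q p u} // ae_eq"
    using u(1) by (auto intro!: quotientI)
  ultimately show "infinite ({u. weak_solution s m a b lam q p u} // ae_eq)" by (rule infinite_super[rotated])
qed

end
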